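(* Let $\nu>-\frac12$, $\sigma>0$, and let $\mathbf{m}=\begin{pmatrix}a&b\\c&d\end{pmatrix}\in SL(2,\mathbb{R})$ with $b\neq0$. For each $f\in\mathcal{L}_{p,\nu}$ ($1\le p\le\infty$) set $u(t,x)=S_\nu^{\mathbf{m}^{-1}}(t)f(x)$ for any $(t,x)\in(0,+\infty)\times\mathbb{R}$. Then: (1) The function $u$ satisfies the heat equation $\left(\partial_t-\sigma\Delta_\nu^{\mathbf{m}^{-1}}\right)u=0$ in $(0,+\infty)\times\mathbb{R}$. (2) The solution $u(t,x)\to f(x)$ as $t\to0$ in the norm of $\mathcal{L}_{p,\nu}$. (3) For $p,q,r\in[1,+\infty]$ such that $1/p+1/q=1+1/r$ and $t>0$, $$\|u(t,\cdot)\|_{r,\nu}\le\left[\frac{(4\sigma t)^{\nu+1}\Gamma(\nu+1)}{2}\right]^{\frac1q-1}q^{-\frac{\nu+1}{q}}\,\|f\|_{p,\nu}.$$ (4) $u(t,\cdot)$ is the unique solution, belonging to $\mathcal{L}_{r,\nu}$ with $r\in[1,+\infty]$, of the Cauchy problem $$\frac{\partial}{\partial t}u(t,x)=\sigma\Delta_\nu^{\mathbf{m}^{-1}}u(t,x),\ (t,x)\in(0,+\infty)\times\mathbb{R},\qquad u(0,x)=f(x).$$ (5) If $f\in\mathcal{S}_*(\mathbb{R})$, then $u(t,\cdot)\in\mathcal{S}_*(\mathbb{R})$ and for all non-negative integers $n$ there are a constant $c_{n+1}>0$ and $n_1,\dots,n_{k_{n+1}},m_1,\dots,m_{k_{n+1}}\in\mathbb{N}$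 such that $$\left\|u(t,\cdot)-\sum_{k=0}^{n}\frac{t^k}{k!}\left(\sigma\Delta_\nu^{\mathbf{m}^{-1}}\right)^kf\right\|_\infty\le\frac{t^{n+1}}{(n+1)!}\,c_{n+1}\sum_{i=1}^{k_{n+1}}q_{n_i,m_i}(f).$$
   Context: $\mathcal{L}_{p,\nu}$ ($1\le p\le\infty$) is the Lebesgue space of measurable functions on $[0,+\infty[$ with finite norm $\|f\|_{p,\nu}=\left(\int_0^{+\infty}|f(y)|^py^{2\nu+1}dy\right)^{1/p}$ for $p<\infty$, and the essential sup norm $\|f\|_\infty$ for $p=\infty$. $\mathcal{S}_*(\mathbb{R})$ is the space of even Schwartz functions on $\mathbb{R}$, with seminorms $q_{n,m}(f)=\sup_{x\ge0}(1+x^2)^n\left|f^{(m)}(x)\right|$, $n,m\in\mathbb{N}=\{0,1,2,\dots\}$. Since $\mathbf{m}^{-1}=\begin{pmatrix}d&-b\\-c&a\end{pmatrix}$, the operator associated with $\mathbf{m}^{-1}$ is $$\Delta_\nu^{\mathbf{m}^{-1}}g(x)=g''(x)+\left(\frac{2\nu+1}{x}+2i\frac ab x\right)g'(x)-\left(\frac{a^2}{b^2}x^2-2i(\nu+1)\frac ab\right)g(x),$$ acting in the variable $x$. The Bessel translation is $T_x^\nu f(y)=\frac{\Gamma(\nu+1)}{\sqrt\pi\,\Gamma(\nu+1/2)}\int_0^\pi f\left(\sqrt{x^2+y^2-2xy\cos\theta}\right)(\sin\theta)^{2\nu}d\theta$, and $T_x^{\nu,\mathbf{m}^{-1}}f(y)=e^{-\frac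 i2\frac ab(x^2+y^2)}T_x^\nu\left[s\mapsto e^{\frac i2\frac ab s^2}f(s)\right](y)$. For $t>0$ put $$\mathcal{P}_t^{\mathbf{m}^{-1}}(x)=\frac{2}{\Gamma(\nu+1)}(4\sigma t)^{-(\nu+1)}e^{-\frac i2\frac ab x^2-\frac{x^2}{4\sigma t}} .$$ For $f\in\mathcal{L}_{p,\nu}$, $S_\nu^{\mathbf{m}^{-1}}(0)f=f$ and for $t>0$ $$S_\nu^{\mathbf{m}^{-1}}(t)f(x)=\left(\mathcal{P}_t^{\mathbf{m}^{-1}}\underset{\nu,\mathbf{m}^{-1}}{*}f\right)(x)=\int_0^{+\infty}T_x^{\nu,\mathbf{m}^{-1}}\left[\mathcal{P}_t^{\mathbf{m}^{-1}}\right](y)\,e^{i\frac ab y^2}f(y)\,y^{2\nu+1}dy.$$ In the Cauchy problem the initial condition $u(0,x)=f(x)$ means that $u(t,x)\to f(x)$ as $t\to0$ in the norm of $\mathcal{L}_{p,\nu}$.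
   Formalization: For p=∞, (2) and existence in (4) require exp(i a y²/(2b))f(y) to be a.e. equal to a uniformly continuous function; existence in (4) is for r≥p; uniqueness in (4) is among jointly C^{1,2} solutions whose L_{r,ν} norm is bounded on compact t-intervals of (0,∞). *)

theory Defs
  imports "HOL-Analysis.Analysis" "HOL-Probability.Essential_Supremum"
begin

definition bessel_measure :: "real \<Rightarrow> real measure" where
  "bessel_measure \<nu> = density (lebesgue_on {0..}) (\<lambda>y. ennreal (y powr (2 * \<nu> + 1)))"

text \<open>Exponents range over [1, top] in \<^typ>\<open>ennreal\<close>, where 1 / top = 0.  Functions are defined
  on all of the real line, but only their values on {0..} matter for membership and norm.
  \<open>Lnorm\<close> is real-valued, so it is meaningful only together with \<open>in_L\<close>.\<close>

definition in_L :: "real \<Rightarrow> ennreal \<Rightarrow> (real \<Rightarrow> complex) \<Rightarrow> bool" where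
  "in_L \<nu> p f \<longleftrightarrow> f \<in> borel_measurable (bessel_measure \<nu>) \<and>
     (if p = top then \<exists>C. AE y in bessel_measure \<nu>. cmod (f y) \<le> C
      else integrable (bessel_measure \<nu>) (\<lambda>y. cmod (f y) powr enn2real p))"

definition Lnorm :: "real \<Rightarrow> ennreal \<Rightarrow> (real \<Rightarrow> complex) \<Rightarrow> real" where
  "Lnorm \<nu> p f =
     (if p = top then enn2real (esssup (bessel_measure \<nu>) (\<lambda>y. ennreal (cmod (f y))))
      else (LINT y|bessel_measure \<nu>. cmod (f y) powr enn2real p) powr (1 / enn2real p))"

definition Lconv_at_0 :: "real \<Rightarrow> ennreal \<Rightarrow> (real \<Rightarrow> real \<Rightarrow> complex) \<Rightarrow> (real \<Rightarrow> complex) \<Rightarrow> bool" where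
  "Lconv_at_0 \<nu> p v f \<longleftrightarrow>
     (\<forall>\<^sub>F t in at_right 0. in_L \<nu> p (\<lambda>x. v t x - f x)) \<and>
     ((\<lambda>t. Lnorm \<nu> p (\<lambda>x. v t x - f x)) \<longlongrightarrow> 0) (at_right 0)"

abbreviation D :: "(real \<Rightarrow> complex) \<Rightarrow> real \<Rightarrow> complex" where
  "D g \<equiv> (\<lambda>x. vector_derivative g (at x))"

definition schwartz_even :: "(real \<Rightarrow> complex) set" where
  "schwartz_even = {f. (\<forall>x. f (- x) = f x) \<and>
     (\<forall>m x. (D ^^ m) f differentiable (at x)) \<and>
     (\<forall>n m. bdd_above (range (\<lambda>x. (1 + x\<^sup>2) ^ n * cmod ((D ^^ m) f x))))}"

definition schwartz_seminorm :: "nat \<Rightarrow> nat \<Rightarrow> (real \<Rightarrow> complex) \<Rightarrow> real" where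
  "schwartz_seminorm n m f = (SUP x\<in>{0..}. (1 + x\<^sup>2) ^ n * cmod ((D ^^ m) f x))"

definition delta_expr :: "real \<Rightarrow> real \<Rightarrow> real \<Rightarrow> (real \<Rightarrow> complex) \<Rightarrow> real \<Rightarrow> complex" where
  "delta_expr \<nu> a b g x =
     D (D g) x
     + (of_real ((2 * \<nu> + 1) / x) + 2 * \<i> * of_real (a / b * x)) * D g x
     - (of_real (a\<^sup>2 / b\<^sup>2 * x\<^sup>2) - 2 * \<i> * of_real ((\<nu> + 1) * (a / b))) * g x"

text \<open>The coefficient (2 \<nu> + 1) / x is singular at 0, where the operator is understood by
  continuity (division by zero in HOL would give a wrong value there).\<close>

definition delta :: "real \<Rightarrow> real \<Rightarrow> real \<Rightarrow> (real \<Rightarrow> complex) \<Rightarrow> real \<Rightarrow> complex" where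
  "delta \<nu> a b g x =
     (if x = 0 then Lim (at 0) (delta_expr \<nu> a b g) else delta_expr \<nu> a b g x)"

definition bessel_translation ::
    "real \<Rightarrow> real \<Rightarrow> (real \<Rightarrow> complex) \<Rightarrow> real \<Rightarrow> complex" where
  "bessel_translation \<nu> x f y =
     of_real (Gamma (\<nu> + 1) / (sqrt pi * Gamma (\<nu> + 1/2))) *
     (LINT \<theta>:{0..pi}|lborel.
        f (sqrt (x\<^sup>2 + y\<^sup>2 - 2 * x * y * cos \<theta>)) * of_real (sin \<theta> powr (2 * \<nu>)))"

definition canonical_translation ::
    "real \<Rightarrow> real \<Rightarrow> real \<Rightarrow> real \<Rightarrow> (real \<Rightarrow> complex) \<Rightarrow> real \<Rightarrow> complex" where
  "canonical_translation \<nu> a b x f y =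
     exp (- (\<i> / 2) * of_real (a / b * (x\<^sup>2 + y\<^sup>2))) *
     bessel_translation \<nu> x (\<lambda>s. exp (\<i> / 2 * of_real (a / b * s\<^sup>2)) * f s) y"

definition heat_kernel ::
    "real \<Rightarrow> real \<Rightarrow> real \<Rightarrow> real \<Rightarrow> real \<Rightarrow> real \<Rightarrow> complex" where
  "heat_kernel \<nu> \<sigma> a b t x =
     of_real (2 / Gamma (\<nu> + 1) * (4 * \<sigma> * t) powr (- (\<nu> + 1))) *
     exp (- (\<i> / 2) * of_real (a / b * x\<^sup>2) - of_real (x\<^sup>2 / (4 * \<sigma> * t)))"

definition heat_semigroup ::
    "real \<Rightarrow> real \<Rightarrow> real \<Rightarrow> real \<Rightarrow> real \<Rightarrow> (real \<Rightarrow> complex) \<Rightarrow> real \<Rightarrow> complex" where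
  "heat_semigroup \<nu> \<sigma> a b t f x =
     (if t = 0 then f x
      else LINT y|bessel_measure \<nu>.
             canonical_translation \<nu> a b x (heat_kernel \<nu> \<sigma> a b t) y *
             exp (\<i> * of_real (a / b * y\<^sup>2)) * f y)"

text \<open>Classical (C^1 in time, C^2 in space) solutions on (0,\<infinity>) \<times> \<real>; the limit condition says
  that the value of the operator at x = 0 is a genuine limit.\<close>

definition heat_solution ::
    "real \<Rightarrow> real \<Rightarrow> real \<Rightarrow> real \<Rightarrow> (real \<Rightarrow> real \<Rightarrow> complex) \<Rightarrow> bool" where
  "heat_solution \<nu> \<sigma> a b v \<longleftrightarrow>
     (\<forall>t>0. \<forall>x. v t differentiable (at x) \<and> D (v t) differentiable (at x)) \<and>
     (\<forall>t>0. \<forall>x. (\<lambda>s. v s x) differentiable (at t)) \<and>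
     continuous_on ({0<..} \<times> UNIV) (\<lambda>(t, x). v t x) \<and>
     continuous_on ({0<..} \<times> UNIV) (\<lambda>(t, x). D (v t) x) \<and>
     continuous_on ({0<..} \<times> UNIV) (\<lambda>(t, x). D (D (v t)) x) \<and>
     continuous_on ({0<..} \<times> UNIV) (\<lambda>(t, x). D (\<lambda>s. v s x) t) \<and>
     (\<forall>t>0. (delta_expr \<nu> a b (v t) \<longlongrightarrow> delta \<nu> a b (v t) 0) (at 0)) \<and>
     (\<forall>t>0. \<forall>x. D (\<lambda>s. v s x) t - of_real \<sigma> * delta \<nu> a b (v t) x = 0)"

text \<open>Solutions of the Cauchy problem belonging to the Lebesgue space with exponent r, the initial
  value f being attained in the norm with exponent p.  Belonging to the space is required locally
  uniformly in t: if it is only required for each single t, uniqueness fails (there are smooth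
  solutions that vanish for t \<le> 1 and are nonzero and integrable to every power for each t > 1,
  the prototype for the one-dimensional heat equation at time 1 + s being the inverse Fourier
  transform of exp (- s \<xi>^2) / Gamma (1 + i \<xi>)).\<close>

definition cauchy_solution ::
    "real \<Rightarrow> real \<Rightarrow> real \<Rightarrow> real \<Rightarrow> ennreal \<Rightarrow> ennreal \<Rightarrow> (real \<Rightarrow> complex) \<Rightarrow>
     (real \<Rightarrow> real \<Rightarrow> complex) \<Rightarrow> bool" where
  "cauchy_solution \<nu> \<sigma> a b p r f v \<longleftrightarrow>
     heat_solution \<nu> \<sigma> a b v \<and>
     (\<forall>t>0. in_L \<nu> r (v t)) \<and>
     (\<forall>t1 t2. 0 < t1 \<and> t1 \<le> t2 \<longrightarrow> bounded ((\<lambda>t. Lnorm \<nu> r (v t)) ` {t1..t2})) \<and>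
     Lconv_at_0 \<nu> p v f"

text \<open>For p < \<infinity> this is no restriction.  In the essential supremum norm the initial value can only be
  attained if f, multiplied by the chirp, is uniformly continuous up to a null set (its chirped
  approximations are, and so is their uniform limit); a jump, for instance, is never attained.\<close>

definition admissible_initial ::
    "real \<Rightarrow> real \<Rightarrow> real \<Rightarrow> ennreal \<Rightarrow> (real \<Rightarrow> complex) \<Rightarrow> bool" where
  "admissible_initial \<nu> a b p f \<longleftrightarrow>
     (p = top \<longrightarrow> (\<exists>g. uniformly_continuous_on {0..} g \<and>
        (AE y in bessel_measure \<nu>. exp (\<i> / 2 * of_real (a / b * y\<^sup>2)) * f y = g y)))"

end

theory Submission
  imports Defs "HOL-Complex_Analysis.Cauchy_Integral_Formula" "HOL-Probability.Probability_Measure" "HOL-Real_Asymp.Real_Asymp"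
begin

text \<open>Multiplication by the chirp \<open>exp (i \<alpha> x\<^sup>2 / 2)\<close> with \<open>\<alpha> = a / b\<close> conjugates the operator to the
Bessel operator \<open>L = d\<^sup>2/dx\<^sup>2 + ((2 \<nu> + 1) / x) d/dx\<close> and preserves all the norms.  So
everything reduces to the Bessel heat flow, whose kernel is, in the variable \<open>\<kappa> = 1 / (4 \<sigma> t)\<close>,
\<open>(2 / \<Gamma>(\<nu> + 1)) \<kappa>\<^bsup>\<nu> + 1\<^esup> exp (- \<kappa> (x\<^sup>2 + y\<^sup>2)) j((\<kappa> x y)\<^sup>2)\<close>, where
\<open>j(z)\<close> is the entire function \<open>\<Sum>\<^sub>k z\<^sup>k / (k! (\<nu> + 1)\<^sub>k)\<close>, a normalised modified Bessel function.  The
integral over the angle that defines the translation produces exactly this series.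

Differentiating \<open>j\<close> raises \<open>\<nu>\<close> by one, and three consecutive orders satisfy a contiguity relation.
These two facts give all the derivatives of the kernel, its heat equation, and the intertwining of the
flows of orders \<open>\<nu>\<close> and \<open>\<nu> + 1\<close> by \<open>(1/x) d/dx\<close>.  From the last one the kernel has mass one.  With
mass one and an off-diagonal bound, the flow is a contraction and attains its initial values; a
power of the kernel is dominated by a multiple of a dilated kernel, and Hoelder's inequality for three
factors then gives the estimate from \<open>L\<^sup>p\<close> to \<open>L\<^sup>r\<close> with the stated constant.

For uniqueness, a solution is paired with the kernel of the remaining time over a large disc.
By Green's formula the pairing changes only through the derivatives of the cut-off, and the
locally uniform bound on the norm makes this change vanish as the disc grows.  Letting the
remaining time, and then the initial time, tend to zero shows that the solution is the flow of
its initial value, at first for \<open>x \<ge> 0\<close>.  Solutions live on the whole line, so it also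
has to be shown that they are even: the odd part vanishes together with its derivative at the origin,
and is zero by pairing it in time with functions of Gevrey class, a uniqueness
theorem for data on the lateral boundary.

On even Schwartz functions the operator \<open>E = (1/x) d/dx\<close> is bounded, and \<open>L = x\<^sup>2 E\<^sup>2 + (2 \<nu> + 2) E\<close>.
The intertwining relation shows that the flow preserves these functions and commutes with
\<open>L\<close>; Taylor's formula in time with the contraction property yields the expansion.\<close>

abbreviation bmeas :: "real => real measure" where
 "bmeas \<equiv> bessel_measure"

section \<open>Integrals depending on a parameter\<close>

lemma has_vector_derivative_LINT:
 fixes g g' :: "real => 'a => complex"
 assumes x0: "x0 \<in> {l<..<r}"
  and int: "!!x. x \<in> {l<..<r} ==> integrable M (g x)"
  and der: "!!x y. x \<in> {l<..<r} ==> y \<in> space M ==> ((%x. g x y) has_vector_derivative g' x y) (at x)"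
  and meas: "g' x0 \<in> borel_measurable M"
  and bound: "!!x y. x \<in> {l<..<r} ==> y \<in> space M ==> norm (g' x y) <= w y"
  and w: "integrable M w"
 shows "((%x. LINT y|M. g x y) has_vector_derivative (LINT y|M. g' x0 y)) (at x0)"
proof -
 define q where "q x y = (g x y - g x0 y) /\<^sub>R (x - x0)" for x y
 have ev: "\<forall>\<^sub>F x in at x0. x \<in> {l<..<r}"
  using x0 by (intro eventually_at_in_open') auto
 have lip: "norm (g x y - g x0 y) <= w y * \<bar>x - x0\<bar>" if "x \<in> {l<..<r}" "y \<in> space M" for x y
 proof -
  have "norm (g x y - g x0 y) <= w y * norm (x - x0)"
  proof (rule differentiable_bound[of "{l<..<r}" "%x. g x y" "%x h. h *\<^sub>R g' x y"])
   fix z assume z: "z \<in> {l<..<r}"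
   show "((%x. g x y) has_derivative (%h. h *\<^sub>R g' z y)) (at z within {l<..<r})"
    using der[OF z that(2)] unfolding has_vector_derivative_def by (rule has_derivative_at_withinI)
   show "onorm (%h. h *\<^sub>R g' z y) <= w y"
    by (rule onorm_bound) (use bound[OF z that(2)] in \<open>auto intro: mult_left_mono order_trans[OF norm_ge_zero] simp: mult.commute\<close>)
  qed (use that x0 in auto)
  then show ?thesis by simp
 qed
 have "((%x. LINT y|M. q x y) \<longlongrightarrow> (LINT y|M. g' x0 y)) (at x0)"
 proof (subst tendsto_at_iff_sequentially, intro allI impI)
  fix X :: "nat => real"
  assume X: "\<forall>i. X i \<in> UNIV - {x0}" "X \<longlonglongrightarrow> x0"
  have "\<forall>\<^sub>F i in sequentially. X i \<in> {l<..<r}"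
   using X(2) x0 by (intro topological_tendstoD) auto
  then obtain N where N: "!!i. i >= N ==> X i \<in> {l<..<r}" by (auto simp: eventually_sequentially)
  have "(%i. LINT y|M. q (X (i + N)) y) \<longlonglongrightarrow> (LINT y|M. g' x0 y)"
  proof (rule integral_dominated_convergence[where w = w])
   show "AE y in M. (%i. q (X (i + N)) y) \<longlonglongrightarrow> g' x0 y"
   proof (rule AE_I2)
    fix y assume y: "y \<in> space M"
    have "((%x. q x y) \<longlongrightarrow> g' x0 y) (at x0)"
    proof -
     have "((%x. ((g x y - g x0 y) - (x - x0) *\<^sub>R g' x0 y) /\<^sub>R norm (x - x0)) \<longlongrightarrow> 0) (at x0)"
      using der[OF x0 y] by (simp add: has_vector_derivative_def has_derivative_at_within)
     then have "((%x. norm (((g x y - g x0 y) - (x - x0) *\<^sub>R g' x0 y) /\<^sub>R norm (x - x0))) \<longlongrightarrow> 0) (at x0)"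
      by (rule tendsto_norm_zero)
     then have "((%x. norm (q x y - g' x0 y)) \<longlongrightarrow> 0) (at x0)"
     proof (rule Lim_transform_eventually)
      show "\<forall>\<^sub>F x in at x0. norm (((g x y - g x0 y) - (x - x0) *\<^sub>R g' x0 y) /\<^sub>R norm (x - x0)) = norm (q x y - g' x0 y)"
      proof (rule eventually_at_filter[THEN iffD2], rule always_eventually, intro allI impI)
       fix x assume "x ~= x0"
       then have "q x y - g' x0 y = ((g x y - g x0 y) - (x - x0) *\<^sub>R g' x0 y) /\<^sub>R (x - x0)"
        by (simp add: q_def scaleR_diff_right)
       then show "norm (((g x y - g x0 y) - (x - x0) *\<^sub>R g' x0 y) /\<^sub>R norm (x - x0)) = norm (q x y - g' x0 y)"
        by simp
      qed
     qed
     then show ?thesis by (rule LIM_zero_cancel[OF tendsto_norm_zero_cancel])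
    qed
    then have "(%i. q (X i) y) \<longlonglongrightarrow> g' x0 y"
     using X unfolding tendsto_at_iff_sequentially o_def by blast
    then show "(%i. q (X (i + N)) y) \<longlonglongrightarrow> g' x0 y"
     by (rule LIMSEQ_ignore_initial_segment)
   qed
   show "AE y in M. norm (q (X (i + N)) y) <= w y" for i
   proof (rule AE_I2)
    fix y assume y: "y \<in> space M"
    have "X (i+N) ~= x0" using X by auto
    then show "norm (q (X (i + N)) y) <= w y"
     using lip[OF N[of "i+N"] y] unfolding q_def norm_scaleR
     by (simp add: divide_inverse_commute[symmetric] pos_divide_le_eq)
   qed
   show "(%y. q (X (i + N)) y) \<in> borel_measurable M" for i
    unfolding q_def using int[OF N[of "i+N"]] int[OF x0] by (auto intro!: borel_measurable_scaleR borel_measurable_diff)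
  qed (use meas w in auto)
  then have "(%i. LINT y|M. q (X i) y) \<longlonglongrightarrow> (LINT y|M. g' x0 y)"
   by (rule LIMSEQ_offset)
  then show "((%x. LINT y|M. q x y) \<circ> X) \<longlonglongrightarrow> (LINT y|M. g' x0 y)" by (simp add: o_def)
 qed
 then have lim: "((%x. ((LINT y|M. g x y) - (LINT y|M. g x0 y)) /\<^sub>R (x - x0)) \<longlongrightarrow> (LINT y|M. g' x0 y)) (at x0)"
 proof (rule Lim_transform_eventually)
  show "\<forall>\<^sub>F x in at x0. (LINT y|M. q x y) = ((LINT y|M. g x y) - (LINT y|M. g x0 y)) /\<^sub>R (x - x0)"
   using ev by eventually_elim (auto simp: q_def int[OF x0] int Bochner_Integration.integral_diff)
 qed
 let ?G = "%x. LINT y|M. g x y" and ?d = "LINT y|M. g' x0 y"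
 have "((%x. norm ((?G x - ?G x0) /\<^sub>R (x - x0) - ?d)) \<longlongrightarrow> 0) (at x0)"
  using tendsto_norm_zero[OF LIM_zero[OF lim]] by simp
 then have "((%x. norm ((?G x - ?G x0) - (x - x0) *\<^sub>R ?d) / norm (x - x0)) \<longlongrightarrow> 0) (at x0)"
 proof (rule Lim_transform_eventually)
  show "\<forall>\<^sub>F x in at x0. norm ((?G x - ?G x0) /\<^sub>R (x - x0) - ?d) = norm ((?G x - ?G x0) - (x - x0) *\<^sub>R ?d) / norm (x - x0)"
  proof (rule eventually_at_filter[THEN iffD2], rule always_eventually, intro allI impI)
   fix x assume "x ~= x0"
   then have "(?G x - ?G x0) /\<^sub>R (x - x0) - ?d = ((?G x - ?G x0) - (x - x0) *\<^sub>R ?d) /\<^sub>R (x - x0)"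
    by (simp add: scaleR_diff_right)
   then show "norm ((?G x - ?G x0) /\<^sub>R (x - x0) - ?d) = norm ((?G x - ?G x0) - (x - x0) *\<^sub>R ?d) / norm (x - x0)"
    by (simp add: divide_inverse_commute)
  qed
 qed
 then show ?thesis
  unfolding has_vector_derivative_def has_derivative_iff_norm
  by (auto intro: bounded_linear_scaleR_left)
qed

lemma continuous_on_LINT:
 fixes g :: "'b::metric_space => 'a => complex"
 assumes meas: "!!z. z \<in> S ==> g z \<in> borel_measurable M"
  and cont: "!!y. y \<in> space M ==> continuous_on S (%z. g z y)"
  and dom: "!!z0. z0 \<in> S ==> \<exists>U w. open U & z0 \<in> U & integrable M w \<and>
        (\<forall>z\<in>S \<inter> U. \<forall>y\<in>space M. norm (g z y) <= w y)"
 shows "continuous_on S (%z. LINT y|M. g z y)"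
 unfolding continuous_on_sequentially
proof (intro allI ballI impI, elim conjE)
 fix X z0 assume X: "\<forall>n. X n \<in> S" "X \<longlonglongrightarrow> z0" and z0: "z0 \<in> S"
 obtain U w where U: "open U" "z0 \<in> U" "integrable M w"
   "!!z y. z\<in>S ==> z \<in> U ==> y\<in>space M ==> norm (g z y) <= w y"
  using dom[OF z0] by blast
 have "\<forall>\<^sub>F i in sequentially. X i \<in> U"
  using X(2) U by (intro topological_tendstoD) auto
 then obtain N where N: "!!i. i >= N ==> X i \<in> U" by (auto simp: eventually_sequentially)
 have "(%i. LINT y|M. g (X (i + N)) y) \<longlonglongrightarrow> (LINT y|M. g z0 y)"
 proof (rule integral_dominated_convergence[where w = w])
  show "AE y in M. (%i. g (X (i + N)) y) \<longlonglongrightarrow> g z0 y"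
  proof (rule AE_I2)
   fix y assume y: "y \<in> space M"
   have "(%i. g (X i) y) \<longlonglongrightarrow> g z0 y"
    using cont[OF y] X z0 unfolding continuous_on_sequentially o_def by blast
   then show "(%i. g (X (i + N)) y) \<longlonglongrightarrow> g z0 y" by (rule LIMSEQ_ignore_initial_segment)
  qed
  show "AE y in M. norm (g (X (i + N)) y) <= w y" for i
   using X N by (auto intro!: AE_I2 U(4))
 qed (use meas z0 X U in auto)
 then have "(%i. LINT y|M. g (X i) y) \<longlonglongrightarrow> (LINT y|M. g z0 y)" by (rule LIMSEQ_offset)
 then show "((%z. LINT y|M. g z y) \<circ> X) \<longlonglongrightarrow> (LINT y|M. g z0 y)" by (simp add: o_def)
qed

section \<open>The normalised modified Bessel function\<close>

text \<open>The series of \<open>\<Gamma>(\<nu> + 1) s\<^bsup>- \<nu>\<^esup> I\<^sub>\<nu>(2 s)\<close> in the variable \<open>z = s\<^sup>2\<close>.\<close>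

definition norm_bessel :: "real => real => real" where
 "norm_bessel \<nu> z = (\<Sum>k. inverse (fact k * pochhammer (\<nu> + 1) k) * z ^ k)"

lemma pochhammer_ge_half:
 fixes \<nu> :: real
 assumes "\<nu> > - 1/2"
 shows "pochhammer (\<nu> + 1) k >= pochhammer (1/2) k"
proof -
 have "(\<Prod>i<k. 1/2 + real i) <= (\<Prod>i<k. \<nu> + 1 + real i)"
  by (rule prod_mono) (use assms in auto)
 then show ?thesis by (simp add: pochhammer_prod atLeast0LessThan)
qed

lemma pochhammer_half: "pochhammer (1/2) k = fact (2 * k) / (4 ^ k * fact k :: real)"
 by (simp add: fact_double power_mult)

lemma pochhammer_half_ge: "pochhammer (1/2) k >= (fact k / 4 ^ k :: real)"
proof -
 have "(fact k :: real) * fact k <= fact (2 * k)"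
 proof -
  have "fact k * fact k dvd (fact (k + k) :: nat)" by (rule fact_fact_dvd_fact)
  then have "fact k * fact k <= (fact (k + k) :: nat)" by (rule dvd_imp_le) simp
  then have "real (fact k * fact k) <= real (fact (k + k))" by (rule of_nat_mono)
  then show ?thesis by (simp add: mult_2)
 qed
 then show ?thesis by (simp add: pochhammer_half field_simps)
qed

lemma pochhammer_pos': "(\<nu> :: real) > - 1/2 ==> pochhammer (\<nu> + 1) k > 0"
 by (intro pochhammer_pos) auto

lemma norm_bessel_summable:
 fixes \<nu> :: real
 assumes "\<nu> > - 1/2"
 shows "summable (%k. inverse (fact k * pochhammer (\<nu> + 1) k) * z ^ k)"
proof (rule summable_comparison_test')
 show "summable (%k. inverse (fact k) * (4 * \<bar>z\<bar>) ^ k)" by (rule summable_exp)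
 show "norm (inverse (fact k * pochhammer (\<nu> + 1) k) * z ^ k) <= inverse (fact k) * (4 * \<bar>z\<bar>) ^ k" for k
 proof -
  have "1 / 4 ^ k <= (fact k / 4 ^ k :: real)" by (intro divide_right_mono) auto
  also have "\<dots> <= pochhammer (\<nu> + 1) k"
   using pochhammer_ge_half[OF assms] pochhammer_half_ge order_trans by blast
  finally have "inverse (pochhammer (\<nu> + 1) k) <= 4 ^ k"
   using pochhammer_pos'[OF assms, of k] by (simp add: field_simps)
  then have "inverse (fact k) * (inverse (pochhammer (\<nu> + 1) k) * \<bar>z\<bar> ^ k) <= inverse (fact k) * (4 ^ k * \<bar>z\<bar> ^ k)"
   by (intro mult_left_mono mult_right_mono) auto
  then show ?thesis
   using pochhammer_pos'[OF assms, of k] by (simp add: abs_mult power_abs power_mult_distrib)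
 qed
qed

lemma norm_bessel_deriv:
 fixes \<nu> :: real
 assumes "\<nu> > - 1/2"
 shows "(norm_bessel \<nu> has_real_derivative norm_bessel (\<nu> + 1) z / (\<nu> + 1)) (at z)"
proof -
 let ?c = "%k. inverse (fact k * pochhammer (\<nu> + 1) k)"
 have "((%z. \<Sum>k. ?c k * z ^ k) has_field_derivative (\<Sum>k. diffs ?c k * z ^ k)) (at z)"
  by (rule termdiffs_strong_converges_everywhere) (rule norm_bessel_summable[OF assms])
 moreover have "diffs ?c k * z ^ k = (inverse (fact k * pochhammer (\<nu> + 1 + 1) k) * z ^ k) / (\<nu> + 1)" for k
 proof -
  have "real (Suc k) * inverse (real (Suc k) * fact k * ((\<nu> + 1) * X)) * z ^ k = inverse (fact k * X) * z ^ k / (\<nu> + 1)" for X :: real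
   using assms by (simp add: divide_simps del: of_nat_Suc)
  from this[of "pochhammer (\<nu> + 1 + 1) k"] show ?thesis
   by (simp add: diffs_def pochhammer_rec del: of_nat_Suc)
 qed
 ultimately show ?thesis
  using suminf_divide[OF norm_bessel_summable[of "\<nu> + 1" z], of "\<nu> + 1"] assms
  by (simp add: norm_bessel_def[abs_def])
qed

lemma norm_bessel_contiguous:
 fixes \<nu> :: real
 assumes "\<nu> > - 1/2"
 shows "norm_bessel \<nu> z = norm_bessel (\<nu> + 1) z + z * norm_bessel (\<nu> + 2) z / ((\<nu> + 1) * (\<nu> + 2))"
proof -
 let ?c = "%\<nu> k. inverse (fact k * pochhammer (\<nu> + 1) k) * z ^ k"
 let ?d = "%k. case k of 0 => 0 | Suc k => z * ?c (\<nu> + 2) k / ((\<nu> + 1) * (\<nu> + 2))"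
 have s: "(%k. ?c \<mu> k) sums norm_bessel \<mu> z" if "\<mu> > - 1/2" for \<mu>
  unfolding norm_bessel_def by (rule summable_sums[OF norm_bessel_summable[OF that]])
 have "(%k. z * ?c (\<nu> + 2) k / ((\<nu> + 1) * (\<nu> + 2))) sums (z * norm_bessel (\<nu> + 2) z / ((\<nu> + 1) * (\<nu> + 2)))"
  using s[of "\<nu> + 2"] assms by (intro sums_divide sums_mult) auto
 then have "?d sums (z * norm_bessel (\<nu> + 2) z / ((\<nu> + 1) * (\<nu> + 2)))"
  using sums_Suc_iff[of ?d] by simp
 from sums_add[OF s[of "\<nu> + 1"] this] have
  "(%k. ?c (\<nu> + 1) k + ?d k) sums (norm_bessel (\<nu> + 1) z + z * norm_bessel (\<nu> + 2) z / ((\<nu> + 1) * (\<nu> + 2)))"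
  using assms by simp
 moreover have "?c (\<nu> + 1) k + ?d k = ?c \<nu> k" for k
 proof (cases k)
  case (Suc j)
  define P where "P = pochhammer (\<nu> + 3) j"
  have P: "P > 0" using pochhammer_pos'[of "\<nu> + 2" j] assms by (simp add: P_def add.commute)
  have e1: "pochhammer (\<nu> + 1) (Suc j) * (\<nu> + 2 + j) = (\<nu> + 1) * ((\<nu> + 2) * P)"
   using pochhammer_rec[of "\<nu> + 1" "Suc j"] pochhammer_rec[of "\<nu> + 2" j]
    pochhammer_Suc[of "\<nu> + 1" "Suc j"]
   by (simp add: P_def algebra_simps)
  have e2: "pochhammer (\<nu> + 2) (Suc j) = (\<nu> + 2) * P"
   using pochhammer_rec[of "\<nu> + 2" j] by (simp add: P_def algebra_simps)
  have p: "\<nu> + 2 + j > 0" "\<nu> + 1 > 0" "\<nu> + 2 > 0" using assms by auto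
  have e3: "pochhammer (\<nu> + 1) (Suc j) = (\<nu> + 1) * ((\<nu> + 2) * P) / (\<nu> + 2 + j)"
   using e1 p by (simp add: field_simps)
  have "?c (\<nu> + 1) k = inverse (fact (Suc j) * ((\<nu> + 2) * P)) * z ^ Suc j"
   using e2 by (simp add: Suc add.commute add.left_commute)
  moreover have "?d k = z * (inverse (fact j * P) * z ^ j) / ((\<nu> + 1) * (\<nu> + 2))"
   by (simp add: Suc P_def add.commute add.left_commute)
  moreover have "?c \<nu> k = inverse (fact (Suc j) * ((\<nu> + 1) * ((\<nu> + 2) * P) / (\<nu> + 2 + j))) * z ^ Suc j"
   by (simp only: Suc e3)
  moreover have "inverse (fact (Suc j) * ((\<nu> + 2) * P)) * z ^ Suc j + z * (inverse (fact j * P) * z ^ j) / ((\<nu> + 1) * (\<nu> + 2))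
   = inverse (fact (Suc j) * ((\<nu> + 1) * ((\<nu> + 2) * P) / (\<nu> + 2 + j))) * z ^ Suc j"
  proof -
   have *: "inverse (Sj * fj * ((\<nu> + 2) * P)) * (z * zj) + z * (inverse (fj * P) * zj) / ((\<nu> + 1) * (\<nu> + 2))
   = inverse (Sj * fj * ((\<nu> + 1) * ((\<nu> + 2) * P) / (\<nu> + 1 + Sj))) * (z * zj)" if "Sj > 0" "fj > 0" for Sj fj zj :: real
    using that P p by (simp add: divide_simps) (simp add: algebra_simps)?
   from *[of "real (Suc j)" "fact j" "z ^ j"] show ?thesis by (simp add: add_ac del: of_nat_Suc) (simp add: add_ac)?
  qed
  ultimately show ?thesis by simp
 qed auto
 ultimately have "(%k. ?c \<nu> k) sums (norm_bessel (\<nu> + 1) z + z * norm_bessel (\<nu> + 2) z / ((\<nu> + 1) * (\<nu> + 2)))"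
  by simp
 with s[OF assms] show ?thesis by (rule sums_unique2)
qed

lemma norm_bessel_0 [simp]: "norm_bessel \<nu> 0 = 1"
 unfolding norm_bessel_def using powser_zero[of "%k. inverse (fact k * pochhammer (\<nu> + 1) k)"] by simp

lemma continuous_on_norm_bessel [continuous_intros]:
 assumes "\<nu> > - 1/2" "continuous_on S f"
 shows "continuous_on S (%x. norm_bessel \<nu> (f x))"
proof -
 have "continuous_on UNIV (norm_bessel \<nu>)"
  using norm_bessel_deriv[OF assms(1)] by (auto intro!: continuous_at_imp_continuous_on DERIV_isCont)
 then show ?thesis using assms(2) continuous_on_compose2 by blast
qed

section \<open>The distribution of the angle\<close>

lemma has_absolute_integral_sin_powr:
 fixes \<nu> :: real
 assumes nu: "\<nu> > - 1/2"
 shows "(%\<theta>. sin \<theta> powr (2 * \<nu>)) absolutely_integrable_on {0<..<pi}"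
  and "integral {0<..<pi} (%\<theta>. sin \<theta> powr (2 * \<nu>)) = sqrt pi * Gamma (\<nu> + 1/2) / Gamma (\<nu> + 1)"
proof -
 let ?S = "{0<..<pi}" and ?g = "%\<theta>::real. (1 - cos \<theta>) / 2" and ?a = "\<nu> + 1/2"
 define f where "f = (%t::real. 2 powr (2 * \<nu>) * (t powr (?a - 1) * (1 - t) powr (?a - 1)))"
 have "((%t. t powr (?a - 1) * (1 - t) powr (?a - 1)) has_integral Beta ?a ?a) {0..1}"
  by (rule has_integral_Beta_real) (use nu in auto)
 then have f01: "(f has_integral 2 powr (2 * \<nu>) * Beta ?a ?a) {0<..<1}"
  unfolding f_def has_integral_Icc_iff_Ioo by (rule has_integral_mult_right)
 have fai: "f absolutely_integrable_on {0<..<1}"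
  by (rule nonnegative_absolutely_integrable_1) (use f01 in \<open>auto simp: f_def\<close>)
 have img: "?g ` ?S = {0<..<1}"
 proof (intro equalityI subsetI)
  fix t assume "t \<in> ?g ` ?S"
  then obtain \<theta> where \<theta>: "0 < \<theta>" "\<theta> < pi" "t = ?g \<theta>" by auto
  have "cos \<theta> < cos 0" "cos pi < cos \<theta>" using \<theta> by (intro cos_monotone_0_pi; simp)+
  then show "t \<in> {0<..<1}" using \<theta> by simp
 next
  fix t :: real assume t: "t \<in> {0<..<1}"
  have "arccos (1 - 2 * t) \<in> ?S" using t arccos_lt_bounded[of "1 - 2 * t"] by auto
  moreover have "?g (arccos (1 - 2 * t)) = t" using t by (simp add: cos_arccos)
  ultimately show "t \<in> ?g ` ?S" by (metis image_eqI)
 qed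
 have inj: "inj_on ?g ?S"
  by (rule inj_onI) (auto intro: cos_inj_pi)
 have "(%\<theta>. \<bar>sin \<theta> / 2\<bar> * f (?g \<theta>)) absolutely_integrable_on ?S \<and>
    integral ?S (%\<theta>. \<bar>sin \<theta> / 2\<bar> * f (?g \<theta>)) = 2 powr (2 * \<nu>) * Beta ?a ?a"
  by (subst has_absolute_integral_change_of_variables_1'[where g = ?g])
   (use inj fai f01 img in \<open>auto intro!: derivative_eq_intros simp: integral_unique\<close>)
 moreover have "\<bar>sin \<theta> / 2\<bar> * f (?g \<theta>) = sin \<theta> powr (2 * \<nu>)" if "\<theta> \<in> ?S" for \<theta>
 proof -
  have s: "sin \<theta> > 0" using that by (intro sin_gt_zero) auto
  have "?g \<theta> * (1 - ?g \<theta>) = (sin \<theta> / 2) powr 2"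

  proof -
   have "?g \<theta> * (1 - ?g \<theta>) = (1 - (cos \<theta>)\<^sup>2) / 4" by (simp add: power2_eq_square field_simps)
   also have "\<dots> = (sin \<theta> / 2)\<^sup>2" by (simp add: sin_squared_eq power_divide)
   finally show ?thesis using s by simp
  qed
  moreover have "?g \<theta> >= 0" using cos_le_one[of \<theta>] by (simp add: field_simps)
  moreover have "1 - ?g \<theta> >= 0"
  proof -
   have "1 - ?g \<theta> = (1 + cos \<theta>) / 2" by (simp add: field_simps)
   moreover have "1 + cos \<theta> >= 0" using abs_cos_le_one[of \<theta>] by linarith
   ultimately show ?thesis by simp
  qed
  ultimately have "f (?g \<theta>) = 2 powr (2 * \<nu>) * (((sin \<theta> / 2) powr 2) powr (?a - 1))"
   unfolding f_def by (simp only: powr_mult[symmetric])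
  also have "\<dots> = 2 powr (2 * \<nu>) * (sin \<theta> / 2) powr (2 * \<nu> - 1)"
   unfolding powr_powr by (simp add: algebra_simps)
  also have "\<bar>sin \<theta> / 2\<bar> * \<dots> = 2 powr (2 * \<nu>) * (sin \<theta> / 2) powr (2 * \<nu>)"
   using s by (simp add: powr_diff)
  also have "\<dots> = (2 * (sin \<theta> / 2)) powr (2 * \<nu>)" using s by (subst powr_mult) auto
  also have "\<dots> = sin \<theta> powr (2 * \<nu>)" by simp
  finally show ?thesis .
 qed
 moreover have "2 powr (2 * \<nu>) * Beta ?a ?a = sqrt pi * Gamma (\<nu> + 1/2) / Gamma (\<nu> + 1)"
 proof -
  have n: "complex_of_real ?a \<notin> \<int>\<^sub>\<le>\<^sub>0" "complex_of_real ?a + 1/2 \<notin> \<int>\<^sub>\<le>\<^sub>0"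
  proof -
   have "complex_of_real ?a ~= of_int k" "complex_of_real ?a + 1/2 ~= of_int k" if "k <= 0" for k
   proof -
    have "?a ~= of_int k" "?a + 1/2 ~= of_int k" using that nu by auto
    then have "complex_of_real ?a ~= complex_of_real (of_int k)" "complex_of_real (?a + 1/2) ~= complex_of_real (of_int k)"
     by (metis of_real_eq_iff)+
    then show "complex_of_real ?a ~= of_int k" "complex_of_real ?a + 1/2 ~= of_int k" by auto
   qed
   then show "complex_of_real ?a \<notin> \<int>\<^sub>\<le>\<^sub>0" "complex_of_real ?a + 1/2 \<notin> \<int>\<^sub>\<le>\<^sub>0" by (auto elim!: nonpos_Ints_cases)
  qed
  have e: "complex_of_real ?a + 1/2 = complex_of_real (\<nu> + 1)" "2 * complex_of_real ?a = complex_of_real (2 * ?a)"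
   "(1 - complex_of_real (2 * ?a)) * of_real (ln 2) = complex_of_real ((1 - 2 * ?a) * ln 2)" by auto
  have "complex_of_real (Gamma ?a * Gamma (\<nu> + 1)) = complex_of_real (exp ((1 - 2 * ?a) * ln 2) * sqrt pi * Gamma (2 * ?a))"
   using Gamma_legendre_duplication[OF n] unfolding e
   by (simp only: Gamma_complex_of_real exp_of_real of_real_mult[symmetric])
  then have "Gamma ?a * Gamma (\<nu> + 1) = exp ((1 - 2 * ?a) * ln 2) * sqrt pi * Gamma (2 * ?a)"
   by (simp only: of_real_eq_iff)
  also have "exp ((1 - 2 * ?a) * ln 2) = 1 / 2 powr (2 * \<nu>)"
  proof -
   have "exp ((1 - 2 * ?a) * ln 2) = 2 powr (- (2 * \<nu>))" by (simp add: powr_def)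
   then show ?thesis by (simp add: powr_minus_divide)
  qed
  finally have d: "2 powr (2 * \<nu>) * (Gamma ?a * Gamma (\<nu> + 1)) = sqrt pi * Gamma (2 * ?a)"
   by (simp add: field_simps)
  have p: "Gamma ?a > 0" "Gamma (\<nu> + 1) > 0" "Gamma (2 * ?a) > 0" using nu by (auto intro!: Gamma_real_pos)
  have "Beta ?a ?a = Gamma ?a * Gamma ?a / Gamma (2 * ?a)" by (simp add: Beta_def)
  then have "2 powr (2 * \<nu>) * Beta ?a ?a = (2 powr (2 * \<nu>) * (Gamma ?a * Gamma (\<nu> + 1))) * Gamma ?a / (Gamma (2 * ?a) * Gamma (\<nu> + 1))"
   using p by (simp add: field_simps)
  also have "\<dots> = sqrt pi * Gamma ?a / Gamma (\<nu> + 1)" unfolding d using p by simp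
  finally show ?thesis by simp
 qed
 ultimately show "(%\<theta>. sin \<theta> powr (2 * \<nu>)) absolutely_integrable_on ?S"
  and "integral ?S (%\<theta>. sin \<theta> powr (2 * \<nu>)) = sqrt pi * Gamma (\<nu> + 1/2) / Gamma (\<nu> + 1)"
  using set_integrable_cong[of lebesgue lebesgue ?S ?S "%\<theta>. \<bar>sin \<theta> / 2\<bar> * f (?g \<theta>)" "%\<theta>. sin \<theta> powr (2 * \<nu>)"]
   Henstock_Kurzweil_Integration.integral_cong[of ?S "%\<theta>. \<bar>sin \<theta> / 2\<bar> * f (?g \<theta>)" "%\<theta>. sin \<theta> powr (2 * \<nu>)"]
  by auto
qed

definition angle_density :: "real => real => real" where
 "angle_density \<nu> \<theta> = indicator {0..pi} \<theta> *
  (Gamma (\<nu> + 1) / (sqrt pi * Gamma (\<nu> + 1/2)) * sin \<theta> powr (2 * \<nu>))"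

definition angle_measure :: "real => real measure" where
 "angle_measure \<nu> = density lborel (%\<theta>. ennreal (angle_density \<nu> \<theta>))"

lemma angle_density_measurable [measurable]: "angle_density \<nu> \<in> borel_measurable borel"
 unfolding angle_density_def by measurable

lemma angle_density_nonneg: "\<nu> > - 1/2 ==> angle_density \<nu> \<theta> >= 0"
 unfolding angle_density_def
 by (intro mult_nonneg_nonneg divide_nonneg_nonneg less_imp_le[OF Gamma_real_pos]) auto

lemma sets_angle_measure [measurable_cong]: "sets (angle_measure \<nu>) = sets borel"
 and space_angle_measure [simp]: "space (angle_measure \<nu>) = UNIV"
 by (simp_all add: angle_measure_def)

lemma integral_angle_measure:
 assumes nu: "\<nu> > - 1/2" and f: "f \<in> borel_measurable borel"
 shows "(LINT \<theta>|angle_measure \<nu>. f \<theta> :: 'a :: {banach, second_countable_topology}) = (LINT \<theta>|lborel. angle_density \<nu> \<theta> *\<^sub>R f \<theta>)"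
 unfolding angle_measure_def using assms
 by (intro integral_density) (auto intro!: AE_I2 angle_density_nonneg)

lemma angle_density_has_integral:
 assumes nu: "\<nu> > - 1/2"
 shows "integrable lborel (angle_density \<nu>)" "(LINT \<theta>|lborel. angle_density \<nu> \<theta>) = 1"
proof -
 let ?C = "Gamma (\<nu> + 1) / (sqrt pi * Gamma (\<nu> + 1/2))"
 have "?C * (sqrt pi * Gamma (\<nu> + 1/2) / Gamma (\<nu> + 1)) = 1"
  using Gamma_real_pos[of "\<nu> + 1"] Gamma_real_pos[of "\<nu> + 1/2"] nu by (simp add: less_imp_neq[symmetric])
 moreover have "((%\<theta>. sin \<theta> powr (2 * \<nu>)) has_integral sqrt pi * Gamma (\<nu> + 1/2) / Gamma (\<nu> + 1)) {0<..<pi}"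
  using has_absolute_integral_sin_powr[OF nu] by (metis set_lebesgue_integral_eq_integral(1) has_integral_integral)
 ultimately have hi: "((%\<theta>. ?C * sin \<theta> powr (2 * \<nu>)) has_integral 1) {0..pi}"
  by (metis has_integral_Icc_iff_Ioo has_integral_mult_right)
 have "((%\<theta>. ?C * sin \<theta> powr (2 * \<nu>)) absolutely_integrable_on {0..pi})"
  by (rule nonnegative_absolutely_integrable_1)
   (use hi nu in \<open>auto intro!: mult_nonneg_nonneg divide_nonneg_nonneg less_imp_le[OF Gamma_real_pos]\<close>)
 then have si: "set_integrable lborel {0..pi} (%\<theta>. ?C * sin \<theta> powr (2 * \<nu>))"
  unfolding set_integrable_def by (subst (asm) integrable_completion) auto
 then show "integrable lborel (angle_density \<nu>)"
  by (simp add: set_integrable_def angle_density_def[abs_def])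
 show "(LINT \<theta>|lborel. angle_density \<nu> \<theta>) = 1"
 proof -
  have "(LINT \<theta>|lborel. angle_density \<nu> \<theta>) = (LINT \<theta>:{0..pi}|lborel. ?C * sin \<theta> powr (2 * \<nu>))"
   by (simp only: set_lebesgue_integral_def angle_density_def real_scaleR_def)
  also have "\<dots> = 1" using set_borel_integral_eq_integral(2)[OF si] integral_unique[OF hi] by (simp only:)
  finally show ?thesis .
 qed
qed

lemma prob_space_angle_measure:
 assumes nu: "\<nu> > - 1/2"
 shows "prob_space (angle_measure \<nu>)"
proof
 have "emeasure (angle_measure \<nu>) (space (angle_measure \<nu>)) = (\<integral>\<^sup>+\<theta>. ennreal (angle_density \<nu> \<theta>) \<partial>lborel)"
  by (simp add: angle_measure_def emeasure_density)
 also have "\<dots> = ennreal (LINT \<theta>|lborel. angle_density \<nu> \<theta>)"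
  using angle_density_has_integral(1)[OF nu] angle_density_nonneg[OF nu] by (intro nn_integral_eq_integral) auto
 finally show "emeasure (angle_measure \<nu>) (space (angle_measure \<nu>)) = 1"
  using angle_density_has_integral(2)[OF nu] by simp
qed

lemma integrable_angle_bounded:
 fixes f :: "real => 'a :: {banach, second_countable_topology}"
 assumes nu: "\<nu> > - 1/2" and f: "f \<in> borel_measurable borel" "!!\<theta>. norm (f \<theta>) <= B"
 shows "integrable (angle_measure \<nu>) f"
proof -
 interpret prob_space "angle_measure \<nu>" by (rule prob_space_angle_measure[OF nu])
 show ?thesis using f by (intro integrable_const_bound[of _ B]) auto
qed

definition angle_moment :: "real => nat => real" where
 "angle_moment \<nu> n = (LINT \<theta>|angle_measure \<nu>. cos \<theta> ^ n)"

lemma angle_moment_has_integral: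
 assumes nu: "\<nu> > - 1/2"
 shows "((%\<theta>. cos \<theta> ^ n * sin \<theta> powr (2 * \<nu>)) has_integral
     angle_moment \<nu> n * (sqrt pi * Gamma (\<nu> + 1/2) / Gamma (\<nu> + 1))) {0..pi}"
proof -
 let ?C = "Gamma (\<nu> + 1) / (sqrt pi * Gamma (\<nu> + 1/2))"
 have C: "?C > 0" using nu by (auto intro!: divide_pos_pos mult_pos_pos Gamma_real_pos)
 have "integrable (angle_measure \<nu>) (%\<theta>. cos \<theta> ^ n)"
  by (rule integrable_angle_bounded[OF nu, of _ 1]) (auto simp: power_abs intro: power_le_one)
 then have "integrable lborel (%\<theta>. angle_density \<nu> \<theta> * cos \<theta> ^ n)"
  unfolding angle_measure_def
  by (subst (asm) integrable_density) (use nu in \<open>auto intro!: AE_I2 angle_density_nonneg\<close>)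
 then have si: "set_integrable lborel {0..pi} (%\<theta>. ?C * (cos \<theta> ^ n * sin \<theta> powr (2 * \<nu>)))"
  by (simp add: set_integrable_def angle_density_def mult_ac)
 have "angle_moment \<nu> n = (LINT \<theta>|lborel. angle_density \<nu> \<theta> * cos \<theta> ^ n)"
  unfolding angle_moment_def using nu by (subst integral_angle_measure) auto
 also have "\<dots> = (LINT \<theta>:{0..pi}|lborel. ?C * (cos \<theta> ^ n * sin \<theta> powr (2 * \<nu>)))"
  by (simp add: set_lebesgue_integral_def angle_density_def mult_ac)
 finally have "((%\<theta>. ?C * (cos \<theta> ^ n * sin \<theta> powr (2 * \<nu>))) has_integral angle_moment \<nu> n) {0..pi}"
  using set_borel_integral_eq_integral[OF si] by (metis has_integral_integral)
 then have "((%\<theta>. inverse ?C * (?C * (cos \<theta> ^ n * sin \<theta> powr (2 * \<nu>)))) has_integral inverse ?C * angle_moment \<nu> n) {0..pi}"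
  by (rule has_integral_mult_right)
 moreover have "inverse ?C * (?C * X) = X" for X
 proof -
  have "inverse c * (c * X) = X" if "c > 0" for c :: real using that by simp
  from this[OF C] show ?thesis .
 qed
 ultimately have "((%\<theta>. cos \<theta> ^ n * sin \<theta> powr (2 * \<nu>)) has_integral inverse ?C * angle_moment \<nu> n) {0..pi}"
  by (simp only:)
 then show ?thesis by (simp only: inverse_divide mult.commute)
qed

lemma has_real_derivative_sin_powr:
 assumes "\<theta> \<in> {0<..<pi}"
 shows "((%\<theta>. sin \<theta> powr s) has_real_derivative s * sin \<theta> powr (s - 1) * cos \<theta>) (at \<theta>)"
proof -
 have "sin \<theta> > 0" using assms by (intro sin_gt_zero) auto
 then show ?thesis by (auto intro!: derivative_eq_intros simp: powr_diff field_simps)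
qed

lemma angle_moment_Suc_0:
 assumes nu: "\<nu> > - 1/2"
 shows "angle_moment \<nu> (Suc 0) = 0"
proof -
 let ?C = "sqrt pi * Gamma (\<nu> + 1/2) / Gamma (\<nu> + 1)"
 have C: "?C > 0" using nu by (auto intro!: divide_pos_pos mult_pos_pos Gamma_real_pos)
 have "((%\<theta>. (2 * \<nu> + 1) * sin \<theta> powr (2 * \<nu> + 1 - 1) * cos \<theta>) has_integral sin pi powr (2 * \<nu> + 1) - sin 0 powr (2 * \<nu> + 1)) {0..pi}"
  by (rule fundamental_theorem_of_calculus_interior)
   (use nu has_real_derivative_sin_powr[of _ "2 * \<nu> + 1"] in \<open>auto intro!: continuous_intros has_real_derivative_iff_has_vector_derivative[THEN iffD1] sin_ge_zero continuous_on_powr' simp del: add_diff_cancel_right'\<close>)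
 then have "((%\<theta>. (2 * \<nu> + 1) * (cos \<theta> ^ Suc 0 * sin \<theta> powr (2 * \<nu>))) has_integral 0) {0..pi}"
  using nu by (simp add: mult_ac)
 moreover have "((%\<theta>. (2 * \<nu> + 1) * (cos \<theta> ^ Suc 0 * sin \<theta> powr (2 * \<nu>))) has_integral (2 * \<nu> + 1) * (angle_moment \<nu> (Suc 0) * ?C)) {0..pi}"
  by (intro has_integral_mult_right angle_moment_has_integral[OF nu])
 ultimately have "(2 * \<nu> + 1) * (angle_moment \<nu> (Suc 0) * ?C) = 0" by (rule has_integral_unique[symmetric])
 then have "2 * \<nu> + 1 = 0 \<or> angle_moment \<nu> (Suc 0) = 0 \<or> ?C = 0" by (simp only: mult_eq_0_iff)
 then show ?thesis using nu C by linarith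
qed

lemma angle_moment_rec:
 assumes nu: "\<nu> > - 1/2"
 shows "angle_moment \<nu> (n + 2) = (n + 1) / (n + 2 + 2 * \<nu>) * angle_moment \<nu> n"
proof -
 let ?C = "sqrt pi * Gamma (\<nu> + 1/2) / Gamma (\<nu> + 1)" and ?s = "%\<theta>. sin \<theta> powr (2 * \<nu>)"
 have C: "?C > 0" using nu by (auto intro!: divide_pos_pos mult_pos_pos Gamma_real_pos)
 have "((%\<theta>. (n + 2 + 2 * \<nu>) * (cos \<theta> ^ (n + 2) * ?s \<theta>) - (n + 1) * (cos \<theta> ^ n * ?s \<theta>)) has_integral
  (cos pi ^ (n + 1) * sin pi powr (2 * \<nu> + 1) - cos 0 ^ (n + 1) * sin 0 powr (2 * \<nu> + 1))) {0..pi}"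
 proof (rule fundamental_theorem_of_calculus_interior)
  show "continuous_on {0..pi} (%\<theta>. cos \<theta> ^ (n + 1) * sin \<theta> powr (2 * \<nu> + 1))"
   using nu by (auto intro!: continuous_intros sin_ge_zero continuous_on_powr')
  fix \<theta> :: real assume \<theta>: "\<theta> \<in> {0<..<pi}"
  have s: "sin \<theta> > 0" using \<theta> by (intro sin_gt_zero) auto
  have "((%\<theta>. cos \<theta> ^ (n + 1) * sin \<theta> powr (2 * \<nu> + 1)) has_real_derivative
   real (n + 1) * cos \<theta> ^ n * (- sin \<theta>) * sin \<theta> powr (2 * \<nu> + 1) +
   cos \<theta> ^ (n + 1) * ((2 * \<nu> + 1) * sin \<theta> powr (2 * \<nu> + 1 - 1) * cos \<theta>)) (at \<theta>)"
  proof -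
   have "((%\<theta>. cos \<theta> ^ (n + 1)) has_real_derivative real (n + 1) * cos \<theta> ^ n * (- sin \<theta>)) (at \<theta>)"
    using DERIV_power[OF DERIV_cos, of "n + 1" \<theta>] by (simp add: mult_ac)
   from DERIV_mult[OF this has_real_derivative_sin_powr[OF \<theta>, of "2 * \<nu> + 1"]] show ?thesis by (simp add: mult_ac add_ac)
  qed
  moreover have "sin \<theta> powr (2 * \<nu> + 1) = sin \<theta> * ?s \<theta>" using s by (simp add: powr_add)
  moreover have "real (n + 1) * cos \<theta> ^ n * (- sin \<theta>) * (sin \<theta> * ?s \<theta>) + cos \<theta> ^ (n + 1) * ((2 * \<nu> + 1) * ?s \<theta> * cos \<theta>)
   = (n + 2 + 2 * \<nu>) * (cos \<theta> ^ (n + 2) * ?s \<theta>) - (n + 1) * (cos \<theta> ^ n * ?s \<theta>)"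
  proof -
   have "sin \<theta> * sin \<theta> = 1 - cos \<theta> * cos \<theta>"
    using sin_cos_squared_add[of \<theta>] by (simp add: power2_eq_square)
   then have "real (n + 1) * cos \<theta> ^ n * (- sin \<theta>) * (sin \<theta> * ?s \<theta>) = - real (n + 1) * cos \<theta> ^ n * (1 - cos \<theta> * cos \<theta>) * ?s \<theta>"
    by (simp only: mult.assoc[symmetric] mult_minus_right minus_mult_left) (simp only: mult.assoc)
   then show ?thesis by (simp add: algebra_simps)
  qed
  ultimately show "((%\<theta>. cos \<theta> ^ (n + 1) * sin \<theta> powr (2 * \<nu> + 1)) has_vector_derivative
   (n + 2 + 2 * \<nu>) * (cos \<theta> ^ (n + 2) * ?s \<theta>) - (n + 1) * (cos \<theta> ^ n * ?s \<theta>)) (at \<theta>)"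
   by (simp add: has_real_derivative_iff_has_vector_derivative)
 qed auto
 then have "((%\<theta>. (n + 2 + 2 * \<nu>) * (cos \<theta> ^ (n + 2) * ?s \<theta>) - (n + 1) * (cos \<theta> ^ n * ?s \<theta>)) has_integral 0) {0..pi}"
  by simp
 moreover have "((%\<theta>. (n + 2 + 2 * \<nu>) * (cos \<theta> ^ (n + 2) * ?s \<theta>) - (n + 1) * (cos \<theta> ^ n * ?s \<theta>)) has_integral
   (n + 2 + 2 * \<nu>) * (angle_moment \<nu> (n + 2) * ?C) - (n + 1) * (angle_moment \<nu> n * ?C)) {0..pi}"
  by (intro has_integral_diff has_integral_mult_right angle_moment_has_integral[OF nu])
 ultimately have "(n + 2 + 2 * \<nu>) * (angle_moment \<nu> (n + 2) * ?C) - (n + 1) * (angle_moment \<nu> n * ?C) = 0"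
  by (rule has_integral_unique[symmetric])
 then have "((n + 2 + 2 * \<nu>) * angle_moment \<nu> (n + 2) - (n + 1) * angle_moment \<nu> n) * ?C = 0"
  by (simp only: left_diff_distrib mult.assoc)
 then have "(n + 2 + 2 * \<nu>) * angle_moment \<nu> (n + 2) = (n + 1) * angle_moment \<nu> n"
  using C by (simp only: mult_eq_0_iff) auto
 moreover have "n + 2 + 2 * \<nu> > 0" using nu by simp
 ultimately show ?thesis by (simp add: field_simps)
qed

lemma angle_moment_odd: "\<nu> > - 1/2 ==> angle_moment \<nu> (2 * k + 1) = 0"
proof (induction k)
 case (Suc k)
 then show ?case using angle_moment_rec[of \<nu> "2 * k + 1"] by simp
qed (simp add: angle_moment_Suc_0)

lemma angle_moment_even:
 assumes nu: "\<nu> > - 1/2"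
 shows "angle_moment \<nu> (2 * k) = pochhammer (1/2) k / pochhammer (\<nu> + 1) k"
proof (induction k)
 case 0
 interpret prob_space "angle_measure \<nu>" by (rule prob_space_angle_measure[OF nu])
 show ?case using prob_space by (simp add: angle_moment_def)
next
 case (Suc k)
 have "angle_moment \<nu> (2 * Suc k) = (2 * k + 1) / (2 * k + 2 + 2 * \<nu>) * (pochhammer (1/2) k / pochhammer (\<nu> + 1) k)"
  using angle_moment_rec[OF nu, of "2 * k"] Suc by (simp add: add_ac)
 also have "(2 * k + 1) / (2 * k + 2 + 2 * \<nu>) = (1/2 + k) / (\<nu> + 1 + k)"
  using nu by (simp add: divide_simps) (simp add: algebra_simps)?
 also have "(1/2 + k) / (\<nu> + 1 + k) * (pochhammer (1/2) k / pochhammer (\<nu> + 1) k) = pochhammer (1/2) (Suc k) / pochhammer (\<nu> + 1) (Suc k)"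
  by (simp only: pochhammer_Suc times_divide_times_eq mult.commute)
 finally show ?case .
qed

text \<open>Integrating the exponential series termwise, only the even moments of \<open>cos \<theta>\<close> survive,
 and they turn it into the series of the normalised Bessel function.\<close>

lemma integral_exp_cos:
 assumes nu: "\<nu> > - 1/2"
 shows "(LINT \<theta>|angle_measure \<nu>. exp (z * cos \<theta>)) = norm_bessel \<nu> (z\<^sup>2 / 4)"
proof -
 interpret prob_space "angle_measure \<nu>" by (rule prob_space_angle_measure[OF nu])
 let ?t = "%n \<theta>. (z * cos \<theta>) ^ n /\<^sub>R fact n"
 have lim: "(%N. LINT \<theta>|angle_measure \<nu>. (\<Sum>n<N. ?t n \<theta>)) \<longlonglongrightarrow> (LINT \<theta>|angle_measure \<nu>. exp (z * cos \<theta>))"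
 proof (rule integral_dominated_convergence[where w = "%_. exp \<bar>z\<bar>"])
  show "AE \<theta> in angle_measure \<nu>. (%N. \<Sum>n<N. ?t n \<theta>) \<longlonglongrightarrow> exp (z * cos \<theta>)"
   using exp_converges[where 'a = real] by (auto simp: sums_def)
  show "AE \<theta> in angle_measure \<nu>. norm (\<Sum>n<N. ?t n \<theta>) <= exp \<bar>z\<bar>" for N
  proof (rule AE_I2)
   fix \<theta>
   have "norm (?t n \<theta>) <= \<bar>z\<bar> ^ n /\<^sub>R fact n" for n
   proof -
    have "\<bar>z * cos \<theta>\<bar> <= \<bar>z\<bar>" using mult_left_mono[OF abs_cos_le_one, of "\<bar>z\<bar>"] by (simp add: abs_mult)
    then have "\<bar>z * cos \<theta>\<bar> ^ n <= \<bar>z\<bar> ^ n" by (intro power_mono) auto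
    then show ?thesis by (simp add: abs_mult power_abs mult_left_mono)
   qed
   then have "norm (\<Sum>n<N. ?t n \<theta>) <= (\<Sum>n<N. \<bar>z\<bar> ^ n /\<^sub>R fact n)" by (intro sum_norm_le)
   also have "\<dots> <= exp \<bar>z\<bar>"
    using sums_unique[OF exp_converges[of "\<bar>z\<bar>"]] sum_le_suminf[OF sums_summable[OF exp_converges[of "\<bar>z\<bar>"]], of "{..<N}"] by simp
   finally show "norm (\<Sum>n<N. ?t n \<theta>) <= exp \<bar>z\<bar>" .
  qed
 qed (auto simp: prob_space)
 have int: "integrable (angle_measure \<nu>) (%\<theta>. cos \<theta> ^ n)" for n
  by (rule integrable_angle_bounded[OF nu, of _ 1]) (auto simp: power_abs intro: power_le_one)
 have "(LINT \<theta>|angle_measure \<nu>. (\<Sum>n<N. ?t n \<theta>)) = (\<Sum>n<N. z ^ n / fact n * angle_moment \<nu> n)" for N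
  using int by (simp add: power_mult_distrib angle_moment_def divide_inverse mult_ac)
 with lim have "(%N. \<Sum>n<N. z ^ n / fact n * angle_moment \<nu> n) \<longlonglongrightarrow> (LINT \<theta>|angle_measure \<nu>. exp (z * cos \<theta>))" by simp
 then have "(%N. \<Sum>n<2 * N. z ^ n / fact n * angle_moment \<nu> n) \<longlonglongrightarrow> (LINT \<theta>|angle_measure \<nu>. exp (z * cos \<theta>))"
  by (rule LIMSEQ_subseq_LIMSEQ[where f = "%N. 2 * N", unfolded o_def]) (auto simp: strict_mono_def)
 moreover have "(\<Sum>n<2 * N. z ^ n / fact n * angle_moment \<nu> n) = (\<Sum>k<N. inverse (fact k * pochhammer (\<nu> + 1) k) * (z\<^sup>2 / 4) ^ k)" for N
 proof (induction N)
  case (Suc N)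
  have "(\<Sum>n<2 * Suc N. z ^ n / fact n * angle_moment \<nu> n) = (\<Sum>n<2 * N. z ^ n / fact n * angle_moment \<nu> n)
    + z ^ (2 * N) / fact (2 * N) * angle_moment \<nu> (2 * N) + z ^ (2 * N + 1) / fact (2 * N + 1) * angle_moment \<nu> (2 * N + 1)"
   by simp
  also have "\<dots> = (\<Sum>k<N. inverse (fact k * pochhammer (\<nu> + 1) k) * (z\<^sup>2 / 4) ^ k) + z ^ (2 * N) / fact (2 * N) * (pochhammer (1/2) N / pochhammer (\<nu> + 1) N)"
   unfolding Suc angle_moment_odd[OF nu] angle_moment_even[OF nu] by simp
  also have "z ^ (2 * N) / fact (2 * N) * (pochhammer (1/2) N / pochhammer (\<nu> + 1) N) = inverse (fact N * pochhammer (\<nu> + 1) N) * (z\<^sup>2 / 4) ^ N"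
   unfolding pochhammer_half by (simp add: power_divide power_mult[symmetric] field_simps)
  finally show ?case by simp
 qed simp
 ultimately have "(%k. inverse (fact k * pochhammer (\<nu> + 1) k) * (z\<^sup>2 / 4) ^ k) sums (LINT \<theta>|angle_measure \<nu>. exp (z * cos \<theta>))"
  by (simp add: sums_def)
 then show ?thesis unfolding norm_bessel_def by (rule sums_unique)
qed

lemma integrable_exp_cos:
 assumes nu: "\<nu> > - 1/2"
 shows "integrable (angle_measure \<nu>) (%\<theta>. exp (z * cos \<theta> + w))"
proof (rule integrable_angle_bounded[OF nu, of _ "exp (\<bar>z\<bar> + w)"])
 fix \<theta> :: real
 have "z * cos \<theta> <= \<bar>z * cos \<theta>\<bar>" by simp
 also have "\<bar>z * cos \<theta>\<bar> <= \<bar>z\<bar>" using mult_left_mono[OF abs_cos_le_one, of "\<bar>z\<bar>"] by (simp add: abs_mult)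
 finally show "norm (exp (z * cos \<theta> + w)) <= exp (\<bar>z\<bar> + w)" by simp
qed simp

lemma norm_bessel_pos:
 assumes nu: "\<nu> > - 1/2" and z: "z >= 0"
 shows "norm_bessel \<nu> z >= 1"
proof -
 have "1 = (\<Sum>k\<in>{0}. inverse (fact k * pochhammer (\<nu> + 1) k) * z ^ k)" by simp
 also have "\<dots> <= norm_bessel \<nu> z"
  unfolding norm_bessel_def
  by (intro sum_le_suminf norm_bessel_summable[OF nu]) (use z pochhammer_pos'[OF nu] in \<open>auto simp: less_imp_le\<close>)
 finally show ?thesis .
qed

lemma norm_bessel_le_exp:
 assumes nu: "\<nu> > - 1/2"
 shows "norm_bessel \<nu> (w\<^sup>2) <= exp (2 * \<bar>w\<bar>)"
proof -
 interpret prob_space "angle_measure \<nu>" by (rule prob_space_angle_measure[OF nu])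
 have "norm_bessel \<nu> (w\<^sup>2) = (LINT \<theta>|angle_measure \<nu>. exp (2 * \<bar>w\<bar> * cos \<theta>))"
  by (subst integral_exp_cos[OF nu]) (simp add: power_mult_distrib)
 also have "\<dots> <= (LINT \<theta>|angle_measure \<nu>. exp (2 * \<bar>w\<bar>))"
  using integrable_exp_cos[OF nu, of "2 * \<bar>w\<bar>" 0]
  by (intro integral_mono) (auto intro: mult_left_le)
 finally show ?thesis using prob_space by simp
qed

text \<open>Jensen's inequality for the angular average.\<close>

lemma norm_bessel_powr_le:
 assumes nu: "\<nu> > - 1/2" and q: "q >= 1"
 shows "norm_bessel \<nu> (w\<^sup>2) powr q <= norm_bessel \<nu> ((q * w)\<^sup>2)"
proof -
 interpret prob_space "angle_measure \<nu>" by (rule prob_space_angle_measure[OF nu])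
 have eq: "exp (2 * w * cos \<theta>) powr q = exp (2 * (q * w) * cos \<theta>)" for \<theta> by (simp add: exp_powr_real mult_ac)
 have "expectation (%\<theta>. exp (2 * w * cos \<theta>)) powr q <= expectation (%\<theta>. exp (2 * w * cos \<theta>) powr q)"
 proof (rule jensens_inequality[where q = "%x. x powr q" and I = "{0<..}"])
  show "convex_on {0<..} (%x. x powr q)" using q by (rule powr_convex)
  show "integrable (angle_measure \<nu>) (%\<theta>. exp (2 * w * cos \<theta>))"
   using integrable_exp_cos[OF nu, of "2 * w" 0] by simp
  show "integrable (angle_measure \<nu>) (%\<theta>. exp (2 * w * cos \<theta>) powr q)"
   unfolding eq using integrable_exp_cos[OF nu, of "2 * (q * w)" 0] by simp
 qed auto
 then show ?thesis
  unfolding eq by (simp add: integral_exp_cos[OF nu] power_mult_distrib)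
qed

section \<open>Uniqueness from lateral data\<close>

lemma power_exp_inverse_square_le:
 fixes d :: real
 assumes d: "d > 0"
 shows "(1 / d) ^ k * exp (- (1 / (2 * d\<^sup>2))) <= sqrt (fact k)"
proof -
 define y where "y = 1 / d\<^sup>2"
 have y: "y > 0" using d by (simp add: y_def)
 have "(\<Sum>n\<in>{k}. y ^ n /\<^sub>R fact n) <= (\<Sum>n. y ^ n /\<^sub>R fact n)"
  by (rule sum_le_suminf) (use y exp_converges[of y] in \<open>auto simp: sums_iff\<close>)
 then have "y ^ k / fact k <= exp y"
  using exp_converges[of y] by (simp add: sums_iff divide_inverse mult.commute)
 then have le: "y ^ k * exp (- y) <= fact k" by (simp add: field_simps exp_minus)
 have "((1 / d) ^ k * exp (- (1 / (2 * d\<^sup>2))))\<^sup>2 = ((1 / d) ^ k)\<^sup>2 * (exp (- (1 / (2 * d\<^sup>2))))\<^sup>2"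
  by (rule power_mult_distrib)
 also have "((1 / d) ^ k)\<^sup>2 = y ^ k" by (simp add: y_def power_mult[symmetric] power_divide mult.commute)
 also have "(exp (- (1 / (2 * d\<^sup>2))))\<^sup>2 = exp (- y)" by (simp add: y_def exp_double[symmetric])
 finally have "((1 / d) ^ k * exp (- (1 / (2 * d\<^sup>2))))\<^sup>2 <= fact k" using le by simp
 then show ?thesis by (rule real_le_rsqrt)
qed

lemma Re_inverse_square_ge:
 fixes w :: complex
 assumes w: "cmod w <= 1 / 4"
 shows "Re (1 / (1 + w)\<^sup>2) >= 1 / 2"
proof -
 define a where "a = 1 + Re w" define b where "b = Im w"
 have u: "1 + w = Complex a b" by (simp add: a_def b_def complex_eq_iff)
 have rw: "\<bar>Re w\<bar> <= 1/4" "\<bar>b\<bar> <= 1/4" using w abs_Re_le_cmod[of w] abs_Im_le_cmod[of w] by (auto simp: b_def)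
 have a: "3/4 <= a" using rw by (simp add: a_def)
 define n where "n = a\<^sup>2 + b\<^sup>2"
 have b2: "b\<^sup>2 <= 1/16" using power_mono[OF rw(2), of 2] by (simp add: power2_eq_square)
 have n1: "n >= 9/16" using power_mono[OF a, of 2] by (simp add: n_def power2_eq_square add_increasing2)
 have n2: "n <= 25/16"
 proof -
  have "cmod (1 + w) <= 5/4" using norm_triangle_ineq[of 1 w] w by simp
  then have "(cmod (1 + w))\<^sup>2 <= (5/4)\<^sup>2" by (intro power_mono) auto
  then show ?thesis unfolding u cmod_power2 by (simp add: n_def power2_eq_square)
 qed
 have "0 <= (n - 9/16) * (25/16 - n)" using n1 n2 by simp
 then have "n\<^sup>2 <= 34/16 * n - 225/256" by (simp add: power2_eq_square algebra_simps)
 then have main: "n\<^sup>2 / 2 <= a\<^sup>2 - b\<^sup>2"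
 proof -
  have "a\<^sup>2 - b\<^sup>2 = n - 2 * b\<^sup>2" by (simp add: n_def)
  with \<open>n\<^sup>2 <= 34/16 * n - 225/256\<close> b2 n2 show ?thesis by linarith
 qed
 have n0: "n > 0" using n1 by simp
 have sq: "(1 + w)\<^sup>2 = Complex (a\<^sup>2 - b\<^sup>2) (2 * a * b)" unfolding u by (simp add: power2_eq_square complex_eq_iff)
 have "(a\<^sup>2 - b\<^sup>2)\<^sup>2 + (2 * a * b)\<^sup>2 = n\<^sup>2" by (simp add: n_def power2_eq_square algebra_simps)
 then have "Re (1 / (1 + w)\<^sup>2) = (a\<^sup>2 - b\<^sup>2) / n\<^sup>2" unfolding sq by (simp add: Re_divide)
 moreover have "1 / 2 <= (a\<^sup>2 - b\<^sup>2) / n\<^sup>2"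
  by (rule mult_imp_le_div_pos) (use main n0 in auto)
 ultimately show ?thesis by simp
qed

definition bump_fun :: "real => real => complex => complex" where
 "bump_fun t1 t2 z = exp (- (1 / (z - of_real t1)\<^sup>2) - 1 / (of_real t2 - z)\<^sup>2)"

lemma bump_fun_holomorphic: "bump_fun t1 t2 holomorphic_on (- {of_real t1, of_real t2})"
 unfolding bump_fun_def by (intro holomorphic_intros) auto

text \<open>On a disc around a real point whose radius is a quarter of the distance to the end points, the
 function is as small as on the real axis, up to a factor in the exponent; Cauchy's inequality
 then gives derivatives of Gevrey order 3/2.\<close>

lemma bump_fun_deriv_bound:
 assumes t: "t1 < t" "t < t2" and d: "d = min (t - t1) (t2 - t)"
 shows "cmod ((deriv ^^ k) (bump_fun t1 t2) (of_real t)) <= fact k * (4 / d) ^ k * exp (- (1 / (2 * d\<^sup>2)))"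
proof -
 have d0: "d > 0" using t d by auto
 have Re1: "Re (1 / (of_real s * (1 + w))\<^sup>2) >= 1 / (2 * s\<^sup>2)" if "s > 0" "cmod w <= 1/4" for s w
 proof -
  have "1 / (complex_of_real s * (1 + w))\<^sup>2 = of_real (1 / s\<^sup>2) * (1 / (1 + w)\<^sup>2)"
   by (simp add: power_mult_distrib)
  moreover have "Re (of_real r * z) = r * Re z" for r z by simp
  ultimately have "Re (1 / (of_real s * (1 + w))\<^sup>2) = 1 / s\<^sup>2 * Re (1 / (1 + w)\<^sup>2)" by (simp only:)
  also have "\<dots> >= 1 / s\<^sup>2 * (1 / 2)" using Re_inverse_square_ge[OF that(2)] by (intro mult_left_mono) auto
  finally show ?thesis by (simp add: mult.commute)
 qed
 have sub: "cball (complex_of_real t) (d / 4) \<subseteq> - {of_real t1, of_real t2}"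
 proof -
  have "d / 4 < dist (of_real t) (complex_of_real t1)" "d / 4 < dist (of_real t) (complex_of_real t2)"
   using t d d0 by (auto simp: dist_of_real dist_real_def)
  then show ?thesis by auto
 qed
 have "cmod ((deriv ^^ k) (bump_fun t1 t2) (of_real t)) <= fact k * exp (- (1 / (2 * d\<^sup>2))) / (d / 4) ^ k"
 proof (rule Cauchy_inequality)
  show "bump_fun t1 t2 holomorphic_on ball (of_real t) (d / 4)"
   using sub ball_subset_cball by (blast intro: holomorphic_on_subset[OF bump_fun_holomorphic])
  show "continuous_on (cball (of_real t) (d / 4)) (bump_fun t1 t2)"
   using sub by (blast intro: continuous_on_subset[OF holomorphic_on_imp_continuous_on[OF bump_fun_holomorphic]])
  fix z :: complex assume "cmod (complex_of_real t - z) = d / 4"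
  then have z: "cmod (z - of_real t) = d / 4" by (simp add: norm_minus_commute)
  define s1 where "s1 = t - t1" define s2 where "s2 = t2 - t"
  have s: "s1 >= d" "s2 >= d" "s1 > 0" "s2 > 0" using t d by (auto simp: s1_def s2_def)
  have e1: "z - of_real t1 = of_real s1 * (1 + (z - of_real t) / of_real s1)"
   using s by (simp add: field_simps s1_def)
  have e2: "of_real t2 - z = of_real s2 * (1 + - (z - of_real t) / of_real s2)"
   using s by (simp add: field_simps s2_def)
  have R1: "Re (1 / (z - of_real t1)\<^sup>2) >= 1 / (2 * s1\<^sup>2)"
   unfolding e1 by (rule Re1) (use z s in \<open>auto simp: norm_divide field_simps\<close>)
  have R2: "Re (1 / (of_real t2 - z)\<^sup>2) >= 1 / (2 * s2\<^sup>2)"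
   unfolding e2 by (rule Re1) (use z s in \<open>auto simp: norm_divide field_simps norm_minus_commute\<close>)
  have "1 / (2 * d\<^sup>2) <= 1 / (2 * s1\<^sup>2) + 1 / (2 * s2\<^sup>2)"
   using d t by (cases "s1 <= s2") (auto simp: s1_def s2_def min_def)
  then show "cmod (bump_fun t1 t2 z) <= exp (- (1 / (2 * d\<^sup>2)))"
   using R1 R2 by (simp add: bump_fun_def norm_exp_eq_Re)
 qed (use d0 in auto)
 also have "fact k * exp (- (1 / (2 * d\<^sup>2))) / (d / 4) ^ k = fact k * (4 / d) ^ k * exp (- (1 / (2 * d\<^sup>2)))"
  using d0 by (simp add: power_divide field_simps)
 finally show ?thesis .
qed

lemma gevrey_bump:
 fixes t1 t2 :: real
 assumes t12: "t1 < t2"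
 obtains \<phi> :: "nat => real => complex" where
  "!!k. continuous_on {t1..t2} (\<phi> k)"
  "!!k t. t \<in> {t1<..<t2} ==> (\<phi> k has_vector_derivative \<phi> (Suc k) t) (at t)"
  "!!k. \<phi> k t1 = 0" "!!k. \<phi> k t2 = 0"
  "!!k t. cmod (\<phi> k t) <= 4 ^ k * fact k * sqrt (fact k)"
  "!!t. t \<in> {t1<..<t2} ==> \<exists>r>0. \<phi> 0 t = of_real r"
  "!!t. \<phi> 0 t = of_real (Re (\<phi> 0 t)) & Re (\<phi> 0 t) >= 0"
proof -
 let ?S = "- {complex_of_real t1, of_real t2}"
 define \<phi> where "\<phi> k t = (if t \<in> {t1<..<t2} then (deriv ^^ k) (bump_fun t1 t2) (of_real t) else 0)" for k t
 let ?d = "%t. min (t - t1) (t2 - t)"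
 have opn: "open ?S" by (intro open_Compl finite_imp_closed) auto
 have der: "(\<phi> k has_vector_derivative \<phi> (Suc k) t) (at t)" if t: "t \<in> {t1<..<t2}" for k t
 proof -
  have "((deriv ^^ k) (bump_fun t1 t2) has_field_derivative (deriv ^^ Suc k) (bump_fun t1 t2) (of_real t)) (at (of_real t))"
   using holomorphic_derivI[OF holomorphic_higher_deriv[OF bump_fun_holomorphic opn, of k] opn, of "of_real t"] t by auto
  from has_vector_derivative_real_field[OF this]
  have "((%t. (deriv ^^ k) (bump_fun t1 t2) (of_real t)) has_vector_derivative \<phi> (Suc k) t) (at t)"
   using t by (simp add: \<phi>_def)
  then show ?thesis
   by (rule has_vector_derivative_transform_within_open[where S = "{t1<..<t2}"]) (use t in \<open>auto simp: \<phi>_def\<close>)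
 qed
 have bound: "cmod (\<phi> k t) <= 4 ^ k * fact k * ((1 / ?d t) ^ k * exp (- (1 / (2 * (?d t)\<^sup>2))))" if "t \<in> {t1<..<t2}" for k t
  using bump_fun_deriv_bound[of t1 t t2 "?d t" k] that by (simp add: \<phi>_def power_divide mult_ac)
 have b1: "cmod (\<phi> k t) <= 4 ^ k * fact k * sqrt (fact k)" for k t
 proof (cases "t \<in> {t1<..<t2}")
  case True
  then have "?d t > 0" by auto
  then have "4 ^ k * fact k * ((1 / ?d t) ^ k * exp (- (1 / (2 * (?d t)\<^sup>2)))) <= 4 ^ k * fact k * sqrt (fact k)"
   by (intro mult_left_mono power_exp_inverse_square_le) auto
  then show ?thesis using bound[OF True, of k] by linarith
 next
  case False
  then show ?thesis by (auto simp: \<phi>_def)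
 qed
 have b2: "cmod (\<phi> k t) <= 4 ^ k * fact k * sqrt (fact (Suc k)) * \<bar>?d t\<bar>" for k t
 proof (cases "t \<in> {t1<..<t2}")
  case True
  then have d: "?d t > 0" by auto
  have "(1 / ?d t) ^ k * exp (- (1 / (2 * (?d t)\<^sup>2))) = ?d t * ((1 / ?d t) ^ Suc k * exp (- (1 / (2 * (?d t)\<^sup>2))))"
  proof -
   have "x = r * (1 / r * x)" if "r > 0" for x r :: real using that by simp
   from this[OF d, of "(1 / ?d t) ^ k * exp (- (1 / (2 * (?d t)\<^sup>2)))"] show ?thesis
    by (simp only: power_Suc mult.assoc)
  qed
  also have "\<dots> <= ?d t * sqrt (fact (Suc k))"
   using d by (intro mult_left_mono power_exp_inverse_square_le) auto
  finally have "4 ^ k * fact k * ((1 / ?d t) ^ k * exp (- (1 / (2 * (?d t)\<^sup>2)))) <= 4 ^ k * fact k * (?d t * sqrt (fact (Suc k)))"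
   by (intro mult_left_mono) auto
  then have "cmod (\<phi> k t) <= 4 ^ k * fact k * (?d t * sqrt (fact (Suc k)))" using bound[OF True, of k] by linarith
  then show ?thesis using d by (simp add: mult_ac)
 next
  case False
  then show ?thesis by (auto simp: \<phi>_def intro!: mult_nonneg_nonneg)
 qed
 have cont: "continuous_on {t1..t2} (\<phi> k)" for k
  unfolding continuous_on_eq_continuous_within
 proof
  fix t assume t: "t \<in> {t1..t2}"
  show "continuous (at t within {t1..t2}) (\<phi> k)"
  proof (cases "t \<in> {t1<..<t2}")
   case True
   then show ?thesis using der[OF True, of k]
    by (meson continuous_at_imp_continuous_at_within has_vector_derivative_continuous)
  next
   case False
   then have e: "t = t1 \<or> t = t2" using t by auto
   let ?C = "4 ^ k * fact k * sqrt (fact (Suc k))"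
   have "(\<phi> k \<longlongrightarrow> 0) (at t within {t1..t2})"
   proof (rule Lim_null_comparison)
    show "\<forall>\<^sub>F s in at t within {t1..t2}. norm (\<phi> k s) <= ?C * \<bar>s - t\<bar>"
    proof (rule eventually_at_filter[THEN iffD2], rule always_eventually, intro allI impI)
     fix s assume s: "s \<in> {t1..t2}"
     have "\<bar>?d s\<bar> <= \<bar>s - t\<bar>" using s e by (auto simp: min_def)
     then have "?C * \<bar>?d s\<bar> <= ?C * \<bar>s - t\<bar>" by (intro mult_left_mono) auto
     then show "norm (\<phi> k s) <= ?C * \<bar>s - t\<bar>" using b2[of k s] by linarith
    qed
    have "((%s. ?C * \<bar>s - t\<bar>) \<longlongrightarrow> ?C * \<bar>t - t\<bar>) (at t within {t1..t2})" by (intro tendsto_intros)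
    then show "((%s. ?C * \<bar>s - t\<bar>) \<longlongrightarrow> 0) (at t within {t1..t2})" by simp
   qed
   moreover have "\<phi> k t = 0" using e by (auto simp: \<phi>_def)
   ultimately show ?thesis by (simp add: continuous_within)
  qed
 qed
 have pos: "\<phi> 0 t = of_real (exp (- (1 / (t - t1)\<^sup>2) - 1 / (t2 - t)\<^sup>2))" if "t \<in> {t1<..<t2}" for t
 proof -
  have "- (1 / (complex_of_real t - of_real t1)\<^sup>2) - 1 / (of_real t2 - complex_of_real t)\<^sup>2 = of_real (- (1 / (t - t1)\<^sup>2) - 1 / (t2 - t)\<^sup>2)"
   by simp
  then show ?thesis using that unfolding \<phi>_def bump_fun_def by (simp only: if_True funpow_0 exp_of_real)
 qed
 show ?thesis
 proof (rule that[of \<phi>, OF cont der])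
  show "\<exists>r>0. \<phi> 0 t = of_real r" if "t \<in> {t1<..<t2}" for t using pos[OF that] exp_gt_zero by blast
  show "\<phi> 0 t = of_real (Re (\<phi> 0 t)) & Re (\<phi> 0 t) >= 0" for t
  proof (cases "t \<in> {t1<..<t2}")
   case True then show ?thesis using pos[OF True] by simp
  next
   case False then have "\<phi> 0 t = 0" by (auto simp: \<phi>_def) then show ?thesis by simp
  qed
 qed (use b1 in \<open>auto simp: \<phi>_def\<close>)
qed

lemma tendsto_power_div_sqrt_fact: "(%j. Q ^ j / sqrt (fact j)) \<longlonglongrightarrow> (0::real)"
proof -
 have "(%j. inverse (fact j) * (Q\<^sup>2) ^ j) \<longlonglongrightarrow> 0" by (rule summable_LIMSEQ_zero[OF summable_exp])
 from tendsto_real_sqrt[OF this] have "(%j. sqrt (inverse (fact j) * (Q\<^sup>2) ^ j)) \<longlonglongrightarrow> 0" by simp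
 moreover have "sqrt (inverse (fact j) * (Q\<^sup>2) ^ j) = \<bar>Q ^ j / sqrt (fact j)\<bar>" for j
 proof -
  have "(Q\<^sup>2) ^ j = (Q ^ j)\<^sup>2" by (simp add: power_mult[symmetric] mult.commute)
  then show ?thesis by (simp add: real_sqrt_mult real_sqrt_inverse divide_inverse abs_mult)
 qed
 ultimately have "(%j. \<bar>Q ^ j / sqrt (fact j)\<bar>) \<longlonglongrightarrow> 0" by (simp only:)
 then show ?thesis by (rule tendsto_rabs_zero_cancel)
qed

text \<open>As \<open>2 \<nu> + 1 > 0\<close>, the equation forces the derivative to vanish at the origin along with the solution.
 Testing in time against a function of Gevrey order less than 2 then gives a function of \<open>x\<close> all of
 whose iterated Bessel operators are controlled and vanish at the origin; so it vanishes identically.\<close>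

lemma flow_lateral_uniqueness:
 fixes h hx hxx ht :: "real => real => complex"
 assumes nu: "\<nu> > - 1/2" and sigma: "\<sigma> > 0"
  and dx: "!!t x. t > 0 ==> (h t has_vector_derivative hx t x) (at x)"
  and dxx: "!!t x. t > 0 ==> (hx t has_vector_derivative hxx t x) (at x)"
  and dt: "!!t x. t > 0 ==> ((%s. h s x) has_vector_derivative ht t x) (at t)"
  and ch: "continuous_on ({0<..} \<times> UNIV) (%(t, x). h t x)" and chx: "continuous_on ({0<..} \<times> UNIV) (%(t, x). hx t x)"
  and chxx: "continuous_on ({0<..} \<times> UNIV) (%(t, x). hxx t x)" and cht: "continuous_on ({0<..} \<times> UNIV) (%(t, x). ht t x)"
  and pde: "!!t x. t > 0 ==> x > 0 ==> ht t x = of_real \<sigma> * (hxx t x + of_real ((2 * \<nu> + 1) / x) * hx t x)"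
  and zero: "!!t. t > 0 ==> h t 0 = 0"
  and t: "t > 0" and x: "x >= 0"
 shows "h t x = 0"
proof (rule ccontr)
 assume nz: "h t x ~= 0"
 have cont_sub: "continuous_on S (%z. f (p z) (q z))" if "continuous_on ({0<..} \<times> UNIV) (%(t, x). f t x)"
  "continuous_on S p" "continuous_on S q" "!!z. z \<in> S ==> p z > 0"
  for f :: "real => real => complex" and S :: "'z :: topological_space set" and p q
 proof -
  have "continuous_on S (%z. (case (p z, q z) of (t, x) => f t x))"
   by (rule continuous_on_compose2[OF that(1)]) (use that in \<open>auto intro!: continuous_on_Pair\<close>)
  then show ?thesis by simp
 qed
 obtain t1 t2 where t12: "0 < t1" "t1 < t" "t < t2" "!!s. s \<in> {t1..t2} ==> Re (cnj (h t x) * h s x) > 0"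
 proof -
  have "continuous_on {0<..} (%s. Re (cnj (h t x) * h s x))"
   by (intro continuous_intros cont_sub[OF ch]) auto
  then have "isCont (%s. Re (cnj (h t x) * h s x)) t"
   using t by (simp add: continuous_on_eq_continuous_at)
  moreover have "Re (cnj (h t x) * h t x) > 0"
   using nz by (simp add: complex_mult_cnj mult.commute[of "cnj _"] cmod_power2[symmetric] flip: of_real_add of_real_power)
  ultimately have "\<forall>\<^sub>F s in at t. Re (cnj (h t x) * h s x) > 0"
   by (auto simp: isCont_def intro: order_tendstoD)
  then obtain e where e: "e > 0" "!!s. s ~= t ==> dist s t < e ==> Re (cnj (h t x) * h s x) > 0"
   by (auto simp: eventually_at)
  define e' where "e' = min e t / 2"
  have e': "0 < e'" "e' < e" "e' < t" using e t by (auto simp: e'_def)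
  show ?thesis
  proof (rule that[of "t - e'" "t + e'"])
   fix s assume "s \<in> {t - e'..t + e'}"
   then have "dist s t < e" using e' by (auto simp: dist_real_def)
   then show "Re (cnj (h t x) * h s x) > 0"
    using e(2)[of s] \<open>Re (cnj (h t x) * h t x) > 0\<close> by (cases "s = t") auto
  qed (use e' in auto)
 qed
 then have tt: "t1 < t2" and pos: "!!s. s \<in> {t1..t2} ==> s > 0" by auto
 obtain \<phi> where \<phi>: "!!k. continuous_on {t1..t2} (\<phi> k)"
  "!!k t. t \<in> {t1<..<t2} ==> (\<phi> k has_vector_derivative \<phi> (Suc k) t) (at t)"
  "!!k. \<phi> k t1 = 0" "!!k. \<phi> k t2 = 0"
  "!!k t. cmod (\<phi> k t) <= 4 ^ k * fact k * sqrt (fact k)"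
  "!!t. t \<in> {t1<..<t2} ==> \<exists>r>0. \<phi> 0 t = of_real r"
  "!!t. \<phi> 0 t = of_real (Re (\<phi> 0 t)) & Re (\<phi> 0 t) >= 0"
  by (rule gevrey_bump[OF tt]) blast
 define H where "H k y = integral {t1..t2} (%s. \<phi> k s * h s y)" for k y
 define H1 where "H1 k y = integral {t1..t2} (%s. \<phi> k s * hx s y)" for k y
 define H2 where "H2 k y = integral {t1..t2} (%s. \<phi> k s * hxx s y)" for k y
 have cint: "continuous_on {t1..t2} (%s. \<phi> k s * f s y)" if "continuous_on ({0<..} \<times> UNIV) (%(t, x). f t x)" for f k and y :: real
  by (intro continuous_on_mult \<phi>(1) cont_sub[OF that] continuous_intros pos) auto
 have cprod: "continuous_on (UNIV \<times> {t1..t2}) (%(y, s). \<phi> k s * f s y)" if "continuous_on ({0<..} \<times> UNIV) (%(t, x). f t x)" for f :: "real => real => complex" and k :: nat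
  unfolding case_prod_unfold
  by (intro continuous_on_mult continuous_on_compose2[OF \<phi>(1)] cont_sub[OF that] continuous_intros) (auto dest: pos)
 have dH: "(H k has_vector_derivative H1 k y) (at y)" for k y
 proof -
  have "((%y. integral (cbox t1 t2) (%s. \<phi> k s * h s y)) has_vector_derivative integral (cbox t1 t2) (%s. \<phi> k s * hx s y)) (at y within UNIV)"
  proof (rule leibniz_rule_vector_derivative)
   show "((%y. \<phi> k s * h s y) has_vector_derivative \<phi> k s * hx s y) (at y within UNIV)" if "s \<in> cbox t1 t2" for y s
    using that pos by (intro has_vector_derivative_mult_right dx) auto
  qed (use cint[OF ch] cprod[OF chx] in \<open>auto intro!: integrable_continuous_real\<close>)
  then show ?thesis by (simp add: H_def[abs_def] H1_def)
 qed
 have dH1: "(H1 k has_vector_derivative H2 k y) (at y)" for k y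
 proof -
  have "((%y. integral (cbox t1 t2) (%s. \<phi> k s * hx s y)) has_vector_derivative integral (cbox t1 t2) (%s. \<phi> k s * hxx s y)) (at y within UNIV)"
  proof (rule leibniz_rule_vector_derivative)
   show "((%y. \<phi> k s * hx s y) has_vector_derivative \<phi> k s * hxx s y) (at y within UNIV)" if "s \<in> cbox t1 t2" for y s
    using that pos by (intro has_vector_derivative_mult_right dxx) auto
  qed (use cint[OF chx] cprod[OF chxx] in \<open>auto intro!: integrable_continuous_real\<close>)
  then show ?thesis by (simp add: H1_def[abs_def] H2_def)
 qed
 have Hpde: "of_real \<sigma> * (H2 k y + of_real ((2 * \<nu> + 1) / y) * H1 k y) = - H (Suc k) y" if y: "y > 0" for k y
 proof -
  have "((%s. \<phi> k s * ht s y + \<phi> (Suc k) s * h s y) has_integral \<phi> k t2 * h t2 y - \<phi> k t1 * h t1 y) {t1..t2}"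
  proof (rule fundamental_theorem_of_calculus_interior)
   show "continuous_on {t1..t2} (%s. \<phi> k s * h s y)" by (rule cint[OF ch])
   fix s assume s: "s \<in> {t1<..<t2}"
   show "((%s. \<phi> k s * h s y) has_vector_derivative \<phi> k s * ht s y + \<phi> (Suc k) s * h s y) (at s)"
    using s pos by (intro has_vector_derivative_mult \<phi> dt) auto
  qed (use tt in simp)
  then have "((%s. \<phi> k s * ht s y + \<phi> (Suc k) s * h s y) has_integral 0) {t1..t2}" by (simp add: \<phi>)
  moreover have "((%s. \<phi> (Suc k) s * h s y) has_integral H (Suc k) y) {t1..t2}"
   unfolding H_def by (intro integrable_integral integrable_continuous_real cint[OF ch])
  ultimately have "((%s. (\<phi> k s * ht s y + \<phi> (Suc k) s * h s y) - \<phi> (Suc k) s * h s y) has_integral 0 - H (Suc k) y) {t1..t2}"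
   by (rule has_integral_diff)
  then have A: "((%s. \<phi> k s * ht s y) has_integral - H (Suc k) y) {t1..t2}" by simp
  have "((%s. of_real \<sigma> * (\<phi> k s * hxx s y + of_real ((2 * \<nu> + 1) / y) * (\<phi> k s * hx s y))) has_integral
   of_real \<sigma> * (H2 k y + of_real ((2 * \<nu> + 1) / y) * H1 k y)) {t1..t2}"
   unfolding H1_def H2_def
   by (intro has_integral_mult_right has_integral_add integrable_integral integrable_continuous_real cint[OF chx] cint[OF chxx])
  moreover have "of_real \<sigma> * (\<phi> k s * hxx s y + of_real ((2 * \<nu> + 1) / y) * (\<phi> k s * hx s y)) = \<phi> k s * ht s y" if "s \<in> {t1..t2}" for s
   using pde[OF pos[OF that] y] by (simp add: algebra_simps)
  ultimately have "((%s. \<phi> k s * ht s y) has_integral of_real \<sigma> * (H2 k y + of_real ((2 * \<nu> + 1) / y) * H1 k y)) {t1..t2}"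
   by (rule has_integral_eq[rotated])
  with A show ?thesis by (rule has_integral_unique[symmetric])
 qed
 have H0: "H k 0 = 0" for k
  unfolding H_def by (rule integral_unique[OF has_integral_is_0]) (use zero pos in auto)
 obtain M where M: "M >= 0" "!!s y. s \<in> {t1..t2} ==> y \<in> {0..x} ==> cmod (h s y) <= M"
 proof -
  have "compact ((%z. h (fst z) (snd z)) ` ({t1..t2} \<times> {0..x}))"
   by (intro compact_continuous_image cont_sub[OF ch] continuous_intros compact_Times) (auto dest: pos)
  then obtain B where "!!z. z \<in> {t1..t2} \<times> {0..x} ==> cmod (h (fst z) (snd z)) <= B"
   using compact_imp_bounded by (force simp: bounded_iff)
  then show ?thesis by (intro that[of "max B 0"]) (auto simp: le_max_iff_disj)
 qed
 define B where "B m = (t2 - t1) * M * (4 ^ m * fact m * sqrt (fact m))" for m :: nat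
 have B0: "B m >= 0" for m using M tt by (simp add: B_def)
 have Hb: "cmod (H k y) <= B (k + j) / (\<sigma> ^ j * 4 ^ j * fact j * pochhammer (\<nu> + 1) j) * y ^ (2 * j)" if "y \<in> {0..x}" for k j y
  using that
 proof (induction j arbitrary: k y)
  case 0
  have "norm (integral {t1..t2} (%s. \<phi> k s * h s y)) <= (4 ^ k * fact k * sqrt (fact k) * M) * (t2 - t1)"
  proof (rule integral_bound)
   show "norm (\<phi> k s * h s y) <= 4 ^ k * fact k * sqrt (fact k) * M" if "s \<in> {t1..t2}" for s
    unfolding norm_mult using that 0 by (intro mult_mono \<phi> M) auto
  qed (use tt cint[OF ch] in auto)
  then show ?case using tt by (simp add: H_def B_def mult_ac)
 next
  case (Suc j)
  define A where "A = B (Suc k + j) / (\<sigma> ^ j * 4 ^ j * fact j * pochhammer (\<nu> + 1) j)"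
  have IH: "cmod (H (Suc k) z) <= A * z ^ (2 * j)" if "z \<in> {0..x}" for z
   using Suc.IH[OF that, of "Suc k"] by (simp only: A_def)
  have A0: "A >= 0" unfolding A_def using sigma pochhammer_pos'[OF nu, of j] B0 by (intro divide_nonneg_nonneg mult_nonneg_nonneg) auto
  define c where "c = 2 * \<nu> + 2 * real j + 2"
  have c: "c > 0" using nu by (simp add: c_def)
  have step1: "cmod (of_real (z powr (2 * \<nu> + 1)) * H1 k z) <= A / \<sigma> * z powr c / c" if z: "0 < z" "z <= x" for z
  proof -
   let ?f = "%z. of_real (z powr (2 * \<nu> + 1)) * H1 k z" and ?\<psi> = "%z. A / \<sigma> * z powr c / c"
   have "norm (?f z - ?f 0) <= ?\<psi> z - ?\<psi> 0"
   proof (rule differentiable_bound_general[OF z(1)])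
    have "continuous_on UNIV (H1 k)" using dH1 by (meson continuous_at_imp_continuous_on has_vector_derivative_continuous)
    then show "continuous_on {0..z} ?f"
     using nu by (intro continuous_intros continuous_on_powr') (auto intro: continuous_on_subset)
    show "continuous_on {0..z} ?\<psi>" using c by (intro continuous_intros continuous_on_powr') auto
    fix y assume y: "0 < y" "y < z"
    have d1: "((%y. complex_of_real (y powr (2 * \<nu> + 1))) has_vector_derivative of_real ((2 * \<nu> + 1) * y powr (2 * \<nu>))) (at y)"
     by (rule has_vector_derivative_of_real) (use y in \<open>auto intro!: derivative_eq_intros\<close>)
    have p: "y powr (2 * \<nu> + 1) = y * y powr (2 * \<nu>)" using y by (simp add: powr_add)
    have "of_real (y powr (2 * \<nu> + 1)) * H2 k y + of_real ((2 * \<nu> + 1) * y powr (2 * \<nu>)) * H1 k y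
     = of_real (y powr (2 * \<nu> + 1)) * (H2 k y + of_real ((2 * \<nu> + 1) / y) * H1 k y)"
    proof -
     have r: "(2 * \<nu> + 1) * y powr (2 * \<nu>) = y powr (2 * \<nu> + 1) * ((2 * \<nu> + 1) / y)" unfolding p using y by simp
     show ?thesis unfolding r by (simp only: of_real_mult distrib_left mult.assoc)
    qed
    also have "H2 k y + of_real ((2 * \<nu> + 1) / y) * H1 k y = - H (Suc k) y / of_real \<sigma>"
     using Hpde[OF y(1), of k] sigma by (simp add: field_simps)
    finally have eq: "of_real (y powr (2 * \<nu> + 1)) * H2 k y + of_real ((2 * \<nu> + 1) * y powr (2 * \<nu>)) * H1 k y
     = of_real (y powr (2 * \<nu> + 1)) * (- H (Suc k) y / of_real \<sigma>)" .
    show "(?f has_vector_derivative of_real (y powr (2 * \<nu> + 1)) * (- H (Suc k) y / of_real \<sigma>)) (at y)"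
     using has_vector_derivative_mult[OF d1 dH1[of k y]] unfolding eq .
    show "(?\<psi> has_vector_derivative A / \<sigma> * y powr (c - 1)) (at y)"
     unfolding has_real_derivative_iff_has_vector_derivative[symmetric]
     using y c sigma by (auto intro!: derivative_eq_intros)
    have "y powr (c - 1) = y powr (2 * \<nu> + 1) * y ^ (2 * j)"
    proof -
     have "y ^ (2 * j) = y powr (2 * real j)" using y by (simp add: powr_realpow[symmetric])
     then show ?thesis by (simp add: c_def powr_add[symmetric] add_ac)
    qed
    then show "norm (of_real (y powr (2 * \<nu> + 1)) * (- H (Suc k) y / of_real \<sigma>)) <= A / \<sigma> * y powr (c - 1)"
     using IH[of y] y z sigma by (simp add: norm_mult norm_divide field_simps mult_left_mono)
   qed
   then show ?thesis using c by simp
  qed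
  have step2: "cmod (H1 k z) <= A / (\<sigma> * c) * z ^ (2 * j + 1)" if z: "0 < z" "z <= x" for z
  proof -
   have "z powr (2 * \<nu> + 1) * cmod (H1 k z) <= A / \<sigma> * z powr c / c"
    using step1[OF z] by (simp add: norm_mult)
   moreover have "z powr c = z powr (2 * \<nu> + 1) * z ^ (2 * j + 1)"
   proof -
    have "z ^ (2 * j + 1) = z powr (2 * real j + 1)" using z powr_realpow[of z "2 * j + 1"] by (simp add: add.commute)
    then show ?thesis by (simp add: c_def powr_add[symmetric] add_ac)
   qed
   ultimately have "z powr (2 * \<nu> + 1) * cmod (H1 k z) <= z powr (2 * \<nu> + 1) * (A / (\<sigma> * c) * z ^ (2 * j + 1))"
    by (simp add: mult_ac)
   then show ?thesis by (rule mult_left_le_imp_le) (use z in simp)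
  qed
  have "cmod (H k y) <= A / (\<sigma> * c) * y ^ (2 * j + 2) / (2 * j + 2)"
  proof (cases "y = 0")
   case True then show ?thesis by (simp add: H0)
  next
   case False
   then have y: "0 < y" "y <= x" using Suc.prems by auto
   let ?\<psi> = "%y. A / (\<sigma> * c) * y ^ (2 * j + 2) / (2 * j + 2)"
   have "norm (H k y - H k 0) <= ?\<psi> y - ?\<psi> 0"
   proof (rule differentiable_bound_general[OF y(1)])
    have "continuous_on UNIV (H k)" using dH by (meson continuous_at_imp_continuous_on has_vector_derivative_continuous)
    then show "continuous_on {0..y} (H k)" by (rule continuous_on_subset) auto
    show "continuous_on {0..y} ?\<psi>" by (intro continuous_intros) auto
    fix z assume z: "0 < z" "z < y"
    show "(H k has_vector_derivative H1 k z) (at z)" by (rule dH)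
    have "((%y. A / (\<sigma> * c) * (y ^ (2 * j + 2) / (2 * j + 2))) has_real_derivative A / (\<sigma> * c) * z ^ (2 * j + 1)) (at z)"
    proof (rule DERIV_cmult)
     have "((%y. y ^ (2 * j + 2)) has_real_derivative real (2 * j + 2) * z ^ (2 * j + 1)) (at z)"
      using DERIV_pow[of "2 * j + 2" z] by simp
     from DERIV_cdivide[OF this, of "real (2 * j + 2)"]
     show "((%y. y ^ (2 * j + 2) / (2 * j + 2)) has_real_derivative z ^ (2 * j + 1)) (at z)" by simp
    qed
    then show "(?\<psi> has_vector_derivative A / (\<sigma> * c) * z ^ (2 * j + 1)) (at z)"
     by (simp add: has_real_derivative_iff_has_vector_derivative)
    show "norm (H1 k z) <= A / (\<sigma> * c) * z ^ (2 * j + 1)" using step2 z y by simp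
   qed
   then show ?thesis by (simp add: H0)
  qed
  also have "\<dots> = B (k + Suc j) / (\<sigma> ^ Suc j * 4 ^ Suc j * fact (Suc j) * pochhammer (\<nu> + 1) (Suc j)) * y ^ (2 * Suc j)"
  proof -
   have "A / (\<sigma> * c) * Y / (2 * j + 2) = B (Suc k + j) / (\<sigma> ^ j * 4 ^ j * fact j * pochhammer (\<nu> + 1) j * (\<sigma> * c * (2 * j + 2))) * Y" for Y
    by (simp add: A_def)
   moreover have "\<sigma> ^ j * 4 ^ j * fact j * pochhammer (\<nu> + 1) j * (\<sigma> * c * (2 * j + 2)) = \<sigma> ^ Suc j * 4 ^ Suc j * fact (Suc j) * pochhammer (\<nu> + 1) (Suc j)"
    by (simp add: c_def pochhammer_Suc algebra_simps)
   ultimately show ?thesis by simp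
  qed
  finally show ?case .
 qed
 have "H 0 x = 0"
 proof -
  let ?Q = "4 * x\<^sup>2 / \<sigma>"
  have "cmod (H 0 x) <= (t2 - t1) * M * (?Q ^ j / sqrt (fact j))" for j
  proof -
   have P: "pochhammer (\<nu> + 1) j >= fact j / 4 ^ j" using pochhammer_ge_half[OF nu] pochhammer_half_ge order_trans by blast
   have "cmod (H 0 x) <= B j / (\<sigma> ^ j * 4 ^ j * fact j * pochhammer (\<nu> + 1) j) * x ^ (2 * j)"
    using Hb[of x 0 j] x by simp
   also have "\<dots> <= B j / (\<sigma> ^ j * 4 ^ j * fact j * (fact j / 4 ^ j)) * x ^ (2 * j)"
    using sigma x P pochhammer_pos'[OF nu, of j]
    by (intro mult_right_mono divide_left_mono mult_left_mono B0 mult_pos_pos divide_pos_pos) auto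
   also have "\<dots> = (t2 - t1) * M * (?Q ^ j * (sqrt (fact j) / fact j))"
    unfolding power_mult[of x 2 j] using sigma by (simp add: B_def power_divide power_mult_distrib field_simps)
   also have "sqrt (fact j) / fact j = 1 / sqrt (fact j)"
    using real_sqrt_mult_self[of "fact j"] by (simp add: field_simps)
   finally show ?thesis by simp
  qed
  moreover have "(%j. (t2 - t1) * M * (?Q ^ j / sqrt (fact j))) \<longlonglongrightarrow> (t2 - t1) * M * 0"
   by (intro tendsto_mult_left tendsto_power_div_sqrt_fact)
  ultimately have "cmod (H 0 x) <= (t2 - t1) * M * 0"
   by (intro LIMSEQ_le_const) auto
  then show ?thesis by simp
 qed
 define g where "g s = Re (\<phi> 0 s) * Re (cnj (h t x) * h s x)" for s
 have "((%s. cnj (h t x) * (\<phi> 0 s * h s x)) has_integral cnj (h t x) * H 0 x) {t1..t2}"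
  unfolding H_def by (intro has_integral_mult_right integrable_integral integrable_continuous_real cint[OF ch])
 from has_integral_Re[OF this] have "((%s. Re (cnj (h t x) * (\<phi> 0 s * h s x))) has_integral 0) {t1..t2}"
  using \<open>H 0 x = 0\<close> by simp
 moreover have "Re (cnj (h t x) * (\<phi> 0 s * h s x)) = g s" for s
 proof -
  have "cnj (h t x) * (\<phi> 0 s * h s x) = of_real (Re (\<phi> 0 s)) * (cnj (h t x) * h s x)"
   using \<phi>(7)[of s] by (metis mult.left_commute)
  moreover have "Re (of_real r * z) = r * Re z" for r z by simp
  ultimately show ?thesis unfolding g_def by (simp only:)
 qed
 ultimately have g0: "(g has_integral 0) {t1..t2}" by simp
 have cg: "continuous_on {t1..t2} g"
  unfolding g_def by (intro continuous_intros \<phi>(1) cont_sub[OF ch] pos) auto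
 have gnn: "g s >= 0" if "s \<in> {t1..t2}" for s
  unfolding g_def using \<phi>(7)[of s] t12(4)[OF that] by simp
 have "g t = 0"
  using integral_eq_0_iff[OF cg tt gnn] g0 t12 by (auto simp: integral_unique)
 moreover have "g t > 0"
  using \<phi>(6)[of t] t12 by (auto simp: g_def)
 ultimately show False by simp
qed

section \<open>The Bessel measure\<close>

lemma space_bessel_measure [simp]: "space (bmeas \<nu>) = {0..}"
 by (simp add: bessel_measure_def)

lemma sets_bessel_measure [measurable_cong]: "sets (bmeas \<nu>) = sets (lebesgue_on {0..})"
 by (simp add: bessel_measure_def)

lemma lebesgue_on_borel_measurable: "f \<in> borel_measurable borel ==> f \<in> borel_measurable (lebesgue_on S)"
 by (intro measurable_restrict_space1 measurable_completion) simp

lemma borel_imp_bessel_measurable: "f \<in> borel_measurable borel ==> f \<in> borel_measurable (bmeas \<nu>)"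
 by (subst measurable_cong_sets[OF sets_bessel_measure refl]) (rule lebesgue_on_borel_measurable)

lemma continuous_imp_bessel_measurable:
 fixes f :: "real => 'a :: euclidean_space"
 shows "continuous_on {0..} f ==> f \<in> borel_measurable (bmeas \<nu>)"
 by (subst measurable_cong_sets[OF sets_bessel_measure refl]) (auto intro: continuous_imp_measurable_on_sets_lebesgue)

lemma id_bessel_measurable [measurable]: "(%y. y) \<in> borel_measurable (bmeas \<nu>)"
 by (rule borel_imp_bessel_measurable) simp

lemma integrable_bessel_iff:
 fixes f :: "real => 'a :: {banach, second_countable_topology}"
 assumes "f \<in> borel_measurable (bmeas \<nu>)"
 shows "integrable (bmeas \<nu>) f \<longleftrightarrow> integrable (lebesgue_on {0..}) (%y. y powr (2 * \<nu> + 1) *\<^sub>R f y)"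
 using assms unfolding bessel_measure_def
 by (subst integrable_density) (auto intro!: lebesgue_on_borel_measurable)

lemma integral_bessel:
 fixes f :: "real => 'a :: {banach, second_countable_topology}"
 assumes "f \<in> borel_measurable (bmeas \<nu>)"
 shows "(LINT y|bmeas \<nu>. f y) = (LINT y|lebesgue_on {0..}. y powr (2 * \<nu> + 1) *\<^sub>R f y)"
 using assms unfolding bessel_measure_def
 by (subst integral_density) (auto intro!: lebesgue_on_borel_measurable)

lemma bessel_emeasure_Icc_finite:
 assumes "\<nu> > - 1/2"
 shows "emeasure (bmeas \<nu>) {0..r} < \<infinity>"
proof -
 have "emeasure (bmeas \<nu>) {0..r} = (\<integral>\<^sup>+y. ennreal (y powr (2 * \<nu> + 1)) * indicator {0..r} y \<partial>lebesgue_on {0..})"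
  unfolding bessel_measure_def
  by (rule emeasure_density) (auto intro!: lebesgue_on_borel_measurable simp: sets_restrict_space_iff)
 also have "\<dots> <= (\<integral>\<^sup>+y. ennreal (r powr (2 * \<nu> + 1)) * indicator {0..r} y \<partial>lebesgue_on {0..})"
  using assms by (intro nn_integral_mono) (auto simp: indicator_def intro!: ennreal_leI powr_mono2)
 also have "\<dots> = ennreal (r powr (2 * \<nu> + 1)) * emeasure (lebesgue_on {0..}) {0..r}"
  by (rule nn_integral_cmult_indicator) (auto simp: sets_restrict_space_iff)
 also have "emeasure (lebesgue_on {0..}) {0..r} = emeasure lborel {0..r}"
  by (subst emeasure_restrict_space) auto
 also have "ennreal (r powr (2 * \<nu> + 1)) * emeasure lborel {0..r} < \<infinity>"
  by (cases "r >= 0") (auto simp: ennreal_mult_less_top)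
 finally show ?thesis .
qed

lemma sigma_finite_bessel_measure:
 assumes "\<nu> > - 1/2"
 shows "sigma_finite_measure (bmeas \<nu>)"
proof
 show "\<exists>A. countable A & A \<subseteq> sets (bmeas \<nu>) & \<Union> A = space (bmeas \<nu>) & (\<forall>a\<in>A. emeasure (bmeas \<nu>) a ~= \<infinity>)"
 proof (intro exI[of _ "range (%n::nat. {0..real n})"] conjI ballI)
  show "range (%n::nat. {0..real n}) \<subseteq> sets (bmeas \<nu>)"
   by (auto simp: sets_bessel_measure sets_restrict_space_iff)
  show "(\<Union>n. {0..real n}) = space (bmeas \<nu>)"
   by (auto intro: real_arch_simple)
  show "emeasure (bmeas \<nu>) a ~= \<infinity>" if "a \<in> range (%n::nat. {0..real n})" for a
   using that bessel_emeasure_Icc_finite[OF assms] by (auto simp: less_top[symmetric])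
 qed simp
qed

lemma Gaussian_bessel_integral:
 fixes \<nu> c :: real
 assumes nu: "\<nu> > - 1/2" and c: "c > 0"
 shows "integrable (bmeas \<nu>) (%y. exp (- c * y\<^sup>2))"
  and "(LINT y|bmeas \<nu>. exp (- c * y\<^sup>2)) = Gamma (\<nu> + 1) / 2 * c powr - (\<nu> + 1)"
proof -
 let ?S = "{0<..} :: real set" and ?g = "%y. c * y\<^sup>2"
 let ?f = "%t. t powr (\<nu> + 1 - 1) / exp t"
 have G: "(?f has_integral Gamma (\<nu> + 1)) {0..}"
  by (rule Gamma_integral_real) (use nu in auto)
 have "(?f has_integral Gamma (\<nu> + 1)) ?S"
  by (rule has_integral_spike_set_eq[THEN iffD1, OF _ _ G]; rule negligible_subset[of "{0}"]) auto
 then have f: "?f absolutely_integrable_on ?S" "integral ?S ?f = Gamma (\<nu> + 1)"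
  by (auto intro!: nonnegative_absolutely_integrable_1 simp: integral_unique)
 have img: "?g ` ?S = ?S"
 proof (intro equalityI subsetI)
  fix t assume "t \<in> ?S"
  then have "t = ?g (sqrt (t / c))" "sqrt (t / c) \<in> ?S" using c by auto
  then show "t \<in> ?g ` ?S" by blast
 qed (use c in auto)
 have "inj_on ?g ?S" using c by (auto intro!: inj_onI)
 then have "(%y. \<bar>2 * c * y\<bar> * ?f (?g y)) absolutely_integrable_on ?S \<and>
    integral ?S (%y. \<bar>2 * c * y\<bar> * ?f (?g y)) = Gamma (\<nu> + 1)"
  by (subst has_absolute_integral_change_of_variables_1'[where g = ?g])
   (use f img in \<open>auto intro!: derivative_eq_intros\<close>)
 moreover have "\<bar>2 * c * y\<bar> * ?f (?g y) = 2 * c powr (\<nu> + 1) * (y powr (2 * \<nu> + 1) * exp (- c * y\<^sup>2))" if "y \<in> ?S" for y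
 proof -
  have "(c * y\<^sup>2) powr \<nu> = c powr \<nu> * (y powr 2) powr \<nu>" using that by (simp add: powr_mult)
  also have "\<dots> = c powr \<nu> * y powr (2 * \<nu>)" by (simp only: powr_powr)
  finally have e: "(c * y\<^sup>2) powr \<nu> = c powr \<nu> * y powr (2 * \<nu>)" .
  show ?thesis using that c unfolding add_diff_cancel_right' e by (simp add: powr_add exp_minus divide_inverse)
 qed
 ultimately have A: "(%y. 2 * c powr (\<nu> + 1) * (y powr (2 * \<nu> + 1) * exp (- c * y\<^sup>2))) absolutely_integrable_on ?S"
  "integral ?S (%y. 2 * c powr (\<nu> + 1) * (y powr (2 * \<nu> + 1) * exp (- c * y\<^sup>2))) = Gamma (\<nu> + 1)"
  using set_integrable_cong[of lebesgue lebesgue ?S ?S "%y. \<bar>2 * c * y\<bar> * ?f (?g y)" "%y. 2 * c powr (\<nu> + 1) * (y powr (2 * \<nu> + 1) * exp (- c * y\<^sup>2))"]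
   Henstock_Kurzweil_Integration.integral_cong[of ?S "%y. \<bar>2 * c * y\<bar> * ?f (?g y)" "%y. 2 * c powr (\<nu> + 1) * (y powr (2 * \<nu> + 1) * exp (- c * y\<^sup>2))"]
  by auto
 let ?h = "%y. y powr (2 * \<nu> + 1) * exp (- c * y\<^sup>2)"
 have C: "2 * c powr (\<nu> + 1) ~= 0" using c by simp
 have h1: "?h absolutely_integrable_on ?S"
  using absolutely_integrable_scaleR_left[OF A(1), of "inverse (2 * c powr (\<nu> + 1))"] C by simp
 have h2: "integral ?S ?h = Gamma (\<nu> + 1) / 2 * c powr - (\<nu> + 1)"
 proof -
  have "2 * c powr (\<nu> + 1) * integral ?S ?h = Gamma (\<nu> + 1)"
   using A(2) by (simp only: Henstock_Kurzweil_Integration.integral_mult_right)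
  then have "integral ?S ?h = Gamma (\<nu> + 1) / (2 * c powr (\<nu> + 1))" using C by (simp add: nonzero_eq_divide_eq mult.commute)
  then show ?thesis using powr_minus[of c "\<nu> + 1"] by (simp only: divide_inverse inverse_mult_distrib mult.assoc)
 qed
 have "(?h has_integral Gamma (\<nu> + 1) / 2 * c powr - (\<nu> + 1)) {0..}"
 proof (rule has_integral_spike_set_eq[THEN iffD1])
  show "(?h has_integral Gamma (\<nu> + 1) / 2 * c powr - (\<nu> + 1)) ?S"
   using set_lebesgue_integral_eq_integral(1)[OF h1] h2 by (simp add: has_integral_iff)
 qed (rule negligible_subset[of "{0}"]; auto)+
 then have h: "?h absolutely_integrable_on {0..}" "integral {0..} ?h = Gamma (\<nu> + 1) / 2 * c powr - (\<nu> + 1)"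
  by (auto intro!: nonnegative_absolutely_integrable_1 simp: integral_unique)
 have i: "integrable (lebesgue_on {0..}) ?h"
  using h(1) by (simp add: absolutely_integrable_on_def set_integrable_def integrable_restrict_space)
 show "integrable (bmeas \<nu>) (%y. exp (- c * y\<^sup>2))"
  using i by (subst integrable_bessel_iff) (auto intro!: borel_imp_bessel_measurable)
 show "(LINT y|bmeas \<nu>. exp (- c * y\<^sup>2)) = Gamma (\<nu> + 1) / 2 * c powr - (\<nu> + 1)"
  using i h(2) by (subst integral_bessel) (auto intro!: borel_imp_bessel_measurable simp: lebesgue_integral_eq_integral)
qed

lemma even_power_le_exp:
 fixes c y :: real
 assumes c: "c > 0"
 shows "y ^ (2 * k) <= fact k / c ^ k * exp (c * y\<^sup>2)"
proof -
 have "(\<Sum>n\<in>{k}. (c * y\<^sup>2) ^ n /\<^sub>R fact n) <= (\<Sum>n. (c * y\<^sup>2) ^ n /\<^sub>R fact n)"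
  by (rule sum_le_suminf) (use c exp_converges[of "c * y\<^sup>2"] in \<open>auto simp: sums_iff\<close>)
 then have "(c * y\<^sup>2) ^ k / fact k <= exp (c * y\<^sup>2)"
  using exp_converges[of "c * y\<^sup>2"] by (simp add: sums_iff divide_inverse mult.commute)
 then show ?thesis unfolding power_mult[of y] using c by (simp add: power_mult_distrib field_simps)
qed

text \<open>Integration by parts against the Bessel measure: the weight vanishes at the origin, so that
 only the behaviour at infinity has to be controlled.\<close>

lemma bessel_integral_derivative_eq_0:
 fixes \<Psi> g :: "real => complex"
 assumes cont: "continuous_on {0..} \<Psi>" and zero: "\<Psi> 0 = 0" and lim: "(\<Psi> \<longlongrightarrow> 0) at_top"
  and der: "!!y. y > 0 ==> (\<Psi> has_vector_derivative y powr (2 * \<nu> + 1) *\<^sub>R g y) (at y)"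
  and int: "integrable (bmeas \<nu>) g"
 shows "(LINT y|bmeas \<nu>. g y) = 0"
proof -
 let ?h = "%y. y powr (2 * \<nu> + 1) *\<^sub>R g y" and ?M = "lebesgue_on {0::real..}"
 have h: "integrable ?M ?h" using int borel_measurable_integrable[OF int] by (simp add: integrable_bessel_iff)
 have ii: "integrable ?M (%y. indicator {0..real n} y *\<^sub>R ?h y)" for n
  by (rule integrable_mult_indicator[OF _ h]) (auto simp: sets_restrict_space_iff)
 have "(%n. LINT y|?M. indicator {0..real n} y *\<^sub>R ?h y) \<longlonglongrightarrow> (LINT y|?M. ?h y)"
 proof (rule integral_dominated_convergence[where w = "%y. norm (?h y)"])
  show "AE y in ?M. (%n. indicator {0..real n} y *\<^sub>R ?h y) \<longlonglongrightarrow> ?h y"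
  proof (rule AE_I2)
   fix y assume y: "y \<in> space ?M"
   obtain N where N: "real N >= y" using real_arch_simple by blast
   have "\<forall>\<^sub>F n in sequentially. indicator {0..real n} y *\<^sub>R ?h y = ?h y"
    using N y by (auto simp: eventually_sequentially indicator_def intro!: exI[of _ N])
   then show "(%n. indicator {0..real n} y *\<^sub>R ?h y) \<longlonglongrightarrow> ?h y" by (rule tendsto_eventually)
  qed
  show "AE y in ?M. norm (indicator {0..real n} y *\<^sub>R ?h y) <= norm (?h y)" for n
   by (rule AE_I2) (simp add: indicator_def)
 qed (rule borel_measurable_integrable[OF h] borel_measurable_integrable[OF ii] integrable_norm[OF h])+
 moreover have "(LINT y|?M. indicator {0..real n} y *\<^sub>R ?h y) = \<Psi> (real n)" for n
 proof -
  have "(?h has_integral \<Psi> (real n) - \<Psi> 0) {0..real n}"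
   by (rule fundamental_theorem_of_calculus_interior) (use der in \<open>auto intro: continuous_on_subset[OF cont]\<close>)
  then have hi: "integral {0..real n} ?h = \<Psi> (real n)" using zero by (simp add: integral_unique)
  have "(LINT y|?M. indicator {0..real n} y *\<^sub>R ?h y) = integral {0..} (%y. indicator {0..real n} y *\<^sub>R ?h y)"
   by (rule lebesgue_integral_eq_integral[OF ii]) simp
  also have "\<dots> = integral {0..} (%y. if y \<in> {0..real n} then ?h y else 0)"
   by (rule Henstock_Kurzweil_Integration.integral_cong) (auto simp: indicator_def)
  also have "\<dots> = integral {0..real n} ?h"
   by (subst integral_restrict_Int) (auto intro!: arg_cong2[where f = integral])
  finally show ?thesis using hi by simp
 qed
 ultimately have "(%n. \<Psi> (real n)) \<longlonglongrightarrow> (LINT y|?M. ?h y)" by simp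
 moreover have "(%n. \<Psi> (real n)) \<longlonglongrightarrow> 0"
  using lim filterlim_real_sequentially by (rule filterlim_compose)
 ultimately have "(LINT y|?M. ?h y) = 0" by (rule LIMSEQ_unique)
 then show ?thesis using int by (subst integral_bessel) auto
qed

section \<open>The Bessel heat kernel\<close>

text \<open>The kernel at time \<open>t\<close> for \<open>\<kappa> = 1 / (4 \<sigma> t)\<close>; in this variable differentiation
in time is polynomial in \<open>x\<close> and \<open>y\<close>.\<close>

definition kern :: "real => real => real => real => real" where
 "kern \<nu> \<kappa> x y = 2 / Gamma (\<nu> + 1) * \<kappa> powr (\<nu> + 1) * exp (- \<kappa> * (x\<^sup>2 + y\<^sup>2)) * norm_bessel \<nu> ((\<kappa> * x * y)\<^sup>2)"

lemma kern_nonneg: "\<nu> > - 1/2 ==> kern \<nu> \<kappa> x y >= 0"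
 unfolding kern_def
 by (intro mult_nonneg_nonneg divide_nonneg_pos Gamma_real_pos order_trans[OF _ norm_bessel_pos]) auto

lemma kern_sym: "kern \<nu> \<kappa> x y = kern \<nu> \<kappa> y x"
 by (simp add: kern_def add_ac mult_ac)

lemma kern_even [simp]: "kern \<nu> \<kappa> (- x) y = kern \<nu> \<kappa> x y"
 by (simp add: kern_def)

lemma continuous_on_kern [continuous_intros]:
 fixes f g h :: "'a :: topological_space => real"
 assumes "\<nu> > - 1/2" "continuous_on S f" "continuous_on S g" "continuous_on S h" "!!x. x \<in> S ==> f x > 0"
 shows "continuous_on S (%x. kern \<nu> (f x) (g x) (h x))"
 unfolding kern_def
 by (intro continuous_intros assms(1-4)) (auto dest!: assms(5))

lemma norm_bessel_measurable [measurable]: "\<nu> > - 1/2 ==> norm_bessel \<nu> \<in> borel_measurable borel"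
 by (intro borel_measurable_continuous_onI continuous_on_norm_bessel continuous_intros)

lemma kern_measurable [measurable (raw)]:
 assumes "\<nu> > - 1/2" and [measurable]: "g \<in> borel_measurable M" "h \<in> borel_measurable M"
 shows "(%x. kern \<nu> l (g x) (h x)) \<in> borel_measurable M"
proof -
 note [measurable] = norm_bessel_measurable[OF assms(1)]
 show ?thesis unfolding kern_def by measurable
qed

lemma Gamma_Suc_pos:
 assumes "\<nu> > - 1/2"
 shows "Gamma (\<nu> + 2) = (\<nu> + 1) * Gamma (\<nu> + 1)" "Gamma (\<nu> + 1) > (0::real)"
proof -
 show "Gamma (\<nu> + 1) > (0::real)" using assms by (intro Gamma_real_pos) auto
 show "Gamma (\<nu> + 2) = (\<nu> + 1) * Gamma (\<nu> + 1)"
 proof -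
  have "\<nu> + 1 \<notin> \<int>\<^sub>\<le>\<^sub>0" using assms by (auto elim!: nonpos_Ints_cases)
  then show ?thesis using Gamma_plus1[of "\<nu> + 1"] by (simp add: add.assoc)
 qed
qed

lemma kern_deriv_x:
 assumes nu: "\<nu> > - 1/2" and l: "\<kappa> > 0"
 shows "((%x. kern \<nu> \<kappa> x y) has_real_derivative
     2 * \<kappa> * x * (y\<^sup>2 * kern (\<nu> + 1) \<kappa> x y - kern \<nu> \<kappa> x y)) (at x)"
proof -
 have "((%x. norm_bessel \<nu> ((\<kappa> * x * y)\<^sup>2)) has_real_derivative norm_bessel (\<nu> + 1) ((\<kappa> * x * y)\<^sup>2) / (\<nu> + 1) * (2 * \<kappa>\<^sup>2 * x * y\<^sup>2)) (at x)"
  by (rule DERIV_chain2[OF norm_bessel_deriv[OF nu]])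
   (auto intro!: derivative_eq_intros simp: power2_eq_square)
 moreover have "((%x. C * exp (- \<kappa> * (x\<^sup>2 + y\<^sup>2))) has_real_derivative
   C * (exp (- \<kappa> * (x\<^sup>2 + y\<^sup>2)) * (- 2 * \<kappa> * x))) (at x)" for C
  by (auto intro!: derivative_eq_intros)
 from this[of "2 / Gamma (\<nu> + 1) * \<kappa> powr (\<nu> + 1)"]
 have "((%x. 2 / Gamma (\<nu> + 1) * \<kappa> powr (\<nu> + 1) * exp (- \<kappa> * (x\<^sup>2 + y\<^sup>2))) has_real_derivative
   2 / Gamma (\<nu> + 1) * \<kappa> powr (\<nu> + 1) * (exp (- \<kappa> * (x\<^sup>2 + y\<^sup>2)) * (- 2 * \<kappa> * x))) (at x)" .
 ultimately have "((%x. kern \<nu> \<kappa> x y) has_real_derivative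
  2 / Gamma (\<nu> + 1) * \<kappa> powr (\<nu> + 1) * (exp (- \<kappa> * (x\<^sup>2 + y\<^sup>2)) * (- 2 * \<kappa> * x)) * norm_bessel \<nu> ((\<kappa> * x * y)\<^sup>2) +
  norm_bessel (\<nu> + 1) ((\<kappa> * x * y)\<^sup>2) / (\<nu> + 1) * (2 * \<kappa>\<^sup>2 * x * y\<^sup>2) * (2 / Gamma (\<nu> + 1) * \<kappa> powr (\<nu> + 1) * exp (- \<kappa> * (x\<^sup>2 + y\<^sup>2)))) (at x)"
  unfolding kern_def by (rule DERIV_mult[rotated])
 moreover have "\<kappa> powr (\<nu> + 2) = \<kappa> powr (\<nu> + 1) * \<kappa>" using l by (simp add: powr_add power2_eq_square)
 ultimately show ?thesis
  using Gamma_Suc_pos[OF nu] nu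
  by (simp add: kern_def field_simps power2_eq_square)
qed

lemma kern_deriv_lambda:
 assumes nu: "\<nu> > - 1/2" and l: "\<kappa> > 0"
 shows "((%\<kappa>. kern \<nu> \<kappa> x y) has_real_derivative
     ((\<nu> + 1) / \<kappa> - x\<^sup>2 - y\<^sup>2) * kern \<nu> \<kappa> x y + 2 * x\<^sup>2 * y\<^sup>2 * kern (\<nu> + 1) \<kappa> x y) (at \<kappa>)"
proof -
 have "((%l. norm_bessel \<nu> ((l * x * y)\<^sup>2)) has_real_derivative norm_bessel (\<nu> + 1) ((\<kappa> * x * y)\<^sup>2) / (\<nu> + 1) * (2 * \<kappa> * x\<^sup>2 * y\<^sup>2)) (at \<kappa>)"
  by (rule DERIV_chain2[OF norm_bessel_deriv[OF nu]])
   (auto intro!: derivative_eq_intros simp: power2_eq_square)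
 moreover have "((%l. 2 / Gamma (\<nu> + 1) * l powr (\<nu> + 1) * exp (- l * (x\<^sup>2 + y\<^sup>2))) has_real_derivative
   2 / Gamma (\<nu> + 1) * ((\<nu> + 1) * \<kappa> powr \<nu>) * exp (- \<kappa> * (x\<^sup>2 + y\<^sup>2)) +
   2 / Gamma (\<nu> + 1) * \<kappa> powr (\<nu> + 1) * (exp (- \<kappa> * (x\<^sup>2 + y\<^sup>2)) * (- (x\<^sup>2 + y\<^sup>2)))) (at \<kappa>)"
 proof -
  have "((%l. C * l powr (\<nu> + 1) * exp (- l * (x\<^sup>2 + y\<^sup>2))) has_real_derivative
   C * ((\<nu> + 1) * \<kappa> powr \<nu>) * exp (- \<kappa> * (x\<^sup>2 + y\<^sup>2)) +
   C * \<kappa> powr (\<nu> + 1) * (exp (- \<kappa> * (x\<^sup>2 + y\<^sup>2)) * (- (x\<^sup>2 + y\<^sup>2)))) (at \<kappa>)" for C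
   using l by (auto intro!: derivative_eq_intros)
  from this[of "2 / Gamma (\<nu> + 1)"] show ?thesis .
 qed
 ultimately have "((%l. kern \<nu> l x y) has_real_derivative
  (2 / Gamma (\<nu> + 1) * ((\<nu> + 1) * \<kappa> powr \<nu>) * exp (- \<kappa> * (x\<^sup>2 + y\<^sup>2)) +
   2 / Gamma (\<nu> + 1) * \<kappa> powr (\<nu> + 1) * (exp (- \<kappa> * (x\<^sup>2 + y\<^sup>2)) * (- (x\<^sup>2 + y\<^sup>2)))) * norm_bessel \<nu> ((\<kappa> * x * y)\<^sup>2) +
  norm_bessel (\<nu> + 1) ((\<kappa> * x * y)\<^sup>2) / (\<nu> + 1) * (2 * \<kappa> * x\<^sup>2 * y\<^sup>2) * (2 / Gamma (\<nu> + 1) * \<kappa> powr (\<nu> + 1) * exp (- \<kappa> * (x\<^sup>2 + y\<^sup>2)))) (at \<kappa>)"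
  unfolding kern_def by (rule DERIV_mult[rotated])
 note D = this
 define A where "A = 2 / Gamma (\<nu> + 1) * \<kappa> powr (\<nu> + 1) * exp (- \<kappa> * (x\<^sup>2 + y\<^sup>2))"
 have p: "\<nu> + 1 > 0" "\<nu> + 1 + 1 = \<nu> + 2" using nu by auto
 have P: "\<kappa> powr (\<nu> + 2) = \<kappa> powr (\<nu> + 1) * \<kappa>" "\<kappa> powr \<nu> = \<kappa> powr (\<nu> + 1) / \<kappa>"
  using l by (simp_all add: powr_add power2_eq_square)
 have e0: "kern \<nu> \<kappa> x y = A * norm_bessel \<nu> ((\<kappa> * x * y)\<^sup>2)" by (simp add: kern_def A_def)
 have e1: "kern (\<nu> + 1) \<kappa> x y = A * \<kappa> / (\<nu> + 1) * norm_bessel (\<nu> + 1) ((\<kappa> * x * y)\<^sup>2)"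
  unfolding kern_def p A_def Gamma_Suc_pos(1)[OF nu] P using p by (simp add: field_simps)
 have A': "2 / Gamma (\<nu> + 1) * ((\<nu> + 1) * \<kappa> powr \<nu>) * exp (- \<kappa> * (x\<^sup>2 + y\<^sup>2)) = A * ((\<nu> + 1) / \<kappa>)"
  unfolding A_def P by simp
 have *: "(A * ((\<nu> + 1) / \<kappa>) + A * (- (x\<^sup>2 + y\<^sup>2))) * N0 + N1 / (\<nu> + 1) * (2 * \<kappa> * x\<^sup>2 * y\<^sup>2) * A =
  ((\<nu> + 1) / \<kappa> - x\<^sup>2 - y\<^sup>2) * (A * N0) + 2 * x\<^sup>2 * y\<^sup>2 * (A * \<kappa> / (\<nu> + 1) * N1)" for N0 N1
  by (simp add: algebra_simps)
 have A'': "2 / Gamma (\<nu> + 1) * \<kappa> powr (\<nu> + 1) * (exp (- \<kappa> * (x\<^sup>2 + y\<^sup>2)) * z) = A * z" for z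
  by (simp add: A_def)
 show ?thesis
  by (rule DERIV_cong[OF D]) (use *[of "norm_bessel \<nu> ((\<kappa> * x * y)\<^sup>2)" "norm_bessel (\<nu> + 1) ((\<kappa> * x * y)\<^sup>2)"]
   in \<open>simp only: e0 e1 A' A'' A_def[symmetric]\<close>)
qed

lemma kern_contiguous:
 assumes nu: "\<nu> > - 1/2" and l: "\<kappa> > 0"
 shows "kern \<nu> \<kappa> x y = (\<nu> + 1) / \<kappa> * kern (\<nu> + 1) \<kappa> x y + x\<^sup>2 * y\<^sup>2 * kern (\<nu> + 2) \<kappa> x y"
proof -
 define A where "A = 2 / Gamma (\<nu> + 1) * \<kappa> powr (\<nu> + 1) * exp (- \<kappa> * (x\<^sup>2 + y\<^sup>2))"
 have p: "\<nu> + 1 > 0" "\<nu> + 2 > 0" "\<nu> + 1 + 1 = \<nu> + 2" "\<nu> + 2 + 1 = \<nu> + 3" using nu by auto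
 have G: "Gamma (\<nu> + 2) = (\<nu> + 1) * Gamma (\<nu> + 1)" "Gamma (\<nu> + 3) = (\<nu> + 2) * ((\<nu> + 1) * Gamma (\<nu> + 1))" "Gamma (\<nu> + 1) > 0"
  using Gamma_Suc_pos[OF nu] Gamma_Suc_pos[of "\<nu> + 1"] nu by (simp_all add: add_ac)
 have P: "\<kappa> powr (\<nu> + 2) = \<kappa> powr (\<nu> + 1) * \<kappa>" "\<kappa> powr (\<nu> + 3) = \<kappa> powr (\<nu> + 1) * \<kappa>\<^sup>2"
  using l by (simp_all add: powr_add power2_eq_square power3_eq_cube)
 have e0: "kern \<nu> \<kappa> x y = A * norm_bessel \<nu> ((\<kappa> * x * y)\<^sup>2)" by (simp add: kern_def A_def)
 have e1: "kern (\<nu> + 1) \<kappa> x y = A * \<kappa> / (\<nu> + 1) * norm_bessel (\<nu> + 1) ((\<kappa> * x * y)\<^sup>2)"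
  unfolding kern_def p A_def G P using p G(3) by (simp add: field_simps)
 have e2: "kern (\<nu> + 2) \<kappa> x y = A * \<kappa>\<^sup>2 / ((\<nu> + 1) * (\<nu> + 2)) * norm_bessel (\<nu> + 2) ((\<kappa> * x * y)\<^sup>2)"
  unfolding kern_def p A_def G P using p G(3) by (simp add: field_simps)
 have "A * norm_bessel \<nu> ((\<kappa> * x * y)\<^sup>2) = A * norm_bessel (\<nu> + 1) ((\<kappa> * x * y)\<^sup>2) +
   x\<^sup>2 * y\<^sup>2 * (A * \<kappa>\<^sup>2 / ((\<nu> + 1) * (\<nu> + 2)) * norm_bessel (\<nu> + 2) ((\<kappa> * x * y)\<^sup>2))"
  unfolding norm_bessel_contiguous[OF nu, of "(\<kappa> * x * y)\<^sup>2"] by (simp add: distrib_left power_mult_distrib mult_ac)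
 moreover have "(\<nu> + 1) / \<kappa> * (A * \<kappa> / (\<nu> + 1) * X) = A * X" for X using l p by simp
 ultimately show ?thesis unfolding e0 e1 e2 by simp
qed

lemma kern_angle:
 assumes nu: "\<nu> > - 1/2"
 shows "kern \<nu> \<kappa> x y = 2 / Gamma (\<nu> + 1) * \<kappa> powr (\<nu> + 1) *
     (LINT \<theta>|angle_measure \<nu>. exp (- \<kappa> * (x\<^sup>2 + y\<^sup>2 - 2 * x * y * cos \<theta>)))"
proof -
 have "exp (- \<kappa> * (x\<^sup>2 + y\<^sup>2 - 2 * x * y * cos \<theta>)) = exp (- \<kappa> * (x\<^sup>2 + y\<^sup>2)) * exp (2 * (\<kappa> * x * y) * cos \<theta>)" for \<theta>
  by (simp add: exp_add[symmetric] algebra_simps)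
 then show ?thesis
  by (simp add: kern_def integral_exp_cos[OF nu] power_mult_distrib)
qed

lemma kern_le:
 assumes nu: "\<nu> > - 1/2" and l: "\<kappa> > 0"
 shows "kern \<nu> \<kappa> x y <= 2 / Gamma (\<nu> + 1) * \<kappa> powr (\<nu> + 1) * exp (- \<kappa> * (\<bar>x\<bar> - \<bar>y\<bar>)\<^sup>2)"
proof -
 have "exp (- \<kappa> * (x\<^sup>2 + y\<^sup>2)) * norm_bessel \<nu> ((\<kappa> * x * y)\<^sup>2) <= exp (- \<kappa> * (x\<^sup>2 + y\<^sup>2)) * exp (2 * \<bar>\<kappa> * x * y\<bar>)"
  by (intro mult_left_mono norm_bessel_le_exp[OF nu]) auto
 also have "\<dots> = exp (- \<kappa> * (\<bar>x\<bar> - \<bar>y\<bar>)\<^sup>2)"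
 proof -
  have "- \<kappa> * (x\<^sup>2 + y\<^sup>2) + 2 * \<bar>\<kappa> * x * y\<bar> = - \<kappa> * (\<bar>x\<bar> - \<bar>y\<bar>)\<^sup>2"
   using l by (simp add: abs_mult power2_diff algebra_simps)
  then show ?thesis by (simp add: exp_add[symmetric])
 qed
 finally show ?thesis
  unfolding kern_def mult.assoc
  by (intro mult_left_mono divide_nonneg_pos Gamma_Suc_pos[OF nu]) auto
qed

lemma kern_le_const:
 assumes nu: "\<nu> > - 1/2" and l: "\<kappa> > 0"
 shows "kern \<nu> \<kappa> x y <= 2 / Gamma (\<nu> + 1) * \<kappa> powr (\<nu> + 1)"
proof -
 have "2 / Gamma (\<nu> + 1) * \<kappa> powr (\<nu> + 1) * exp (- \<kappa> * (\<bar>x\<bar> - \<bar>y\<bar>)\<^sup>2) <= 2 / Gamma (\<nu> + 1) * \<kappa> powr (\<nu> + 1) * 1"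
  using l by (intro mult_left_mono mult_nonneg_nonneg divide_nonneg_pos Gamma_Suc_pos[OF nu]) auto
 then show ?thesis using kern_le[OF nu l, of x y] by simp
qed

lemma kern_dominated:
 assumes nu: "\<nu> > - 1/2" and l: "l > 0"
 shows "\<exists>C\<ge>0. \<forall>\<kappa>\<in>{l..L}. \<forall>x. \<bar>x\<bar> <= X --> (\<forall>y. y ^ (2 * k) * kern \<nu> \<kappa> x y <= C * exp (- (l / 4) * y\<^sup>2))"
proof -
 define A where "A = 2 / Gamma (\<nu> + 1) * L powr (\<nu> + 1) * exp (L * X\<^sup>2)"
 define B where "B = fact k / (l / 4) ^ k"
 have A: "A >= 0" unfolding A_def by (intro mult_nonneg_nonneg divide_nonneg_pos Gamma_Suc_pos[OF nu]) auto
 have B: "B >= 0" using l by (simp add: B_def)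
 have "y ^ (2 * k) * kern \<nu> \<kappa> x y <= B * A * exp (- (l / 4) * y\<^sup>2)"
  if lam: "\<kappa> \<in> {l..L}" and x: "\<bar>x\<bar> <= X" for \<kappa> x y
 proof -
  have "0 <= (2 * \<bar>x\<bar> - \<bar>y\<bar>)\<^sup>2" by simp
  then have s: "y\<^sup>2 / 2 - x\<^sup>2 <= (\<bar>x\<bar> - \<bar>y\<bar>)\<^sup>2" by (simp add: power2_diff power_mult_distrib)
  have xx: "x\<^sup>2 <= X\<^sup>2" using power_mono[OF x, of 2] by simp
  have "- \<kappa> * (\<bar>x\<bar> - \<bar>y\<bar>)\<^sup>2 <= - \<kappa> * (y\<^sup>2 / 2 - x\<^sup>2)"
   using mult_left_mono[OF s, of \<kappa>] lam l by simp
  also have "\<dots> = - \<kappa> * (y\<^sup>2 / 2) + \<kappa> * x\<^sup>2" by (simp add: algebra_simps)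
  also have "\<dots> <= - l * (y\<^sup>2 / 2) + L * X\<^sup>2"
  proof (rule add_mono)
   show "- \<kappa> * (y\<^sup>2 / 2) <= - l * (y\<^sup>2 / 2)" using lam by (intro mult_right_mono) auto
   show "\<kappa> * x\<^sup>2 <= L * X\<^sup>2" using lam l xx by (intro mult_mono) auto
  qed
  finally have e: "exp (- \<kappa> * (\<bar>x\<bar> - \<bar>y\<bar>)\<^sup>2) <= exp (L * X\<^sup>2) * exp (- (l / 2) * y\<^sup>2)"
   by (simp add: exp_add[symmetric])
  have "kern \<nu> \<kappa> x y <= 2 / Gamma (\<nu> + 1) * \<kappa> powr (\<nu> + 1) * exp (- \<kappa> * (\<bar>x\<bar> - \<bar>y\<bar>)\<^sup>2)"
   using lam l by (intro kern_le nu) auto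
  also have "\<dots> <= 2 / Gamma (\<nu> + 1) * L powr (\<nu> + 1) * (exp (L * X\<^sup>2) * exp (- (l / 2) * y\<^sup>2))"
   using lam l nu by (intro mult_mono e powr_mono2 mult_nonneg_nonneg divide_nonneg_pos Gamma_Suc_pos[OF nu]) auto
  finally have K: "kern \<nu> \<kappa> x y <= A * exp (- (l / 2) * y\<^sup>2)" by (simp add: A_def mult_ac)
  have "y ^ (2 * k) * kern \<nu> \<kappa> x y <= (B * exp (l / 4 * y\<^sup>2)) * (A * exp (- (l / 2) * y\<^sup>2))"
   using even_power_le_exp[of "l / 4" y k] l K A B kern_nonneg[OF nu]
   by (intro mult_mono) (auto simp: B_def)
  also have "\<dots> = B * A * exp (l / 4 * y\<^sup>2 + - (l / 2) * y\<^sup>2)" by (simp only: exp_add mult_ac)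
  also have "l / 4 * y\<^sup>2 + - (l / 2) * y\<^sup>2 = - (l / 4) * y\<^sup>2" by (simp add: field_simps)
  finally show ?thesis .
 qed
 then show ?thesis using A B by (intro exI[of _ "B * A"]) auto
qed

lemma kern_far:
 assumes nu: "\<nu> > - 1/2" and l: "\<kappa> > 0" and "x >= 0" "y >= 0" "\<bar>y - x\<bar> >= \<delta>" "\<delta> >= 0"
 shows "kern \<nu> \<kappa> x y <= 2 powr (\<nu> + 1) * exp (- (\<kappa> / 2) * \<delta>\<^sup>2) * kern \<nu> (\<kappa> / 2) x y"
proof -
 let ?r = "%\<theta>. x\<^sup>2 + y\<^sup>2 - 2 * x * y * cos \<theta>"
 have int: "integrable (angle_measure \<nu>) (%\<theta>. exp (- l * ?r \<theta>))" for l
 proof -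
  have "exp (- l * ?r \<theta>) = exp ((2 * l * x * y) * cos \<theta> + (- l * (x\<^sup>2 + y\<^sup>2)))" for \<theta> by (simp add: algebra_simps)
  then show ?thesis using integrable_exp_cos[OF nu, of "2 * l * x * y" "- l * (x\<^sup>2 + y\<^sup>2)"] by (simp only:)
 qed
 have "exp (- \<kappa> * ?r \<theta>) <= exp (- (\<kappa> / 2) * \<delta>\<^sup>2) * exp (- (\<kappa> / 2) * ?r \<theta>)" for \<theta>
 proof -
  have "\<delta>\<^sup>2 <= \<bar>y - x\<bar>\<^sup>2" using assms by (intro power_mono) auto
  also have "\<dots> = x\<^sup>2 + y\<^sup>2 - 2 * x * y * 1" by (simp add: power2_diff)
  also have "\<dots> <= ?r \<theta>" using assms by (intro diff_left_mono mult_left_mono) auto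
  finally have "\<kappa> / 2 * \<delta>\<^sup>2 <= \<kappa> / 2 * ?r \<theta>" using l by (intro mult_left_mono) auto
  then have "- \<kappa> * ?r \<theta> <= - (\<kappa> / 2) * \<delta>\<^sup>2 + - (\<kappa> / 2) * ?r \<theta>" by (simp add: field_simps)
  then show ?thesis by (simp add: exp_add[symmetric])
 qed
 then have "(LINT \<theta>|angle_measure \<nu>. exp (- \<kappa> * ?r \<theta>)) <= (LINT \<theta>|angle_measure \<nu>. exp (- (\<kappa> / 2) * \<delta>\<^sup>2) * exp (- (\<kappa> / 2) * ?r \<theta>))"
  by (intro integral_mono integrable_mult_right int) auto
 then have "(LINT \<theta>|angle_measure \<nu>. exp (- \<kappa> * ?r \<theta>)) <= exp (- (\<kappa> / 2) * \<delta>\<^sup>2) * (LINT \<theta>|angle_measure \<nu>. exp (- (\<kappa> / 2) * ?r \<theta>))"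
  by simp
 then have "2 / Gamma (\<nu> + 1) * \<kappa> powr (\<nu> + 1) * (LINT \<theta>|angle_measure \<nu>. exp (- \<kappa> * ?r \<theta>)) \<le>
  2 / Gamma (\<nu> + 1) * \<kappa> powr (\<nu> + 1) * (exp (- (\<kappa> / 2) * \<delta>\<^sup>2) * (LINT \<theta>|angle_measure \<nu>. exp (- (\<kappa> / 2) * ?r \<theta>)))"
  by (rule mult_left_mono) (intro mult_nonneg_nonneg divide_nonneg_pos Gamma_Suc_pos[OF nu], auto)
 moreover have "\<kappa> powr (\<nu> + 1) = 2 powr (\<nu> + 1) * (\<kappa> / 2) powr (\<nu> + 1)" by (subst powr_mult[symmetric]) simp
 ultimately show ?thesis unfolding kern_angle[OF nu] by (simp add: mult_ac)
qed

text \<open>A power of the angular average is at most the average of the power, and the power of an exponential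
is an exponential with a dilated argument.\<close>

lemma kern_powr:
 assumes nu: "\<nu> > - 1/2" and l: "\<kappa> > 0" and q: "q >= 1"
 shows "kern \<nu> \<kappa> x y powr q \<le>
  (2 / Gamma (\<nu> + 1) * \<kappa> powr (\<nu> + 1)) powr (q - 1) * q powr - (\<nu> + 1) * kern \<nu> (q * \<kappa>) x y"
proof -
 define c where "c = 2 / Gamma (\<nu> + 1) * \<kappa> powr (\<nu> + 1)"
 have c: "c > 0" using l Gamma_Suc_pos[OF nu] by (simp add: c_def)
 have "kern \<nu> \<kappa> x y powr q = c powr q * exp (- \<kappa> * (x\<^sup>2 + y\<^sup>2)) powr q * norm_bessel \<nu> ((\<kappa> * x * y)\<^sup>2) powr q"
  by (simp only: kern_def c_def powr_mult)
 also have "\<dots> <= c powr q * exp (- \<kappa> * (x\<^sup>2 + y\<^sup>2)) powr q * norm_bessel \<nu> ((q * (\<kappa> * x * y))\<^sup>2)"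
  by (intro mult_left_mono norm_bessel_powr_le[OF nu q]) auto
 also have "exp (- \<kappa> * (x\<^sup>2 + y\<^sup>2)) powr q = exp (- (q * \<kappa>) * (x\<^sup>2 + y\<^sup>2))" by (simp add: exp_powr_real mult_ac)
 also have "c powr q = c powr (q - 1) * (q powr - (\<nu> + 1) * (2 / Gamma (\<nu> + 1) * (q * \<kappa>) powr (\<nu> + 1)))"
 proof -
  have *: "c powr q = c powr (q - 1) * c" using c by (simp add: powr_diff)

  have "q powr - (\<nu> + 1) * (q * \<kappa>) powr (\<nu> + 1) = (q powr - (\<nu> + 1) * q powr (\<nu> + 1)) * \<kappa> powr (\<nu> + 1)"
   by (simp add: powr_mult)
  also have "q powr - (\<nu> + 1) * q powr (\<nu> + 1) = 1" using q by (simp add: powr_add[symmetric])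
  finally have "c = q powr - (\<nu> + 1) * (2 / Gamma (\<nu> + 1) * (q * \<kappa>) powr (\<nu> + 1))" by (simp add: c_def)
  with * show ?thesis by simp
 qed
 finally show ?thesis unfolding c_def[symmetric] by (simp add: kern_def mult_ac)
qed

section \<open>Bessel heat integrals\<close>

text \<open>The condition under which the flow is defined and smooth for all positive times; every
Lebesgue space with an exponent at least 1 consists of such functions.\<close>

definition gauss_integrable :: "real => (real => complex) => bool" where
 "gauss_integrable \<nu> F \<longleftrightarrow> F \<in> borel_measurable (bmeas \<nu>) \<and>
  (\<forall>c>0. integrable (bmeas \<nu>) (%y. exp (- c * y\<^sup>2) * cmod (F y)))"

definition heat_integral :: "real => (real => complex) => nat => nat => real => real => complex" where
 "heat_integral \<nu> F j k \<kappa> x = (LINT y|bmeas \<nu>. of_real (y ^ (2 * k) * kern (\<nu> + real j) \<kappa> x y) * F y)"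

abbreviation flow :: "real => (real => complex) => real => real => complex" where
 "flow \<nu> F \<equiv> heat_integral \<nu> F 0 0"

lemma gauss_integrable_measurable: "gauss_integrable \<nu> F ==> F \<in> borel_measurable (bmeas \<nu>)"
 by (simp add: gauss_integrable_def)

lemma kernel_bessel_measurable [measurable]:
 "\<nu> > - 1/2 ==> (%y. kern \<nu> \<kappa> x y) \<in> borel_measurable (bmeas \<mu>)"
 by (rule borel_imp_bessel_measurable) measurable

lemma kernel_integrand_dominated:
 assumes nu: "\<nu> > - 1/2" and F: "gauss_integrable \<nu> F" and l: "l > 0"
 shows "\<exists>w. integrable (bmeas \<nu>) w & (\<forall>\<kappa>\<in>{l..L}. \<forall>x. \<bar>x\<bar> <= X \<longrightarrow>
     (\<forall>y. cmod (of_real (y ^ (2 * k) * kern (\<nu> + real j) \<kappa> x y) * F y) <= w y))"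
proof -
 have nuj: "\<nu> + real j > - 1/2" using nu by simp
 obtain C where C: "C >= 0" "!!\<kappa> x y. \<kappa> \<in> {l..L} ==> \<bar>x\<bar> <= X ==> y ^ (2 * k) * kern (\<nu> + real j) \<kappa> x y <= C * exp (- (l / 4) * y\<^sup>2)"
  using kern_dominated[OF nuj l, of L X k] by blast
 let ?w = "%y. C * (exp (- (l / 4) * y\<^sup>2) * cmod (F y))"
 have "integrable (bmeas \<nu>) ?w"
  by (intro integrable_mult_right F[unfolded gauss_integrable_def, THEN conjunct2, rule_format]) (use l in simp)
 moreover have "cmod (of_real (y ^ (2 * k) * kern (\<nu> + real j) \<kappa> x y) * F y) <= ?w y" if "\<kappa> \<in> {l..L}" "\<bar>x\<bar> <= X" for \<kappa> x y
 proof -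
  have n: "0 <= y ^ (2 * k) * kern (\<nu> + real j) \<kappa> x y"
   using kern_nonneg[OF nuj] by (intro mult_nonneg_nonneg) auto
  have "cmod (of_real (y ^ (2 * k) * kern (\<nu> + real j) \<kappa> x y) * F y) = y ^ (2 * k) * kern (\<nu> + real j) \<kappa> x y * cmod (F y)"
   using n by (simp only: norm_mult norm_of_real abs_of_nonneg)
  also have "\<dots> <= C * exp (- (l / 4) * y\<^sup>2) * cmod (F y)"
   by (intro mult_right_mono C that) simp
  finally show ?thesis by (simp add: mult.assoc)
 qed
 ultimately show ?thesis by blast
qed

lemma kernel_integrand_measurable:
 assumes nu: "\<nu> > - 1/2" and F: "gauss_integrable \<nu> F"
 shows "(%y. of_real (y ^ (2 * k) * kern (\<nu> + real j) \<kappa> x y) * F y :: complex) \<in> borel_measurable (bmeas \<nu>)"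
proof -
 have nuj: "\<nu> + real j > - 1/2" using nu by simp
 note [measurable] = gauss_integrable_measurable[OF F] kernel_bessel_measurable[OF nuj]
 show ?thesis by measurable
qed

lemma kernel_integrand_integrable:
 assumes nu: "\<nu> > - 1/2" and F: "gauss_integrable \<nu> F" and k: "\<kappa> > 0"
 shows "integrable (bmeas \<nu>) (%y. of_real (y ^ (2 * k) * kern (\<nu> + real j) \<kappa> x y) * F y :: complex)"
proof -
 obtain w where w: "integrable (bmeas \<nu>) w"
  "!!y. cmod (of_real (y ^ (2 * k) * kern (\<nu> + real j) \<kappa> x y) * F y) <= w y"
  using kernel_integrand_dominated[OF nu F k, of \<kappa> "\<bar>x\<bar>" k j] by auto
 show ?thesis
 proof (rule Bochner_Integration.integrable_bound[OF w(1) kernel_integrand_measurable[OF nu F]], rule AE_I2)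
  fix y show "norm (of_real (y ^ (2 * k) * kern (\<nu> + real j) \<kappa> x y) * F y) <= norm (w y)"
   using w(2)[of y] unfolding real_norm_def by linarith
 qed
qed

lemma integral_lin_comb3:
 fixes f1 f2 f3 :: "'a => complex"
 assumes "integrable M f1" "integrable M f2" "integrable M f3"
 shows "(LINT y|M. A * f1 y + B * f2 y + C * f3 y) = A * (LINT y|M. f1 y) + B * (LINT y|M. f2 y) + C * (LINT y|M. f3 y)"
 using assms by simp

lemma heat_integral_combination:
 assumes nu: "\<nu> > - 1/2" and F: "gauss_integrable \<nu> F" and k: "\<kappa> > 0"
 shows "(LINT y|bmeas \<nu>. of_real (A * (y ^ (2 * k1) * kern (\<nu> + real j1) \<kappa> x y) + B * (y ^ (2 * k2) * kern (\<nu> + real j2) \<kappa> x y)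
     + C * (y ^ (2 * k3) * kern (\<nu> + real j3) \<kappa> x y)) * F y :: complex) =
  of_real A * heat_integral \<nu> F j1 k1 \<kappa> x + of_real B * heat_integral \<nu> F j2 k2 \<kappa> x + of_real C * heat_integral \<nu> F j3 k3 \<kappa> x"
proof -
 note i = kernel_integrand_integrable[OF nu F k]
 let ?f = "%j k y. of_real (y ^ (2 * k) * kern (\<nu> + real j) \<kappa> x y) * F y :: complex"
 have "(LINT y|bmeas \<nu>. of_real A * ?f j1 k1 y + of_real B * ?f j2 k2 y + of_real C * ?f j3 k3 y) =
  of_real A * heat_integral \<nu> F j1 k1 \<kappa> x + of_real B * heat_integral \<nu> F j2 k2 \<kappa> x + of_real C * heat_integral \<nu> F j3 k3 \<kappa> x"
  unfolding heat_integral_def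
  by (rule integral_lin_comb3) (rule i)+
 moreover have "of_real (A * (y ^ (2 * k1) * kern (\<nu> + real j1) \<kappa> x y) + B * (y ^ (2 * k2) * kern (\<nu> + real j2) \<kappa> x y)
     + C * (y ^ (2 * k3) * kern (\<nu> + real j3) \<kappa> x y)) * F y = of_real A * ?f j1 k1 y + of_real B * ?f j2 k2 y + of_real C * ?f j3 k3 y" for y
  by (simp only: of_real_add of_real_mult distrib_right mult.assoc)
 ultimately show ?thesis by simp
qed

lemma has_vector_derivative_of_real_mult:
 fixes F :: complex
 assumes "(f has_real_derivative f') (at x)"
 shows "((%x. of_real (f x) * F) has_vector_derivative of_real f' * F) (at x)"
 using has_vector_derivative_mult_left[OF has_vector_derivative_of_real[OF assms], of F] .

lemma heat_integral_deriv_x: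
 assumes nu: "\<nu> > - 1/2" and F: "gauss_integrable \<nu> F" and k: "\<kappa> > 0"
 shows "(heat_integral \<nu> F j k \<kappa> has_vector_derivative
     of_real (2 * \<kappa> * x) * (heat_integral \<nu> F (Suc j) (Suc k) \<kappa> x - heat_integral \<nu> F j k \<kappa> x)) (at x)"
proof -
 have nuj: "\<nu> + real j > - 1/2" using nu by simp
 let ?K = "%j k x y. y ^ (2 * k) * kern (\<nu> + real j) \<kappa> x y"
 let ?g' = "%x y. of_real (2 * \<kappa> * x * (?K (Suc j) (Suc k) x y) + - (2 * \<kappa> * x) * (?K j k x y) + 0 * (?K j k x y)) * F y :: complex"
 have g'_eq: "?g' x y = of_real (2 * \<kappa> * x) * (of_real (?K (Suc j) (Suc k) x y) * F y - of_real (?K j k x y) * F y)" for x y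
  by (simp add: algebra_simps)
 let ?X = "\<bar>x\<bar> + 1"
 obtain w1 where w1: "integrable (bmeas \<nu>) w1" "!!z y. \<bar>z\<bar> <= ?X ==> cmod (of_real (?K (Suc j) (Suc k) z y) * F y) <= w1 y"
  using kernel_integrand_dominated[OF nu F k, of \<kappa> ?X "Suc k" "Suc j"] by auto
 obtain w2 where w2: "integrable (bmeas \<nu>) w2" "!!z y. \<bar>z\<bar> <= ?X ==> cmod (of_real (?K j k z y) * F y) <= w2 y"
  using kernel_integrand_dominated[OF nu F k, of \<kappa> ?X k j] by auto
 have "((%x. LINT y|bmeas \<nu>. of_real (?K j k x y) * F y) has_vector_derivative (LINT y|bmeas \<nu>. ?g' x y)) (at x)"
 proof (rule has_vector_derivative_LINT[where l = "x - 1" and r = "x + 1" and w = "%y. 2 * \<kappa> * ?X * (w1 y + w2 y)"])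
  fix z assume z: "z \<in> {x - 1<..<x + 1}"
  show "integrable (bmeas \<nu>) (%y. of_real (?K j k z y) * F y :: complex)" by (rule kernel_integrand_integrable[OF nu F k])
  fix y
  have "((%x. ?K j k x y) has_real_derivative y ^ (2 * k) * (2 * \<kappa> * z * (y\<^sup>2 * kern (\<nu> + real j + 1) \<kappa> z y - kern (\<nu> + real j) \<kappa> z y))) (at z)"
   by (rule DERIV_cmult[OF kern_deriv_x[OF nuj k]])
  also have "y ^ (2 * k) * (2 * \<kappa> * z * (y\<^sup>2 * kern (\<nu> + real j + 1) \<kappa> z y - kern (\<nu> + real j) \<kappa> z y))
   = 2 * \<kappa> * z * (?K (Suc j) (Suc k) z y) + - (2 * \<kappa> * z) * (?K j k z y) + 0 * (?K j k z y)"
   by (simp add: algebra_simps power2_eq_square)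
  finally show "((%x. of_real (?K j k x y) * F y) has_vector_derivative ?g' z y) (at z)"
   by (rule has_vector_derivative_of_real_mult)
  have zX: "\<bar>z\<bar> <= ?X" using z by auto
  have "cmod (?g' z y) <= (2 * \<kappa> * \<bar>z\<bar>) * (cmod (of_real (?K (Suc j) (Suc k) z y) * F y) + cmod (of_real (?K j k z y) * F y))"
   unfolding g'_eq norm_mult[of "of_real (2 * \<kappa> * z)"] using k
   by (intro mult_mono norm_triangle_ineq4) (auto simp: norm_mult)
  also have "\<dots> <= 2 * \<kappa> * ?X * (w1 y + w2 y)"
   using zX k by (intro mult_mono add_mono w1 w2) (auto intro!: add_nonneg_nonneg)
  finally show "cmod (?g' z y) <= 2 * \<kappa> * ?X * (w1 y + w2 y)" .
 next
  show "?g' x \<in> borel_measurable (bmeas \<nu>)"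
   unfolding g'_eq by (rule borel_measurable_times[OF borel_measurable_const borel_measurable_diff]; rule kernel_integrand_measurable[OF nu F])
  show "integrable (bmeas \<nu>) (%y. 2 * \<kappa> * ?X * (w1 y + w2 y))"
   by (intro integrable_mult_right Bochner_Integration.integrable_add w1 w2)
 qed auto
 then show ?thesis
  unfolding heat_integral_combination[OF nu F k] by (simp add: heat_integral_def[abs_def] algebra_simps)
qed

lemma heat_integral_deriv_lambda:
 assumes nu: "\<nu> > - 1/2" and F: "gauss_integrable \<nu> F" and k: "\<kappa> > 0"
 shows "((%\<kappa>. heat_integral \<nu> F j k \<kappa> x) has_vector_derivative
     of_real ((\<nu> + real j + 1) / \<kappa> - x\<^sup>2) * heat_integral \<nu> F j k \<kappa> x - heat_integral \<nu> F j (Suc k) \<kappa> x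
     + of_real (2 * x\<^sup>2) * heat_integral \<nu> F (Suc j) (Suc k) \<kappa> x) (at \<kappa>)"
proof -
 have nuj: "\<nu> + real j > - 1/2" using nu by simp
 let ?K = "%j k l y. y ^ (2 * k) * kern (\<nu> + real j) l x y"
 let ?g' = "%l y. of_real (((\<nu> + real j + 1) / l - x\<^sup>2) * (?K j k l y) + - 1 * (?K j (Suc k) l y) + 2 * x\<^sup>2 * (?K (Suc j) (Suc k) l y)) * F y :: complex"
 have g'_eq: "?g' l y = of_real ((\<nu> + real j + 1) / l - x\<^sup>2) * (of_real (?K j k l y) * F y) - of_real (?K j (Suc k) l y) * F y
   + of_real (2 * x\<^sup>2) * (of_real (?K (Suc j) (Suc k) l y) * F y)" for l y
  by (simp add: algebra_simps)
 have k2: "\<kappa> / 2 > 0" using k by simp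
 obtain w1 where w1: "integrable (bmeas \<nu>) w1" "!!l y. l \<in> {\<kappa>/2..2*\<kappa>} ==> cmod (of_real (?K j k l y) * F y) <= w1 y"
  using kernel_integrand_dominated[OF nu F k2, of "2 * \<kappa>" "\<bar>x\<bar>" k j] by (metis order_refl)
 obtain w2 where w2: "integrable (bmeas \<nu>) w2" "!!l y. l \<in> {\<kappa>/2..2*\<kappa>} ==> cmod (of_real (?K j (Suc k) l y) * F y) <= w2 y"
  using kernel_integrand_dominated[OF nu F k2, of "2 * \<kappa>" "\<bar>x\<bar>" "Suc k" j] by (metis order_refl)
 obtain w3 where w3: "integrable (bmeas \<nu>) w3" "!!l y. l \<in> {\<kappa>/2..2*\<kappa>} ==> cmod (of_real (?K (Suc j) (Suc k) l y) * F y) <= w3 y"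
  using kernel_integrand_dominated[OF nu F k2, of "2 * \<kappa>" "\<bar>x\<bar>" "Suc k" "Suc j"] by (metis order_refl)
 define a where "a = (\<nu> + real j + 1) / (\<kappa> / 2) + x\<^sup>2"
 have "((%l. LINT y|bmeas \<nu>. of_real (?K j k l y) * F y) has_vector_derivative (LINT y|bmeas \<nu>. ?g' \<kappa> y)) (at \<kappa>)"
 proof (rule has_vector_derivative_LINT[where l = "\<kappa> / 2" and r = "2 * \<kappa>" and w = "%y. a * w1 y + w2 y + 2 * x\<^sup>2 * w3 y"])
  show "\<kappa> \<in> {\<kappa> / 2<..<2 * \<kappa>}" using k by auto
  fix z assume z: "z \<in> {\<kappa> / 2<..<2 * \<kappa>}"
  then have z0: "z > 0" "z \<in> {\<kappa> / 2..2 * \<kappa>}" using k by auto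
  show "integrable (bmeas \<nu>) (%y. of_real (?K j k z y) * F y :: complex)" by (rule kernel_integrand_integrable[OF nu F z0(1)])
  fix y
  have "((%l. ?K j k l y) has_real_derivative y ^ (2 * k) * (((\<nu> + real j + 1) / z - x\<^sup>2 - y\<^sup>2) * kern (\<nu> + real j) z x y + 2 * x\<^sup>2 * y\<^sup>2 * kern (\<nu> + real j + 1) z x y)) (at z)"
   by (rule DERIV_cmult[OF kern_deriv_lambda[OF nuj z0(1)]])
  also have "y ^ (2 * k) * (((\<nu> + real j + 1) / z - x\<^sup>2 - y\<^sup>2) * kern (\<nu> + real j) z x y + 2 * x\<^sup>2 * y\<^sup>2 * kern (\<nu> + real j + 1) z x y)
   = ((\<nu> + real j + 1) / z - x\<^sup>2) * (?K j k z y) + - 1 * (?K j (Suc k) z y) + 2 * x\<^sup>2 * (?K (Suc j) (Suc k) z y)"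
  proof -
   have "y ^ (2 * Suc k) = y ^ (2 * k) * y\<^sup>2" "\<nu> + real (Suc j) = \<nu> + real j + 1" by (auto simp: power2_eq_square)
   then show ?thesis by (simp add: algebra_simps power2_eq_square)
  qed
  finally show "((%l. of_real (?K j k l y) * F y) has_vector_derivative ?g' z y) (at z)"
   by (rule has_vector_derivative_of_real_mult)
  have "\<bar>(\<nu> + real j + 1) / z - x\<^sup>2\<bar> <= \<bar>(\<nu> + real j + 1) / z\<bar> + x\<^sup>2" by (simp add: order_trans[OF abs_triangle_ineq4])
  also have "\<bar>(\<nu> + real j + 1) / z\<bar> <= (\<nu> + real j + 1) / (\<kappa> / 2)"
  proof -
   have "(\<nu> + real j + 1) / z <= (\<nu> + real j + 1) / (\<kappa> / 2)"
    by (rule divide_left_mono) (use z0 nuj k in auto)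
   moreover have "(\<nu> + real j + 1) / z >= 0" using z0 nuj by (intro divide_nonneg_pos) auto
   ultimately show ?thesis by linarith
  qed
  finally have a: "cmod (of_real ((\<nu> + real j + 1) / z - x\<^sup>2)) <= a" unfolding norm_of_real by (simp add: a_def)
  have "cmod (?g' z y) <= cmod (of_real ((\<nu> + real j + 1) / z - x\<^sup>2)) * cmod (of_real (?K j k z y) * F y) + cmod (of_real (?K j (Suc k) z y) * F y)
    + cmod (of_real (2 * x\<^sup>2)) * cmod (of_real (?K (Suc j) (Suc k) z y) * F y)"
   unfolding g'_eq norm_mult[of "of_real ((\<nu> + real j + 1) / z - x\<^sup>2)", symmetric] norm_mult[of "of_real (2 * x\<^sup>2)", symmetric]
   by (rule order_trans[OF norm_triangle_ineq add_right_mono[OF norm_triangle_ineq4]])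
  also have "\<dots> <= a * w1 y + w2 y + 2 * x\<^sup>2 * w3 y"
   by (intro add_mono mult_mono a w1(2) w2(2) w3(2) z0(2) order_trans[OF norm_ge_zero a]) (auto simp: norm_power)
  finally show "cmod (?g' z y) <= a * w1 y + w2 y + 2 * x\<^sup>2 * w3 y" .
 next
  show "?g' \<kappa> \<in> borel_measurable (bmeas \<nu>)"
   unfolding g'_eq
   by (rule borel_measurable_add borel_measurable_diff borel_measurable_times[OF borel_measurable_const] kernel_integrand_measurable[OF nu F])+
  show "integrable (bmeas \<nu>) (%y. a * w1 y + w2 y + 2 * x\<^sup>2 * w3 y)"
   by (intro integrable_mult_right Bochner_Integration.integrable_add w1 w2 w3)
 qed
 then show ?thesis
  unfolding heat_integral_combination[OF nu F k] by (simp add: heat_integral_def[abs_def] algebra_simps)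
qed

lemma continuous_on_heat_integral:
 assumes nu: "\<nu> > - 1/2" and F: "gauss_integrable \<nu> F"
 shows "continuous_on ({0<..} \<times> UNIV) (%(\<kappa>, x). heat_integral \<nu> F j k \<kappa> x)"
proof -
 have nuj: "\<nu> + real j > - 1/2" using nu by simp
 let ?g = "%z y. of_real (y ^ (2 * k) * kern (\<nu> + real j) (fst z) (snd z) y) * F y :: complex"
 have "continuous_on ({0<..} \<times> UNIV) (%z. LINT y|bmeas \<nu>. ?g z y)"
 proof (rule continuous_on_LINT)
  show "?g z \<in> borel_measurable (bmeas \<nu>)" for z by (rule kernel_integrand_measurable[OF nu F])
  show "continuous_on ({0<..} \<times> UNIV) (%z. ?g z y)" for y by (intro continuous_intros nuj) auto
  fix z0 :: "real \<times> real" assume z0: "z0 \<in> {0<..} \<times> UNIV"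
  define l where "l = fst z0 / 2"
  have l: "l > 0" "fst z0 \<in> {l<..<4*l}" using z0 by (auto simp: l_def)
  obtain w where w: "integrable (bmeas \<nu>) w" "!!\<kappa> x y. \<kappa> \<in> {l..4*l} ==> \<bar>x\<bar> <= \<bar>snd z0\<bar> + 1 ==>
    cmod (of_real (y ^ (2 * k) * kern (\<nu> + real j) \<kappa> x y) * F y) <= w y"
   using kernel_integrand_dominated[OF nu F l(1), of "4*l" "\<bar>snd z0\<bar> + 1" k j] by blast
  show "\<exists>U w. open U & z0 \<in> U & integrable (bmeas \<nu>) w & (\<forall>z\<in>{0<..} \<times> UNIV \<inter> U. \<forall>y\<in>space (bmeas \<nu>). cmod (?g z y) <= w y)"
   by (rule exI[of _ "{l<..<4*l} \<times> {snd z0 - 1<..<snd z0 + 1}"], rule exI[of _ w])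
    (use l w in \<open>auto intro!: open_Times w(2) simp: mem_Times_iff\<close>)
 qed
 then show ?thesis by (simp add: heat_integral_def case_prod_unfold)
qed

lemma continuous_on_heat_integral':
 assumes nu: "\<nu> > - 1/2" and F: "gauss_integrable \<nu> F"
  and "continuous_on S f" "continuous_on S g" "!!x. x \<in> S ==> f x > 0"
 shows "continuous_on S (%x. heat_integral \<nu> F j k (f x) (g x))"
proof -
 have "continuous_on S (%x. (case (f x, g x) of (\<kappa>, x) => heat_integral \<nu> F j k \<kappa> x))"
  by (rule continuous_on_compose2[OF continuous_on_heat_integral[OF nu F]]) (use assms in \<open>auto intro!: continuous_intros\<close>)
 then show ?thesis by simp
qed

lemma heat_integral_contiguous:
 assumes nu: "\<nu> > - 1/2" and F: "gauss_integrable \<nu> F" and k: "\<kappa> > 0"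
 shows "heat_integral \<nu> F j k \<kappa> x = of_real ((\<nu> + real j + 1) / \<kappa>) * heat_integral \<nu> F (Suc j) k \<kappa> x
     + of_real (x\<^sup>2) * heat_integral \<nu> F (Suc (Suc j)) (Suc k) \<kappa> x"
proof -
 have nuj: "\<nu> + real j > - 1/2" using nu by simp
 have "y ^ (2 * k) * kern (\<nu> + real j) \<kappa> x y =
  (\<nu> + real j + 1) / \<kappa> * (y ^ (2 * k) * kern (\<nu> + real (Suc j)) \<kappa> x y) +
  x\<^sup>2 * (y ^ (2 * Suc k) * kern (\<nu> + real (Suc (Suc j))) \<kappa> x y) + 0 * (y ^ (2 * k) * kern (\<nu> + real j) \<kappa> x y)" for y
 proof -
  have e: "y ^ (2 * Suc k) = y ^ (2 * k) * y\<^sup>2" "\<nu> + real (Suc j) = \<nu> + real j + 1" "\<nu> + real (Suc (Suc j)) = \<nu> + real j + 2" by (auto simp: power2_eq_square)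
  show ?thesis unfolding e kern_contiguous[OF nuj k] by (simp add: algebra_simps)
 qed
 then have "heat_integral \<nu> F j k \<kappa> x = (LINT y|bmeas \<nu>. of_real ((\<nu> + real j + 1) / \<kappa> * (y ^ (2 * k) * kern (\<nu> + real (Suc j)) \<kappa> x y) +
  x\<^sup>2 * (y ^ (2 * Suc k) * kern (\<nu> + real (Suc (Suc j))) \<kappa> x y) + 0 * (y ^ (2 * k) * kern (\<nu> + real j) \<kappa> x y)) * F y)"
  unfolding heat_integral_def by (intro Bochner_Integration.integral_cong refl arg_cong2[where f = "(*)"] arg_cong[where f = of_real])
 then show ?thesis by (simp only: heat_integral_combination[OF nu F k]) simp
qed

lemma heat_integral_dx2:
 assumes nu: "\<nu> > - 1/2" and F: "gauss_integrable \<nu> F" and k: "\<kappa> > 0"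
 shows "((%x. of_real (2 * \<kappa> * x) * (heat_integral \<nu> F 1 1 \<kappa> x - heat_integral \<nu> F 0 0 \<kappa> x)) has_vector_derivative
  of_real (2 * \<kappa>) * (heat_integral \<nu> F 1 1 \<kappa> x - heat_integral \<nu> F 0 0 \<kappa> x) +
  of_real (4 * \<kappa>\<^sup>2 * x\<^sup>2) * (heat_integral \<nu> F 2 2 \<kappa> x - 2 * heat_integral \<nu> F 1 1 \<kappa> x + heat_integral \<nu> F 0 0 \<kappa> x)) (at x)"
proof -
 note d = heat_integral_deriv_x[OF nu F k]
 have "((%x. complex_of_real (2 * \<kappa> * x)) has_vector_derivative of_real (2 * \<kappa>)) (at x)"
  by (rule has_vector_derivative_of_real) (auto intro!: derivative_eq_intros)
 from has_vector_derivative_mult[OF this has_vector_derivative_diff[OF d[of 1 1 x] d[of 0 0 x]]]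
 show ?thesis
  by (rule has_vector_derivative_eq_rhs) (simp add: algebra_simps power2_eq_square numeral_2_eq_2)
qed

text \<open>In the variables \<open>\<kappa> = 1 / (4 \<sigma> t)\<close> and \<open>x\<close> the heat equation for the
 kernel is the contiguity relation of the normalised Bessel functions.\<close>

lemma heat_integral_pde:
 assumes nu: "\<nu> > - 1/2" and F: "gauss_integrable \<nu> F" and k: "\<kappa> > 0"
 shows "- of_real (4 * \<kappa>\<^sup>2) * (of_real ((\<nu> + 1) / \<kappa> - x\<^sup>2) * heat_integral \<nu> F 0 0 \<kappa> x - heat_integral \<nu> F 0 1 \<kappa> x
     + of_real (2 * x\<^sup>2) * heat_integral \<nu> F 1 1 \<kappa> x) =
  of_real (2 * \<kappa>) * (heat_integral \<nu> F 1 1 \<kappa> x - heat_integral \<nu> F 0 0 \<kappa> x) +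
  of_real (4 * \<kappa>\<^sup>2 * x\<^sup>2) * (heat_integral \<nu> F 2 2 \<kappa> x - 2 * heat_integral \<nu> F 1 1 \<kappa> x + heat_integral \<nu> F 0 0 \<kappa> x)
  + of_real ((2 * \<nu> + 1) * (2 * \<kappa>)) * (heat_integral \<nu> F 1 1 \<kappa> x - heat_integral \<nu> F 0 0 \<kappa> x)"
proof -
 have c: "heat_integral \<nu> F 0 1 \<kappa> x = of_real ((\<nu> + 1) / \<kappa>) * heat_integral \<nu> F 1 1 \<kappa> x + of_real (x\<^sup>2) * heat_integral \<nu> F 2 2 \<kappa> x"
  using heat_integral_contiguous[OF nu F k, of 0 1 x] by (simp add: numeral_2_eq_2)
 have "complex_of_real \<kappa> ~= 0" using k by simp
 then show ?thesis unfolding c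
  by (simp add: field_simps power2_eq_square)
qed

section \<open>Chirps\<close>

definition chirp :: "real => real => complex" where
 "chirp \<alpha> x = exp (\<i> / 2 * of_real (\<alpha> * x\<^sup>2))"

lemma norm_chirp [simp]: "cmod (chirp \<alpha> x) = 1"
 by (simp add: chirp_def norm_exp_eq_Re)

lemma chirp_inverse [simp]: "chirp (- \<alpha>) x * (chirp \<alpha> x * z) = z" "chirp \<alpha> x * (chirp (- \<alpha>) x * z) = z"
 by (simp_all add: chirp_def mult.assoc[symmetric] exp_add[symmetric])

lemma chirp_nonzero [simp]: "chirp \<alpha> x ~= 0"
 by (simp add: chirp_def)

lemma chirp_even [simp]: "chirp \<alpha> (- x) = chirp \<alpha> x"
 by (simp add: chirp_def)

lemma continuous_on_chirp [continuous_intros]: "continuous_on S f ==> continuous_on S (%x. chirp \<alpha> (f x))"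
 unfolding chirp_def by (intro continuous_intros)

lemma chirp_measurable [measurable]: "chirp \<alpha> \<in> borel_measurable (bmeas \<nu>)"
 by (intro continuous_imp_bessel_measurable continuous_intros)

lemma chirp_deriv: "(chirp \<alpha> has_vector_derivative \<i> * of_real (\<alpha> * x) * chirp \<alpha> x) (at x)"
proof -
 have "((%z. exp (\<i> / 2 * (of_real \<alpha> * z\<^sup>2))) has_field_derivative \<i> * of_real (\<alpha> * x) * exp (\<i> / 2 * (of_real \<alpha> * (of_real x)\<^sup>2))) (at (of_real x))"
  by (auto intro!: derivative_eq_intros)
 from has_vector_derivative_real_field[OF this] show ?thesis by (simp add: chirp_def[abs_def])
qed

lemma chirp_mult_deriv:
 assumes "(G has_vector_derivative G') (at x)"
 shows "((%x. chirp \<alpha> x * G x) has_vector_derivative chirp \<alpha> x * (G' + \<i> * of_real (\<alpha> * x) * G x)) (at x)"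
 using has_vector_derivative_mult[OF chirp_deriv assms, of \<alpha>]
 by (rule has_vector_derivative_eq_rhs) (simp add: algebra_simps)

lemma chirp_mult_deriv2:
 assumes "!!x. (G has_vector_derivative G1 x) (at x)" "(G1 has_vector_derivative G2) (at x)"
 shows "((%x. chirp \<alpha> x * (G1 x + \<i> * of_real (\<alpha> * x) * G x)) has_vector_derivative
  chirp \<alpha> x * (G2 + 2 * \<i> * of_real (\<alpha> * x) * G1 x + (\<i> * of_real \<alpha> - of_real (\<alpha>\<^sup>2 * x\<^sup>2)) * G x)) (at x)"
proof -
 have "((%x. complex_of_real (\<alpha> * x)) has_vector_derivative of_real \<alpha>) (at x)"
  by (rule has_vector_derivative_of_real) (auto intro!: derivative_eq_intros)
 from has_vector_derivative_mult[OF has_vector_derivative_mult_right[OF this, of \<i>] assms(1)[of x]]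
 have "((%x. G1 x + \<i> * of_real (\<alpha> * x) * G x) has_vector_derivative G2 + (\<i> * of_real (\<alpha> * x) * G1 x + \<i> * of_real \<alpha> * G x)) (at x)"
  by (rule has_vector_derivative_add[OF assms(2)])
 from chirp_mult_deriv[OF this, of \<alpha>] show ?thesis
  by (rule has_vector_derivative_eq_rhs) (simp add: algebra_simps power2_eq_square)
qed

lemma in_L_chirp [simp]: "in_L \<nu> p (%y. chirp \<alpha> y * F y) \<longleftrightarrow> in_L \<nu> p F"
proof -
 have "F \<in> borel_measurable (bmeas \<nu>)" if m: "(%y. chirp \<alpha> y * F y) \<in> borel_measurable (bmeas \<nu>)"
  using borel_measurable_times[OF chirp_measurable[of "- \<alpha>"] m] by simp
 then have "(%y. chirp \<alpha> y * F y) \<in> borel_measurable (bmeas \<nu>) \<longleftrightarrow> F \<in> borel_measurable (bmeas \<nu>)"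
  using borel_measurable_times[OF chirp_measurable[of \<alpha>], of F] by blast
 then show ?thesis by (simp add: in_L_def norm_mult)
qed

lemma Lnorm_cong_norm: "(!!y. cmod (F y) = cmod (G y)) ==> Lnorm \<nu> p F = Lnorm \<nu> p G"
 by (simp add: Lnorm_def)

lemma Lnorm_chirp [simp]: "Lnorm \<nu> p (%y. chirp \<alpha> y * F y) = Lnorm \<nu> p F"
 by (rule Lnorm_cong_norm) (simp add: norm_mult)

lemma enn2real_ge_1: "1 <= p ==> p ~= top ==> 1 <= enn2real p"
 using enn2real_mono[of 1 p] by (simp add: less_top)

lemma le_one_plus_powr:
 assumes "x >= 0" "q >= (1::real)"
 shows "x <= 1 + x powr q"
proof (cases "x <= 1")
 case False
 then have "x powr 1 <= x powr q" using assms by (intro powr_mono) auto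
 then show ?thesis using False by simp
qed (simp add: add_increasing2)

lemma in_L_imp_gauss_integrable:
 assumes nu: "\<nu> > - 1/2" and p: "1 <= p" and F: "in_L \<nu> p F"
 shows "gauss_integrable \<nu> F"
 unfolding gauss_integrable_def
proof (intro conjI allI impI)
 show m: "F \<in> borel_measurable (bmeas \<nu>)" using F by (simp add: in_L_def)
 fix c :: real assume c: "c > 0"
 note g = Gaussian_bessel_integral(1)[OF nu c]
 have em: "(%y. exp (- c * y\<^sup>2) * cmod (F y)) \<in> borel_measurable (bmeas \<nu>)"
  by (intro borel_measurable_times borel_measurable_integrable[OF g] measurable_compose[OF m borel_measurable_norm])
 show "integrable (bmeas \<nu>) (%y. exp (- c * y\<^sup>2) * cmod (F y))"
 proof (cases "p = top")
  case True
  then obtain C where C: "AE y in bmeas \<nu>. cmod (F y) <= C" using F by (auto simp: in_L_def)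
  show ?thesis
  proof (rule Bochner_Integration.integrable_bound[of _ "%y. C * exp (- c * y\<^sup>2)"])
   show "AE y in bmeas \<nu>. norm (exp (- c * y\<^sup>2) * cmod (F y)) <= norm (C * exp (- c * y\<^sup>2))"
    using C by eventually_elim (simp add: mult.commute abs_mult mult_left_mono)
  qed (rule em integrable_mult_right[OF g])+
 next
  case False
  have i: "integrable (bmeas \<nu>) (%y. cmod (F y) powr enn2real p)" using F False by (simp add: in_L_def)
  show ?thesis
  proof (rule Bochner_Integration.integrable_bound[OF Bochner_Integration.integrable_add[OF g i] em], rule AE_I2)
   fix y
   have e: "exp (- c * y\<^sup>2) <= 1" using c by simp
   have "exp (- c * y\<^sup>2) * cmod (F y) <= exp (- c * y\<^sup>2) * (1 + cmod (F y) powr enn2real p)"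
    using p False by (intro mult_left_mono le_one_plus_powr enn2real_ge_1) auto
   also have "\<dots> <= exp (- c * y\<^sup>2) + cmod (F y) powr enn2real p"
    using mult_right_mono[OF e, of "cmod (F y) powr enn2real p"] by (simp add: distrib_left)
   finally show "norm (exp (- c * y\<^sup>2) * cmod (F y)) <= norm (exp (- c * y\<^sup>2) + cmod (F y) powr enn2real p)"
    by simp
  qed
 qed
qed

section \<open>The semigroup as a chirped Bessel heat integral\<close>

lemma canonical_translation_heat_kernel:
 assumes nu: "\<nu> > - 1/2" and sigma: "\<sigma> > 0" and t: "t > 0"
 shows "canonical_translation \<nu> a b x (heat_kernel \<nu> \<sigma> a b t) y =
  chirp (- (a / b)) x * chirp (- (a / b)) y * of_real (kern \<nu> (1 / (4 * \<sigma> * t)) x y)"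
proof -
 let ?q = "%\<theta>. x\<^sup>2 + y\<^sup>2 - 2 * x * y * cos \<theta>" and ?k = "1 / (4 * \<sigma> * t)"
 let ?C = "2 / Gamma (\<nu> + 1) * ?k powr (\<nu> + 1)"
 let ?A = "Gamma (\<nu> + 1) / (sqrt pi * Gamma (\<nu> + 1/2))"
 have q: "?q \<theta> >= 0" for \<theta>
 proof -
  have "x\<^sup>2 + y\<^sup>2 - 2 * x * y * cos \<theta> = (x - y * cos \<theta>)\<^sup>2 + y\<^sup>2 * (sin \<theta>)\<^sup>2"
   by (simp add: sin_squared_eq power2_diff power_mult_distrib algebra_simps)
  then show ?thesis by simp
 qed
 have k: "(4 * \<sigma> * t) powr - (\<nu> + 1) = ?k powr (\<nu> + 1)"
  using sigma t by (simp only: powr_minus_divide powr_divide powr_one_eq_one)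
 have "exp (\<i> / 2 * of_real (a / b * s\<^sup>2)) * heat_kernel \<nu> \<sigma> a b t s = of_real (?C * exp (- ?k * s\<^sup>2))" for s
 proof -
  have "exp (\<i> / 2 * z) * (c * exp (- (\<i> / 2) * z - w)) = c * exp (- w)" for z w c :: complex
   by (simp add: mult.left_commute mult_exp_exp)
  moreover have "exp (- complex_of_real (s\<^sup>2 / (4 * \<sigma> * t))) = of_real (exp (- ?k * s\<^sup>2))"
   unfolding of_real_minus[symmetric] exp_of_real by simp
  ultimately show ?thesis unfolding heat_kernel_def k by (simp only: of_real_mult)
 qed
 note this[of "sqrt (?q \<theta>)" for \<theta>]
 then have "bessel_translation \<nu> x (%s. exp (\<i> / 2 * of_real (a / b * s\<^sup>2)) * heat_kernel \<nu> \<sigma> a b t s) y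
  = of_real ?A * (LINT \<theta>:{0..pi}|lborel. of_real (?C * exp (- ?k * ?q \<theta>)) * of_real (sin \<theta> powr (2 * \<nu>)))"
  unfolding bessel_translation_def real_sqrt_pow2[OF q] by (simp only:)
 also have "\<dots> = of_real (?C * (LINT \<theta>|lborel. angle_density \<nu> \<theta> * exp (- ?k * ?q \<theta>)))"
 proof -
  have "(LINT \<theta>:{0..pi}|lborel. of_real (?C * exp (- ?k * ?q \<theta>)) * of_real (sin \<theta> powr (2 * \<nu>)))
   = complex_of_real (LINT \<theta>:{0..pi}|lborel. (?C * exp (- ?k * ?q \<theta>)) * sin \<theta> powr (2 * \<nu>))"
   unfolding set_lebesgue_integral_def integral_complex_of_real[symmetric]
   by (intro Bochner_Integration.integral_cong refl) (simp add: indicator_def)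
  moreover have "?A * (LINT \<theta>:{0..pi}|lborel. (?C * exp (- ?k * ?q \<theta>)) * sin \<theta> powr (2 * \<nu>))
   = ?C * (LINT \<theta>|lborel. angle_density \<nu> \<theta> * exp (- ?k * ?q \<theta>))"
   unfolding set_lebesgue_integral_def angle_density_def
   unfolding integral_mult_right_zero[symmetric]
   by (intro Bochner_Integration.integral_cong refl) (simp add: indicator_def)
  ultimately show ?thesis by (simp only: of_real_mult[symmetric])
 qed
 also have "?C * (LINT \<theta>|lborel. angle_density \<nu> \<theta> * exp (- ?k * ?q \<theta>)) = kern \<nu> ?k x y"
  unfolding kern_angle[OF nu] by (subst integral_angle_measure[OF nu]) auto
 finally have B: "bessel_translation \<nu> x (%s. exp (\<i> / 2 * of_real (a / b * s\<^sup>2)) * heat_kernel \<nu> \<sigma> a b t s) y = of_real (kern \<nu> ?k x y)" .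
 have "exp (- (\<i> / 2) * of_real (a / b * (x\<^sup>2 + y\<^sup>2))) = chirp (- (a / b)) x * chirp (- (a / b)) y"
  by (simp add: chirp_def exp_add[symmetric] algebra_simps add_divide_distrib)
 then show ?thesis unfolding canonical_translation_def B by simp
qed

lemma heat_semigroup_eq:
 assumes nu: "\<nu> > - 1/2" and sigma: "\<sigma> > 0" and t: "t > 0"
 shows "heat_semigroup \<nu> \<sigma> a b t f x =
  chirp (- (a / b)) x * flow \<nu> (%y. chirp (a / b) y * f y) (1 / (4 * \<sigma> * t)) x"
proof -
 have e: "exp (\<i> * of_real (a / b * y\<^sup>2)) = chirp (a / b) y * chirp (a / b) y" for y
  by (simp add: chirp_def exp_add[symmetric] mult.assoc[symmetric])
 have "canonical_translation \<nu> a b x (heat_kernel \<nu> \<sigma> a b t) y * exp (\<i> * of_real (a / b * y\<^sup>2)) * f y =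
  chirp (- (a / b)) x * (of_real (kern \<nu> (1 / (4 * \<sigma> * t)) x y) * (chirp (a / b) y * f y))" for y
  unfolding canonical_translation_heat_kernel[OF assms] e
  using chirp_inverse(1)[of "a / b" y "chirp (a / b) y * f y"] by (simp add: mult_ac)
 then have "heat_semigroup \<nu> \<sigma> a b t f x = (LINT y|bmeas \<nu>.
  chirp (- (a / b)) x * (of_real (kern \<nu> (1 / (4 * \<sigma> * t)) x y) * (chirp (a / b) y * f y)))"
  using t unfolding heat_semigroup_def by (simp only: if_not_P less_imp_neq[symmetric] not_False_eq_True)
 then show ?thesis by (simp only: heat_integral_def integral_mult_right_zero) simp
qed

section \<open>The semigroup solves the heat equation\<close>

lemma heat_solutionI:
 assumes sigma: "\<sigma> ~= 0"
  and dx: "!!t x. t > 0 ==> (v t has_vector_derivative vx t x) (at x)"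
  and dxx: "!!t x. t > 0 ==> (vx t has_vector_derivative vxx t x) (at x)"
  and dt: "!!t x. t > 0 ==> ((%s. v s x) has_vector_derivative vt t x) (at t)"
  and cont: "continuous_on ({0<..} \<times> UNIV) (%(t, x). v t x)" "continuous_on ({0<..} \<times> UNIV) (%(t, x). vx t x)"
   "continuous_on ({0<..} \<times> UNIV) (%(t, x). vxx t x)" "continuous_on ({0<..} \<times> UNIV) (%(t, x). vt t x)"
  and pde: "!!t x. t > 0 ==> x ~= 0 ==> vt t x = of_real \<sigma> * (vxx t x
   + (of_real ((2 * \<nu> + 1) / x) + 2 * \<i> * of_real (a / b * x)) * vx t x
   - (of_real (a\<^sup>2 / b\<^sup>2 * x\<^sup>2) - 2 * \<i> * of_real ((\<nu> + 1) * (a / b))) * v t x)"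
 shows "heat_solution \<nu> \<sigma> a b v"
proof -
 have Dx: "D (v t) = vx t" if "t > 0" for t using vector_derivative_at[OF dx[OF that]] by auto
 have Dx': "D (v t) x = vx t x" if "t > 0" for t x using vector_derivative_at[OF dx[OF that]] .
 have Dxx: "D (vx t) x = vxx t x" if "t > 0" for t x using vector_derivative_at[OF dxx[OF that]] .
 have Dt: "D (%s. v s x) t = vt t x" if "t > 0" for t x using vector_derivative_at[OF dt[OF that]] .
 have expr: "delta_expr \<nu> a b (v t) x = vt t x / of_real \<sigma>" if "t > 0" "x ~= 0" for t x
  unfolding delta_expr_def Dx[OF that(1)] Dx'[OF that(1)] Dxx[OF that(1)] pde[OF that]
  by (rule nonzero_mult_div_cancel_left[symmetric]) (use sigma in simp)
 have lim: "(delta_expr \<nu> a b (v t) \<longlongrightarrow> vt t 0 / of_real \<sigma>) (at 0)" if t: "t > 0" for t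
 proof -
  have "continuous_on UNIV (%x. (case (t, x) of (t, x) => vt t x))"
   by (rule continuous_on_compose2[OF cont(4)]) (use t in \<open>auto intro!: continuous_intros\<close>)
  then have "isCont (vt t) 0" by (simp add: continuous_on_eq_continuous_at)
  then have "((%x. vt t x / of_real \<sigma>) \<longlongrightarrow> vt t 0 / of_real \<sigma>) (at 0)"
   using sigma by (intro tendsto_divide) (auto simp: isCont_def)
  then show ?thesis
   by (rule Lim_transform_eventually) (auto simp: eventually_at_filter expr[OF t])
 qed
 have delta0: "delta \<nu> a b (v t) 0 = vt t 0 / of_real \<sigma>" if t: "t > 0" for t
  unfolding delta_def using tendsto_Lim[OF _ lim[OF t]] by simp
 have diff: "v t differentiable (at x)" "vx t differentiable (at x)" "(%s. v s x) differentiable (at t)" if "t > 0" for t x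
  using dx[OF that] dxx[OF that] dt[OF that] by (auto intro: differentiableI_vector)
 show ?thesis unfolding heat_solution_def
 proof (intro conjI allI impI)
  show "continuous_on ({0<..} \<times> UNIV) (%(t, x). D (v t) x)"
   by (rule continuous_on_cong[THEN iffD1, OF refl _ cont(2)]) (auto simp: Dx')
  show "continuous_on ({0<..} \<times> UNIV) (%(t, x). D (D (v t)) x)"
   by (rule continuous_on_cong[THEN iffD1, OF refl _ cont(3)]) (auto simp: Dx Dxx)
  show "continuous_on ({0<..} \<times> UNIV) (%(t, x). D (%s. v s x) t)"
   by (rule continuous_on_cong[THEN iffD1, OF refl _ cont(4)]) (auto simp: Dt)
  fix t x :: real assume t: "t > 0"
  show "(delta_expr \<nu> a b (v t) \<longlongrightarrow> delta \<nu> a b (v t) 0) (at 0)"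
   using lim[OF t] by (simp add: delta0[OF t])
  show "D (%s. v s x) t - of_real \<sigma> * delta \<nu> a b (v t) x = 0"
  proof (cases "x = 0")
   case True
   then show ?thesis using t sigma by (simp add: Dt delta0)
  next
   case False
   then have "delta \<nu> a b (v t) x = vt t x / of_real \<sigma>" using expr[OF t] by (simp add: delta_def)
   then show ?thesis using t sigma by (simp add: Dt)
  qed
 qed (use cont diff in \<open>auto simp: Dx Dx'\<close>)
qed

lemma heat_solution_cong:
 assumes eq: "!!t x. t > 0 ==> v t x = u t x" and v: "heat_solution \<nu> \<sigma> a b v"
 shows "heat_solution \<nu> \<sigma> a b u"
proof -
 have eq': "u t = v t" if "t > 0" for t using eq[OF that] by auto
 have key: "((%s. u s x) has_vector_derivative d) (at t) \<longleftrightarrow> ((%s. v s x) has_vector_derivative d) (at t)" if "t > 0" for t x d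
  using that eq has_vector_derivative_transform_within_open[of "%s. u s x" d t "{0<..}" "%s. v s x"]
   has_vector_derivative_transform_within_open[of "%s. v s x" d t "{0<..}" "%s. u s x"] by auto
 have Dt: "D (%s. u s x) t = D (%s. v s x) t" if "t > 0" for t x
  unfolding vector_derivative_def using key[OF that] by simp
 have diff: "(%s. u s x) differentiable (at t) \<longleftrightarrow> (%s. v s x) differentiable (at t)" if "t > 0" for t x
  unfolding vector_derivative_works using key[OF that] Dt[OF that] by simp
 have cc: "continuous_on ({0<..} \<times> UNIV) (%(t, x). f t x) \<longleftrightarrow> continuous_on ({0<..} \<times> UNIV) (%(t, x). g t x)"
  if "!!t x. t > 0 ==> f t x = g t x" for f g :: "real => real => complex"
  using that by (intro continuous_on_cong refl) auto
 have c: "continuous_on ({0<..} \<times> UNIV) (%(t, x). v t x)" "continuous_on ({0<..} \<times> UNIV) (%(t, x). D (v t) x)"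
  "continuous_on ({0<..} \<times> UNIV) (%(t, x). D (D (v t)) x)" "continuous_on ({0<..} \<times> UNIV) (%(t, x). D (%s. v s x) t)"
  using v unfolding heat_solution_def by blast+
 have "continuous_on ({0<..} \<times> UNIV) (%(t, x). u t x)" "continuous_on ({0<..} \<times> UNIV) (%(t, x). D (u t) x)"
  "continuous_on ({0<..} \<times> UNIV) (%(t, x). D (D (u t)) x)" "continuous_on ({0<..} \<times> UNIV) (%(t, x). D (%s. u s x) t)"
  by (rule cc[THEN iffD2, OF _ c(1)], simp add: eq', rule cc[THEN iffD2, OF _ c(2)], simp add: eq',
    rule cc[THEN iffD2, OF _ c(3)], simp add: eq', rule cc[THEN iffD2, OF _ c(4)], simp add: Dt)
 moreover have "(\<forall>t>0. \<forall>x. u t differentiable (at x) & D (u t) differentiable (at x))"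
  "(\<forall>t>0. \<forall>x. (%s. u s x) differentiable (at t))"
  "(\<forall>t>0. (delta_expr \<nu> a b (u t) \<longlongrightarrow> delta \<nu> a b (u t) 0) (at 0))"
  "(\<forall>t>0. \<forall>x. D (%s. u s x) t - of_real \<sigma> * delta \<nu> a b (u t) x = 0)"
  using v unfolding heat_solution_def by (simp_all add: eq' diff Dt)
 ultimately show ?thesis unfolding heat_solution_def by blast
qed

lemma inverse_time_deriv:
 assumes "\<sigma> > 0" "t > 0"
 shows "((%t. 1 / (4 * \<sigma> * t)) has_real_derivative - (4 * \<sigma> * (1 / (4 * \<sigma> * t))\<^sup>2)) (at t)"
 using assms by (auto intro!: derivative_eq_intros simp: power2_eq_square field_simps)

lemma flow_dt:
 assumes nu: "\<nu> > - 1/2" and F: "gauss_integrable \<nu> F" and sigma: "\<sigma> > 0" and t: "t > 0"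
 shows "((%t. flow \<nu> F (1 / (4 * \<sigma> * t)) x) has_vector_derivative
  - of_real (4 * \<sigma> * (1 / (4 * \<sigma> * t))\<^sup>2) * (of_real ((\<nu> + 1) / (1 / (4 * \<sigma> * t)) - x\<^sup>2) * heat_integral \<nu> F 0 0 (1 / (4 * \<sigma> * t)) x
   - heat_integral \<nu> F 0 1 (1 / (4 * \<sigma> * t)) x + of_real (2 * x\<^sup>2) * heat_integral \<nu> F 1 1 (1 / (4 * \<sigma> * t)) x)) (at t)"
proof -
 have k: "1 / (4 * \<sigma> * t) > 0" using sigma t by simp
 from vector_diff_chain_at[OF inverse_time_deriv[OF sigma t, unfolded has_real_derivative_iff_has_vector_derivative] heat_integral_deriv_lambda[OF nu F k, of 0 0 x]]
 show ?thesis
  by (simp only: o_def scaleR_conv_of_real of_real_minus One_nat_def of_nat_0 add_0_right)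
qed

lemma heat_semigroup_heat_solution:
 assumes nu: "\<nu> > - 1/2" and sigma: "\<sigma> > 0" and F: "gauss_integrable \<nu> (%y. chirp (a / b) y * f y)"
 shows "heat_solution \<nu> \<sigma> a b (%t x. heat_semigroup \<nu> \<sigma> a b t f x)"
proof -
 define F where "F = (%y. chirp (a / b) y * f y)"
 have F: "gauss_integrable \<nu> F" using assms(3) by (simp add: F_def)
 let ?al = "a / b" and ?k = "%t. 1 / (4 * \<sigma> * t)" and ?W = "heat_integral \<nu> F"
 define w where "w t x = ?W 0 0 (?k t) x" for t x
 define wx where "wx t x = of_real (2 * ?k t * x) * (?W 1 1 (?k t) x - ?W 0 0 (?k t) x)" for t x
 define wxx where "wxx t x = of_real (2 * ?k t) * (?W 1 1 (?k t) x - ?W 0 0 (?k t) x) +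
  of_real (4 * (?k t)\<^sup>2 * x\<^sup>2) * (?W 2 2 (?k t) x - 2 * ?W 1 1 (?k t) x + ?W 0 0 (?k t) x)" for t x
 define wt where "wt t x = - of_real (4 * \<sigma> * (?k t)\<^sup>2) * (of_real ((\<nu> + 1) / ?k t - x\<^sup>2) * ?W 0 0 (?k t) x
   - ?W 0 1 (?k t) x + of_real (2 * x\<^sup>2) * ?W 1 1 (?k t) x)" for t x
 define v where "v t x = chirp (- ?al) x * w t x" for t x
 define vx where "vx t x = chirp (- ?al) x * (wx t x + \<i> * of_real (- ?al * x) * w t x)" for t x
 define vxx where "vxx t x = chirp (- ?al) x * (wxx t x + 2 * \<i> * of_real (- ?al * x) * wx t x + (\<i> * of_real (- ?al) - of_real ((- ?al)\<^sup>2 * x\<^sup>2)) * w t x)" for t x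
 define vt where "vt t x = chirp (- ?al) x * wt t x" for t x
 have k: "?k t > 0" if "t > 0" for t using sigma that by simp
 have dw: "(w t has_vector_derivative wx t x) (at x)" if "t > 0" for t x
  using heat_integral_deriv_x[OF nu F k[OF that], of 0 0 x] by (simp add: w_def[abs_def] wx_def)
 have dwx: "(wx t has_vector_derivative wxx t x) (at x)" if "t > 0" for t x
  using heat_integral_dx2[OF nu F k[OF that], of x] unfolding wx_def[abs_def] wxx_def .
 have dwt: "((%t. w t x) has_vector_derivative wt t x) (at t)" if "t > 0" for t x
  using flow_dt[OF nu F sigma that, of x] unfolding w_def wt_def .
 have pde: "wt t x = of_real \<sigma> * (wxx t x + of_real ((2 * \<nu> + 1) / x) * wx t x)" if "t > 0" "x ~= 0" for t x
 proof -
  have "wt t x = of_real \<sigma> * (- of_real (4 * (?k t)\<^sup>2) * (of_real ((\<nu> + 1) / ?k t - x\<^sup>2) * ?W 0 0 (?k t) x - ?W 0 1 (?k t) x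
     + of_real (2 * x\<^sup>2) * ?W 1 1 (?k t) x))"
   unfolding wt_def by simp
  also have "\<dots> = of_real \<sigma> * (wxx t x + of_real ((2 * \<nu> + 1) * (2 * ?k t)) * (?W 1 1 (?k t) x - ?W 0 0 (?k t) x))"
   unfolding heat_integral_pde[OF nu F k[OF that(1)]] wxx_def by (simp only: add.assoc)
  also have "of_real ((2 * \<nu> + 1) * (2 * ?k t)) * (?W 1 1 (?k t) x - ?W 0 0 (?k t) x) = of_real ((2 * \<nu> + 1) / x) * wx t x"
   unfolding wx_def using that(2) by simp
  finally show ?thesis .
 qed
 have cw: "continuous_on ({0<..} \<times> UNIV) (%z. ?W j l (?k (fst z)) (snd z))" for j l
  by (rule continuous_on_heat_integral'[OF nu F]) (use sigma in \<open>auto intro!: continuous_intros\<close>)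
 have ck: "continuous_on ({0<..} \<times> (UNIV :: real set)) (%z. ?k (fst z))"
  by (intro continuous_intros) (use sigma in auto)
 have ck2: "continuous_on ({0<..} \<times> (UNIV :: real set)) (%z. (\<nu> + 1) / ?k (fst z))"
  by (intro continuous_intros ck) (use sigma in auto)
 note CI = continuous_on_mult continuous_on_add continuous_on_diff continuous_on_minus continuous_on_of_real
  continuous_on_const continuous_on_power continuous_on_fst continuous_on_snd continuous_on_id continuous_on_chirp
 have hv: "heat_solution \<nu> \<sigma> a b v"
 proof (rule heat_solutionI)
  show "\<sigma> ~= 0" using sigma by simp
  show "continuous_on ({0<..} \<times> UNIV) (%(t, x). v t x)"
   unfolding v_def w_def case_prod_unfold by (intro CI cw)
  show "continuous_on ({0<..} \<times> UNIV) (%(t, x). vx t x)"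
   unfolding vx_def wx_def w_def case_prod_unfold by (intro CI cw ck)
  show "continuous_on ({0<..} \<times> UNIV) (%(t, x). vxx t x)"
   unfolding vxx_def wxx_def wx_def w_def case_prod_unfold by (intro CI cw ck)
  show "continuous_on ({0<..} \<times> UNIV) (%(t, x). vt t x)"
   unfolding vt_def wt_def case_prod_unfold by (intro CI cw ck ck2)
  fix t x :: real assume t: "t > 0"
  show "(v t has_vector_derivative vx t x) (at x)"
   unfolding v_def[abs_def] vx_def by (rule chirp_mult_deriv[OF dw[OF t]])
  show "(vx t has_vector_derivative vxx t x) (at x)"
   unfolding vx_def[abs_def] vxx_def by (rule chirp_mult_deriv2[OF dw[OF t] dwx[OF t]])
  show "((%s. v s x) has_vector_derivative vt t x) (at t)"
   unfolding v_def vt_def by (rule has_vector_derivative_mult_right[OF dwt[OF t]])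
  assume x: "x ~= 0"
  have "of_real ((2 * \<nu> + 1) / x) * (\<i> * of_real (- ?al * x) * w t x) = - (\<i> * of_real ((2 * \<nu> + 1) * ?al) * w t x)"
   using x by simp
  then show "vt t x = of_real \<sigma> * (vxx t x
   + (of_real ((2 * \<nu> + 1) / x) + 2 * \<i> * of_real (a / b * x)) * vx t x
   - (of_real (a\<^sup>2 / b\<^sup>2 * x\<^sup>2) - 2 * \<i> * of_real ((\<nu> + 1) * (a / b))) * v t x)"
  proof -
   define r where "r = complex_of_real ((2 * \<nu> + 1) / x)"
   define A where "A = complex_of_real ?al"
   define X where "X = complex_of_real x"
   have rX: "r * X = 2 * of_real \<nu> + 1" using x by (simp add: r_def X_def)
   have "chirp (- ?al) x * (wxx t x + r * wx t x) = chirp (- ?al) x * (wxx t x + 2 * \<i> * (- A * X) * wx t x + (\<i> * (- A) - A\<^sup>2 * X\<^sup>2) * w t x)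
   + (r + 2 * \<i> * (A * X)) * (chirp (- ?al) x * (wx t x + \<i> * (- A * X) * w t x))
   - (A\<^sup>2 * X\<^sup>2 - 2 * \<i> * ((of_real \<nu> + 1) * A)) * (chirp (- ?al) x * w t x)"
   proof -
    have "(r + 2 * \<i> * (A * X)) * (\<i> * (- A * X)) = - \<i> * A * (r * X) + 2 * A\<^sup>2 * X\<^sup>2"
     by (simp add: algebra_simps power2_eq_square)
    also have "\<dots> = - \<i> * A * (2 * of_real \<nu> + 1) + 2 * A\<^sup>2 * X\<^sup>2" unfolding rX ..
    finally have rr: "(r + 2 * \<i> * (A * X)) * (\<i> * (- A * X)) = - \<i> * A * (2 * of_real \<nu> + 1) + 2 * A\<^sup>2 * X\<^sup>2" .
    have e: "(r + 2 * \<i> * (A * X)) * (chirp (- ?al) x * (wx t x + \<i> * (- A * X) * w t x)) =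
     chirp (- ?al) x * ((r + 2 * \<i> * (A * X)) * wx t x + (- \<i> * A * (2 * of_real \<nu> + 1) + 2 * A\<^sup>2 * X\<^sup>2) * w t x)"
    proof -
     have "R * (c * (w1 + m * w0)) = c * (R * w1 + (R * m) * w0)" for R c w1 m w0 :: complex
      by (simp add: algebra_simps)
     then show ?thesis by (simp only: rr)
    qed
    show ?thesis unfolding e by (simp add: algebra_simps)
   qed
   then show ?thesis
    unfolding vt_def pde[OF t x] vxx_def vx_def v_def
    by (simp add: r_def A_def X_def power_divide power_mult_distrib)
  qed
 qed
 have eqv: "v t x = heat_semigroup \<nu> \<sigma> a b t f x" if "t > 0" for t x
  by (simp add: v_def w_def heat_semigroup_eq[OF nu sigma that] F_def)
 show ?thesis by (rule heat_solution_cong[OF eqv hv])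
qed

section \<open>Conservation of mass\<close>

lemma bessel_measure_Suc:
 fixes h :: "real => complex"
 assumes h: "h \<in> borel_measurable (bmeas \<nu>)"
 shows "integrable (bmeas (\<nu> + 1)) h \<longleftrightarrow> integrable (bmeas \<nu>) (%y. of_real (y\<^sup>2) * h y)"
  and "(LINT y|bmeas (\<nu> + 1). h y) = (LINT y|bmeas \<nu>. of_real (y\<^sup>2) * h y)"
proof -
 have h': "h \<in> borel_measurable (bmeas (\<nu> + 1))"
  using h by (simp add: measurable_def sets_bessel_measure)
 have h2: "(%y. of_real (y\<^sup>2) * h y) \<in> borel_measurable (bmeas \<nu>)"
  by (intro borel_measurable_times h continuous_imp_bessel_measurable continuous_intros)
 have e: "y powr (2 * (\<nu> + 1) + 1) *\<^sub>R h y = y powr (2 * \<nu> + 1) *\<^sub>R (of_real (y\<^sup>2) * h y)" if "y \<in> space (lebesgue_on {0..})" for y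
 proof -
  have "y powr (2 * (\<nu> + 1) + 1) = y powr (2 * \<nu> + 1) * y powr 2" by (simp add: powr_add[symmetric] algebra_simps)
  also have "y powr 2 = y\<^sup>2" using that by simp
  finally show ?thesis by (simp add: scaleR_conv_of_real)
 qed
 show "integrable (bmeas (\<nu> + 1)) h \<longleftrightarrow> integrable (bmeas \<nu>) (%y. of_real (y\<^sup>2) * h y)"
  unfolding integrable_bessel_iff[OF h'] integrable_bessel_iff[OF h2]
  by (intro Bochner_Integration.integrable_cong refl e)
 show "(LINT y|bmeas (\<nu> + 1). h y) = (LINT y|bmeas \<nu>. of_real (y\<^sup>2) * h y)"
  unfolding integral_bessel[OF h'] integral_bessel[OF h2]
  by (intro Bochner_Integration.integral_cong refl e)
qed

lemma bounded_continuous_gauss_integrable: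
 assumes nu: "\<nu> > - 1/2" and "continuous_on {0..} G" and "!!y. y >= 0 ==> cmod (G y) <= M"
 shows "gauss_integrable \<nu> G"
proof (rule in_L_imp_gauss_integrable[OF nu, of top])
 show "in_L \<nu> top G"
  unfolding in_L_def using assms by (auto intro!: continuous_imp_bessel_measurable exI[of _ M] AE_I2)
qed simp

lemma bessel_measurable_shift: "f \<in> borel_measurable (bmeas \<mu>) \<longleftrightarrow> f \<in> borel_measurable (bmeas \<nu>)"
 by (simp add: measurable_def sets_bessel_measure)

text \<open>The operator \<open>(1/x) d/dx\<close> intertwines the Bessel heat flows of orders \<open>\<nu>\<close> and
 \<open>\<nu> + 1\<close>: on the level of kernels this is an exact derivative in the integration variable.\<close>

lemma flow_intertwining:
 assumes nu: "\<nu> > - 1/2" and k: "\<kappa> > 0"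
  and cG: "continuous_on {0..} G" and bG: "!!y. y >= 0 ==> cmod (G y) <= M"
  and dG: "!!y. y > 0 ==> (G has_vector_derivative of_real y * H y) (at y)"
  and H: "gauss_integrable (\<nu> + 1) H"
 shows "of_real (2 * \<kappa>) * (heat_integral \<nu> G 1 1 \<kappa> x - heat_integral \<nu> G 0 0 \<kappa> x) = flow (\<nu> + 1) H \<kappa> x"
proof -
 have nu1: "\<nu> + 1 > - 1/2" using nu by simp
 have G: "gauss_integrable \<nu> G" by (rule bounded_continuous_gauss_integrable[OF nu cG bG])
 let ?K = "%j y. kern (\<nu> + j) \<kappa> x y"
 let ?g1 = "%y. of_real (2 * \<kappa>) * (of_real (?K 0 y) * G y - of_real (y\<^sup>2 * ?K 1 y) * G y)"
 let ?g2 = "%y. of_real (y\<^sup>2) * (of_real (?K 1 y) * H y)"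
 let ?\<Psi> = "%y. of_real (y powr (2 * \<nu> + 2) * ?K 1 y) * G y"
 have i0: "integrable (bmeas \<nu>) (%y. of_real (?K 0 y) * G y)" using kernel_integrand_integrable[OF nu G k, of 0 0] by simp
 have i1: "integrable (bmeas \<nu>) (%y. of_real (y\<^sup>2 * ?K 1 y) * G y)" using kernel_integrand_integrable[OF nu G k, of 1 1] by simp
 have i2': "integrable (bmeas (\<nu> + 1)) (%y. of_real (?K 1 y) * H y)"
  using kernel_integrand_integrable[OF nu1 H k, of 0 0] by simp
 have m2: "(%y. of_real (?K 1 y) * H y) \<in> borel_measurable (bmeas \<nu>)"
  using borel_measurable_integrable[OF i2'] bessel_measurable_shift by blast
 have i2: "integrable (bmeas \<nu>) ?g2" using i2' bessel_measure_Suc(1)[OF m2] by simp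
 obtain C where C: "!!y. y ^ (2 * nat \<lceil>\<nu> + 2\<rceil>) * ?K 1 y <= C"
 proof -
  obtain C where "C >= 0" "!!y. y ^ (2 * nat \<lceil>\<nu> + 2\<rceil>) * ?K 1 y <= C * exp (- (\<kappa> / 4) * y\<^sup>2)"
   using kern_dominated[OF nu1 k, of \<kappa> "\<bar>x\<bar>" "nat \<lceil>\<nu> + 2\<rceil>"] by auto
  moreover have "C * exp (- (\<kappa> / 4) * y\<^sup>2) <= C" for y using \<open>C >= 0\<close> k by (simp add: mult_left_le)
  ultimately show ?thesis using that order_trans by blast
 qed
 have "(LINT y|bmeas \<nu>. ?g1 y + ?g2 y) = 0"
 proof (rule bessel_integral_derivative_eq_0[where \<Psi> = ?\<Psi>])
  show "continuous_on {0..} ?\<Psi>"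
   by (intro continuous_intros cG continuous_on_powr' nu1) (use nu k in auto)
  show "?\<Psi> 0 = 0" by simp
  show "integrable (bmeas \<nu>) (%y. ?g1 y + ?g2 y)"
   by (intro Bochner_Integration.integrable_add Bochner_Integration.integrable_diff integrable_mult_right i0 i1 i2)
  show "(?\<Psi> \<longlongrightarrow> 0) at_top"
  proof (rule Lim_null_comparison)
   show "\<forall>\<^sub>F y in at_top. norm (?\<Psi> y) <= C * M / y\<^sup>2"
   proof (rule eventually_at_top_linorder[THEN iffD2], intro exI[of _ 1] allI impI)
    fix y :: real assume y: "y >= 1"
    have "y powr (2 * \<nu> + 4) <= y powr real (2 * nat \<lceil>\<nu> + 2\<rceil>)"
     using y nu by (intro powr_mono) (simp add: of_nat_ceiling, linarith)
    then have "y\<^sup>2 * y powr (2 * \<nu> + 2) <= y ^ (2 * nat \<lceil>\<nu> + 2\<rceil>)"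
    proof -
     assume a: "y powr (2 * \<nu> + 4) <= y powr real (2 * nat \<lceil>\<nu> + 2\<rceil>)"
     have "y\<^sup>2 * y powr (2 * \<nu> + 2) = y powr 2 * y powr (2 * \<nu> + 2)" using y by simp
     also have "\<dots> = y powr (2 * \<nu> + 4)" unfolding powr_add[symmetric] by (simp add: add_ac)
     finally show ?thesis using a y by (simp only: powr_realpow)
    qed
    then have "y\<^sup>2 * y powr (2 * \<nu> + 2) * ?K 1 y <= C"
     using C[of y] mult_right_mono[OF _ kern_nonneg[OF nu1, of \<kappa> x y]] order_trans by blast
    then have "y powr (2 * \<nu> + 2) * ?K 1 y <= C / y\<^sup>2" using y by (simp add: field_simps)
    then have "y powr (2 * \<nu> + 2) * ?K 1 y * cmod (G y) <= C / y\<^sup>2 * M"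
    proof (rule mult_mono)
     have "0 <= y powr (2 * \<nu> + 2) * ?K 1 y" using kern_nonneg[OF nu1, of \<kappa> x y] by simp
     then show "0 <= C / y\<^sup>2" using \<open>y powr (2 * \<nu> + 2) * ?K 1 y <= C / y\<^sup>2\<close> by linarith
    qed (use y bG[of y] in auto)
    then show "norm (?\<Psi> y) <= C * M / y\<^sup>2"
     using kern_nonneg[OF nu1, of \<kappa> x y] by (simp add: norm_mult abs_mult)
   qed
   have "((%y::real. inverse (y\<^sup>2)) \<longlongrightarrow> 0) at_top"
    by (intro tendsto_inverse_0_at_top filterlim_pow_at_top filterlim_ident) simp
   then show "((%y::real. C * M / y\<^sup>2) \<longlongrightarrow> 0) at_top"
    using tendsto_mult_right_zero[of "%y::real. inverse (y\<^sup>2)" at_top "C * M"] by (simp only: divide_inverse)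
  qed
  fix y :: real assume y: "y > 0"
  have dK: "(?K 1 has_real_derivative 2 * \<kappa> * y * (x\<^sup>2 * ?K 2 y - ?K 1 y)) (at y)"
   using kern_deriv_x[OF nu1 k, of x y]
   by (simp add: kern_sym[of _ _ _ x] add.assoc)
  have dP: "((%y. y powr (2 * \<nu> + 2)) has_real_derivative (2 * \<nu> + 2) * y powr (2 * \<nu> + 1)) (at y)"
  proof -
   have e: "2 * \<nu> + 2 - 1 = 2 * \<nu> + 1" by simp
   show ?thesis using has_real_derivative_powr[OF y, of "2 * \<nu> + 2"] unfolding e .
  qed
  have p: "y powr (2 * \<nu> + 2) = y powr (2 * \<nu> + 1) * y" using powr_add[of y "2 * \<nu> + 1" 1] y by (simp add: add.assoc)
  have con: "?K 0 y = (\<nu> + 1) / \<kappa> * ?K 1 y + x\<^sup>2 * y\<^sup>2 * ?K 2 y"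
   using kern_contiguous[OF nu k, of x y] by simp
  have "((%y. y powr (2 * \<nu> + 2) * ?K 1 y) has_real_derivative
   (2 * \<nu> + 2) * y powr (2 * \<nu> + 1) * ?K 1 y + (2 * \<kappa> * y * (x\<^sup>2 * ?K 2 y - ?K 1 y)) * y powr (2 * \<nu> + 2)) (at y)"
   by (rule DERIV_mult[OF dP dK])
  also have "(2 * \<nu> + 2) * y powr (2 * \<nu> + 1) * ?K 1 y + (2 * \<kappa> * y * (x\<^sup>2 * ?K 2 y - ?K 1 y)) * y powr (2 * \<nu> + 2)
   = y powr (2 * \<nu> + 1) * (2 * \<kappa> * (?K 0 y - y\<^sup>2 * ?K 1 y))"
   unfolding p con using k by (simp add: field_simps power2_eq_square)
  finally have "((%y. complex_of_real (y powr (2 * \<nu> + 2) * ?K 1 y)) has_vector_derivative of_real (y powr (2 * \<nu> + 1) * (2 * \<kappa> * (?K 0 y - y\<^sup>2 * ?K 1 y)))) (at y)"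
   by (rule has_vector_derivative_of_real)
  from has_vector_derivative_mult[OF this dG[OF y]]
  show "(?\<Psi> has_vector_derivative y powr (2 * \<nu> + 1) *\<^sub>R (?g1 y + ?g2 y)) (at y)"
   by (rule has_vector_derivative_eq_rhs) (unfold p, simp add: scaleR_conv_of_real algebra_simps power2_eq_square)
 qed
 then have "(LINT y|bmeas \<nu>. ?g1 y) + (LINT y|bmeas \<nu>. ?g2 y) = 0"
  by (subst (asm) Bochner_Integration.integral_add)
   (intro Bochner_Integration.integrable_diff integrable_mult_right i0 i1 i2)+
 moreover have "(LINT y|bmeas \<nu>. ?g1 y) = of_real (2 * \<kappa>) * (heat_integral \<nu> G 0 0 \<kappa> x - heat_integral \<nu> G 1 1 \<kappa> x)"
  using i0 i1 by (simp add: heat_integral_def)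
 moreover have "(LINT y|bmeas \<nu>. ?g2 y) = flow (\<nu> + 1) H \<kappa> x"
  unfolding bessel_measure_Suc(2)[OF m2, symmetric] by (simp add: heat_integral_def)
 ultimately show ?thesis by (simp add: algebra_simps add_eq_0_iff)
qed

lemma kern_mass:
 assumes nu: "\<nu> > - 1/2" and k: "\<kappa> > 0"
 shows "integrable (bmeas \<nu>) (%y. kern \<nu> \<kappa> x y)"
  and "(LINT y|bmeas \<nu>. kern \<nu> \<kappa> x y) = 1"
proof -
 let ?G = "%_::real. 1 :: complex"
 have G: "gauss_integrable \<nu> ?G" by (rule bounded_continuous_gauss_integrable[OF nu, of _ 1]) auto
 have "gauss_integrable (\<nu> + 1) (%_. 0)" by (rule bounded_continuous_gauss_integrable[of _ _ 0]) (use nu in auto)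
 then have "of_real (2 * \<kappa>) * (heat_integral \<nu> ?G 1 1 \<kappa> x - heat_integral \<nu> ?G 0 0 \<kappa> x) = 0" for x
  using flow_intertwining[OF nu k, of ?G 1 "%_. 0" x] by (simp add: heat_integral_def)
 then have "heat_integral \<nu> ?G 1 1 \<kappa> x - heat_integral \<nu> ?G 0 0 \<kappa> x = 0" for x using k by simp
 then have "(flow \<nu> ?G \<kappa> has_vector_derivative 0) (at x)" for x
  using heat_integral_deriv_x[OF nu G k, of 0 0 x] by simp
 then obtain c where c: "!!x. flow \<nu> ?G \<kappa> x = c"
  using has_vector_derivative_zero_constant[of UNIV "flow \<nu> ?G \<kappa>"] by auto
 have eq: "flow \<nu> ?G \<kappa> x = of_real (LINT y|bmeas \<nu>. kern \<nu> \<kappa> x y)" for x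
  unfolding heat_integral_def by simp
 have "(LINT y|bmeas \<nu>. kern \<nu> \<kappa> 0 y) = 2 / Gamma (\<nu> + 1) * \<kappa> powr (\<nu> + 1) * (Gamma (\<nu> + 1) / 2 * \<kappa> powr - (\<nu> + 1))"
  unfolding Gaussian_bessel_integral(2)[OF nu k, symmetric] by (simp add: kern_def)
 also have "\<dots> = 1"
 proof -
  have "\<kappa> powr (\<nu> + 1) * \<kappa> powr - (\<nu> + 1) = 1" using k by (simp add: powr_add[symmetric])
  then show ?thesis using Gamma_Suc_pos(2)[OF nu] by simp
 qed
 finally have "c = 1" using c[of 0] eq[of 0] by simp
 then show "(LINT y|bmeas \<nu>. kern \<nu> \<kappa> x y) = 1" using c[of x] eq[of x] by simp
 show "integrable (bmeas \<nu>) (%y. kern \<nu> \<kappa> x y)"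
  using kernel_integrand_integrable[OF nu G k, of 0 0 x] integrable_norm[of "bmeas \<nu>" "%y. complex_of_real (kern \<nu> \<kappa> x y)"]
   kern_nonneg[OF nu] by (simp add: abs_of_nonneg)
qed

lemma norm_flow_le_LINT:
 assumes nu: "\<nu> > - 1/2" and F: "gauss_integrable \<nu> F" and k: "\<kappa> > 0"
 shows "integrable (bmeas \<nu>) (%y. kern \<nu> \<kappa> x y * cmod (F y))"
  and "cmod (flow \<nu> F \<kappa> x) <= (LINT y|bmeas \<nu>. kern \<nu> \<kappa> x y * cmod (F y))"
proof -
 have e: "cmod (of_real (kern \<nu> \<kappa> x y) * F y) = kern \<nu> \<kappa> x y * cmod (F y)" for y
  using kern_nonneg[OF nu] by (simp add: norm_mult)
 show "integrable (bmeas \<nu>) (%y. kern \<nu> \<kappa> x y * cmod (F y))"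
  using integrable_norm[OF kernel_integrand_integrable[OF nu F k, of 0 0 x]] by (simp add: e)
 show "cmod (flow \<nu> F \<kappa> x) <= (LINT y|bmeas \<nu>. kern \<nu> \<kappa> x y * cmod (F y))"
  using integral_norm_bound[of "bmeas \<nu>" "%y. of_real (kern \<nu> \<kappa> x y) * F y"]
  by (simp add: heat_integral_def e)
qed

lemma norm_flow_le_sup:
 assumes nu: "\<nu> > - 1/2" and F: "gauss_integrable \<nu> F" and k: "\<kappa> > 0"
  and B: "AE y in bmeas \<nu>. cmod (F y) <= B"
 shows "cmod (flow \<nu> F \<kappa> x) <= B"
proof -
 have "(LINT y|bmeas \<nu>. kern \<nu> \<kappa> x y * cmod (F y)) <= (LINT y|bmeas \<nu>. kern \<nu> \<kappa> x y * B)"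
 proof (rule integral_mono_AE)
  show "AE y in bmeas \<nu>. kern \<nu> \<kappa> x y * cmod (F y) <= kern \<nu> \<kappa> x y * B"
   using B by eventually_elim (intro mult_left_mono kern_nonneg[OF nu])
 qed (use norm_flow_le_LINT(1)[OF nu F k] kern_mass[OF nu k] in auto)
 also have "\<dots> = B" using kern_mass[OF nu k, of x] by simp
 finally show ?thesis using norm_flow_le_LINT(2)[OF nu F k, of x] by simp
qed

text \<open>Away from the diagonal the kernel is dominated by an exponentially small multiple of the kernel
 at twice the time; so the flow only sees the behaviour of \<open>F\<close> near \<open>x\<close>.\<close>

lemma flow_near:
 assumes nu: "\<nu> > - 1/2" and F: "gauss_integrable \<nu> F" and k: "\<kappa> > 0"
  and x: "x >= 0" and \<delta>: "\<delta> > 0" and \<epsilon>: "\<epsilon> >= 0"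
  and near: "AE y in bmeas \<nu>. \<bar>y - x\<bar> < \<delta> --> cmod (F y - z) <= \<epsilon>"
 shows "cmod (flow \<nu> F \<kappa> x - z) <= \<epsilon> + 2 powr (\<nu> + 1) * exp (- (\<kappa> / 2) * \<delta>\<^sup>2) *
     ((LINT y|bmeas \<nu>. kern \<nu> (\<kappa> / 2) x y * cmod (F y)) + cmod z)"
proof -
 let ?M = "bmeas \<nu>" and ?K = "%y. kern \<nu> \<kappa> x y" and ?L = "%y. kern \<nu> (\<kappa> / 2) x y"
 let ?c = "2 powr (\<nu> + 1) * exp (- (\<kappa> / 2) * \<delta>\<^sup>2)"
 have k2: "\<kappa> / 2 > 0" using k by simp
 note mK = kern_mass[OF nu k, of x] and mL = kern_mass[OF nu k2, of x]
 have iF: "integrable ?M (%y. of_real (?K y) * F y)" using kernel_integrand_integrable[OF nu F k, of 0 0 x] by simp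
 have iz: "integrable ?M (%y. of_real (?K y) * z)" using mK(1) by (intro integrable_mult_left) auto
 have iL: "integrable ?M (%y. ?L y * cmod (F y))" by (rule norm_flow_le_LINT(1)[OF nu F k2])
 have "flow \<nu> F \<kappa> x - z = (LINT y|?M. of_real (?K y) * F y) - (LINT y|?M. of_real (?K y) * z)"
  using mK by (simp add: heat_integral_def)
 also have "\<dots> = (LINT y|?M. of_real (?K y) * (F y - z))"
  using iF iz by (simp add: right_diff_distrib)
 finally have "cmod (flow \<nu> F \<kappa> x - z) <= (LINT y|?M. cmod (of_real (?K y) * (F y - z)))"
  using integral_norm_bound by metis
 also have "\<dots> <= (LINT y|?M. \<epsilon> * ?K y + ?c * (?L y * cmod (F y) + ?L y * cmod z))"
 proof (rule integral_mono_AE)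
  show "integrable ?M (%y. cmod (of_real (?K y) * (F y - z)))"
   using Bochner_Integration.integrable_diff[OF iF iz] by (intro integrable_norm) (simp add: right_diff_distrib)
  show "integrable ?M (%y. \<epsilon> * ?K y + ?c * (?L y * cmod (F y) + ?L y * cmod z))"
   by (intro Bochner_Integration.integrable_add integrable_mult_right integrable_mult_left mK mL iL)
  show "AE y in ?M. cmod (of_real (?K y) * (F y - z)) <= \<epsilon> * ?K y + ?c * (?L y * cmod (F y) + ?L y * cmod z)"
   using near AE_space
  proof eventually_elim
   case (elim y)
   have n: "cmod (of_real (?K y) * (F y - z)) = ?K y * cmod (F y - z)" using kern_nonneg[OF nu, of \<kappa> x y] by (simp add: norm_mult)
   have K0: "?K y >= 0" "?L y >= 0" using kern_nonneg[OF nu] by auto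
   show ?case
   proof (cases "\<bar>y - x\<bar> < \<delta>")
    case True
    then have "?K y * cmod (F y - z) <= ?K y * \<epsilon>" using elim K0 by (intro mult_left_mono) auto
    moreover have "?c * (?L y * cmod (F y) + ?L y * cmod z) >= 0" using K0 by (intro mult_nonneg_nonneg add_nonneg_nonneg) auto
    ultimately show ?thesis unfolding n by (simp add: mult.commute)
   next
    case False
    then have "?K y <= ?c * ?L y" using elim \<delta> by (intro kern_far[OF nu k x]) auto
    then have "?K y * cmod (F y - z) <= (?c * ?L y) * (cmod (F y) + cmod z)"
     using K0 by (intro mult_mono norm_triangle_ineq4) auto
    moreover have "\<epsilon> * ?K y >= 0" using \<epsilon> K0 by simp
    ultimately show ?thesis unfolding n by (simp add: algebra_simps)
   qed
  qed
 qed
 also have "\<dots> = \<epsilon> + ?c * ((LINT y|?M. ?L y * cmod (F y)) + cmod z)"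
  using mK mL iL by simp
 finally show ?thesis .
qed

section \<open>Young's inequality\<close>

lemma weighted_AM_GM3:
 fixes a b c r s t :: real
 assumes "a > 0" "b > 0" "c > 0" "r >= 0" "s >= 0" "t >= 0" "r + s + t = 1"
 shows "a powr r * b powr s * c powr t <= r * a + s * b + t * c"
proof -
 define m where "m = r * a + s * b + t * c"
 have "m > 0"
 proof -
  have "r > 0 \<or> s > 0 \<or> t > 0" using assms by linarith
  then have "r * a > 0 \<or> s * b > 0 \<or> t * c > 0" using assms by auto
  moreover have "r * a >= 0" "s * b >= 0" "t * c >= 0" using assms by auto
  ultimately show ?thesis unfolding m_def by linarith
 qed
 have l: "ln z <= ln m + (z / m - 1)" if "z > 0" for z
  using ln_le_minus_one[of "z / m"] that \<open>m > 0\<close> by (simp add: ln_div)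
 have "r * ln a + s * ln b + t * ln c <= r * (ln m + (a / m - 1)) + s * (ln m + (b / m - 1)) + t * (ln m + (c / m - 1))"
  using assms by (intro add_mono mult_left_mono l) auto
 also have "\<dots> = (r + s + t) * (ln m - 1) + (r * a + s * b + t * c) / m" by (simp add: algebra_simps add_divide_distrib)
 also have "\<dots> = ln m" using assms(7) \<open>m > 0\<close> by (simp add: m_def[symmetric])
 finally have "exp (r * ln a + s * ln b + t * ln c) <= m" using \<open>m > 0\<close> by (simp add: ln_ge_iff[symmetric])
 then show ?thesis using assms by (simp add: powr_def exp_add m_def)
qed

text \<open>Hoelder's inequality for three factors, in the form in which it proves Young's
 inequality: \<open>k f = (k^q f^p)^(1/r) (k^q)^(1 - 1/p) (f^p)^(1 - 1/q)\<close>.\<close>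

lemma Hoelder_Young:
 fixes k f :: "'a => real"
 assumes k: "!!y. k y >= 0" and f: "!!y. f y >= 0" and m: "k \<in> borel_measurable M" "f \<in> borel_measurable M"
  and pq: "p >= 1" "q >= 1" "1 / p + 1 / q >= 1"
  and i1: "integrable M (%y. k y powr q * f y powr p)" and i2: "integrable M (%y. k y powr q)" and i3: "integrable M (%y. f y powr p)"
 shows "(LINT y|M. k y * f y) <= (LINT y|M. k y powr q * f y powr p) powr (1 / p + 1 / q - 1)
      * (LINT y|M. k y powr q) powr (1 - 1 / p) * (LINT y|M. f y powr p) powr (1 - 1 / q)"
proof -
 define I1 where "I1 = (LINT y|M. k y powr q * f y powr p)"
 define I2 where "I2 = (LINT y|M. k y powr q)"
 define I3 where "I3 = (LINT y|M. f y powr p)"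
 define \<rho> where "\<rho> = 1 / p + 1 / q - 1"
 have nn: "I1 >= 0" "I2 >= 0" "I3 >= 0" using k f by (auto simp: I1_def I2_def I3_def intro!: integral_nonneg)
 show ?thesis
 proof (cases "I1 > 0 & I2 > 0 & I3 > 0")
  case False
  then have "I1 = 0 \<or> I2 = 0 \<or> I3 = 0" using nn by linarith
  then have "AE y in M. k y * f y = 0"
  proof (elim disjE)
   assume "I1 = 0"
   then have "AE y in M. k y powr q * f y powr p = 0"
    using integral_nonneg_eq_0_iff_AE[OF i1] k f by (simp add: I1_def)
   then show ?thesis by eventually_elim (auto simp: powr_eq_0_iff)
  next
   assume "I2 = 0"
   then have "AE y in M. k y powr q = 0"
    using integral_nonneg_eq_0_iff_AE[OF i2] k f by (simp add: I2_def)
   then show ?thesis by eventually_elim (auto simp: powr_eq_0_iff)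
  next
   assume "I3 = 0"
   then have "AE y in M. f y powr p = 0"
    using integral_nonneg_eq_0_iff_AE[OF i3] k f by (simp add: I3_def)
   then show ?thesis by eventually_elim (auto simp: powr_eq_0_iff)
  qed
  then have "(LINT y|M. k y * f y) = 0" by (rule integral_eq_zero_AE)
  then show ?thesis by simp
 next
  case True
  define S where "S = I1 powr \<rho> * I2 powr (1 - 1 / p) * I3 powr (1 - 1 / q)"
  have S: "S > 0" using True by (simp add: S_def)
  let ?w = "%y. S * (\<rho> * (k y powr q * f y powr p / I1) + (1 - 1 / p) * (k y powr q / I2) + (1 - 1 / q) * (f y powr p / I3))"
  have ex: "0 <= \<rho>" "0 <= 1 - 1 / p" "0 <= 1 - 1 / q" using pq by (auto simp: \<rho>_def)
  have le: "k y * f y <= ?w y" for y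
  proof (cases "k y > 0 & f y > 0")
   case False
   then have "k y * f y = 0" using k[of y] f[of y] by auto
   also have "\<dots> <= ?w y" using S True ex by (intro mult_nonneg_nonneg add_nonneg_nonneg) auto
   finally show ?thesis .
  next
   case kf: True
   let ?a = "k y powr q * f y powr p / I1" and ?b = "k y powr q / I2" and ?c = "f y powr p / I3"
   have p0: "p ~= 0" "q ~= 0" using pq by auto
   have "?a powr \<rho> * ?b powr (1 - 1 / p) * ?c powr (1 - 1 / q)
    = ((k y powr q) powr \<rho> * (k y powr q) powr (1 - 1 / p)) * ((f y powr p) powr \<rho> * (f y powr p) powr (1 - 1 / q)) / S"
    using kf True by (simp add: powr_divide powr_mult S_def)
   also have "(k y powr q) powr \<rho> * (k y powr q) powr (1 - 1 / p) = k y powr (q * (\<rho> + (1 - 1 / p)))"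
    by (simp add: powr_powr powr_add[symmetric] distrib_left)
   also have "q * (\<rho> + (1 - 1 / p)) = 1" using p0 by (simp add: \<rho>_def)
   also have "(f y powr p) powr \<rho> * (f y powr p) powr (1 - 1 / q) = f y powr (p * (\<rho> + (1 - 1 / q)))"
    by (simp add: powr_powr powr_add[symmetric] distrib_left)
   also have "p * (\<rho> + (1 - 1 / q)) = 1" using p0 by (simp add: \<rho>_def)
   finally have "k y * f y = S * (?a powr \<rho> * ?b powr (1 - 1 / p) * ?c powr (1 - 1 / q))" using kf S by simp
   also have "\<dots> <= ?w y"
    using kf True ex S by (intro mult_left_mono weighted_AM_GM3) (auto simp: \<rho>_def)
   finally show ?thesis .
  qed
  have iw: "integrable M ?w" by (intro integrable_mult_right Bochner_Integration.integrable_add integrable_divide i1 i2 i3)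
  have "integrable M (%y. k y * f y)"
  proof (rule Bochner_Integration.integrable_bound[OF iw borel_measurable_times[OF m]], rule AE_I2)
   fix y
   have "\<bar>k y * f y\<bar> = k y * f y" using k[of y] f[of y] by simp
   then show "norm (k y * f y) <= norm (?w y)" using le[of y] abs_ge_self[of "?w y"] unfolding real_norm_def by linarith
  qed
  then have "(LINT y|M. k y * f y) <= (LINT y|M. ?w y)" using iw le by (intro integral_mono) auto
  also have "\<dots> = S * (\<rho> * (I1 / I1) + (1 - 1 / p) * (I2 / I2) + (1 - 1 / q) * (I3 / I3))"
   using i1 i2 i3 by (simp add: I1_def I2_def I3_def)
  also have "\<dots> = S" using True by (simp add: \<rho>_def)
  finally show ?thesis by (simp add: S_def I1_def I2_def I3_def \<rho>_def)
 qed
qed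

lemma in_L_top_AE:
 assumes "in_L \<nu> top F"
 shows "AE y in bmeas \<nu>. cmod (F y) <= Lnorm \<nu> top F" and "Lnorm \<nu> top F >= 0"
proof -
 let ?s = "esssup (bmeas \<nu>) (%y. ennreal (cmod (F y)))"
 from assms obtain C where C: "AE y in bmeas \<nu>. cmod (F y) <= C" and m: "F \<in> borel_measurable (bmeas \<nu>)"
  by (auto simp: in_L_def)
 have "?s <= ennreal C"
  using m C by (intro esssup_I) (auto intro: ennreal_leI)
 then have "?s < top" by (rule le_less_trans) simp
 then have s: "?s = ennreal (Lnorm \<nu> top F)" by (simp add: Lnorm_def)
 have "AE y in bmeas \<nu>. ennreal (cmod (F y)) <= ?s" by (rule esssup_AE)
 then show "AE y in bmeas \<nu>. cmod (F y) <= Lnorm \<nu> top F"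
  unfolding s by eventually_elim (simp add: Lnorm_def ennreal_le_iff)
 show "Lnorm \<nu> top F >= 0" by (simp add: Lnorm_def)
qed

lemma in_L_topI:
 assumes m: "F \<in> borel_measurable (bmeas \<nu>)" and C: "AE y in bmeas \<nu>. cmod (F y) <= C" "C >= 0"
 shows "in_L \<nu> top F" "Lnorm \<nu> top F <= C"
proof -
 show "in_L \<nu> top F" using assms by (auto simp: in_L_def)
 have "esssup (bmeas \<nu>) (%y. ennreal (cmod (F y))) <= ennreal C"
  using m C by (intro esssup_I) (auto intro: ennreal_leI)
 then show "Lnorm \<nu> top F <= C"
  using enn2real_mono[of _ "ennreal C"] C by (simp add: Lnorm_def)
qed

lemma Lnorm_nonneg: "Lnorm \<nu> p F >= 0"
 by (simp add: Lnorm_def)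

lemma flow_measurable:
 assumes nu: "\<nu> > - 1/2" and F: "gauss_integrable \<nu> F" and k: "\<kappa> > 0"
 shows "flow \<nu> F \<kappa> \<in> borel_measurable (bmeas \<mu>)"
 by (rule continuous_imp_bessel_measurable[OF continuous_on_heat_integral'[OF nu F]]) (use k in \<open>auto intro: continuous_intros\<close>)

lemma kern_powr_mass:
 assumes nu: "\<nu> > - 1/2" and k: "\<kappa> > 0" and q: "q >= 1"
 shows "integrable (bmeas \<nu>) (%y. kern \<nu> \<kappa> x y powr q)"
  and "(LINT y|bmeas \<nu>. kern \<nu> \<kappa> x y powr q) <= (2 / Gamma (\<nu> + 1) * \<kappa> powr (\<nu> + 1)) powr (q - 1) * q powr - (\<nu> + 1)"
proof -
 let ?A = "(2 / Gamma (\<nu> + 1) * \<kappa> powr (\<nu> + 1)) powr (q - 1) * q powr - (\<nu> + 1)"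
 have qk: "q * \<kappa> > 0" using q k by simp
 have i: "integrable (bmeas \<nu>) (%y. ?A * kern \<nu> (q * \<kappa>) x y)"
  by (intro integrable_mult_right kern_mass(1)[OF nu qk])
 have le: "kern \<nu> \<kappa> x y powr q <= ?A * kern \<nu> (q * \<kappa>) x y" for y
  by (rule kern_powr[OF nu k q])
 have m: "(%y. kern \<nu> \<kappa> x y powr q) \<in> borel_measurable (bmeas \<nu>)"
  using kernel_bessel_measurable[OF nu, of \<kappa> x \<nu>] by measurable
 show i2: "integrable (bmeas \<nu>) (%y. kern \<nu> \<kappa> x y powr q)"
 proof (rule Bochner_Integration.integrable_bound[OF i m], rule AE_I2)
  fix y show "norm (kern \<nu> \<kappa> x y powr q) <= norm (?A * kern \<nu> (q * \<kappa>) x y)"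
  proof -
   have "norm (kern \<nu> \<kappa> x y powr q) = kern \<nu> \<kappa> x y powr q" by simp
   then show ?thesis using le[of y] abs_ge_self[of "?A * kern \<nu> (q * \<kappa>) x y"] unfolding real_norm_def by linarith
  qed
 qed
 have "(LINT y|bmeas \<nu>. kern \<nu> \<kappa> x y powr q) <= (LINT y|bmeas \<nu>. ?A * kern \<nu> (q * \<kappa>) x y)"
  by (rule integral_mono[OF i2 i le])
 also have "\<dots> = ?A" using kern_mass(2)[OF nu qk, of x] by simp
 finally show "(LINT y|bmeas \<nu>. kern \<nu> \<kappa> x y powr q) <= ?A" .
qed

lemma kern_powr_mult_integrable:
 assumes nu: "\<nu> > - 1/2" and k: "\<kappa> > 0" and q: "q >= 0"
  and g: "integrable (bmeas \<nu>) g"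
 shows "integrable (bmeas \<nu>) (%y. kern \<nu> \<kappa> x y powr q * (g y :: real))"
proof -
 let ?c = "2 / Gamma (\<nu> + 1) * \<kappa> powr (\<nu> + 1)"
 have m: "(%y. kern \<nu> \<kappa> x y powr q) \<in> borel_measurable (bmeas \<nu>)"
  using kernel_bessel_measurable[OF nu, of \<kappa> x \<nu>] by measurable
 have i: "integrable (bmeas \<nu>) (%y. ?c powr q * norm (g y))" using g by (intro integrable_mult_right integrable_norm)
 show ?thesis
 proof (rule Bochner_Integration.integrable_bound[OF i borel_measurable_times[OF m borel_measurable_integrable[OF g]]], rule AE_I2)
  fix y
  have "kern \<nu> \<kappa> x y powr q <= ?c powr q"
   by (intro powr_mono2 q kern_nonneg[OF nu] kern_le_const[OF nu k])
  then have "kern \<nu> \<kappa> x y powr q * \<bar>g y\<bar> <= ?c powr q * \<bar>g y\<bar>" by (rule mult_right_mono) simp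
  then show "norm (kern \<nu> \<kappa> x y powr q * g y) <= norm (?c powr q * norm (g y))"
   by (simp add: abs_mult)
 qed
qed

lemma bessel_Young_pointwise:
 assumes nu: "\<nu> > - 1/2" and k: "\<kappa> > 0" and F: "gauss_integrable \<nu> F"
  and pq: "p >= 1" "q >= 1" "1 / p + 1 / q >= 1"
  and i: "integrable (bmeas \<nu>) (%y. cmod (F y) powr p)"
  and A: "A = (2 / Gamma (\<nu> + 1) * \<kappa> powr (\<nu> + 1)) powr (q - 1) * q powr - (\<nu> + 1)"
  and N: "N = (LINT y|bmeas \<nu>. cmod (F y) powr p)"
 shows "cmod (flow \<nu> F \<kappa> x) <= (LINT y|bmeas \<nu>. kern \<nu> \<kappa> x y powr q * cmod (F y) powr p) powr (1 / p + 1 / q - 1)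
     * (A powr (1 - 1 / p) * N powr (1 - 1 / q))"
proof -
 have m: "(%y. cmod (F y)) \<in> borel_measurable (bmeas \<nu>)"
  using gauss_integrable_measurable[OF F] by measurable
 have i1: "integrable (bmeas \<nu>) (%y. kern \<nu> \<kappa> x y powr q * cmod (F y) powr p)"
  using pq by (intro kern_powr_mult_integrable[OF nu k _ i]) auto
 have "cmod (flow \<nu> F \<kappa> x) <= (LINT y|bmeas \<nu>. kern \<nu> \<kappa> x y * cmod (F y))"
  by (rule norm_flow_le_LINT(2)[OF nu F k])
 also have "\<dots> <= (LINT y|bmeas \<nu>. kern \<nu> \<kappa> x y powr q * cmod (F y) powr p) powr (1 / p + 1 / q - 1)
  * (LINT y|bmeas \<nu>. kern \<nu> \<kappa> x y powr q) powr (1 - 1 / p) * N powr (1 - 1 / q)"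
  unfolding N using kern_nonneg[OF nu]
  by (intro Hoelder_Young pq i1 i m kernel_bessel_measurable[OF nu] kern_powr_mass(1)[OF nu k pq(2)]) auto
 also have "\<dots> <= (LINT y|bmeas \<nu>. kern \<nu> \<kappa> x y powr q * cmod (F y) powr p) powr (1 / p + 1 / q - 1)
  * A powr (1 - 1 / p) * N powr (1 - 1 / q)"
  unfolding A using pq kern_powr_mass(2)[OF nu k pq(2), of x]
  by (intro mult_right_mono mult_left_mono powr_mono2) auto
 finally show ?thesis by (simp add: mult.assoc)
qed

lemma bessel_Tonelli:
 assumes nu: "\<nu> > - 1/2" and k: "\<kappa> > 0" and q: "q >= 1"
  and g: "integrable (bmeas \<nu>) g" "!!y. g y >= 0"
  and A: "A = (2 / Gamma (\<nu> + 1) * \<kappa> powr (\<nu> + 1)) powr (q - 1) * q powr - (\<nu> + 1)"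
 shows "integrable (bmeas \<nu>) (%x. LINT y|bmeas \<nu>. kern \<nu> \<kappa> x y powr q * (g y :: real))"
  and "(LINT x|bmeas \<nu>. LINT y|bmeas \<nu>. kern \<nu> \<kappa> x y powr q * g y) <= A * (LINT y|bmeas \<nu>. g y)"
proof -
 let ?M = "bmeas \<nu>" and ?K = "kern \<nu> \<kappa>"
 interpret sigma_finite_measure ?M by (rule sigma_finite_bessel_measure[OF nu])
 interpret P: pair_sigma_finite ?M ?M ..
 have gm: "g \<in> borel_measurable ?M" using g by auto
 have f: "(%z. fst z) \<in> borel_measurable (?M \<Otimes>\<^sub>M ?M)" by (rule measurable_compose[OF measurable_fst id_bessel_measurable])
 have s: "(%z. snd z) \<in> borel_measurable (?M \<Otimes>\<^sub>M ?M)" by (rule measurable_compose[OF measurable_snd id_bessel_measurable])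
 have gs: "(%z. g (snd z)) \<in> borel_measurable (?M \<Otimes>\<^sub>M ?M)" by (rule measurable_compose[OF measurable_snd gm])
 have Km: "(%z. ?K (fst z) (snd z)) \<in> borel_measurable (?M \<Otimes>\<^sub>M ?M)" by (rule kern_measurable[OF nu f s])
 have jm: "(%z. ?K (fst z) (snd z) powr q * g (snd z)) \<in> borel_measurable (?M \<Otimes>\<^sub>M ?M)"
  using Km gs by measurable
 then have jm': "(%(x, y). ennreal (?K x y powr q * g y)) \<in> borel_measurable (?M \<Otimes>\<^sub>M ?M)"
  unfolding case_prod_unfold by measurable
 let ?I = "%x. LINT y|?M. ?K x y powr q * g y"
 have Im: "?I \<in> borel_measurable ?M"
  by (rule borel_measurable_lebesgue_integral) (use jm in \<open>simp add: case_prod_unfold\<close>)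
 have i1: "integrable ?M (%y. ?K x y powr q * g y)" for x
  using q by (intro kern_powr_mult_integrable[OF nu k _ g(1)]) auto
 have A0: "A >= 0" by (simp add: A)
 have "(\<integral>\<^sup>+x. ennreal (?I x) \<partial>?M) = (\<integral>\<^sup>+x. \<integral>\<^sup>+y. ennreal (?K x y powr q * g y) \<partial>?M \<partial>?M)"
  using i1 g by (intro nn_integral_cong nn_integral_eq_integral[symmetric]) auto
 also have "\<dots> = (\<integral>\<^sup>+y. \<integral>\<^sup>+x. ennreal (?K x y powr q * g y) \<partial>?M \<partial>?M)"
  by (rule P.Fubini'[symmetric, OF jm'])
 also have "\<dots> <= (\<integral>\<^sup>+y. ennreal (A * g y) \<partial>?M)"
 proof (rule nn_integral_mono)
  fix y
  have "(\<integral>\<^sup>+x. ennreal (?K x y powr q * g y) \<partial>?M) = ennreal (LINT x|?M. ?K x y powr q * g y)"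
   using kern_powr_mass(1)[OF nu k q, of y] g
   by (intro nn_integral_eq_integral integrable_mult_left) (auto simp: kern_sym[of \<nu> \<kappa> _ y])
  also have "(LINT x|?M. ?K x y powr q * g y) = (LINT x|?M. ?K y x powr q) * g y"
   by (simp add: kern_sym[of \<nu> \<kappa> _ y])
  also have "\<dots> <= A * g y"
   unfolding A using kern_powr_mass(2)[OF nu k q, of y] g by (intro mult_right_mono) auto
  finally show "(\<integral>\<^sup>+x. ennreal (?K x y powr q * g y) \<partial>?M) <= ennreal (A * g y)" by (simp add: ennreal_leI)
 qed
 also have "\<dots> = ennreal (A * (LINT y|?M. g y))"
  using g A0 by (subst nn_integral_eq_integral) auto
 finally have le: "(\<integral>\<^sup>+x. ennreal (?I x) \<partial>?M) <= ennreal (A * (LINT y|?M. g y))" .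
 have I0: "?I x >= 0" for x using g by (intro Bochner_Integration.integral_nonneg) auto
 show ii: "integrable ?M ?I"
  using Im I0 le by (intro integrableI_bounded) (auto simp: order_le_less_trans[OF le])
 have "ennreal (LINT x|?M. ?I x) <= ennreal (A * (LINT y|?M. g y))"
  using le nn_integral_eq_integral[OF ii] I0 by simp
 moreover have "A * (LINT y|?M. g y) >= 0" using A0 g by (intro mult_nonneg_nonneg Bochner_Integration.integral_nonneg) auto
 ultimately show "(LINT x|?M. ?I x) <= A * (LINT y|?M. g y)" by (simp add: ennreal_le_iff)
qed

lemma bessel_Young_finite:
 assumes nu: "\<nu> > - 1/2" and k: "\<kappa> > 0" and F: "gauss_integrable \<nu> F"
  and pqr: "p >= 1" "q >= 1" "r >= 1" "1 / p + 1 / q = 1 + 1 / r"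
  and i: "integrable (bmeas \<nu>) (%y. cmod (F y) powr p)"
  and A: "A = (2 / Gamma (\<nu> + 1) * \<kappa> powr (\<nu> + 1)) powr (q - 1) * q powr - (\<nu> + 1)"
  and N: "N = (LINT y|bmeas \<nu>. cmod (F y) powr p)"
 shows "integrable (bmeas \<nu>) (%x. cmod (flow \<nu> F \<kappa> x) powr r)"
  and "(LINT x|bmeas \<nu>. cmod (flow \<nu> F \<kappa> x) powr r) powr (1 / r) <= A powr (1 / q) * N powr (1 / p)"
proof -
 let ?M = "bmeas \<nu>" and ?P = "flow \<nu> F \<kappa>"
 let ?I = "%x. LINT y|?M. kern \<nu> \<kappa> x y powr q * cmod (F y) powr p"
 define S where "S = A powr (1 - 1 / p) * N powr (1 - 1 / q)"
 have S0: "S >= 0" by (simp add: S_def)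
 have A0: "A > 0" using Gamma_Suc_pos[OF nu] k pqr by (simp add: A)
 have N0: "N >= 0" unfolding N by (intro Bochner_Integration.integral_nonneg) auto
 have ii: "integrable ?M ?I" "(LINT x|?M. ?I x) <= A * N"
  unfolding N by (rule bessel_Tonelli[OF nu k pqr(2) i _ A]; simp)+
 have rho: "1 / p + 1 / q - 1 = 1 / r" using pqr by simp
 have I0: "?I x >= 0" for x by (intro Bochner_Integration.integral_nonneg) auto
 have le: "cmod (?P x) powr r <= ?I x * S powr r" for x
 proof -
  have "cmod (?P x) powr r <= (?I x powr (1 / r) * S) powr r"
   using bessel_Young_pointwise[OF nu k F pqr(1,2) _ i A N, of x] pqr
   by (intro powr_mono2) (auto simp: rho S_def)
  also have "\<dots> = ?I x * S powr r" using I0[of x] pqr by (simp add: powr_mult powr_powr)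
  finally show ?thesis .
 qed
 have iS: "integrable ?M (%x. ?I x * S powr r)" using ii by (intro integrable_mult_left) auto
 have m: "(%x. cmod (?P x) powr r) \<in> borel_measurable ?M"
  using flow_measurable[OF nu F k, of \<nu>] by measurable
 show i2: "integrable ?M (%x. cmod (?P x) powr r)"
 proof (rule Bochner_Integration.integrable_bound[OF iS m], rule AE_I2)
  fix x show "norm (cmod (?P x) powr r) <= norm (?I x * S powr r)"
   using le[of x] I0[of x] by (simp add: abs_mult)
 qed
 have "(LINT x|?M. cmod (?P x) powr r) <= (LINT x|?M. ?I x * S powr r)" by (rule integral_mono[OF i2 iS le])
 also have "\<dots> = (LINT x|?M. ?I x) * S powr r" by simp
 also have "\<dots> <= A * N * S powr r" using ii(2) by (intro mult_right_mono) auto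
 finally have "(LINT x|?M. cmod (?P x) powr r) powr (1 / r) <= (A * N * S powr r) powr (1 / r)"
  using pqr by (intro powr_mono2 Bochner_Integration.integral_nonneg) auto
 also have "\<dots> = A powr (1 / r) * N powr (1 / r) * S"
  using A0 N0 S0 pqr by (simp add: powr_mult powr_powr)
 also have "\<dots> = (A powr (1 / r) * A powr (1 - 1 / p)) * (N powr (1 / r) * N powr (1 - 1 / q))" by (simp add: S_def)
 also have "\<dots> = A powr (1 / q) * N powr (1 / p)"
 proof -
  have "1 / r + (1 - 1 / p) = 1 / q" "1 / r + (1 - 1 / q) = 1 / p" using pqr by auto
  then show ?thesis by (simp only: powr_add[symmetric])
 qed
 finally show "(LINT x|?M. cmod (?P x) powr r) powr (1 / r) <= A powr (1 / q) * N powr (1 / p)" .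
qed

lemma flow_powr_contraction:
 assumes nu: "\<nu> > - 1/2" and k: "\<kappa> > 0" and F: "gauss_integrable \<nu> F" and p: "p >= 1"
  and i: "integrable (bmeas \<nu>) (%y. cmod (F y) powr p)"
 shows "integrable (bmeas \<nu>) (%x. cmod (flow \<nu> F \<kappa> x) powr p)"
  and "(LINT x|bmeas \<nu>. cmod (flow \<nu> F \<kappa> x) powr p) <= (LINT y|bmeas \<nu>. cmod (F y) powr p)"
proof -
 have c: "2 / Gamma (\<nu> + 1) * \<kappa> powr (\<nu> + 1) > 0" using Gamma_Suc_pos[OF nu] k by simp
 have "c powr (1 - 1) * 1 powr - (\<nu> + 1) = 1" if "c > 0" for c using that by simp
 note A1 = this[OF c]
 have "1 / p + 1 / 1 = 1 + 1 / p" by simp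
 note Y = bessel_Young_finite[OF nu k F p order_refl p this i refl refl, unfolded A1]
 show "integrable (bmeas \<nu>) (%x. cmod (flow \<nu> F \<kappa> x) powr p)" by (rule Y(1))
 let ?a = "LINT x|bmeas \<nu>. cmod (flow \<nu> F \<kappa> x) powr p" and ?b = "LINT y|bmeas \<nu>. cmod (F y) powr p"
 have nn: "?a >= 0" "?b >= 0" by (auto intro!: Bochner_Integration.integral_nonneg)
 have "?a powr (1 / p) <= ?b powr (1 / p)" using Y(2) by simp
 from powr_mono2[OF _ _ this] have "(?a powr (1 / p)) powr p <= (?b powr (1 / p)) powr p" using p by simp
 moreover have "(?a powr (1 / p)) powr p = ?a" "(?b powr (1 / p)) powr p = ?b" using p nn by (simp_all add: powr_powr)
 ultimately show "?a <= ?b" by linarith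
qed

lemma enn2real_inverse_exponents:
 fixes p q r :: ennreal
 assumes "1 <= p" "1 <= q" "1 <= r" "1 / p + 1 / q = 1 + 1 / r"
 shows "enn2real (1 / p) + enn2real (1 / q) = 1 + enn2real (1 / r)"
proof -
 have f: "1 / x < top" if "1 <= x" for x :: ennreal
 proof -
  have "1 / x <= 1" using that by (metis divide_le_posI_ennreal ennreal_zero_less_one less_le_trans mult.right_neutral)
  then show ?thesis by (rule le_less_trans) simp
 qed
 have "enn2real (1 / p + 1 / q) = enn2real (1 + 1 / r)" using assms(4) by simp
 then show ?thesis
  using enn2real_plus[OF f[OF assms(1)] f[OF assms(2)]] enn2real_plus[of 1 "1 / r"] f[OF assms(3)] by simp
qed

lemma enn2real_one_divide: "p ~= top ==> 1 <= p ==> enn2real (1 / p) = 1 / enn2real p"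
proof (cases p)
 case (real x)
 assume "1 <= p"
 then have x: "x >= 1" using real by (simp flip: ennreal_1)
 then have "1 / p = ennreal (1 / x)" using divide_ennreal[of 1 x] real by simp
 then show ?thesis using x real by simp
qed simp

lemma ennreal_exponent_cases:
 fixes p :: ennreal
 assumes "1 <= p"
 obtains "p = top" "enn2real (1 / p) = 0" | x where "p = ennreal x" "x >= 1" "enn2real p = x" "enn2real (1 / p) = 1 / x"
proof (cases p)
 case (real x)
 then have "x >= 1" using assms by (simp add: ennreal_1[symmetric] del: ennreal_1)
 then show ?thesis using real that(2)[of x] enn2real_one_divide[of p] assms by auto
qed (use that(1) in simp)

text \<open>The constant is the \<open>L\<^sup>q\<close> norm of the heat kernel.\<close>

lemma flow_Lp_Lr:
 assumes nu: "\<nu> > - 1/2" and k: "\<kappa> > 0"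
  and pqr: "1 <= p" "1 <= q" "1 <= r" "1 / p + 1 / q = 1 + 1 / r" and F: "in_L \<nu> p F"
 shows "in_L \<nu> r (flow \<nu> F \<kappa>)"
  and "Lnorm \<nu> r (flow \<nu> F \<kappa>) <= (2 / Gamma (\<nu> + 1) * \<kappa> powr (\<nu> + 1)) powr (1 - enn2real (1 / q))
     * (if q = top then 1 else enn2real q powr (- (\<nu> + 1) / enn2real q)) * Lnorm \<nu> p F"
proof -
 let ?P = "flow \<nu> F \<kappa>"
 define c where "c = 2 / Gamma (\<nu> + 1) * \<kappa> powr (\<nu> + 1)"
 have c: "c > 0" using Gamma_Suc_pos[OF nu] k by (simp add: c_def)
 have G: "gauss_integrable \<nu> F" by (rule in_L_imp_gauss_integrable[OF nu pqr(1) F])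
 note m = flow_measurable[OF nu G k, of \<nu>]
 note ex = enn2real_inverse_exponents[OF pqr]
 have sup: "in_L \<nu> top ?P & Lnorm \<nu> top ?P <= B" if "!!x. cmod (?P x) <= B" for B
  using in_L_topI[OF m, of B] that[of 0] by (auto intro: that order_trans[OF norm_ge_zero])
 have goal: "in_L \<nu> r ?P & Lnorm \<nu> r ?P <= c powr (1 - enn2real (1 / q))
     * (if q = top then 1 else enn2real q powr (- (\<nu> + 1) / enn2real q)) * Lnorm \<nu> p F"
 proof (cases rule: ennreal_exponent_cases[OF pqr(1)])
  case 1
  note p = this
  have "r = top & q = 1"
  proof (cases rule: ennreal_exponent_cases[OF pqr(2)])
   case 1
   then show ?thesis using ex p by (simp add: add_nonneg_eq_0_iff)
  next
   case (2 y)
   show ?thesis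
   proof (cases rule: ennreal_exponent_cases[OF pqr(3)])
    case 1
    then have "1 / y = 1" using ex p 2 by simp
    then show ?thesis using 1 2 by (simp add: ennreal_1)
   next
    case (2 z)
    have "1 / y <= 1" "1 / z > 0" using \<open>y >= 1\<close> 2 by auto
    then show ?thesis using ex p 2 \<open>enn2real (1 / q) = 1 / y\<close> by simp
   qed
  qed
  moreover have "cmod (?P x) <= Lnorm \<nu> top F" for x
   using in_L_top_AE(1) F p by (intro norm_flow_le_sup[OF nu G k]) auto
  moreover have "enn2real (1 / q) = 1" using ex p calculation by simp
  ultimately show ?thesis using sup[of "Lnorm \<nu> top F"] p c by simp
 next
  case (2 x)
  note p = this
  have pi: "integrable (bmeas \<nu>) (%y. cmod (F y) powr x)" using F p by (auto simp: in_L_def)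
  have LF: "Lnorm \<nu> p F = (LINT y|bmeas \<nu>. cmod (F y) powr x) powr (1 / x)" using p by (simp add: Lnorm_def)
  show ?thesis
  proof (cases rule: ennreal_exponent_cases[OF pqr(2)])
   case 1
   note q = this
   have xr: "1 / x = 1 + enn2real (1 / r)" using ex p q by simp
   have "1 / x <= 1" using p by simp
   then have x1: "x = 1" and r0: "enn2real (1 / r) = 0" using xr enn2real_nonneg[of "1 / r"] p by (auto simp: field_simps)
   have r: "r = top" by (cases rule: ennreal_exponent_cases[OF pqr(3)]) (use r0 in auto)
   have "cmod (?P z) <= c * Lnorm \<nu> p F" for z
   proof -
    have i1: "integrable (bmeas \<nu>) (%y. cmod (F y))" using pi x1 by simp
    have "cmod (?P z) <= (LINT y|bmeas \<nu>. kern \<nu> \<kappa> z y * cmod (F y))"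
     by (rule norm_flow_le_LINT(2)[OF nu G k])
    also have "\<dots> <= (LINT y|bmeas \<nu>. c * cmod (F y))"
     by (intro integral_mono norm_flow_le_LINT(1)[OF nu G k] integrable_mult_right i1 mult_right_mono kern_le_const[OF nu k, folded c_def]) auto
    also have "\<dots> = c * Lnorm \<nu> p F"
     using LF x1 Bochner_Integration.integral_nonneg[of "bmeas \<nu>" "%y. cmod (F y)"] by simp
    finally show ?thesis .
   qed
   then show ?thesis using sup[of "c * Lnorm \<nu> p F"] r q c by simp
  next
   case (2 y)
   note q = this
   let ?A = "c powr (y - 1) * y powr - (\<nu> + 1)" and ?N = "LINT y|bmeas \<nu>. cmod (F y) powr x"
   have Aq: "?A powr (1 / y) = c powr (1 - 1 / y) * y powr (- (\<nu> + 1) / y)"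
   proof -
    have "?A powr (1 / y) = c powr ((y - 1) * (1 / y)) * y powr (- (\<nu> + 1) * (1 / y))"
     by (simp add: powr_mult powr_powr)
    also have "(y - 1) * (1 / y) = 1 - 1 / y" using q by (simp add: field_simps)
    finally show ?thesis by simp
   qed
   show ?thesis
   proof (cases rule: ennreal_exponent_cases[OF pqr(3)])
    case 1
    have xy: "1 / x + 1 / y - 1 = 0" using ex p q 1 by simp
    then have xy': "1 - 1 / x = 1 / y" "1 - 1 / y = 1 / x" by auto
    have "cmod (?P z) <= ?A powr (1 / y) * Lnorm \<nu> p F" for z
    proof -
     have "cmod (?P z) <= (LINT y'|bmeas \<nu>. kern \<nu> \<kappa> z y' powr y * cmod (F y') powr x) powr (1 / x + 1 / y - 1)
       * (?A powr (1 - 1 / x) * ?N powr (1 - 1 / y))"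
      using xy by (intro bessel_Young_pointwise[OF nu k G p(2) q(2) _ pi _ refl]) (auto simp: c_def)
     also have "\<dots> <= 1 * (?A powr (1 - 1 / x) * ?N powr (1 - 1 / y))"
      unfolding xy by (intro mult_right_mono) auto
     also have "\<dots> = ?A powr (1 / y) * Lnorm \<nu> p F" unfolding xy' LF by simp
     finally show ?thesis .
    qed
    note * = this[unfolded Aq]
    show ?thesis using sup[OF *] 1 q by simp
   next
    case (2 z)
    have pqr': "1 / x + 1 / y = 1 + 1 / z" using ex p q 2 by simp
    note Y = bessel_Young_finite[OF nu k G p(2) q(2) 2(2) pqr' pi refl refl, folded c_def]
    have Lr: "Lnorm \<nu> r ?P = (LINT x|bmeas \<nu>. cmod (?P x) powr z) powr (1 / z)"
     using 2 by (simp add: Lnorm_def)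
    have "in_L \<nu> r ?P" using Y(1) m 2 by (simp add: in_L_def)
    moreover have "Lnorm \<nu> r ?P <= c powr (1 - 1 / y) * y powr (- (\<nu> + 1) / y) * Lnorm \<nu> p F"
     using Y(2) unfolding LF Lr Aq .
    ultimately show ?thesis using q by simp
   qed
  qed
 qed
 from goal show "in_L \<nu> r ?P" by blast
 from goal show "Lnorm \<nu> r ?P <= (2 / Gamma (\<nu> + 1) * \<kappa> powr (\<nu> + 1)) powr (1 - enn2real (1 / q))
     * (if q = top then 1 else enn2real q powr (- (\<nu> + 1) / enn2real q)) * Lnorm \<nu> p F" unfolding c_def by blast
qed

lemma heat_semigroup_Lp_Lr:
 assumes nu: "\<nu> > - 1/2" and sigma: "\<sigma> > 0" and t: "t > 0"
  and pqr: "1 <= p" "1 <= q" "1 <= r" "1 / p + 1 / q = 1 + 1 / r" and f: "in_L \<nu> p f"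
 shows "in_L \<nu> r (heat_semigroup \<nu> \<sigma> a b t f)"
  and "Lnorm \<nu> r (heat_semigroup \<nu> \<sigma> a b t f) <= ((4 * \<sigma> * t) powr (\<nu> + 1) * Gamma (\<nu> + 1) / 2) powr (enn2real (1 / q) - 1)
      * (if q = top then 1 else enn2real q powr (- (\<nu> + 1) / enn2real q)) * Lnorm \<nu> p f"
proof -
 let ?F = "%y. chirp (a / b) y * f y" and ?k = "1 / (4 * \<sigma> * t)"
 let ?d = "(4 * \<sigma> * t) powr (\<nu> + 1) * Gamma (\<nu> + 1) / 2"
 have k: "?k > 0" using sigma t by simp
 have F: "in_L \<nu> p ?F" using f by simp
 have e: "heat_semigroup \<nu> \<sigma> a b t f = (%x. chirp (- (a / b)) x * flow \<nu> ?F ?k x)"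
  using heat_semigroup_eq[OF nu sigma t] by auto
 note B = flow_Lp_Lr[OF nu k pqr F]
 have d: "?d > 0" using Gamma_Suc_pos[OF nu] sigma t by simp
 have "2 / Gamma (\<nu> + 1) * ?k powr (\<nu> + 1) = 1 / ?d"
  using sigma t by (simp add: powr_divide)
 then have "(2 / Gamma (\<nu> + 1) * ?k powr (\<nu> + 1)) powr (1 - enn2real (1 / q)) = ?d powr (enn2real (1 / q) - 1)"
 proof -
  have "(1 / D) powr (1 - e) = D powr (e - 1)" if "D > 0" for D e :: real
   using powr_minus[of D "1 - e"] that by (simp add: powr_divide inverse_eq_divide)
  then show ?thesis using d \<open>_ = 1 / ?d\<close> by (simp only:)
 qed
 then show "Lnorm \<nu> r (heat_semigroup \<nu> \<sigma> a b t f) <= ?d powr (enn2real (1 / q) - 1)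
      * (if q = top then 1 else enn2real q powr (- (\<nu> + 1) / enn2real q)) * Lnorm \<nu> p f"
  using B(2) unfolding e Lnorm_chirp by (simp only:)
 show "in_L \<nu> r (heat_semigroup \<nu> \<sigma> a b t f)" unfolding e using B(1) by simp
qed

section \<open>Attainment of the initial value\<close>

lemma norm_add_powr_le:
 fixes a b :: "'a :: real_normed_vector"
 assumes p: "p >= 1"
 shows "norm (a + b) powr p <= 2 powr p * (norm a powr p + norm b powr p)"
proof -
 have "norm (a + b) <= 2 * max (norm a) (norm b)" using norm_triangle_ineq[of a b] by linarith
 then have "norm (a + b) powr p <= (2 * max (norm a) (norm b)) powr p" using p by (intro powr_mono2) auto
 also have "\<dots> = 2 powr p * max (norm a) (norm b) powr p" by (simp only: powr_mult)
 also have "max (norm a) (norm b) powr p <= norm a powr p + norm b powr p" by (auto simp: max_def)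
 finally show ?thesis by (simp add: mult_left_mono)
qed

definition Lp_fun :: "real => real => (real => complex) => bool" where
 "Lp_fun \<nu> p F \<longleftrightarrow> F \<in> borel_measurable (bmeas \<nu>) & integrable (bmeas \<nu>) (%y. cmod (F y) powr p)"

definition Lp_int :: "real => real => (real => complex) => real" where
 "Lp_int \<nu> p F = (LINT y|bmeas \<nu>. cmod (F y) powr p)"

text \<open>Shown first for indicator functions of open sets of finite measure and extended by
approximation.\<close>

definition attains :: "real => real => (real => complex) => bool" where
 "attains \<nu> p F \<longleftrightarrow> Lp_fun \<nu> p F & ((%\<kappa>. Lp_int \<nu> p (%x. flow \<nu> F \<kappa> x - F x)) \<longlongrightarrow> 0) at_top"

lemma Lp_fun_iff_in_L: "p >= 1 ==> Lp_fun \<nu> p F \<longleftrightarrow> in_L \<nu> (ennreal p) F"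
 by (simp add: Lp_fun_def in_L_def)

lemma Lp_fun_gauss: "\<nu> > - 1/2 ==> p >= 1 ==> Lp_fun \<nu> p F ==> gauss_integrable \<nu> F"
 using in_L_imp_gauss_integrable[of \<nu> "ennreal p" F] by (simp add: Lp_fun_iff_in_L flip: ennreal_1)

lemma Lp_fun_add:
 assumes p: "p >= 1" and F: "Lp_fun \<nu> p F" and G: "Lp_fun \<nu> p G"
 shows "Lp_fun \<nu> p (%x. F x + G x)" "Lp_int \<nu> p (%x. F x + G x) <= 2 powr p * (Lp_int \<nu> p F + Lp_int \<nu> p G)"
proof -
 note [measurable] = F[unfolded Lp_fun_def, THEN conjunct1] G[unfolded Lp_fun_def, THEN conjunct1]
 have i: "integrable (bmeas \<nu>) (%y. 2 powr p * (cmod (F y) powr p + cmod (G y) powr p))"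
  using F G by (intro integrable_mult_right Bochner_Integration.integrable_add) (auto simp: Lp_fun_def)
 have i2: "integrable (bmeas \<nu>) (%y. cmod (F y + G y) powr p)"
 proof (rule Bochner_Integration.integrable_bound[OF i])
  show "(%y. cmod (F y + G y) powr p) \<in> borel_measurable (bmeas \<nu>)" by measurable
  show "AE y in bmeas \<nu>. norm (cmod (F y + G y) powr p) <= norm (2 powr p * (cmod (F y) powr p + cmod (G y) powr p))"
   using norm_add_powr_le[OF p] by (intro AE_I2) (simp add: abs_mult)
 qed
 have m: "(%x. F x + G x) \<in> borel_measurable (bmeas \<nu>)" by measurable
 show "Lp_fun \<nu> p (%x. F x + G x)" using i2 m by (simp add: Lp_fun_def)
 have "Lp_int \<nu> p (%x. F x + G x) <= (LINT y|bmeas \<nu>. 2 powr p * (cmod (F y) powr p + cmod (G y) powr p))"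
  unfolding Lp_int_def by (rule integral_mono[OF i2 i norm_add_powr_le[OF p]])
 also have "\<dots> = 2 powr p * (Lp_int \<nu> p F + Lp_int \<nu> p G)"
  using F G by (simp add: Lp_int_def Lp_fun_def)
 finally show "Lp_int \<nu> p (%x. F x + G x) <= 2 powr p * (Lp_int \<nu> p F + Lp_int \<nu> p G)" .
qed

lemma Lp_fun_cmult:
 assumes "Lp_fun \<nu> p F"
 shows "Lp_fun \<nu> p (%x. c * F x)" "Lp_int \<nu> p (%x. c * F x) = cmod c powr p * Lp_int \<nu> p F"
 using assms by (auto simp: Lp_fun_def Lp_int_def norm_mult powr_mult intro!: borel_measurable_times)

lemma Lp_fun_diff:
 assumes p: "p >= 1" and F: "Lp_fun \<nu> p F" and G: "Lp_fun \<nu> p G"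
 shows "Lp_fun \<nu> p (%x. F x - G x)" "Lp_int \<nu> p (%x. F x - G x) <= 2 powr p * (Lp_int \<nu> p F + Lp_int \<nu> p G)"
 using Lp_fun_add[OF p F Lp_fun_cmult(1)[OF G, of "- 1"]] Lp_fun_cmult(2)[OF G, of "- 1"] by auto

lemma Lp_int_nonneg: "Lp_int \<nu> p F >= 0"
 by (simp add: Lp_int_def)

lemma flow_add:
 assumes "\<nu> > - 1/2" "gauss_integrable \<nu> F" "gauss_integrable \<nu> G" "\<kappa> > 0"
 shows "flow \<nu> (%y. F y + G y) \<kappa> x = flow \<nu> F \<kappa> x + flow \<nu> G \<kappa> x"
 using kernel_integrand_integrable[OF assms(1,2,4), of 0 0 x] kernel_integrand_integrable[OF assms(1,3,4), of 0 0 x]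
 by (simp add: heat_integral_def distrib_left)

lemma flow_cmult: "flow \<nu> (%y. c * F y) \<kappa> x = c * flow \<nu> F \<kappa> x"
 by (simp only: heat_integral_def mult.left_commute[of _ c] integral_mult_right_zero)

lemma flow_diff:
 assumes "\<nu> > - 1/2" "gauss_integrable \<nu> F" "gauss_integrable \<nu> G" "\<kappa> > 0"
 shows "flow \<nu> (%y. F y - G y) \<kappa> x = flow \<nu> F \<kappa> x - flow \<nu> G \<kappa> x"
 using kernel_integrand_integrable[OF assms(1,2,4), of 0 0 x] kernel_integrand_integrable[OF assms(1,3,4), of 0 0 x]
 by (simp add: heat_integral_def right_diff_distrib)

lemma flow_Lp:
 assumes nu: "\<nu> > - 1/2" and p: "p >= 1" and F: "Lp_fun \<nu> p F" and k: "\<kappa> > 0"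
 shows "Lp_fun \<nu> p (flow \<nu> F \<kappa>)" "Lp_int \<nu> p (flow \<nu> F \<kappa>) <= Lp_int \<nu> p F"
 using flow_powr_contraction[OF nu k Lp_fun_gauss[OF nu p F] p] flow_measurable[OF nu Lp_fun_gauss[OF nu p F] k, of \<nu>] F
 by (auto simp: Lp_fun_def Lp_int_def)

lemma attains_add:
 assumes nu: "\<nu> > - 1/2" and p: "p >= 1" and F: "attains \<nu> p F" and G: "attains \<nu> p G"
 shows "attains \<nu> p (%x. F x + G x)"
proof -
 have LF: "Lp_fun \<nu> p F" and LG: "Lp_fun \<nu> p G" using F G by (auto simp: attains_def)
 let ?E = "%F \<kappa>. Lp_int \<nu> p (%x. flow \<nu> F \<kappa> x - F x)"
 have "((%\<kappa>. ?E (%x. F x + G x) \<kappa>) \<longlongrightarrow> 0) at_top"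
 proof (rule real_tendsto_sandwich[of "%_. 0"])
  have "((%\<kappa>. 2 powr p * (?E F \<kappa> + ?E G \<kappa>)) \<longlongrightarrow> 2 powr p * (0 + 0)) at_top"
   using F G by (intro tendsto_intros) (auto simp: attains_def)
  then show "((%\<kappa>. 2 powr p * (?E F \<kappa> + ?E G \<kappa>)) \<longlongrightarrow> 0) at_top" by simp
  show "\<forall>\<^sub>F \<kappa> in at_top. ?E (%x. F x + G x) \<kappa> <= 2 powr p * (?E F \<kappa> + ?E G \<kappa>)"
  proof (rule eventually_mono[OF eventually_gt_at_top[of 0]])
   fix \<kappa> :: real assume k: "\<kappa> > 0"
   have "(%x. flow \<nu> (%x. F x + G x) \<kappa> x - (F x + G x)) = (%x. (flow \<nu> F \<kappa> x - F x) + (flow \<nu> G \<kappa> x - G x))"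
    using flow_add[OF nu Lp_fun_gauss[OF nu p LF] Lp_fun_gauss[OF nu p LG] k] by auto
   then show "?E (%x. F x + G x) \<kappa> <= 2 powr p * (?E F \<kappa> + ?E G \<kappa>)"
    using Lp_fun_add(2)[OF p Lp_fun_diff(1)[OF p flow_Lp(1)[OF nu p LF k] LF] Lp_fun_diff(1)[OF p flow_Lp(1)[OF nu p LG k] LG]]
    by (simp only:)
  qed
 qed (auto simp: Lp_int_nonneg)
 then show ?thesis using Lp_fun_add(1)[OF p LF LG] by (simp add: attains_def)
qed

lemma attains_cmult:
 assumes "attains \<nu> p F"
 shows "attains \<nu> p (%x. c * F x)"
proof -
 have LF: "Lp_fun \<nu> p F" and lim: "((%\<kappa>. Lp_int \<nu> p (%x. flow \<nu> F \<kappa> x - F x)) \<longlongrightarrow> 0) at_top"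
  using assms by (auto simp: attains_def)
 have "Lp_int \<nu> p (%x. flow \<nu> (%x. c * F x) \<kappa> x - c * F x) = cmod c powr p * Lp_int \<nu> p (%x. flow \<nu> F \<kappa> x - F x)" for \<kappa>
  by (simp add: flow_cmult Lp_int_def right_diff_distrib[symmetric] norm_mult powr_mult)
 then show ?thesis using Lp_fun_cmult(1)[OF LF] tendsto_mult_right_zero[OF lim] by (simp add: attains_def)
qed

lemma attains_limit:
 assumes nu: "\<nu> > - 1/2" and p: "p >= 1" and F: "Lp_fun \<nu> p F"
  and approx: "!!e. e > 0 ==> \<exists>G. attains \<nu> p G & Lp_int \<nu> p (%x. F x - G x) <= e"
 shows "attains \<nu> p F"
proof -
 let ?E = "%F \<kappa>. Lp_int \<nu> p (%x. flow \<nu> F \<kappa> x - F x)"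
 have "((%\<kappa>. ?E F \<kappa>) \<longlongrightarrow> 0) at_top"
 proof (rule tendstoI)
  fix e :: real assume e: "e > 0"
  define c where "c = 2 powr p"
  have c: "c > 0" by (simp add: c_def)
  define e' where "e' = e / (4 * (c * c))"
  have e': "e' > 0" using e c by (simp add: e'_def)
  obtain G where G: "attains \<nu> p G" "Lp_int \<nu> p (%x. F x - G x) <= e' / (1 + c)"
   using approx[of "e' / (1 + c)"] e' c by auto
  have LG: "Lp_fun \<nu> p G" using G by (simp add: attains_def)
  note LD = Lp_fun_diff(1)[OF p F LG]
  have d: "(1 + c) * Lp_int \<nu> p (%x. F x - G x) <= e'" using G(2) c by (simp add: field_simps)
  have "\<forall>\<^sub>F \<kappa> in at_top. ?E G \<kappa> < e'"
   using G(1) e' unfolding attains_def by (intro order_tendstoD) auto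
  then show "\<forall>\<^sub>F \<kappa> in at_top. dist (?E F \<kappa>) 0 < e"
   using eventually_gt_at_top[of 0]
  proof eventually_elim
   case (elim \<kappa>)
   note k = elim(2)
   let ?A = "flow \<nu> (%x. F x - G x) \<kappa>" and ?B = "%x. flow \<nu> G \<kappa> x - G x" and ?C = "%x. F x - G x"
   have eq: "(%x. flow \<nu> F \<kappa> x - F x) = (%x. (?A x - ?C x) + ?B x)"
    using flow_diff[OF nu Lp_fun_gauss[OF nu p F] Lp_fun_gauss[OF nu p LG] k] by auto
   note LA = flow_Lp[OF nu p LD k]
   note LB = Lp_fun_diff(1)[OF p flow_Lp(1)[OF nu p LG k] LG]
   have "?E F \<kappa> <= c * (Lp_int \<nu> p (%x. ?A x - ?C x) + ?E G \<kappa>)"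
    unfolding eq c_def by (rule Lp_fun_add(2)[OF p Lp_fun_diff(1)[OF p LA(1) LD] LB])
   also have "\<dots> <= c * (c * (Lp_int \<nu> p ?A + Lp_int \<nu> p ?C) + ?E G \<kappa>)"
    using c Lp_fun_diff(2)[OF p LA(1) LD] by (intro mult_left_mono add_right_mono) (auto simp: c_def)
   also have "\<dots> <= c * (c * (2 * Lp_int \<nu> p ?C) + e')"
    using c LA(2) elim by (intro mult_left_mono add_mono) auto
   also have "\<dots> <= c * (c * (2 * e') + c * e')"
   proof -
    have "Lp_int \<nu> p ?C <= (1 + c) * Lp_int \<nu> p ?C" using c Lp_int_nonneg[of \<nu> p ?C] by (simp add: mult_left_le_one_le distrib_right)
    then have "Lp_int \<nu> p ?C <= e'" using d by linarith
    moreover have "1 <= c" using p by (simp add: c_def ge_one_powr_ge_zero)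
    then have "e' <= c * e'" using e' by simp
    ultimately show ?thesis using c by (intro mult_left_mono add_mono) auto
   qed
   also have "\<dots> = 3 * (c * c) * e'" by (simp add: algebra_simps)
   also have "\<dots> < e" using e c by (simp add: e'_def)
   finally show ?case using Lp_int_nonneg by (simp add: dist_real_def)
  qed
 qed
 then show ?thesis using F by (simp add: attains_def)
qed

lemma exp_neg_tendsto_0:
 assumes "c > (0::real)"
 shows "((%\<kappa>. exp (- (\<kappa> / 2) * c)) \<longlongrightarrow> 0) at_top"
proof -
 have "filterlim (%\<kappa>. (c / 2) * \<kappa>) at_top at_top"
  using assms by (intro filterlim_tendsto_pos_mult_at_top[OF tendsto_const _ filterlim_ident]) auto
 then have "((%\<kappa>. exp (- ((c / 2) * \<kappa>))) \<longlongrightarrow> 0) at_top"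
  by (intro filterlim_compose[OF exp_at_bot] filterlim_uminus_at_top[THEN iffD1])
 then show ?thesis by (simp add: mult.commute)
qed

lemma flow_tendsto_bounded:
 assumes nu: "\<nu> > - 1/2" and F: "gauss_integrable \<nu> F" and x: "x >= 0"
  and B: "AE y in bmeas \<nu>. cmod (F y) <= B"
  and near: "!!\<epsilon>. \<epsilon> > 0 ==> \<exists>\<delta>>0. AE y in bmeas \<nu>. \<bar>y - x\<bar> < \<delta> --> cmod (F y - z) <= \<epsilon>"
 shows "((%\<kappa>. flow \<nu> F \<kappa> x) \<longlongrightarrow> z) at_top"
proof (rule tendstoI)
 fix e :: real assume e: "e > 0"
 obtain \<delta> where \<delta>: "\<delta> > 0" "AE y in bmeas \<nu>. \<bar>y - x\<bar> < \<delta> --> cmod (F y - z) <= e / 2"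
  using near[of "e / 2"] e by auto
 have "((%\<kappa>. 2 powr (\<nu> + 1) * exp (- (\<kappa> / 2) * \<delta>\<^sup>2) * (B + cmod z)) \<longlongrightarrow> 2 powr (\<nu> + 1) * 0 * (B + cmod z)) at_top"
  using \<delta> by (intro tendsto_intros exp_neg_tendsto_0) auto
 then have "\<forall>\<^sub>F \<kappa> in at_top. 2 powr (\<nu> + 1) * exp (- (\<kappa> / 2) * \<delta>\<^sup>2) * (B + cmod z) < e / 2"
  using e by (intro order_tendstoD) auto
 then show "\<forall>\<^sub>F \<kappa> in at_top. dist (flow \<nu> F \<kappa> x) z < e"
  using eventually_gt_at_top[of 0]
 proof eventually_elim
  case (elim \<kappa>)
  then have k2: "\<kappa> / 2 > 0" by simp
  have "(LINT y|bmeas \<nu>. kern \<nu> (\<kappa> / 2) x y * cmod (F y)) <= (LINT y|bmeas \<nu>. kern \<nu> (\<kappa> / 2) x y * B)"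
  proof (rule integral_mono_AE)
   show "AE y in bmeas \<nu>. kern \<nu> (\<kappa> / 2) x y * cmod (F y) <= kern \<nu> (\<kappa> / 2) x y * B"
    using B by eventually_elim (intro mult_left_mono kern_nonneg[OF nu])
  qed (use norm_flow_le_LINT(1)[OF nu F k2] kern_mass[OF nu k2] in auto)
  also have "\<dots> = B" using kern_mass[OF nu k2, of x] by simp
  finally have "2 powr (\<nu> + 1) * exp (- (\<kappa> / 2) * \<delta>\<^sup>2) * ((LINT y|bmeas \<nu>. kern \<nu> (\<kappa> / 2) x y * cmod (F y)) + cmod z)
   <= 2 powr (\<nu> + 1) * exp (- (\<kappa> / 2) * \<delta>\<^sup>2) * (B + cmod z)"
   by (intro mult_left_mono add_right_mono) auto
  then have "cmod (flow \<nu> F \<kappa> x - z) <= e / 2 + 2 powr (\<nu> + 1) * exp (- (\<kappa> / 2) * \<delta>\<^sup>2) * (B + cmod z)"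
   using flow_near[OF nu F elim(2) x \<delta>(1) _ \<delta>(2)] e by linarith
  then show ?case using elim(1) by (simp add: dist_norm)
 qed
qed

lemma indicator_Lp_fun:
 assumes p: "p >= 1" and S: "S \<inter> {0..} \<in> sets (bmeas \<nu>)" and fin: "emeasure (bmeas \<nu>) (S \<inter> {0..}) < \<infinity>"
 shows "Lp_fun \<nu> p (indicator S)" "Lp_int \<nu> p (indicator S) = measure (bmeas \<nu>) (S \<inter> {0..})"
proof -
 let ?M = "bmeas \<nu>"
 have e: "cmod (indicator S y) powr p = indicator (S \<inter> {0..}) y" if "y \<in> space ?M" for y
  using that p by (auto simp: indicator_def)
 have i: "integrable ?M (indicator (S \<inter> {0..}) :: real => real)" using S fin by (intro integrable_real_indicator) auto
 have "(indicator S :: real => complex) \<in> borel_measurable ?M \<longleftrightarrow> (indicator (S \<inter> {0..}) :: real => complex) \<in> borel_measurable ?M"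
  by (intro measurable_cong) (auto simp: indicator_def)
 moreover have "integrable ?M (%y. cmod (indicator S y) powr p)"
  using i by (subst Bochner_Integration.integrable_cong[OF refl e]) auto
 ultimately show "Lp_fun \<nu> p (indicator S)" using S by (simp add: Lp_fun_def)
 show "Lp_int \<nu> p (indicator S) = measure ?M (S \<inter> {0..})"
  unfolding Lp_int_def using S by (subst Bochner_Integration.integral_cong[OF refl e]) auto
qed

text \<open>For an open set \<open>U\<close> of finite measure the flow \<open>w\<close> of its indicator
 satisfies \<open>\<bar>w - 1\<^sub>U\<bar> = w + 1\<^sub>U - 2 w 1\<^sub>U\<close>, and the integral of \<open>w\<close> does not exceed
 the measure of \<open>U\<close>; so pointwise convergence on \<open>U\<close> alone gives convergence in the mean.\<close>

lemma attains_open: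
 assumes nu: "\<nu> > - 1/2" and p: "p >= 1" and U: "open U" "U \<subseteq> {-r..r}"
 shows "attains \<nu> p (indicator U)"
proof -
 let ?M = "bmeas \<nu>"
 have Us: "U \<inter> {0..} \<in> sets ?M" using U(1) by (auto simp: sets_bessel_measure sets_restrict_space_iff)
 have "emeasure ?M (U \<inter> {0..}) <= emeasure ?M {0..r}"
  using U by (intro emeasure_mono) (auto simp: sets_bessel_measure sets_restrict_space_iff)
 then have fin: "emeasure ?M (U \<inter> {0..}) < \<infinity>" using bessel_emeasure_Icc_finite[OF nu, of r] by (rule le_less_trans)
 note L = indicator_Lp_fun[OF _ Us fin]
 have Lp: "Lp_fun \<nu> p (indicator U)" by (rule L(1)[OF p])
 have L1: "Lp_fun \<nu> 1 (indicator U)" by (rule L(1)) simp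
 note G = Lp_fun_gauss[OF nu p Lp]
 define m where "m = measure ?M (U \<inter> {0..})"
 let ?F = "indicator U :: real => complex" and ?f = "indicator (U \<inter> {0..}) :: real => real"
 define w where "w \<kappa> x = (LINT y|?M. kern \<nu> \<kappa> x y * indicator U y)" for \<kappa> x
 have Pw: "flow \<nu> ?F \<kappa> x = of_real (w \<kappa> x)" for \<kappa> x
  unfolding heat_integral_def w_def by (subst integral_complex_of_real[symmetric]) (simp add: of_real_indicator)
 have w1: "\<bar>w \<kappa> x\<bar> <= 1" if "\<kappa> > 0" for \<kappa> x
  using norm_flow_le_sup[OF nu G that, of 1 x] unfolding Pw by (simp add: indicator_def)
 have w0: "w \<kappa> x >= 0" for \<kappa> x
  unfolding w_def using kern_nonneg[OF nu] by (intro Bochner_Integration.integral_nonneg mult_nonneg_nonneg) auto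
 have fi: "integrable ?M ?f" "(LINT x|?M. ?f x) = m" using Us fin by (auto simp: m_def)
 have wi: "integrable ?M (w \<kappa>)" "(LINT x|?M. w \<kappa> x) <= m" if "\<kappa> > 0" for \<kappa>
  using flow_Lp[OF nu order_refl L1 that] L(2)[of 1] w0 by (simp_all add: Lp_fun_def Lp_int_def Pw m_def)
 have wm: "w \<kappa> \<in> borel_measurable ?M" if "\<kappa> > 0" for \<kappa> using wi(1)[OF that] by auto
 have fw: "integrable ?M (%x. ?f x * w \<kappa> x)" if "\<kappa> > 0" for \<kappa>
 proof (rule Bochner_Integration.integrable_bound[OF wi(1)[OF that]])
  show "(%x. ?f x * w \<kappa> x) \<in> borel_measurable ?M" using Us wm[OF that] by measurable
 qed (auto simp: indicator_def)
 have lim: "((%\<kappa>. LINT x|?M. ?f x * w (max \<kappa> 1) x) \<longlongrightarrow> m) at_top"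
  unfolding fi(2)[symmetric]
 proof (rule integral_dominated_convergence_at_top[where w = ?f])
  show "\<forall>\<^sub>F \<kappa> in at_top. AE x in ?M. norm (?f x * w (max \<kappa> 1) x) <= ?f x"
   using eventually_gt_at_top[of 0]
   by eventually_elim (auto intro!: AE_I2 simp: indicator_def w1)
  show "AE x in ?M. ((%\<kappa>. ?f x * w (max \<kappa> 1) x) \<longlongrightarrow> ?f x) at_top"
  proof (rule AE_I2)
   fix x assume x: "x \<in> space ?M"
   show "((%\<kappa>. ?f x * w (max \<kappa> 1) x) \<longlongrightarrow> ?f x) at_top"
   proof (cases "x \<in> U")
    case True
    then obtain d where d: "d > 0" "!!y. dist y x < d ==> y \<in> U" using U(1) by (auto simp: open_dist)
    have "((%\<kappa>. flow \<nu> ?F \<kappa> x) \<longlongrightarrow> 1) at_top"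
    proof (rule flow_tendsto_bounded[OF nu G, where B = 1])
     fix e :: real assume "e > 0"
     then show "\<exists>\<delta>>0. AE y in ?M. \<bar>y - x\<bar> < \<delta> --> cmod (?F y - 1) <= e"
      using d by (intro exI[of _ d]) (auto simp: dist_real_def)
    qed (use x in \<open>auto simp: indicator_def\<close>)
    then have "((%\<kappa>. Re (flow \<nu> ?F \<kappa> x)) \<longlongrightarrow> Re 1) at_top" by (rule tendsto_Re)
    then have "((%\<kappa>. w \<kappa> x) \<longlongrightarrow> 1) at_top" by (simp add: Pw)
    then have "((%\<kappa>. w (max \<kappa> 1) x) \<longlongrightarrow> 1) at_top"
     by (rule Lim_transform_eventually) (rule eventually_mono[OF eventually_ge_at_top[of 1]], simp add: max_def)
    then show ?thesis using True x by simp
   qed simp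
  qed
  show "(%x. ?f x * w (max \<kappa> 1) x) \<in> borel_measurable ?M" for \<kappa>
   by (rule borel_measurable_integrable[OF fw]) simp
 qed (use fi in auto)
 have lim: "((%\<kappa>. LINT x|?M. ?f x * w \<kappa> x) \<longlongrightarrow> m) at_top"
  by (rule Lim_transform_eventually[OF lim]) (rule eventually_mono[OF eventually_ge_at_top[of 1]], simp add: max_def)
 have "((%\<kappa>. Lp_int \<nu> p (%x. flow \<nu> ?F \<kappa> x - ?F x)) \<longlongrightarrow> 0) at_top"
 proof (rule real_tendsto_sandwich[of "%_. 0"])
  have "((%\<kappa>. m + m - 2 * (LINT x|?M. ?f x * w \<kappa> x)) \<longlongrightarrow> m + m - 2 * m) at_top"
   by (intro tendsto_intros lim)
  then show "((%\<kappa>. m + m - 2 * (LINT x|?M. ?f x * w \<kappa> x)) \<longlongrightarrow> 0) at_top" by simp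
  show "\<forall>\<^sub>F \<kappa> in at_top. Lp_int \<nu> p (%x. flow \<nu> ?F \<kappa> x - ?F x) <= m + m - 2 * (LINT x|?M. ?f x * w \<kappa> x)"
   using eventually_gt_at_top[of 0]
  proof eventually_elim
   case (elim \<kappa>)
   have "Lp_int \<nu> p (%x. flow \<nu> ?F \<kappa> x - ?F x) <= (LINT x|?M. w \<kappa> x + ?f x - 2 * (?f x * w \<kappa> x))"
    unfolding Lp_int_def
   proof (rule integral_mono)
    show "integrable ?M (%x. cmod (flow \<nu> ?F \<kappa> x - ?F x) powr p)"
     using Lp_fun_diff(1)[OF p flow_Lp(1)[OF nu p Lp elim] Lp] by (simp add: Lp_fun_def)
    show "integrable ?M (%x. w \<kappa> x + ?f x - 2 * (?f x * w \<kappa> x))"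
     by (intro Bochner_Integration.integrable_add Bochner_Integration.integrable_diff integrable_mult_right wi(1) fi(1) fw elim)
    fix x assume x: "x \<in> space ?M"
    have e: "flow \<nu> ?F \<kappa> x - ?F x = of_real (w \<kappa> x - ?f x)"
     using x unfolding Pw by (auto simp: indicator_def)
    have "\<bar>w \<kappa> x - ?f x\<bar> <= 1" using w1[OF elim, of x] w0[of \<kappa> x] by (auto simp: indicator_def)
    then have "\<bar>w \<kappa> x - ?f x\<bar> powr p <= \<bar>w \<kappa> x - ?f x\<bar> powr 1" using p by (intro powr_mono') auto
    also have "\<dots> = w \<kappa> x + ?f x - 2 * (?f x * w \<kappa> x)"
     using w1[OF elim, of x] w0[of \<kappa> x] by (auto simp: indicator_def)
    finally show "cmod (flow \<nu> ?F \<kappa> x - ?F x) powr p <= w \<kappa> x + ?f x - 2 * (?f x * w \<kappa> x)"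
     unfolding e norm_of_real .
   qed
   also have "\<dots> = (LINT x|?M. w \<kappa> x) + m - 2 * (LINT x|?M. ?f x * w \<kappa> x)"
    using wi(1)[OF elim] fi fw[OF elim] by simp
   finally show ?case using wi(2)[OF elim] by linarith
  qed
 qed (auto simp: Lp_int_nonneg)
 then show ?thesis using Lp by (simp add: attains_def)
qed

lemma attains_measurable_set:
 assumes nu: "\<nu> > - 1/2" and p: "p >= 1" and S: "S \<in> sets lebesgue" "S \<subseteq> {0..r}"
 shows "attains \<nu> p (indicator S)"
proof -
 let ?M = "bmeas \<nu>"
 have sets: "A \<in> sets ?M" if "A \<in> sets lebesgue" "A \<subseteq> {0..}" for A
  using that by (auto simp: sets_bessel_measure sets_restrict_space_iff)
 have S0: "S \<inter> {0..} \<in> sets ?M" using S by (intro sets) auto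
 have finS: "emeasure ?M (S \<inter> {0..}) < \<infinity>"
 proof -
  have "emeasure ?M (S \<inter> {0..}) <= emeasure ?M {0..r}" using S by (intro emeasure_mono sets) auto
  then show ?thesis using bessel_emeasure_Icc_finite[OF nu, of r] by (rule le_less_trans)
 qed
 show ?thesis
 proof (rule attains_limit[OF nu p indicator_Lp_fun(1)[OF p S0 finS]])
  fix e :: real assume e: "e > 0"
  define R where "R = \<bar>r\<bar> + 1"
  have R: "R > 0" by (simp add: R_def)
  define c where "c = R powr (2 * \<nu> + 1)"
  have c: "c > 0" using R by (simp add: c_def)
  obtain T where T: "open T" "S \<subseteq> T" "T - S \<in> lmeasurable" "emeasure lebesgue (T - S) < ennreal (e / c)"
   using sets_lebesgue_outer_open[OF S(1), of "e / c"] e c by auto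
  define U where "U = T \<inter> {-R<..<R}"
  have U: "open U" "U \<subseteq> {-R..R}" "S \<subseteq> U" using T S by (auto simp: U_def R_def)
  let ?D = "(U - S) \<inter> {0..}"
  have "U \<in> sets lebesgue" using U(1) by auto
  then have Dl: "?D \<in> sets lebesgue" using S(1) by (intro sets.Int sets.Diff) auto
  have "emeasure ?M ?D = (\<integral>\<^sup>+y. ennreal (y powr (2 * \<nu> + 1)) * indicator ?D y \<partial>lebesgue_on {0..})"
   unfolding bessel_measure_def
   by (rule emeasure_density) (use Dl in \<open>auto intro!: lebesgue_on_borel_measurable simp: sets_restrict_space_iff\<close>)
  also have "\<dots> <= (\<integral>\<^sup>+y. ennreal c * indicator ?D y \<partial>lebesgue_on {0..})"
   using nu U by (intro nn_integral_mono) (auto simp: indicator_def c_def intro!: ennreal_leI powr_mono2)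
  also have "\<dots> = ennreal c * emeasure (lebesgue_on {0..}) ?D"
   by (rule nn_integral_cmult_indicator) (use Dl in \<open>auto simp: sets_restrict_space_iff\<close>)
  also have "emeasure (lebesgue_on {0..}) ?D = emeasure lebesgue ?D"
   by (subst emeasure_restrict_space) auto
  also have "emeasure lebesgue ?D <= emeasure lebesgue (T - S)"
   using T(3) by (intro emeasure_mono) (auto simp: U_def fmeasurableD)
  also have "ennreal c * emeasure lebesgue (T - S) <= ennreal c * ennreal (e / c)" using T(4) by (intro mult_left_mono) auto
  also have "\<dots> = ennreal e" using c e by (simp add: ennreal_mult[symmetric])
  finally have D: "emeasure ?M ?D <= ennreal e" by (simp add: mult_left_mono)
  have Dfin: "emeasure ?M ?D < \<infinity>" using D by (rule le_less_trans) simp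
  have eq: "Lp_int \<nu> p (%x. indicator S x - indicator U x) = Lp_int \<nu> p (indicator (U - S))"
   unfolding Lp_int_def using U(3) by (intro Bochner_Integration.integral_cong refl) (auto simp: indicator_def)
  also have "\<dots> = measure ?M ?D" by (rule indicator_Lp_fun(2)[OF p sets[OF Dl] Dfin]) auto
  also have "\<dots> <= e" using D e by (simp add: measure_def enn2real_leI)
  finally show "\<exists>G. attains \<nu> p G & Lp_int \<nu> p (%x. indicator S x - G x) <= e"
   using attains_open[OF nu p U(1,2)] by blast
 qed
qed

lemma flow_cong: "(!!y. y >= 0 ==> F y = G y) ==> flow \<nu> F \<kappa> x = flow \<nu> G \<kappa> x"
 unfolding heat_integral_def by (intro Bochner_Integration.integral_cong) auto

lemma attains_cong:
 assumes "!!y. y >= 0 ==> F y = G y" and "attains \<nu> p F"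
 shows "attains \<nu> p G"
proof -
 have "Lp_fun \<nu> p G \<longleftrightarrow> Lp_fun \<nu> p F"
  unfolding Lp_fun_def using assms(1)
  by (intro arg_cong2[where f = "(\<and>)"] measurable_cong Bochner_Integration.integrable_cong) auto
 moreover have "Lp_int \<nu> p (%x. flow \<nu> G \<kappa> x - G x) = Lp_int \<nu> p (%x. flow \<nu> F \<kappa> x - F x)" for \<kappa>
 proof -
  have "flow \<nu> G \<kappa> x = flow \<nu> F \<kappa> x" for x by (rule flow_cong) (simp add: assms(1))
  then show ?thesis unfolding Lp_int_def using assms(1)
   by (intro Bochner_Integration.integral_cong refl) auto
 qed
 ultimately show ?thesis using assms(2) by (simp add: attains_def)
qed

lemma attains_sum:
 assumes nu: "\<nu> > - 1/2" and p: "p >= 1" and "finite I" "!!i. i \<in> I ==> attains \<nu> p (f i)"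
 shows "attains \<nu> p (%x. \<Sum>i\<in>I. f i x)"
 using assms(3,4)
proof (induction I rule: finite_induct)
 case empty
 have "Lp_fun \<nu> p (%_. 0)" using p by (simp add: Lp_fun_def)
 then show ?case by (simp add: attains_def Lp_int_def heat_integral_def)
next
 case (insert i I)
 then show ?case using attains_add[OF nu p, of "f i" "%x. \<Sum>i\<in>I. f i x"] by simp
qed

theorem attains_Lp:
 assumes nu: "\<nu> > - 1/2" and p: "p >= 1" and F: "Lp_fun \<nu> p F"
 shows "attains \<nu> p F"
proof (rule attains_limit[OF nu p F])
 fix e :: real assume e: "e > 0"
 let ?M = "bmeas \<nu>"
 have Fm: "F \<in> borel_measurable ?M" and Fi: "integrable ?M (%y. cmod (F y) powr p)" using F by (auto simp: Lp_fun_def)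
 from borel_measurable_implies_sequence_metric[OF Fm, of 0] obtain s where
  "(\<forall>i. simple_function ?M (s i)) & (\<forall>x\<in>space ?M. (%i. s i x) \<longlonglongrightarrow> F x) & (\<forall>i. \<forall>x\<in>space ?M. dist (s i x) 0 <= 2 * dist (F x) 0)"
  by blast
 then have
  s: "!!i. simple_function ?M (s i)" "!!x. x \<in> space ?M ==> (%i. s i x) \<longlonglongrightarrow> F x"
   "!!i x. x \<in> space ?M ==> cmod (s i x) <= 2 * cmod (F x)" by (auto simp: dist_norm)
 define G where "G n x = s n x * indicator {0..real n} x" for n x
 have "(%n. Lp_int \<nu> p (%x. F x - G n x)) \<longlonglongrightarrow> (LINT x|?M. 0)"
  unfolding Lp_int_def
 proof (rule integral_dominated_convergence[where w = "%x. 3 powr p * cmod (F x) powr p"])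
  have Gm: "G n \<in> borel_measurable ?M" for n
   unfolding G_def by (intro borel_measurable_times borel_measurable_simple_function[OF s(1)] borel_imp_bessel_measurable) auto
  show "(%x. cmod (F x - G n x) powr p) \<in> borel_measurable ?M" for n using Fm Gm[of n] by measurable
  show "AE x in ?M. (%n. cmod (F x - G n x) powr p) \<longlonglongrightarrow> 0"
  proof (rule AE_I2)
   fix x assume x: "x \<in> space ?M"
   obtain N where N: "x <= real N" using real_arch_simple by blast
   have "\<forall>\<^sub>F n in sequentially. s n x = G n x"
    using N x by (auto simp: eventually_sequentially G_def indicator_def intro!: exI[of _ N])
   then have "(%n. G n x) \<longlonglongrightarrow> F x" using s(2)[OF x] by (rule Lim_transform_eventually[rotated])
   then have "(%n. F x - G n x) \<longlonglongrightarrow> F x - F x" by (intro tendsto_intros)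
   then have "(%n. cmod (F x - G n x)) \<longlonglongrightarrow> 0" using tendsto_norm by fastforce
   then have "(%n. cmod (F x - G n x) powr p) \<longlonglongrightarrow> 0 powr p" using p by (intro tendsto_powr2) auto
   then show "(%n. cmod (F x - G n x) powr p) \<longlonglongrightarrow> 0" by simp
  qed
  show "AE x in ?M. norm (cmod (F x - G n x) powr p) <= 3 powr p * cmod (F x) powr p" for n
  proof (rule AE_I2)
   fix x assume x: "x \<in> space ?M"
   have "cmod (G n x) <= 2 * cmod (F x)" using s(3)[OF x, of n] by (auto simp: G_def indicator_def)
   then have "cmod (F x - G n x) <= 3 * cmod (F x)" using norm_triangle_ineq4[of "F x" "G n x"] by linarith
   then have "cmod (F x - G n x) powr p <= (3 * cmod (F x)) powr p" using p by (intro powr_mono2) auto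
   then show "norm (cmod (F x - G n x) powr p) <= 3 powr p * cmod (F x) powr p" by (simp add: powr_mult)
  qed
 qed (use Fi in auto)
 then have "\<forall>\<^sub>F n in sequentially. Lp_int \<nu> p (%x. F x - G n x) < e" using e by (intro order_tendstoD) auto
 then obtain n where n: "Lp_int \<nu> p (%x. F x - G n x) < e" by (auto simp: eventually_sequentially)
 let ?S = "%z. (s n -` {z} \<inter> space ?M) \<inter> {0..real n}"
 have fin: "finite (s n ` space ?M)" and Ss: "!!z. s n -` {z} \<inter> space ?M \<in> sets ?M"
  using s(1)[of n] simple_functionD by blast+
 have "attains \<nu> p (%x. \<Sum>z\<in>s n ` space ?M. z * indicator (?S z) x)"
 proof (intro attains_sum[OF nu p fin] attains_cmult attains_measurable_set[OF nu p])
  fix z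
  show "?S z \<in> sets lebesgue" using Ss[of z] by (auto simp: sets_bessel_measure sets_restrict_space_iff)
  show "?S z \<subseteq> {0..real n}" by auto
 qed
 then have "attains \<nu> p (G n)"
 proof (rule attains_cong[rotated])
  fix y :: real assume y: "y >= 0"
  have "(\<Sum>z\<in>s n ` space ?M. z * indicator (?S z) y) = (\<Sum>z\<in>s n ` space ?M. if z = s n y then z * indicator {0..real n} y else 0)"
   using y by (intro sum.cong) (auto simp: indicator_def)
  also have "\<dots> = G n y" using fin y by (subst sum.delta) (auto simp: G_def)
  finally show "(\<Sum>z\<in>s n ` space ?M. z * indicator (?S z) y) = G n y" .
 qed
 then show "\<exists>G. attains \<nu> p G & Lp_int \<nu> p (%x. F x - G x) <= e" using n by (intro exI[of _ "G n"]) auto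
qed

lemma inverse_time_at_top:
 fixes \<sigma> :: real
 assumes "\<sigma> > 0"
 shows "filterlim (%t. 1 / (4 * \<sigma> * t)) at_top (at_right 0)"
proof -
 have "filterlim (%t. inverse (4 * \<sigma>) * inverse t) at_top (at_right 0)"
  using assms by (intro filterlim_tendsto_pos_mult_at_top[OF tendsto_const _ filterlim_inverse_at_top_right]) auto
 moreover have "(%t. inverse (4 * \<sigma>) * inverse t) = (%t. 1 / (4 * \<sigma> * t))"
  by (simp only: divide_inverse inverse_mult_distrib mult_1)
 ultimately show ?thesis by (simp only:)
qed

text \<open>For finite exponents this is the density argument behind \<open>attains_Lp\<close>.  In the supremum norm
uniform continuity of the chirped function makes the near-diagonal error small uniformly in \<open>x\<close>, while
the far part carries an exponentially small factor.\<close>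

lemma heat_semigroup_Lconv:
 assumes nu: "\<nu> > - 1/2" and sigma: "\<sigma> > 0" and p: "1 <= p" and f: "in_L \<nu> p f"
  and adm: "admissible_initial \<nu> a b p f"
 shows "Lconv_at_0 \<nu> p (%t x. heat_semigroup \<nu> \<sigma> a b t f x) f"
proof -
 let ?al = "a / b" and ?k = "%t. 1 / (4 * \<sigma> * t)" and ?M = "bmeas \<nu>"
 let ?F = "%y. chirp ?al y * f y"
 have F: "in_L \<nu> p ?F" using f by simp
 note G = in_L_imp_gauss_integrable[OF nu p F]
 let ?E = "%t x. flow \<nu> ?F (?k t) x - ?F x"
 have k: "?k t > 0" if "t > 0" for t using sigma that by simp
 have e: "(%x. heat_semigroup \<nu> \<sigma> a b t f x - f x) = (%x. chirp (- ?al) x * ?E t x)" if "t > 0" for t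
  using heat_semigroup_eq[OF nu sigma that, of a b f] by (auto simp: right_diff_distrib)
 have ev: "\<forall>\<^sub>F t in at_right (0::real). t > 0" by (rule eventually_at_right_less)
 have red: "Lconv_at_0 \<nu> p (%t x. heat_semigroup \<nu> \<sigma> a b t f x) f"
  if 1: "\<forall>\<^sub>F t in at_right 0. in_L \<nu> p (?E t)" and 2: "((%t. Lnorm \<nu> p (?E t)) \<longlongrightarrow> 0) (at_right 0)"
  unfolding Lconv_at_0_def
 proof
  show "\<forall>\<^sub>F t in at_right 0. in_L \<nu> p (%x. heat_semigroup \<nu> \<sigma> a b t f x - f x)"
   using 1 ev by eventually_elim (simp only: e in_L_chirp)
  show "((%t. Lnorm \<nu> p (%x. heat_semigroup \<nu> \<sigma> a b t f x - f x)) \<longlongrightarrow> 0) (at_right 0)"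
   by (rule Lim_transform_eventually[OF 2]) (use ev in \<open>eventually_elim, simp only: e Lnorm_chirp\<close>)
 qed
 show ?thesis
 proof (cases rule: ennreal_exponent_cases[OF p])
  case (2 P)
  have LF: "Lp_fun \<nu> P ?F" using F 2 by (simp add: Lp_fun_iff_in_L)
  have at: "((%\<kappa>. Lp_int \<nu> P (%x. flow \<nu> ?F \<kappa> x - ?F x)) \<longlongrightarrow> 0) at_top"
   using attains_Lp[OF nu 2(2) LF] by (simp add: attains_def)
  have "((%t. Lp_int \<nu> P (?E t)) \<longlongrightarrow> 0) (at_right 0)"
   by (rule filterlim_compose[OF at inverse_time_at_top[OF sigma]])
  then have "((%t. Lp_int \<nu> P (?E t) powr (1 / P)) \<longlongrightarrow> 0 powr (1 / P)) (at_right 0)"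
   using 2 by (intro tendsto_powr2) (auto simp: Lp_int_nonneg)
  then have "((%t. Lnorm \<nu> p (?E t)) \<longlongrightarrow> 0) (at_right 0)" using 2 by (simp add: Lnorm_def Lp_int_def)
  moreover have "\<forall>\<^sub>F t in at_right 0. in_L \<nu> p (?E t)"
   using ev
  proof eventually_elim
   case (elim t)
   have "Lp_fun \<nu> P (?E t)" by (rule Lp_fun_diff(1)[OF 2(2) flow_Lp(1)[OF nu 2(2) LF k[OF elim]] LF])
   then show ?case using 2 by (simp add: Lp_fun_iff_in_L)
  qed
  ultimately show ?thesis by (rule red[rotated])
 next
  case 1
  obtain g where g: "uniformly_continuous_on {0..} g" "AE y in ?M. ?F y = g y"
   using adm 1 by (auto simp: admissible_initial_def chirp_def)
  define B where "B = Lnorm \<nu> top ?F"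
  have B: "AE y in ?M. cmod (?F y) <= B" "B >= 0" using in_L_top_AE[of \<nu> ?F] F 1 by (simp_all add: B_def)
  have main: "\<forall>\<^sub>F t in at_right 0. in_L \<nu> p (?E t) & Lnorm \<nu> p (?E t) <= \<epsilon>" if eps: "\<epsilon> > 0" for \<epsilon>
  proof -
   obtain \<delta> where d: "\<delta> > 0" "!!x y. x >= 0 ==> y >= 0 ==> \<bar>y - x\<bar> < \<delta> ==> cmod (g y - g x) < \<epsilon> / 2"
    using g(1) eps unfolding uniformly_continuous_on_def by (metis atLeast_iff dist_norm half_gt_zero real_norm_def)
   have "((%\<kappa>. 2 powr (\<nu> + 1) * exp (- (\<kappa> / 2) * \<delta>\<^sup>2) * (B + B)) \<longlongrightarrow> 2 powr (\<nu> + 1) * 0 * (B + B)) at_top"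
    using d by (intro tendsto_intros exp_neg_tendsto_0) auto
   then have "\<forall>\<^sub>F \<kappa> in at_top. 2 powr (\<nu> + 1) * exp (- (\<kappa> / 2) * \<delta>\<^sup>2) * (B + B) < \<epsilon> / 2"
    using eps by (intro order_tendstoD) auto
   then have "\<forall>\<^sub>F t in at_right 0. 2 powr (\<nu> + 1) * exp (- (?k t / 2) * \<delta>\<^sup>2) * (B + B) < \<epsilon> / 2"
    using inverse_time_at_top[OF sigma] by (rule eventually_compose_filterlim)
   then show ?thesis using ev
   proof eventually_elim
    case (elim t)
    have k2: "?k t / 2 > 0" using k[OF elim(2)] by simp
    have "AE x in ?M. cmod (?E t x) <= \<epsilon>"
     using g(2) B(1) AE_space
    proof eventually_elim
     case (elim x)
     then have x: "x >= 0" and Fx: "?F x = g x" and Bx: "cmod (?F x) <= B" by auto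
     have "AE y in ?M. \<bar>y - x\<bar> < \<delta> --> cmod (?F y - ?F x) <= \<epsilon> / 2"
      using g(2) AE_space by eventually_elim (use d(2)[of x] x Fx in \<open>auto intro: less_imp_le\<close>)
     then have "cmod (?E t x) <= \<epsilon> / 2 + 2 powr (\<nu> + 1) * exp (- (?k t / 2) * \<delta>\<^sup>2) *
       ((LINT y|?M. kern \<nu> (?k t / 2) x y * cmod (?F y)) + cmod (?F x))"
      using flow_near[OF nu G k[OF \<open>t > 0\<close>] x d(1), of "\<epsilon> / 2" "?F x"] eps by simp
     also have "\<dots> <= \<epsilon> / 2 + 2 powr (\<nu> + 1) * exp (- (?k t / 2) * \<delta>\<^sup>2) * (B + B)"
     proof (intro add_left_mono mult_left_mono add_mono Bx)
      have "(LINT y|?M. kern \<nu> (?k t / 2) x y * cmod (?F y)) <= (LINT y|?M. kern \<nu> (?k t / 2) x y * B)"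
      proof (rule integral_mono_AE)
       show "AE y in ?M. kern \<nu> (?k t / 2) x y * cmod (?F y) <= kern \<nu> (?k t / 2) x y * B"
        using B(1) by eventually_elim (intro mult_left_mono kern_nonneg[OF nu])
       show "integrable ?M (%y. kern \<nu> (?k t / 2) x y * cmod (?F y))" by (rule norm_flow_le_LINT(1)[OF nu G k2])
       show "integrable ?M (%y. kern \<nu> (?k t / 2) x y * B)" by (intro integrable_mult_left kern_mass[OF nu k2])
      qed
      then show "(LINT y|?M. kern \<nu> (?k t / 2) x y * cmod (?F y)) <= B"
       using kern_mass(2)[OF nu k2, of x] by simp
     qed auto
     also have "\<dots> <= \<epsilon>" using \<open>2 powr (\<nu> + 1) * exp (- (?k t / 2) * \<delta>\<^sup>2) * (B + B) < \<epsilon> / 2\<close> by simp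
     finally show ?case .
    qed
    moreover have "?E t \<in> borel_measurable ?M"
     by (intro borel_measurable_diff flow_measurable[OF nu G k[OF elim(2)]] gauss_integrable_measurable[OF G])
    ultimately show ?case using in_L_topI[of "?E t" \<nu> \<epsilon>] 1 eps by auto
   qed
  qed
  show ?thesis
  proof (rule red)
   show "\<forall>\<^sub>F t in at_right 0. in_L \<nu> p (?E t)" using main[of 1] by (auto elim: eventually_mono)
   show "((%t. Lnorm \<nu> p (?E t)) \<longlongrightarrow> 0) (at_right 0)"
   proof (rule tendstoI)
    fix e :: real assume "e > 0"
    then have "\<forall>\<^sub>F t in at_right 0. in_L \<nu> p (?E t) & Lnorm \<nu> p (?E t) <= e / 2" by (intro main) auto
    then show "\<forall>\<^sub>F t in at_right 0. dist (Lnorm \<nu> p (?E t)) 0 < e"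
     by eventually_elim (use Lnorm_nonneg \<open>e > 0\<close> in \<open>auto simp: dist_real_def\<close>)
   qed
  qed
 qed
qed

section \<open>Uniqueness\<close>

text \<open>The only information on the growth of solutions that the uniqueness proof uses.  For finite
exponents it follows from \<open>G \<bar>F\<bar> <= G + \<gamma> \<bar>F\<bar>\<^sup>r\<close>.\<close>

lemma in_L_weighted_bound:
 fixes M :: real
 assumes r: "1 <= r" and M: "M >= 0"
 shows "\<exists>D\<ge>0. \<forall>F G \<gamma>. in_L \<nu> r F & Lnorm \<nu> r F <= M & integrable (bmeas \<nu>) G & (\<forall>y. 0 <= G y & G y <= \<gamma>) \<longrightarrow>
     integrable (bmeas \<nu>) (%y. G y * cmod (F y)) \<and>
     (LINT y|bmeas \<nu>. G y * cmod (F y)) <= D * ((LINT y|bmeas \<nu>. G y) + \<gamma>)"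
proof (cases rule: ennreal_exponent_cases[OF r])
 case 1
 show ?thesis
 proof (intro exI[of _ M] conjI allI impI M)
  fix F :: "real => complex" and G :: "real => real" and \<gamma> :: real
  assume "in_L \<nu> r F & Lnorm \<nu> r F <= M & integrable (bmeas \<nu>) G & (\<forall>y. 0 <= G y & G y <= \<gamma>)"
  then have F: "in_L \<nu> r F" "Lnorm \<nu> r F <= M" and G: "integrable (bmeas \<nu>) G" and g: "!!y. 0 <= G y" "!!y. G y <= \<gamma>" by auto
  have m: "F \<in> borel_measurable (bmeas \<nu>)" using F by (simp add: in_L_def)
  have ae: "AE y in bmeas \<nu>. G y * cmod (F y) <= M * G y"
  proof -
   have "AE y in bmeas \<nu>. cmod (F y) <= Lnorm \<nu> top F" using in_L_top_AE(1)[of \<nu> F] F 1 by simp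
   then show ?thesis
  proof eventually_elim
   case (elim y)
   then have "cmod (F y) <= M" using F 1 by simp
   then show ?case using mult_left_mono[of "cmod (F y)" M "G y"] g by (simp add: mult.commute)
  qed
  qed
  have iM: "integrable (bmeas \<nu>) (%y. M * G y)" using G by (rule integrable_mult_right)
  show i: "integrable (bmeas \<nu>) (%y. G y * cmod (F y))"
  proof (rule Bochner_Integration.integrable_bound[OF iM])
   show "(%y. G y * cmod (F y)) \<in> borel_measurable (bmeas \<nu>)"
    using G m by (intro borel_measurable_times measurable_compose[OF m borel_measurable_norm]) auto
   show "AE y in bmeas \<nu>. norm (G y * cmod (F y)) <= norm (M * G y)"
    using ae by eventually_elim (use g M in \<open>simp add: abs_mult\<close>)
  qed
  have "(LINT y|bmeas \<nu>. G y * cmod (F y)) <= (LINT y|bmeas \<nu>. M * G y)"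
   by (rule integral_mono_AE[OF i iM ae])
  also have "\<dots> <= M * ((LINT y|bmeas \<nu>. G y) + \<gamma>)"
   using M g(1)[of 0] g(2)[of 0] by (simp add: distrib_left)
  finally show "(LINT y|bmeas \<nu>. G y * cmod (F y)) <= M * ((LINT y|bmeas \<nu>. G y) + \<gamma>)" .
 qed
next
 case (2 R)
 show ?thesis
 proof (intro exI[of _ "max 1 (M powr R)"] conjI allI impI)
  fix F :: "real => complex" and G :: "real => real" and \<gamma> :: real
  assume "in_L \<nu> r F & Lnorm \<nu> r F <= M & integrable (bmeas \<nu>) G & (\<forall>y. 0 <= G y & G y <= \<gamma>)"
  then have F: "in_L \<nu> r F" "Lnorm \<nu> r F <= M" and G: "integrable (bmeas \<nu>) G" and g: "!!y. 0 <= G y" "!!y. G y <= \<gamma>" by auto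
  have m: "F \<in> borel_measurable (bmeas \<nu>)" and Fi: "integrable (bmeas \<nu>) (%y. cmod (F y) powr R)"
   using F 2 by (auto simp: in_L_def)
  let ?N = "LINT y|bmeas \<nu>. cmod (F y) powr R"
  have "?N powr (1 / R) <= M" using F(2) 2 by (simp add: Lnorm_def)
  then have "(?N powr (1 / R)) powr R <= M powr R" using 2 by (intro powr_mono2[of R "?N powr (1 / R)" M]) auto
  then have N: "?N <= M powr R" using 2 by (simp add: powr_powr)
  have g0: "\<gamma> >= 0" using g[of 0] by linarith
  have le: "G y * cmod (F y) <= G y + \<gamma> * cmod (F y) powr R" for y
  proof -
   have "G y * cmod (F y) <= G y * (1 + cmod (F y) powr R)" using 2 g by (intro mult_left_mono le_one_plus_powr) auto
   also have "\<dots> <= G y + \<gamma> * cmod (F y) powr R" using g by (simp add: distrib_left mult_right_mono)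
   finally show ?thesis .
  qed
  have iM: "integrable (bmeas \<nu>) (%y. G y + \<gamma> * cmod (F y) powr R)"
   using G Fi by (intro Bochner_Integration.integrable_add integrable_mult_right)
  show i: "integrable (bmeas \<nu>) (%y. G y * cmod (F y))"
  proof (rule Bochner_Integration.integrable_bound[OF iM])
   show "(%y. G y * cmod (F y)) \<in> borel_measurable (bmeas \<nu>)"
    using G m by (intro borel_measurable_times measurable_compose[OF m borel_measurable_norm]) auto
   show "AE y in bmeas \<nu>. norm (G y * cmod (F y)) <= norm (G y + \<gamma> * cmod (F y) powr R)"
   proof (rule AE_I2)
    fix y
    have "\<bar>G y * cmod (F y)\<bar> = G y * cmod (F y)" using g by simp
    then show "norm (G y * cmod (F y)) <= norm (G y + \<gamma> * cmod (F y) powr R)"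
     using le[of y] unfolding real_norm_def by linarith
   qed
  qed
  have "(LINT y|bmeas \<nu>. G y * cmod (F y)) <= (LINT y|bmeas \<nu>. G y + \<gamma> * cmod (F y) powr R)"
   by (rule integral_mono[OF i iM le])
  also have "\<dots> = (LINT y|bmeas \<nu>. G y) + \<gamma> * ?N" using G Fi by simp
  also have "\<dots> <= max 1 (M powr R) * (LINT y|bmeas \<nu>. G y) + \<gamma> * max 1 (M powr R)"
  proof (rule add_mono)
   have "0 <= (LINT y|bmeas \<nu>. G y)" using g by (intro Bochner_Integration.integral_nonneg)
   then show "(LINT y|bmeas \<nu>. G y) <= max 1 (M powr R) * (LINT y|bmeas \<nu>. G y)"
    using mult_right_mono[of 1 "max 1 (M powr R)" "LINT y|bmeas \<nu>. G y"] by simp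
   show "\<gamma> * ?N <= \<gamma> * max 1 (M powr R)" using N g0 by (intro mult_left_mono) auto
  qed
  finally show "(LINT y|bmeas \<nu>. G y * cmod (F y)) <= max 1 (M powr R) * ((LINT y|bmeas \<nu>. G y) + \<gamma>)"
   by (simp add: distrib_left mult.commute)
 qed simp
qed

text \<open>The third power of this function is twice continuously differentiable, which suffices for Green's
formula, and its derivatives are explicit.\<close>

definition cutoff :: "real => real => real" where
 "cutoff \<rho> y = max 0 (1 - y\<^sup>2 / \<rho>\<^sup>2)"

lemma cutoff_bounds: "0 <= cutoff \<rho> y" "cutoff \<rho> y <= 1"
 by (auto simp: cutoff_def)

lemma cutoff_eq_0: "\<rho> > 0 ==> y >= \<rho> ==> cutoff \<rho> y = 0"
 by (simp add: cutoff_def power_mono)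

lemma continuous_on_cutoff [continuous_intros]: "continuous_on S f ==> continuous_on S (%x. cutoff \<rho> (f x))"
 unfolding cutoff_def divide_inverse by (intro continuous_intros)

lemma cutoff_power_deriv:
 "((%y. cutoff \<rho> y ^ Suc (Suc n)) has_real_derivative (real n + 2) * cutoff \<rho> y ^ Suc n * (- 2 * y / \<rho>\<^sup>2)) (at y)"
proof -
 have d: "((%u::real. max 0 u ^ Suc (Suc n)) has_real_derivative (real n + 2) * max 0 u ^ Suc n) (at u)" for u :: real
 proof -
  consider "u > 0" | "u < 0" | "u = 0" by linarith
  then show ?thesis
  proof cases
   case 1
   have "((%u::real. u ^ Suc (Suc n)) has_real_derivative (real n + 2) * u ^ Suc n) (at u)"
    using DERIV_pow[of "Suc (Suc n)" u] by (simp add: add.commute)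
   then have "((%u::real. max 0 u ^ Suc (Suc n)) has_real_derivative (real n + 2) * u ^ Suc n) (at u)"
    by (rule has_field_derivative_transform_within_open[where S = "{0<..}"]) (use 1 in auto)
   then show ?thesis using 1 by simp
  next
   case 2
   have "((%u::real. 0) has_real_derivative 0) (at u)" by simp
   then have "((%u::real. max 0 u ^ Suc (Suc n)) has_real_derivative 0) (at u)"
    by (rule has_field_derivative_transform_within_open[where S = "{..<0}"]) (use 2 in auto)
   then show ?thesis using 2 by simp
  next
   case 3
   have "((%h. (max 0 h ^ Suc (Suc n)) / h) \<longlongrightarrow> 0) (at (0::real))"
   proof (rule Lim_null_comparison)
    show "\<forall>\<^sub>F h in at (0::real). norm (max 0 h ^ Suc (Suc n) / h) <= \<bar>h\<bar> ^ Suc n"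
    proof (rule always_eventually, rule allI)
     fix h :: real
     show "norm (max 0 h ^ Suc (Suc n) / h) <= \<bar>h\<bar> ^ Suc n"
     proof (cases "h > 0")
      case False
      then have "max 0 h ^ Suc (Suc n) / h = 0" by simp
      then show ?thesis by (simp only: norm_zero zero_le_power abs_ge_zero)
     qed (simp add: abs_mult power_abs)
    qed
    have "((%h::real. \<bar>h\<bar> ^ Suc n) \<longlongrightarrow> \<bar>0\<bar> ^ Suc n) (at 0)" by (intro tendsto_intros)
    then show "((%h::real. \<bar>h\<bar> ^ Suc n) \<longlongrightarrow> 0) (at 0)" by simp
   qed
   then show ?thesis using 3 by (simp add: DERIV_def)
  qed
 qed
 have "((%y. 1 - y\<^sup>2 / \<rho>\<^sup>2) has_real_derivative - 2 * y / \<rho>\<^sup>2) (at y)"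
  by (auto intro!: derivative_eq_intros simp: divide_inverse)
 from DERIV_chain2[OF d this] show ?thesis by (simp add: cutoff_def)
qed

lemma kern_deriv_y:
 assumes nu: "\<nu> > - 1/2" and k: "\<kappa> > 0"
 shows "((%y. kern \<nu> \<kappa> x y) has_real_derivative
  2 * \<kappa> * y * (x\<^sup>2 * kern (\<nu> + 1) \<kappa> x y - kern \<nu> \<kappa> x y)) (at y)"
 unfolding kern_sym[of _ _ x] by (rule kern_deriv_x[OF nu k])

lemma kern_deriv_yy:
 assumes nu: "\<nu> > - 1/2" and k: "\<kappa> > 0"
 shows "((%y. 2 * \<kappa> * y * (x\<^sup>2 * kern (\<nu> + 1) \<kappa> x y - kern \<nu> \<kappa> x y)) has_real_derivative
  2 * \<kappa> * (x\<^sup>2 * kern (\<nu> + 1) \<kappa> x y - kern \<nu> \<kappa> x y) +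
  4 * \<kappa>\<^sup>2 * y\<^sup>2 * (x ^ 4 * kern (\<nu> + 2) \<kappa> x y - 2 * x\<^sup>2 * kern (\<nu> + 1) \<kappa> x y + kern \<nu> \<kappa> x y)) (at y)"
proof -
 have nu1: "\<nu> + 1 > - 1/2" using nu by simp
 have e: "\<nu> + 1 + 1 = \<nu> + 2" by simp
 note d0 = kern_deriv_y[OF nu k, of x y] and d1 = kern_deriv_y[OF nu1 k, of x y, unfolded e]
 have "((%y. 2 * \<kappa> * y) has_real_derivative 2 * \<kappa>) (at y)" by (auto intro!: derivative_eq_intros)
 from DERIV_mult[OF this DERIV_diff[OF DERIV_cmult[OF d1, of "x\<^sup>2"] d0]]
 show ?thesis
  by (rule DERIV_cong) (simp add: algebra_simps power2_eq_square power4_eq_xxxx)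
qed

text \<open>Up to the factor \<open>- 4 \<kappa>\<^sup>2\<close>, the left-hand side is the derivative of the kernel in \<open>\<kappa>\<close> and the
right-hand side is the Bessel operator in \<open>y\<close>; the two agree because of the contiguity relation.\<close>

lemma kern_heat_equation:
 assumes nu: "\<nu> > - 1/2" and k: "\<kappa> > 0"
 shows "- 4 * \<kappa>\<^sup>2 * (((\<nu> + 1) / \<kappa> - x\<^sup>2 - y\<^sup>2) * kern \<nu> \<kappa> x y + 2 * x\<^sup>2 * y\<^sup>2 * kern (\<nu> + 1) \<kappa> x y) =
  2 * \<kappa> * (x\<^sup>2 * kern (\<nu> + 1) \<kappa> x y - kern \<nu> \<kappa> x y) +
  4 * \<kappa>\<^sup>2 * y\<^sup>2 * (x ^ 4 * kern (\<nu> + 2) \<kappa> x y - 2 * x\<^sup>2 * kern (\<nu> + 1) \<kappa> x y + kern \<nu> \<kappa> x y)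
  + (2 * \<nu> + 1) * (2 * \<kappa> * (x\<^sup>2 * kern (\<nu> + 1) \<kappa> x y - kern \<nu> \<kappa> x y))"
proof -
 define K0 K1 K2 where "K0 = kern \<nu> \<kappa> x y" and "K1 = kern (\<nu> + 1) \<kappa> x y" and "K2 = kern (\<nu> + 2) \<kappa> x y"
 define P where "P = (\<nu> + 1) / \<kappa>"
 have n: "\<nu> = \<kappa> * P - 1" using k by (simp add: P_def)
 have c: "K0 = P * K1 + x\<^sup>2 * y\<^sup>2 * K2"
  using kern_contiguous[OF nu k, of x y] by (simp add: K0_def K1_def K2_def P_def)
 have "- 4 * \<kappa>\<^sup>2 * ((P - x\<^sup>2 - y\<^sup>2) * K0 + 2 * x\<^sup>2 * y\<^sup>2 * K1) = 2 * \<kappa> * (x\<^sup>2 * K1 - K0) +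
  4 * \<kappa>\<^sup>2 * y\<^sup>2 * (x ^ 4 * K2 - 2 * x\<^sup>2 * K1 + K0) + (2 * \<mu> + 1) * (2 * \<kappa> * (x\<^sup>2 * K1 - K0))"
  if "\<mu> = \<kappa> * P - 1" for \<mu>
  unfolding that c by (simp add: algebra_simps power2_eq_square power4_eq_xxxx)
 from this[OF n] show ?thesis unfolding K0_def K1_def K2_def P_def .
qed

section \<open>Solutions of the Bessel heat equation\<close>

text \<open>The derivatives are parameters because the locale is applied to a solution multiplied by a chirp,
whose derivatives come as explicit expressions.\<close>

locale flow_solution =
 fixes \<nu> \<sigma> :: real and V Vx Vxx Vt :: "real => real => complex"
 assumes nu: "\<nu> > - 1/2" and sigma: "\<sigma> > 0"
  and dx: "!!t x. t > 0 ==> (V t has_vector_derivative Vx t x) (at x)"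
  and dxx: "!!t x. t > 0 ==> (Vx t has_vector_derivative Vxx t x) (at x)"
  and dt: "!!t x. t > 0 ==> ((%s. V s x) has_vector_derivative Vt t x) (at t)"
  and cV: "continuous_on ({0<..} \<times> UNIV) (%(t, x). V t x)"
  and cVx: "continuous_on ({0<..} \<times> UNIV) (%(t, x). Vx t x)"
  and cVxx: "continuous_on ({0<..} \<times> UNIV) (%(t, x). Vxx t x)"
  and cVt: "continuous_on ({0<..} \<times> UNIV) (%(t, x). Vt t x)"
  and pde: "!!t x. t > 0 ==> x ~= 0 ==> Vt t x = of_real \<sigma> * (Vxx t x + of_real ((2 * \<nu> + 1) / x) * Vx t x)"
begin

lemma continuous_on_jointly:
 fixes f :: "real => real => complex" and S :: "'z :: topological_space set"
 assumes "continuous_on ({0<..} \<times> UNIV) (%(t, x). f t x)"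
  "continuous_on S p" "continuous_on S q" "!!z. z \<in> S ==> p z > 0"
 shows "continuous_on S (%z. f (p z) (q z))"
proof -
 have "continuous_on S (%z. (case (p z, q z) of (t, x) => f t x))"
  by (rule continuous_on_compose2[OF assms(1)]) (use assms in \<open>auto intro!: continuous_on_Pair\<close>)
 then show ?thesis by simp
qed

text \<open>The odd part is a solution that vanishes at the origin.\<close>

lemma even_in_space:
 assumes "t > 0"
 shows "V t (- x) = V t x"
proof -
 have key: "V t (- x) = V t x" if "x >= 0" for x
 proof -
  have c: "continuous_on ({0<..} \<times> UNIV) (%(t, x). f t (- x))" if "continuous_on ({0<..} \<times> UNIV) (%(t, x). f t x)" for f :: "real => real => complex"
   unfolding case_prod_unfold by (rule continuous_on_jointly[OF that]) (auto intro!: continuous_intros)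
  have m: "((%x. f (- x)) has_vector_derivative - f') (at x)" if "(f has_vector_derivative f') (at (- x))" for f f' and x :: real
  proof -
   have "(uminus has_vector_derivative - 1) (at x)"
    using has_vector_derivative_minus[OF has_vector_derivative_id[of "at x"]] by simp
   from vector_diff_chain_at[OF this that] show ?thesis by (simp add: o_def)
  qed
  have "V t x - V t (- x) = 0"
  proof (rule flow_lateral_uniqueness[OF nu sigma, of "%t x. V t x - V t (- x)" "%t x. Vx t x + Vx t (- x)"
     "%t x. Vxx t x - Vxx t (- x)" "%t x. Vt t x - Vt t (- x)"])
   fix t x :: real assume t: "t > 0"
   show "((%x. V t x - V t (- x)) has_vector_derivative Vx t x + Vx t (- x)) (at x)"
    using has_vector_derivative_diff[OF dx[OF t] m[OF dx[OF t]], of x] by simp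
   show "((%x. Vx t x + Vx t (- x)) has_vector_derivative Vxx t x - Vxx t (- x)) (at x)"
    using has_vector_derivative_add[OF dxx[OF t] m[OF dxx[OF t]], of x] by simp
   show "((%s. V s x - V s (- x)) has_vector_derivative Vt t x - Vt t (- x)) (at t)"
    by (rule has_vector_derivative_diff[OF dt[OF t] dt[OF t]])
   show "V t 0 - V t (- 0) = 0" by simp
   assume x: "x > 0"
   define c where "c = complex_of_real ((2 * \<nu> + 1) / x)"
   have "complex_of_real ((2 * \<nu> + 1) / - x) = - c" by (simp add: c_def)
   then have p2: "Vt t (- x) = of_real \<sigma> * (Vxx t (- x) + - c * Vx t (- x))" using pde[OF t, of "- x"] x by simp
   have p1: "Vt t x = of_real \<sigma> * (Vxx t x + c * Vx t x)" using pde[OF t, of x] x by (simp add: c_def)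
   show "Vt t x - Vt t (- x) = of_real \<sigma> * (Vxx t x - Vxx t (- x) + of_real ((2 * \<nu> + 1) / x) * (Vx t x + Vx t (- x)))"
    unfolding p1 p2 c_def[symmetric] by (simp add: algebra_simps)
  next
   show "continuous_on ({0<..} \<times> UNIV) (%(t, x). V t x - V t (- x))"
    using continuous_on_diff[OF cV c[OF cV]] by (simp add: case_prod_unfold)
   show "continuous_on ({0<..} \<times> UNIV) (%(t, x). Vx t x + Vx t (- x))"
    using continuous_on_add[OF cVx c[OF cVx]] by (simp add: case_prod_unfold)
   show "continuous_on ({0<..} \<times> UNIV) (%(t, x). Vxx t x - Vxx t (- x))"
    using continuous_on_diff[OF cVxx c[OF cVxx]] by (simp add: case_prod_unfold)
   show "continuous_on ({0<..} \<times> UNIV) (%(t, x). Vt t x - Vt t (- x))"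
    using continuous_on_diff[OF cVt c[OF cVt]] by (simp add: case_prod_unfold)
  qed (use assms that in auto)
  then show ?thesis by simp
 qed
 show ?thesis using key[of x] key[of "- x"] by (cases "x >= 0") auto
qed

definition remaining :: "real => real => real" where
 "remaining t \<tau> = 1 / (4 * \<sigma> * (t - \<tau>))"

lemma remaining_deriv:
 assumes "\<tau> < t"
 shows "(remaining t has_real_derivative 4 * \<sigma> * (remaining t \<tau>)\<^sup>2) (at \<tau>)" "remaining t \<tau> > 0"
proof -
 show "(remaining t has_real_derivative 4 * \<sigma> * (remaining t \<tau>)\<^sup>2) (at \<tau>)"
  unfolding remaining_def[abs_def] using assms sigma
  by (auto intro!: derivative_eq_intros simp: power2_eq_square field_simps)
 show "remaining t \<tau> > 0" using assms sigma by (simp add: remaining_def)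
qed

lemma remaining_mono: "\<tau>1 <= \<tau>2 ==> \<tau>2 < t ==> remaining t \<tau>1 <= remaining t \<tau>2"
 unfolding remaining_def using sigma by (intro divide_left_mono mult_left_mono mult_pos_pos) auto

text \<open>The kernel solves the backward equation, so by Green's formula the localised pairing of the
 solution with the kernel changes only through the derivatives of the cut-off.\<close>

lemma pairing_deriv:
 fixes x :: real
 assumes tau: "0 < \<tau>" "\<tau> < t" and rho: "\<rho> > 0"
 defines "K \<equiv> %j y. kern (\<nu> + j) (remaining t \<tau>) x y"
 defines "Ky \<equiv> %y. 2 * remaining t \<tau> * y * (x\<^sup>2 * K 1 y - K 0 y)"
 shows "((%\<tau>. LINT y|bmeas \<nu>. of_real (cutoff \<rho> y ^ 3 * kern \<nu> (remaining t \<tau>) x y) * V \<tau> y)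
  has_vector_derivative (LINT y|bmeas \<nu>. of_real \<sigma> * (of_real
    (2 * (3 * cutoff \<rho> y ^ 2 * (- 2 * y / \<rho>\<^sup>2)) * Ky y +
     (24 * cutoff \<rho> y * y\<^sup>2 / \<rho> ^ 4 - 6 * cutoff \<rho> y ^ 2 / \<rho>\<^sup>2 * (2 * \<nu> + 2)) * K 0 y) * V \<tau> y))) (at \<tau>)"
proof -
 let ?M = "bmeas \<nu>"
 let ?k = "remaining t"
 have nu1: "\<nu> + 1 > - 1/2" "\<nu> + 2 > - 1/2" using nu by auto
 have k0: "?k \<tau> > 0" using remaining_deriv(2)[OF tau(2)] .
 let ?c = "cutoff \<rho>"
 define Kt where "Kt s y = 4 * \<sigma> * (?k s)\<^sup>2 * (((\<nu> + 1) / ?k s - x\<^sup>2 - y\<^sup>2) * kern \<nu> (?k s) x y + 2 * x\<^sup>2 * y\<^sup>2 * kern (\<nu> + 1) (?k s) x y)" for s y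
 define g where "g s y = of_real (?c y ^ 3 * kern \<nu> (?k s) x y) * V s y" for s y
 define g' where "g' s y = of_real (?c y ^ 3 * Kt s y) * V s y + of_real (?c y ^ 3 * kern \<nu> (?k s) x y) * Vt s y" for s y
 have dK: "((%s. kern \<nu> (?k s) x y) has_real_derivative Kt s y) (at s)" if "s < t" for s y
  using DERIV_chain2[OF kern_deriv_lambda[OF nu remaining_deriv(2)[OF that]] remaining_deriv(1)[OF that], of x y]
  by (simp add: Kt_def mult_ac)
 have dg: "((%s. g s y) has_vector_derivative g' s y) (at s)" if "0 < s" "s < t" for s y
 proof -
  have "((%s. ?c y ^ 3 * kern \<nu> (?k s) x y) has_real_derivative ?c y ^ 3 * Kt s y) (at s)"
   by (rule DERIV_cmult[OF dK[OF that(2)]])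
  from has_vector_derivative_mult[OF has_vector_derivative_of_real[OF this] dt[OF that(1)]]
  show ?thesis unfolding g_def g'_def by (rule has_vector_derivative_eq_rhs) simp
 qed
 note CI = continuous_on_mult continuous_on_add continuous_on_diff continuous_on_of_real
  continuous_on_const continuous_on_power continuous_on_fst continuous_on_snd continuous_on_id continuous_on_cutoff
 have ck: "continuous_on ({0<..<t} \<times> {0..}) (%z. ?k (fst z))"
  unfolding remaining_def using sigma by (intro continuous_intros) auto
 have cK: "continuous_on ({0<..<t} \<times> {0..}) (%z. kern \<mu> (?k (fst z)) x (snd z))" if "\<mu> > - 1/2" for \<mu>
  by (rule continuous_on_kern[OF that ck]) (auto intro!: continuous_intros remaining_deriv(2))
 have cdk: "continuous_on ({0<..<t} \<times> {0..}) (%z. (\<nu> + 1) / ?k (fst z))"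
  by (intro continuous_on_divide continuous_on_const ck) (use remaining_deriv(2) in force)
 have cVV: "continuous_on ({0<..<t} \<times> {0..}) (%z. f (fst z) (snd z))" if "continuous_on ({0<..} \<times> UNIV) (%(t, x). f t x)" for f :: "real => real => complex"
  by (rule continuous_on_jointly[OF that]) (auto intro!: continuous_intros)
 have cg: "continuous_on ({0<..<t} \<times> {0..}) (%z. g (fst z) (snd z))"
  unfolding g_def by (intro CI cK nu cVV cV)
 have cg': "continuous_on ({0<..<t} \<times> {0..}) (%z. g' (fst z) (snd z))"
  unfolding g'_def Kt_def by (intro CI cK nu nu1 ck cdk cVV cV cVt)
 define l where "l = \<tau> / 2" define r where "r = (\<tau> + t) / 2"
 have lr: "0 < l" "l < \<tau>" "\<tau> < r" "r < t" using tau by (auto simp: l_def r_def)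
 have bnd: "\<exists>B. \<forall>s\<in>{l..r}. \<forall>y\<in>{0..\<rho>}. cmod (f s y) <= B" if "continuous_on ({0<..<t} \<times> {0..}) (%z. f (fst z) (snd z))" for f :: "real => real => complex"
 proof -
  have "compact ((%z. f (fst z) (snd z)) ` ({l..r} \<times> {0..\<rho>}))"
   by (intro compact_continuous_image continuous_on_subset[OF that] compact_Times) (use lr in auto)
  then show ?thesis using compact_imp_bounded by (force simp: bounded_iff)
 qed
 have ind: "integrable ?M (%y. B * indicator {0..\<rho>} y :: real)" for B
  using bessel_emeasure_Icc_finite[OF nu, of \<rho>]
  by (intro integrable_mult_right integrable_real_indicator) (auto simp: sets_bessel_measure sets_restrict_space_iff)
 have slice: "continuous_on {0..} (f s)" if "continuous_on ({0<..<t} \<times> {0..}) (%z. f (fst z) (snd z))" "0 < s" "s < t" for f :: "real => real => complex" and s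
 proof -
  have "continuous_on {0..} (Pair s)" "Pair s ` {0..} \<subseteq> {0<..<t} \<times> {0..}"
   using that(2,3) by (auto intro!: continuous_on_Pair continuous_on_const continuous_on_id)
  from continuous_on_compose2[OF that(1) this] show ?thesis by simp
 qed
 have z0: "g s y = 0" "g' s y = 0" if "y > \<rho>" for s y
  using cutoff_eq_0[OF rho, of y] that by (auto simp: g_def g'_def)
 have int: "integrable ?M (f s)" if c: "continuous_on ({0<..<t} \<times> {0..}) (%z. f (fst z) (snd z))" "!!y. y > \<rho> ==> f s y = 0" "l <= s" "s <= r" for f :: "real => real => complex" and s
 proof -
  obtain B where B: "!!s y. s \<in> {l..r} ==> y \<in> {0..\<rho>} ==> cmod (f s y) <= B" using bnd[OF c(1)] by blast
  show ?thesis
  proof (rule Bochner_Integration.integrable_bound[OF ind[of "max B 0"]])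
   show "f s \<in> borel_measurable ?M" using that lr by (intro continuous_imp_bessel_measurable slice[OF that(1)]) auto
   show "AE y in ?M. norm (f s y) <= norm (max B 0 * indicator {0..\<rho>} y :: real)"
   proof (rule AE_I2)
    fix y assume "y \<in> space ?M"
    then show "norm (f s y) <= norm (max B 0 * indicator {0..\<rho>} y :: real)"
     using B[of s y] that(2)[of y] that(3,4) by (cases "y <= \<rho>") (auto simp: indicator_def)
   qed
  qed
 qed
 obtain B where B: "!!s y. s \<in> {l..r} ==> y \<in> {0..\<rho>} ==> cmod (g' s y) <= B" using bnd[OF cg'] by blast
 have step: "((%s. LINT y|?M. g s y) has_vector_derivative (LINT y|?M. g' \<tau> y)) (at \<tau>)"
 proof (rule has_vector_derivative_LINT[where l = l and r = r and w = "%y. max B 0 * indicator {0..\<rho>} y"])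
  show "\<tau> \<in> {l<..<r}" using lr by auto
  show "integrable ?M (g s)" if "s \<in> {l<..<r}" for s using that by (intro int[OF cg] z0) auto
  show "((%s. g s y) has_vector_derivative g' s y) (at s)" if "s \<in> {l<..<r}" for s y using that lr by (intro dg) auto
  show "g' \<tau> \<in> borel_measurable ?M" using lr by (intro borel_measurable_integrable int[OF cg'] z0) auto
  show "norm (g' s y) <= max B 0 * indicator {0..\<rho>} y" if "s \<in> {l<..<r}" "y \<in> space ?M" for s y
   using B[of s y] z0(2)[of y s] that by (cases "y <= \<rho>") (auto simp: indicator_def)
  show "integrable ?M (%y. max B 0 * indicator {0..\<rho>} y)" by (rule ind)
 qed
 let ?k0 = "?k \<tau>"
 define Kyy where "Kyy y = 2 * ?k0 * (x\<^sup>2 * K 1 y - K 0 y) + 4 * ?k0\<^sup>2 * y\<^sup>2 * (x ^ 4 * K 2 y - 2 * x\<^sup>2 * K 1 y + K 0 y)" for y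
 define c1 where "c1 y = 3 * ?c y ^ 2 * (- 2 * y / \<rho>\<^sup>2)" for y
 define c2 where "c2 y = 24 * ?c y * y\<^sup>2 / \<rho> ^ 4 - 6 * ?c y ^ 2 / \<rho>\<^sup>2" for y
 define ph where "ph y = ?c y ^ 3 * K 0 y" for y
 define ph1 where "ph1 y = c1 y * K 0 y + ?c y ^ 3 * Ky y" for y
 define ph2 where "ph2 y = c2 y * K 0 y + 2 * c1 y * Ky y + ?c y ^ 3 * Kyy y" for y
 define R where "R y = 2 * c1 y * Ky y + (24 * ?c y * y\<^sup>2 / \<rho> ^ 4 - 6 * ?c y ^ 2 / \<rho>\<^sup>2 * (2 * \<nu> + 2)) * K 0 y" for y
 have dc: "((%y. ?c y ^ 3) has_real_derivative c1 y) (at y)" for y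
  using cutoff_power_deriv[of \<rho> 1 y] by (simp add: c1_def numeral_3_eq_3 numeral_2_eq_2)
 have dc1: "(c1 has_real_derivative c2 y) (at y)" for y
 proof -
  have "((%y. ?c y ^ 2) has_real_derivative 2 * ?c y * (- 2 * y / \<rho>\<^sup>2)) (at y)"
   using cutoff_power_deriv[of \<rho> 0 y] by (simp add: numeral_2_eq_2)
  moreover have "((%y. - 2 * y / \<rho>\<^sup>2) has_real_derivative - 2 / \<rho>\<^sup>2) (at y)"
  proof -
   have "(%y. - 2 * y / \<rho>\<^sup>2) = times (- 2 / \<rho>\<^sup>2)" by (simp add: fun_eq_iff)
   then show ?thesis using DERIV_cmult_Id[of "- 2 / \<rho>\<^sup>2" y] by (simp only:)
  qed
  ultimately have "((%y. ?c y ^ 2 * (- 2 * y / \<rho>\<^sup>2)) has_real_derivative 2 * ?c y * (- 2 * y / \<rho>\<^sup>2) * (- 2 * y / \<rho>\<^sup>2) + - 2 / \<rho>\<^sup>2 * ?c y ^ 2) (at y)"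
   by (rule DERIV_mult)
  note d = DERIV_cmult[OF this, of 3]
  have "(%y. 3 * (?c y ^ 2 * (- 2 * y / \<rho>\<^sup>2))) = c1" by (simp add: fun_eq_iff c1_def)
  moreover have "3 * (2 * ?c y * (- 2 * y / \<rho>\<^sup>2) * (- 2 * y / \<rho>\<^sup>2) + - 2 / \<rho>\<^sup>2 * ?c y ^ 2) = c2 y"
   using rho unfolding c2_def by (simp add: power2_eq_square power4_eq_xxxx divide_simps)
  ultimately show ?thesis using d by (simp only:)
 qed
 have dK0: "((K 0) has_real_derivative Ky y) (at y)" for y
  unfolding K_def Ky_def using kern_deriv_y[OF nu k0, of x y] by simp
 have dKy: "(Ky has_real_derivative Kyy y) (at y)" for y
  using kern_deriv_yy[OF nu k0, of x y] by (simp add: K_def Ky_def[abs_def] Kyy_def)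
 have dph: "(ph has_real_derivative ph1 y) (at y)" for y
  unfolding ph_def[abs_def] ph1_def using DERIV_mult[OF dc dK0, of y] by (simp add: mult.commute)
 have dph1: "(ph1 has_real_derivative ph2 y) (at y)" for y
  unfolding ph1_def[abs_def] ph2_def using DERIV_add[OF DERIV_mult[OF dc1 dK0] DERIV_mult[OF dc dKy], of y]
  by (rule DERIV_cong) (simp add: algebra_simps)
 have bes: "complex_of_real (?c y ^ 3 * Kt \<tau> y) = - of_real \<sigma> * of_real (?c y ^ 3 * (Kyy y + (2 * \<nu> + 1) * (2 * ?k0 * (x\<^sup>2 * K 1 y - K 0 y)))) " for y
 proof -
  have "Kt \<tau> y = - \<sigma> * (- 4 * ?k0\<^sup>2 * (((\<nu> + 1) / ?k0 - x\<^sup>2 - y\<^sup>2) * K 0 y + 2 * x\<^sup>2 * y\<^sup>2 * K 1 y))"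
   by (simp add: Kt_def K_def)
  also have "- 4 * ?k0\<^sup>2 * (((\<nu> + 1) / ?k0 - x\<^sup>2 - y\<^sup>2) * K 0 y + 2 * x\<^sup>2 * y\<^sup>2 * K 1 y) = Kyy y + (2 * \<nu> + 1) * (2 * ?k0 * (x\<^sup>2 * K 1 y - K 0 y))"
   using kern_heat_equation[OF nu k0, of x y] by (simp add: K_def Kyy_def)
  finally have "?c y ^ 3 * Kt \<tau> y = - \<sigma> * (?c y ^ 3 * (Kyy y + (2 * \<nu> + 1) * (2 * ?k0 * (x\<^sup>2 * K 1 y - K 0 y))))" by simp
  then show ?thesis by (metis of_real_minus of_real_mult)
 qed
 let ?\<Psi> = "%y. of_real (y powr (2 * \<nu> + 1)) * (of_real (ph y) * Vx \<tau> y - of_real (ph1 y) * V \<tau> y)"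
 define G where "G y = g' \<tau> y - of_real \<sigma> * (of_real (R y) * V \<tau> y)" for y
 have cph: "continuous_on UNIV ph" "continuous_on UNIV ph1" "continuous_on UNIV c1" "continuous_on UNIV Ky" "continuous_on UNIV (K 0)"
  using dph dph1 dc1 dKy dK0 by (auto intro!: continuous_at_imp_continuous_on DERIV_isCont)
 have cVs: "continuous_on S (V \<tau>)" "continuous_on S (Vx \<tau>)" for S
  using continuous_on_jointly[OF cV, of S "%_. \<tau>" "%y. y"] continuous_on_jointly[OF cVx, of S "%_. \<tau>" "%y. y"] tau
  by (auto intro: continuous_intros)
 have cR: "continuous_on {0..} (%y. of_real \<sigma> * (of_real (R y) * V \<tau> y))"
  unfolding R_def divide_inverse by (intro CI cVs continuous_on_subset[OF cph(3)] continuous_on_subset[OF cph(4)] continuous_on_subset[OF cph(5)]) auto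
 have Rz: "R y = 0" if "y > \<rho>" for y using cutoff_eq_0[OF rho, of y] that by (simp add: R_def c1_def)
 have iR: "integrable ?M (%y. of_real \<sigma> * (of_real (R y) * V \<tau> y))"
 proof -
  have "continuous_on ({0<..<t} \<times> {0..}) (%z :: real \<times> real. of_real \<sigma> * (of_real (R (snd z)) * V \<tau> (snd z)))"
   by (rule continuous_on_compose2[OF cR, of "{0<..<t} \<times> {0..}" snd]) (auto intro: continuous_on_snd continuous_on_id)
  then show ?thesis
   using int[of "%_ y. of_real \<sigma> * (of_real (R y) * V \<tau> y)" \<tau>] Rz lr by simp
 qed
 have ig': "integrable ?M (g' \<tau>)" using lr by (intro int[OF cg'] z0) auto
 have "(LINT y|?M. G y) = 0"
 proof -
  have "(LINT y|?M. of_real (1 / \<sigma>) * G y) = 0"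
  proof (rule bessel_integral_derivative_eq_0[where \<Psi> = ?\<Psi>])
   show "continuous_on {0..} ?\<Psi>"
    by (intro continuous_intros cVs continuous_on_subset[OF cph(1)] continuous_on_subset[OF cph(2)] continuous_on_powr') (use nu in auto)
   show "?\<Psi> 0 = 0" using nu by simp
   have "\<forall>\<^sub>F y in at_top. ?\<Psi> y = 0"
    using eventually_ge_at_top[of \<rho>]
    by eventually_elim (use cutoff_eq_0[OF rho] in \<open>simp add: ph_def ph1_def c1_def\<close>)
   then show "(?\<Psi> \<longlongrightarrow> 0) at_top" by (rule tendsto_eventually)
   show "integrable ?M (%y. of_real (1 / \<sigma>) * G y)"
    unfolding G_def by (intro integrable_mult_right Bochner_Integration.integrable_diff ig' iR)
   fix y :: real assume y: "y > 0"
   define p where "p = y powr (2 * \<nu>)"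
   have pp: "y powr (2 * \<nu> + 1) = y * p" using y by (simp add: powr_add p_def)
   have d1: "((%y. complex_of_real (y powr (2 * \<nu> + 1))) has_vector_derivative of_real ((2 * \<nu> + 1) * p)) (at y)"
    unfolding p_def by (rule has_vector_derivative_of_real) (use y in \<open>auto intro!: derivative_eq_intros\<close>)
   note d2 = has_vector_derivative_diff[OF has_vector_derivative_mult[OF has_vector_derivative_of_real[OF dph] dxx[OF tau(1)], of y]
      has_vector_derivative_mult[OF has_vector_derivative_of_real[OF dph1] dx[OF tau(1)], of y]]
   have Vxx: "of_real y * Vt \<tau> y / of_real \<sigma> = of_real y * Vxx \<tau> y + of_real (2 * \<nu> + 1) * Vx \<tau> y"
    using pde[OF tau(1), of y] y sigma by (simp add: field_simps)
   have Ryeq: "y * ph2 y + (2 * \<nu> + 1) * ph1 y = y * (?c y ^ 3 * (Kyy y + (2 * \<nu> + 1) * (2 * ?k0 * (x\<^sup>2 * K 1 y - K 0 y)))) + y * R y"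
   proof -
    have c1y: "c1 y = y * (- 6 * ?c y ^ 2 / \<rho>\<^sup>2)" by (simp add: c1_def)
    show ?thesis unfolding ph2_def ph1_def R_def c2_def
     unfolding Ky_def by (simp add: c1y algebra_simps add_divide_distrib)
   qed
   have cRy: "complex_of_real y * of_real (?c y ^ 3 * Kt \<tau> y) = - of_real \<sigma> * of_real (y * ph2 y + (2 * \<nu> + 1) * ph1 y - y * R y)"
    unfolding bes Ryeq by (simp add: mult.left_commute)
   show "(?\<Psi> has_vector_derivative y powr (2 * \<nu> + 1) *\<^sub>R (of_real (1 / \<sigma>) * G y)) (at y)"
    using has_vector_derivative_mult[OF d1 d2]
   proof (rule has_vector_derivative_eq_rhs)
    have s: "complex_of_real \<sigma> ~= 0" using sigma by simp
    have "of_real y * G y = of_real \<sigma> * (of_real (ph y) * (of_real y * Vxx \<tau> y + of_real (2 * \<nu> + 1) * Vx \<tau> y)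
      - of_real (y * ph2 y + (2 * \<nu> + 1) * ph1 y) * V \<tau> y)"
    proof -
     have "of_real y * G y = (of_real y * of_real (?c y ^ 3 * Kt \<tau> y)) * V \<tau> y + of_real (ph y) * (of_real y * Vt \<tau> y) - of_real \<sigma> * (of_real (y * R y) * V \<tau> y)"
      by (simp add: G_def g'_def ph_def K_def algebra_simps)
     also have "of_real y * Vt \<tau> y = of_real \<sigma> * (of_real y * Vxx \<tau> y + of_real (2 * \<nu> + 1) * Vx \<tau> y)"
      unfolding Vxx[symmetric] using s by simp
     finally show ?thesis unfolding cRy by (simp add: algebra_simps)
    qed
    then have G1: "of_real (1 / \<sigma>) * (of_real y * G y) = of_real (ph y) * (of_real y * Vxx \<tau> y + of_real (2 * \<nu> + 1) * Vx \<tau> y)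
      - of_real (y * ph2 y + (2 * \<nu> + 1) * ph1 y) * V \<tau> y"
     using s by simp
    have G2: "y powr (2 * \<nu> + 1) *\<^sub>R (of_real (1 / \<sigma>) * G y) = of_real p * (of_real (1 / \<sigma>) * (of_real y * G y))"
     by (simp add: pp scaleR_conv_of_real)
    show "of_real (y powr (2 * \<nu> + 1)) * (of_real (ph y) * Vxx \<tau> y + of_real (ph1 y) * Vx \<tau> y - (of_real (ph1 y) * Vx \<tau> y + of_real (ph2 y) * V \<tau> y)) +
      of_real ((2 * \<nu> + 1) * p) * (of_real (ph y) * Vx \<tau> y - of_real (ph1 y) * V \<tau> y) = y powr (2 * \<nu> + 1) *\<^sub>R (of_real (1 / \<sigma>) * G y)"
     unfolding G2 unfolding G1 unfolding pp by (simp add: algebra_simps)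
   qed
  qed
  then show ?thesis using sigma by (subst (asm) integral_mult_right_zero) simp
 qed
 then have "(LINT y|?M. g' \<tau> y) = (LINT y|?M. of_real \<sigma> * (of_real (R y) * V \<tau> y))"
  unfolding G_def using ig' iR by simp
 then show ?thesis
  using step unfolding g_def R_def c1_def by simp
qed

end

section \<open>Recovering a solution from its initial value\<close>

lemma powr_exp_tendsto_0:
 fixes a d :: real
 assumes "d > 0"
 shows "((%\<kappa>. exp (- (\<kappa> / 2) * d) * (\<kappa> / 2) powr a) \<longlongrightarrow> 0) at_top"
proof (rule Lim_null_comparison)
 define n where "n = nat \<lceil>a\<rceil>"
 have n: "a <= real n" by (simp add: n_def) linarith
 have "filterlim (%\<kappa>. (d / 2) * \<kappa>) at_top at_top"
  using assms by (intro filterlim_tendsto_pos_mult_at_top[OF tendsto_const _ filterlim_ident]) auto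
 from filterlim_compose[OF tendsto_power_div_exp_0 this, of n]
 have "((%\<kappa>. 1 / d ^ n * ((d / 2 * \<kappa>) ^ n / exp (d / 2 * \<kappa>))) \<longlongrightarrow> 1 / d ^ n * 0) at_top" by (rule tendsto_mult_left)
 then show "((%\<kappa>. 1 / d ^ n * ((d / 2 * \<kappa>) ^ n / exp (d / 2 * \<kappa>))) \<longlongrightarrow> 0) at_top" by simp
 show "\<forall>\<^sub>F \<kappa> in at_top. norm (exp (- (\<kappa> / 2) * d) * (\<kappa> / 2) powr a) <= 1 / d ^ n * ((d / 2 * \<kappa>) ^ n / exp (d / 2 * \<kappa>))"
  using eventually_ge_at_top[of 2]
 proof eventually_elim
  case (elim \<kappa>)
  have "(\<kappa> / 2) powr a <= (\<kappa> / 2) powr real n" using elim n by (intro powr_mono) auto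
  also have "\<dots> = (\<kappa> / 2) ^ n" using elim by (intro powr_realpow) simp
  finally have "exp (- (\<kappa> / 2) * d) * (\<kappa> / 2) powr a <= exp (- (\<kappa> / 2) * d) * (\<kappa> / 2) ^ n" by (intro mult_left_mono) auto
  also have "exp (- (\<kappa> / 2) * d) * (\<kappa> / 2) ^ n = 1 / exp (d / 2 * \<kappa>) * (\<kappa> / 2) ^ n"
  proof -
   have "- (\<kappa> / 2) * d = - (d / 2 * \<kappa>)" by simp
   then show ?thesis by (simp only: exp_minus inverse_eq_divide)
  qed
  also have "\<dots> = 1 / d ^ n * ((d / 2 * \<kappa>) ^ n / exp (d / 2 * \<kappa>))"
   using assms by (simp add: power_mult_distrib power_divide)
  finally show ?case by (simp only: real_norm_def abs_of_nonneg mult_nonneg_nonneg exp_ge_zero powr_ge_zero)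
 qed
qed

lemma flow_le_Lnorm:
 assumes nu: "\<nu> > - 1/2" and k: "\<kappa> > 0" and p: "1 <= p" and F: "in_L \<nu> p F"
 shows "cmod (flow \<nu> F \<kappa> x) <= (2 / Gamma (\<nu> + 1) * \<kappa> powr (\<nu> + 1)) powr enn2real (1 / p) * Lnorm \<nu> p F"
proof -
 let ?c = "2 / Gamma (\<nu> + 1) * \<kappa> powr (\<nu> + 1)"
 note G = in_L_imp_gauss_integrable[OF nu p F]
 have c: "?c > 0" using k Gamma_Suc_pos[OF nu] by simp
 have z: "?c powr 0 = 1" using c by (metis less_irrefl powr_zero_eq_one)
 show ?thesis
 proof (cases rule: ennreal_exponent_cases[OF p])
  case 1
  have "cmod (flow \<nu> F \<kappa> x) <= Lnorm \<nu> p F"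
   using norm_flow_le_sup[OF nu G k] in_L_top_AE(1)[of \<nu> F] F 1(1) by simp
  then show ?thesis unfolding 1(2) by (simp only: mult_1 z)
 next
  case (2 P)
  let ?N = "LINT y|bmeas \<nu>. cmod (F y) powr P"
  have i: "integrable (bmeas \<nu>) (%y. cmod (F y) powr P)" using F 2 by (simp add: in_L_def)
  let ?I = "LINT y|bmeas \<nu>. kern \<nu> \<kappa> x y powr 1 * cmod (F y) powr P"
  have "cmod (flow \<nu> F \<kappa> x) <= ?I powr (1 / P + 1 / 1 - 1) * ((?c powr (1 - 1) * 1 powr - (\<nu> + 1)) powr (1 - 1 / P) * ?N powr (1 - 1 / 1))"
   by (rule bessel_Young_pointwise[OF nu k G 2(2) _ _ i refl refl]) (use 2 in auto)
  also have "\<dots> = ?I powr (1 / P) * ?N powr 0"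
   by (simp only: z div_by_1 diff_self powr_one_eq_one mult_1 add_diff_cancel_right')
  also have "\<dots> <= ?I powr (1 / P) * 1" by (intro mult_left_mono) auto
  also have "?I powr (1 / P) <= (?c * ?N) powr (1 / P)"
  proof (rule powr_mono2)
   have "?I <= (LINT y|bmeas \<nu>. ?c * cmod (F y) powr P)"
   proof (rule integral_mono)
    show "integrable (bmeas \<nu>) (%y. kern \<nu> \<kappa> x y powr 1 * cmod (F y) powr P)"
     by (rule kern_powr_mult_integrable[OF nu k _ i]) simp
    show "integrable (bmeas \<nu>) (%y. ?c * cmod (F y) powr P)" using i by (rule integrable_mult_right)
    show "kern \<nu> \<kappa> x y powr 1 * cmod (F y) powr P <= ?c * cmod (F y) powr P" for y
     using kern_le_const[OF nu k, of x y] kern_nonneg[OF nu, of \<kappa> x y] by (intro mult_right_mono) auto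
   qed
   then show "?I <= ?c * ?N" by simp
   show "0 <= ?I" by (intro Bochner_Integration.integral_nonneg) auto
  qed (use 2 in auto)
  also have "(?c * ?N) powr (1 / P) = ?c powr (1 / P) * ?N powr (1 / P)" by (rule powr_mult)
  finally show ?thesis using 2 by (simp add: Lnorm_def)
 qed
qed

context flow_solution
begin

text \<open>The cut-off derivatives are of order \<open>\<rho>\<^bsup>- 2\<^esup>\<close>, uniformly against a fixed Gaussian.\<close>

lemma heat_pairing_constant:
 assumes r: "1 <= r" and Lr: "!!t. t > 0 ==> in_L \<nu> r (V t)"
  and bd: "!!t1 t2. 0 < t1 ==> t1 <= t2 ==> bounded ((%t. Lnorm \<nu> r (V t)) ` {t1..t2})"
  and s: "0 < s" "s < t1" "t1 < t"
 shows "flow \<nu> (V t1) (remaining t t1) x = flow \<nu> (V s) (remaining t s) x"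
proof -
 let ?M = "bmeas \<nu>"
 have nu1: "\<nu> + 1 > - 1/2" using nu by simp
 obtain M0 where M0: "!!\<tau>. \<tau> \<in> {s..t1} ==> \<bar>Lnorm \<nu> r (V \<tau>)\<bar> <= M0"
  using bd[of s t1] s by (auto simp: bounded_iff simp del: atLeastAtMost_iff)
 define M where "M = max M0 0"
 have M: "M >= 0" "!!\<tau>. \<tau> \<in> {s..t1} ==> Lnorm \<nu> r (V \<tau>) <= M" using M0 by (force simp: M_def)+
 obtain D0 where D0_nonneg: "D0 >= 0" and D0_all: "\<forall>F G \<gamma>. in_L \<nu> r F & Lnorm \<nu> r F <= M & integrable ?M G & (\<forall>y. 0 <= G y & G y <= \<gamma>) \<longrightarrow>
  integrable ?M (%y. G y * cmod (F y)) & (LINT y|?M. G y * cmod (F y)) <= D0 * ((LINT y|?M. G y) + \<gamma>)"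
  using in_L_weighted_bound[OF r M(1), of \<nu>] by (elim exE conjE)
 have D0: "integrable ?M (%y. G y * cmod (F y)) & (LINT y|?M. G y * cmod (F y)) <= D0 * ((LINT y|?M. G y) + \<gamma>)"
  if "in_L \<nu> r F" "Lnorm \<nu> r F <= M" "integrable ?M G" "!!y. 0 <= G y" "!!y. G y <= \<gamma>" for F G \<gamma>
  by (intro D0_all[rule_format] conjI allI that)
 define l where "l = remaining t s" define L where "L = remaining t t1"
 have l: "l > 0" using remaining_deriv(2)[of s t] s by (simp add: l_def)
 have L: "L > 0" using remaining_deriv(2)[of t1 t] s by (simp add: L_def)
 have kl: "remaining t \<tau> \<in> {l..L}" if "\<tau> \<in> {s..t1}" for \<tau>
  using remaining_mono[of s \<tau> t] remaining_mono[of \<tau> t1 t] that s by (auto simp: l_def L_def)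
 define E where "E y = exp (- (l / 4) * y\<^sup>2)" for y
 have E: "0 <= E y" "E y <= 1" for y using l by (auto simp: E_def)
 have iE: "integrable ?M E" unfolding E_def[abs_def] using Gaussian_bessel_integral(1)[OF nu, of "l / 4"] l by simp
 obtain A0 where A0: "A0 >= 0" "!!\<kappa> y. \<kappa> \<in> {l..L} ==> y ^ (2 * 0) * kern \<nu> \<kappa> x y <= A0 * E y"
  using kern_dominated[OF nu l, of L "\<bar>x\<bar>" 0] unfolding E_def by blast
 obtain A1 where A1: "A1 >= 0" "!!\<kappa> y. \<kappa> \<in> {l..L} ==> y ^ (2 * 1) * kern \<nu> \<kappa> x y <= A1 * E y"
  using kern_dominated[OF nu l, of L "\<bar>x\<bar>" 1] unfolding E_def by blast
 obtain A2 where A2: "A2 >= 0" "!!\<kappa> y. \<kappa> \<in> {l..L} ==> y ^ (2 * 1) * kern (\<nu> + 1) \<kappa> x y <= A2 * E y"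
  using kern_dominated[OF nu1 l, of L "\<bar>x\<bar>" 1] unfolding E_def by blast
 define B where "B = 24 * L * (x\<^sup>2 * A2 + A1) + 24 * A1 + 12 * (\<nu> + 1) * A0"
 have B: "B >= 0"
 proof -
  have "0 <= 24 * L * (x\<^sup>2 * A2 + A1)" using A1(1) A2(1) L by (intro mult_nonneg_nonneg add_nonneg_nonneg) auto
  moreover have "0 <= 12 * (\<nu> + 1) * A0" using nu A0(1) by (intro mult_nonneg_nonneg) auto
  ultimately show ?thesis using A1(1) by (simp add: B_def)
 qed
 define R where "R \<rho> \<tau> y = 2 * (3 * cutoff \<rho> y ^ 2 * (- 2 * y / \<rho>\<^sup>2)) *
   (2 * remaining t \<tau> * y * (x\<^sup>2 * kern (\<nu> + 1) (remaining t \<tau>) x y - kern (\<nu> + 0) (remaining t \<tau>) x y)) +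
   (24 * cutoff \<rho> y * y\<^sup>2 / \<rho> ^ 4 - 6 * cutoff \<rho> y ^ 2 / \<rho>\<^sup>2 * (2 * \<nu> + 2)) * kern (\<nu> + 0) (remaining t \<tau>) x y" for \<rho> \<tau> y
 have Rb: "\<bar>R \<rho> \<tau> y\<bar> <= B / \<rho>\<^sup>2 * E y" if rho: "\<rho> >= 1" and tau: "\<tau> \<in> {s..t1}" for \<rho> \<tau> y
 proof -
  define k c K0 K1 where "k = remaining t \<tau>" and "c = cutoff \<rho> y" and "K0 = kern \<nu> k x y" and "K1 = kern (\<nu> + 1) k x y"
  have k: "k \<in> {l..L}" using kl[OF tau] by (simp add: k_def)
  have K: "K0 >= 0" "K1 >= 0" "K0 <= A0 * E y" "y\<^sup>2 * K0 <= A1 * E y" "y\<^sup>2 * K1 <= A2 * E y"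
   using kern_nonneg[OF nu] kern_nonneg[OF nu1] A0(2)[OF k, of y] A1(2)[OF k, of y] A2(2)[OF k, of y]
   by (simp_all add: K0_def K1_def)
  have c: "0 <= c" "c <= 1" "c\<^sup>2 <= 1" using cutoff_bounds[of \<rho> y] by (auto simp: c_def power_le_one)
  have R: "R \<rho> \<tau> y * \<rho>\<^sup>2 = c\<^sup>2 * (24 * k * (y\<^sup>2 * K0)) - c\<^sup>2 * (24 * k * (x\<^sup>2 * (y\<^sup>2 * K1))) + c * (24 * (y\<^sup>2 * K0) / \<rho>\<^sup>2) - c\<^sup>2 * (12 * (\<nu> + 1) * K0)"
  proof -
   have "\<rho> ~= 0" using rho by simp
   have "R \<rho> \<tau> y = (c\<^sup>2 * (24 * k * (y\<^sup>2 * K0)) - c\<^sup>2 * (24 * k * (x\<^sup>2 * (y\<^sup>2 * K1))) + c * (24 * (y\<^sup>2 * K0) / \<rho>\<^sup>2) - c\<^sup>2 * (12 * (\<nu> + 1) * K0)) / \<rho>\<^sup>2"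
   proof -
    define w where "w = inverse (\<rho>\<^sup>2)"
    have w4: "inverse (\<rho> ^ 4) = w * w" by (simp add: w_def power2_eq_square power4_eq_xxxx)
    show ?thesis
     unfolding R_def add_0_right k_def[symmetric] c_def[symmetric] K0_def[symmetric] K1_def[symmetric] divide_inverse w4 w_def[symmetric]
     by (simp add: algebra_simps power2_eq_square)
   qed
   then show ?thesis using \<open>\<rho> ~= 0\<close> by simp
  qed
  have up: "0 <= w * X & w * X <= 1 * Y" if "0 <= w" "w <= 1" "0 <= X" "X <= Y" for w X Y :: real
   using mult_mono[OF that(2) that(4)] that by simp
  have kL: "0 <= k" "24 * k <= 24 * L" "0 <= 24 * L" using k l L by auto
  have n: "0 <= y\<^sup>2 * K0" "0 <= x\<^sup>2 * (y\<^sup>2 * K1)" "0 <= 24 * k * (y\<^sup>2 * K0)" "0 <= 24 * k * (x\<^sup>2 * (y\<^sup>2 * K1))" "0 <= 24 * (y\<^sup>2 * K0) / \<rho>\<^sup>2" "0 <= 12 * (\<nu> + 1) * K0"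
   using K kL nu by auto
  note u1 = up[OF zero_le_power2[of c] c(3) n(3) mult_mono[OF kL(2) K(4) kL(3) n(1)]]
  note u2 = up[OF zero_le_power2[of c] c(3) n(4) mult_mono[OF kL(2) mult_left_mono[OF K(5) zero_le_power2] kL(3) n(2)]]
  have "24 * (y\<^sup>2 * K0) / \<rho>\<^sup>2 <= 24 * (A1 * E y) / 1"
   using rho K(4) A1(1) E(1)[of y] by (intro frac_le mult_left_mono) auto
  note u3 = up[OF c(1,2) n(5) this]
  have "12 * (\<nu> + 1) * K0 <= 12 * (\<nu> + 1) * (A0 * E y)" using K(3) nu by (intro mult_left_mono) auto
  note u4 = up[OF zero_le_power2[of c] c(3) n(6) this]
  have abs4: "\<bar>a1 - a2 + a3 - a4\<bar> <= b1 + b2 + b3 + b4"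
   if "0 <= a1 & a1 <= 1 * b1" "0 <= a2 & a2 <= 1 * b2" "0 <= a3 & a3 <= 1 * (b3 / 1)" "0 <= a4 & a4 <= 1 * b4" for a1 a2 a3 a4 b1 b2 b3 b4 :: real
   using that by (simp, linarith)
  have "\<bar>R \<rho> \<tau> y * \<rho>\<^sup>2\<bar> <= 24 * L * (A1 * E y) + 24 * L * (x\<^sup>2 * (A2 * E y)) + 24 * (A1 * E y) + 12 * (\<nu> + 1) * (A0 * E y)"
   unfolding R by (rule abs4[OF u1 u2 u3 u4])
  also have "\<dots> = B * E y" by (simp add: B_def algebra_simps)
  finally show ?thesis using rho by (simp add: abs_mult pos_le_divide_eq)
 qed
 define J where "J \<rho> \<tau> = (LINT y|?M. of_real (cutoff \<rho> y ^ 3 * kern \<nu> (remaining t \<tau>) x y) * V \<tau> y)" for \<rho> \<tau>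
 define J' where "J' \<rho> \<tau> = (LINT y|?M. of_real \<sigma> * (of_real (R \<rho> \<tau> y) * V \<tau> y))" for \<rho> \<tau>
 have dJ: "(J \<rho> has_vector_derivative J' \<rho> \<tau>) (at \<tau>)" if "\<rho> >= 1" "\<tau> \<in> {s..t1}" for \<rho> \<tau>
  using pairing_deriv[of \<tau> t \<rho> x] that s unfolding J_def[abs_def] J'_def R_def by simp
 define Q where "Q = \<sigma> * B * (D0 * ((LINT y|?M. E y) + 1))"
 have J'b: "cmod (J' \<rho> \<tau>) <= Q / \<rho>\<^sup>2" if rho: "\<rho> >= 1" and tau: "\<tau> \<in> {s..t1}" for \<rho> \<tau>
 proof -
  have "in_L \<nu> r (V \<tau>)" using Lr s tau by auto
  note EF = D0[OF this M(2)[OF tau] iE E]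
  have "cmod (J' \<rho> \<tau>) <= (LINT y|?M. (\<sigma> * B / \<rho>\<^sup>2) * (E y * cmod (V \<tau> y)))"
   unfolding J'_def
  proof (rule Bochner_Integration.integral_norm_bound_integral)
   show i: "integrable ?M (%y. (\<sigma> * B / \<rho>\<^sup>2) * (E y * cmod (V \<tau> y)))" using EF by (intro integrable_mult_right) auto
   show b: "norm (of_real \<sigma> * (of_real (R \<rho> \<tau> y) * V \<tau> y)) <= \<sigma> * B / \<rho>\<^sup>2 * (E y * cmod (V \<tau> y))" for y
   proof -
    have "norm (of_real \<sigma> * (of_real (R \<rho> \<tau> y) * V \<tau> y)) = \<sigma> * (\<bar>R \<rho> \<tau> y\<bar> * cmod (V \<tau> y))" using sigma by (simp add: norm_mult)
    also have "\<dots> <= \<sigma> * (B / \<rho>\<^sup>2 * E y * cmod (V \<tau> y))" using sigma by (intro mult_left_mono mult_right_mono Rb[OF rho tau]) auto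
    finally show ?thesis by (simp add: mult_ac)
   qed
   show "integrable ?M (%y. of_real \<sigma> * (of_real (R \<rho> \<tau> y) * V \<tau> y))"
   proof (rule Bochner_Integration.integrable_bound[OF i])
    have [measurable]: "V \<tau> \<in> borel_measurable ?M" using \<open>in_L \<nu> r (V \<tau>)\<close> by (simp add: in_L_def)
    have [measurable]: "(%y. kern (\<nu> + 1) \<kappa> x y) \<in> borel_measurable ?M" "(%y. kern (\<nu> + 0) \<kappa> x y) \<in> borel_measurable ?M" for \<kappa>
     using nu by auto
    have [measurable]: "cutoff \<rho> \<in> borel_measurable ?M" "(%y. y) \<in> borel_measurable ?M"
     by (auto intro!: continuous_imp_bessel_measurable continuous_on_cutoff)
    show "(%y. of_real \<sigma> * (of_real (R \<rho> \<tau> y) * V \<tau> y)) \<in> borel_measurable ?M"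
     unfolding R_def by measurable
    show "AE y in ?M. norm (of_real \<sigma> * (of_real (R \<rho> \<tau> y) * V \<tau> y)) <= norm (\<sigma> * B / \<rho>\<^sup>2 * (E y * cmod (V \<tau> y)))"
     by (rule AE_I2, rule order_trans[OF b]) (simp only: real_norm_def abs_ge_self)
   qed
  qed
  also have "\<dots> = \<sigma> * B / \<rho>\<^sup>2 * (LINT y|?M. E y * cmod (V \<tau> y))" by simp
  also have "\<dots> <= \<sigma> * B / \<rho>\<^sup>2 * (D0 * ((LINT y|?M. E y) + 1))" using EF sigma B by (intro mult_left_mono) auto
  finally show ?thesis by (simp add: Q_def)
 qed
 have Jdiff: "cmod (J \<rho> t1 - J \<rho> s) <= Q / \<rho>\<^sup>2 * t1 - Q / \<rho>\<^sup>2 * s" if rho: "\<rho> >= 1" for \<rho>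
 proof (rule differentiable_bound_general[where f = "J \<rho>" and f' = "J' \<rho>" and \<phi> = "%\<tau>. Q / \<rho>\<^sup>2 * \<tau>" and \<phi>' = "%_. Q / \<rho>\<^sup>2"])
  show "continuous_on {s..t1} (J \<rho>)"
   by (rule continuous_at_imp_continuous_on) (use has_vector_derivative_continuous[OF dJ[OF rho]] in blast)
  show "((%\<tau>. Q / \<rho>\<^sup>2 * \<tau>) has_vector_derivative Q / \<rho>\<^sup>2) (at \<tau>)" for \<tau>
   unfolding has_real_derivative_iff_has_vector_derivative[symmetric] by (rule DERIV_cmult_Id)
  show "continuous_on {s..t1} (%\<tau>. Q / \<rho>\<^sup>2 * \<tau>)" by (intro continuous_on_mult continuous_on_const continuous_on_id)
  show "s < t1" by (rule s(2))
  show "(J \<rho> has_vector_derivative J' \<rho> \<tau>) (at \<tau>)" if "s < \<tau>" "\<tau> < t1" for \<tau> using that by (intro dJ[OF rho]) simp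
  show "norm (J' \<rho> \<tau>) <= Q / \<rho>\<^sup>2" if "s < \<tau>" "\<tau> < t1" for \<tau> using that by (intro J'b[OF rho]) simp
 qed
 have lim: "(%n. J (real n) \<tau>) \<longlonglongrightarrow> flow \<nu> (V \<tau>) (remaining t \<tau>) x" if tau: "\<tau> \<in> {s..t1}" for \<tau>
 proof -
  have k: "remaining t \<tau> > 0" using kl[OF tau] l by simp
  have g: "gauss_integrable \<nu> (V \<tau>)" by (rule in_L_imp_gauss_integrable[OF nu r Lr]) (use s tau in auto)
  have i: "integrable ?M (%y. of_real (kern \<nu> (remaining t \<tau>) x y) * V \<tau> y)"
   using kernel_integrand_integrable[OF nu g k, of 0 0 x] by simp
  have "(%n. J (real n) \<tau>) \<longlonglongrightarrow> (LINT y|?M. of_real (kern \<nu> (remaining t \<tau>) x y) * V \<tau> y)"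
   unfolding J_def
  proof (rule integral_dominated_convergence[where w = "%y. cmod (of_real (kern \<nu> (remaining t \<tau>) x y) * V \<tau> y)"])
   show "integrable ?M (%y. cmod (of_real (kern \<nu> (remaining t \<tau>) x y) * V \<tau> y))" by (rule integrable_norm[OF i])
   show m: "(%y. of_real (kern \<nu> (remaining t \<tau>) x y) * V \<tau> y) \<in> borel_measurable ?M" by (rule borel_measurable_integrable[OF i])
   show "(%y. of_real (cutoff (real n) y ^ 3 * kern \<nu> (remaining t \<tau>) x y) * V \<tau> y) \<in> borel_measurable ?M" for n
   proof -
    have "(%y. complex_of_real (cutoff (real n) y ^ 3)) \<in> borel_measurable ?M"
     by (auto intro!: continuous_imp_bessel_measurable continuous_intros)
    from borel_measurable_times[OF this m] show ?thesis by (simp add: mult.assoc)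
   qed
   show "AE y in ?M. (%n. of_real (cutoff (real n) y ^ 3 * kern \<nu> (remaining t \<tau>) x y) * V \<tau> y) \<longlonglongrightarrow> of_real (kern \<nu> (remaining t \<tau>) x y) * V \<tau> y"
   proof (rule AE_I2)
    fix y :: real
    have "(%n. cutoff (real n) y) \<longlonglongrightarrow> max 0 (1 - 0)"
     unfolding cutoff_def by (intro tendsto_max tendsto_diff tendsto_const) real_asymp
    then have "(%n. cutoff (real n) y) \<longlonglongrightarrow> 1" by simp
    then have "(%n. of_real (cutoff (real n) y ^ 3 * kern \<nu> (remaining t \<tau>) x y) * V \<tau> y) \<longlonglongrightarrow> of_real (1 ^ 3 * kern \<nu> (remaining t \<tau>) x y) * V \<tau> y"
     by (intro tendsto_intros)
    then show "(%n. of_real (cutoff (real n) y ^ 3 * kern \<nu> (remaining t \<tau>) x y) * V \<tau> y) \<longlonglongrightarrow> of_real (kern \<nu> (remaining t \<tau>) x y) * V \<tau> y" by simp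
   qed
   show "AE y in ?M. norm (of_real (cutoff (real n) y ^ 3 * kern \<nu> (remaining t \<tau>) x y) * V \<tau> y) <= cmod (of_real (kern \<nu> (remaining t \<tau>) x y) * V \<tau> y)" for n
   proof (rule AE_I2)
    fix y
    have "\<bar>cutoff (real n) y ^ 3\<bar> <= 1" using cutoff_bounds[of "real n" y] by (simp add: power_le_one)
    then show "norm (of_real (cutoff (real n) y ^ 3 * kern \<nu> (remaining t \<tau>) x y) * V \<tau> y) <= cmod (of_real (kern \<nu> (remaining t \<tau>) x y) * V \<tau> y)"
     unfolding of_real_mult norm_mult mult.assoc by (intro mult_left_le_one_le) (simp_all only: norm_of_real norm_ge_zero abs_ge_zero mult_nonneg_nonneg)
   qed
  qed
  then show ?thesis by (simp add: heat_integral_def)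
 qed
 have "(%n. J (real n) t1 - J (real n) s) \<longlonglongrightarrow> flow \<nu> (V t1) (remaining t t1) x - flow \<nu> (V s) (remaining t s) x"
  using s by (intro tendsto_diff lim) auto
 moreover have "(%n. J (real n) t1 - J (real n) s) \<longlonglongrightarrow> 0"
 proof (rule Lim_null_comparison)
  show "\<forall>\<^sub>F n in sequentially. cmod (J (real n) t1 - J (real n) s) <= Q / (real n)\<^sup>2 * t1 - Q / (real n)\<^sup>2 * s"
   using eventually_ge_at_top[of 1] by eventually_elim (rule Jdiff, simp)
  show "(%n. Q / (real n)\<^sup>2 * t1 - Q / (real n)\<^sup>2 * s) \<longlonglongrightarrow> 0" by real_asymp
 qed
 ultimately show ?thesis by (auto dest: LIMSEQ_unique)
qed

text \<open>As the remaining time shrinks, the kernel concentrates at \<open>x\<close>, where the solution is jointly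
continuous.  The far part is harmless: the kernel grows there only polynomially in \<open>\<kappa>\<close> against an
exponentially small factor.\<close>

lemma eq_flow_of_slice:
 assumes r: "1 <= r" and Lr: "!!t. t > 0 ==> in_L \<nu> r (V t)"
  and bd: "!!t1 t2. 0 < t1 ==> t1 <= t2 ==> bounded ((%t. Lnorm \<nu> r (V t)) ` {t1..t2})"
  and s: "0 < s" "s < t" and x: "x >= 0"
 shows "V t x = flow \<nu> (V s) (remaining t s) x"
proof -
 let ?M = "bmeas \<nu>" and ?k = "remaining t"
 obtain M0 where M0: "!!\<tau>. \<tau> \<in> {s..t} ==> \<bar>Lnorm \<nu> r (V \<tau>)\<bar> <= M0"
  using bd[of s t] s by (auto simp: bounded_iff simp del: atLeastAtMost_iff)
 define M where "M = max M0 0"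
 have M: "M >= 0" "!!\<tau>. \<tau> \<in> {s..t} ==> Lnorm \<nu> r (V \<tau>) <= M" using M0 by (force simp: M_def)+
 obtain D0 where D0_nonneg: "D0 >= 0" and D0_all: "\<forall>F G \<gamma>. in_L \<nu> r F & Lnorm \<nu> r F <= M & integrable ?M G & (\<forall>y. 0 <= G y & G y <= \<gamma>) \<longrightarrow>
  integrable ?M (%y. G y * cmod (F y)) & (LINT y|?M. G y * cmod (F y)) <= D0 * ((LINT y|?M. G y) + \<gamma>)"
  using in_L_weighted_bound[OF r M(1), of \<nu>] by (elim exE conjE)
 have D0: "integrable ?M (%y. G y * cmod (F y)) & (LINT y|?M. G y * cmod (F y)) <= D0 * ((LINT y|?M. G y) + \<gamma>)"
  if "in_L \<nu> r F" "Lnorm \<nu> r F <= M" "integrable ?M G" "!!y. 0 <= G y" "!!y. G y <= \<gamma>" for F G \<gamma>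
  by (intro D0_all[rule_format] conjI allI that)
 have ev: "\<forall>\<^sub>F \<tau> in at_left t. \<tau> \<in> {s<..<t}" using s(2) by (rule eventually_at_left_real)
 have top: "filterlim ?k at_top (at_left t)"
  unfolding remaining_def[abs_def] using sigma by real_asymp
 have "((%\<tau>. flow \<nu> (V \<tau>) (?k \<tau>) x) \<longlongrightarrow> V t x) (at_left t)"
 proof (rule tendstoI)
  fix e :: real assume e: "e > 0"
  have tx: "(t, x) \<in> {0<..} \<times> UNIV" using s by simp
  obtain \<delta> where d: "\<delta> > 0" "!!\<tau> y. \<tau> > 0 ==> dist (\<tau>, y) (t, x) < \<delta> ==> dist (V \<tau> y) (V t x) < e / 2"
   using cV[unfolded continuous_on_iff, rule_format, OF tx, of "e / 2"] e by auto
  define h where "h = \<delta> / 2"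
  have h: "h > 0" using d by (simp add: h_def)
  have near: "dist (V \<tau> y) (V t x) < e / 2" if "\<tau> > 0" "\<bar>\<tau> - t\<bar> < h" "\<bar>y - x\<bar> < h" for \<tau> y
  proof (rule d(2)[OF that(1)])
   have "dist (\<tau>, y) (t, x) <= \<bar>\<tau> - t\<bar> + \<bar>y - x\<bar>"
    unfolding dist_Pair_Pair dist_real_def by (rule sqrt_sum_squares_le_sum) auto
   then show "dist (\<tau>, y) (t, x) < \<delta>" using that by (simp add: h_def)
  qed
  let ?g = "2 / Gamma (\<nu> + 1)"
  let ?b = "%\<kappa>. 2 powr (\<nu> + 1) * ((D0 + cmod (V t x)) * exp (- (\<kappa> / 2) * h\<^sup>2) + D0 * ?g * (exp (- (\<kappa> / 2) * h\<^sup>2) * (\<kappa> / 2) powr (\<nu> + 1)))"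
  have "(?b \<longlongrightarrow> 2 powr (\<nu> + 1) * ((D0 + cmod (V t x)) * 0 + D0 * ?g * 0)) at_top"
   using h by (intro tendsto_intros exp_neg_tendsto_0 powr_exp_tendsto_0) auto
  then have "\<forall>\<^sub>F \<kappa> in at_top. ?b \<kappa> < e / 2" using e by (intro order_tendstoD) auto
  then have "\<forall>\<^sub>F \<tau> in at_left t. ?b (?k \<tau>) < e / 2" using top by (rule eventually_compose_filterlim)
  moreover have "\<forall>\<^sub>F \<tau> in at_left t. \<tau> \<in> {t - h<..<t}" using h by (intro eventually_at_left_real) auto
  ultimately show "\<forall>\<^sub>F \<tau> in at_left t. dist (flow \<nu> (V \<tau>) (?k \<tau>) x) (V t x) < e"
   using ev
  proof eventually_elim
   case (elim \<tau>)
   have tau: "\<tau> > 0" "\<tau> < t" "\<tau> \<in> {s..t}" using elim s by auto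
   have k: "?k \<tau> > 0" and k2: "?k \<tau> / 2 > 0" using remaining_deriv(2)[OF tau(2)] by auto
   note Lt = Lr[OF tau(1)]
   have "cmod (flow \<nu> (V \<tau>) (?k \<tau>) x - V t x) <= e / 2 + 2 powr (\<nu> + 1) * exp (- (?k \<tau> / 2) * h\<^sup>2) *
     ((LINT y|?M. kern \<nu> (?k \<tau> / 2) x y * cmod (V \<tau> y)) + cmod (V t x))"
   proof (rule flow_near[OF nu in_L_imp_gauss_integrable[OF nu r Lt] k x h])
    show "AE y in ?M. \<bar>y - x\<bar> < h --> cmod (V \<tau> y - V t x) <= e / 2"
     using near[OF tau(1)] elim by (intro AE_I2) (auto simp: dist_norm intro!: less_imp_le)
   qed (use e in simp)
   also have "\<dots> <= e / 2 + 2 powr (\<nu> + 1) * exp (- (?k \<tau> / 2) * h\<^sup>2) * (D0 * (1 + ?g * (?k \<tau> / 2) powr (\<nu> + 1)) + cmod (V t x))"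
   proof (intro add_left_mono mult_left_mono add_right_mono)
    show "(LINT y|?M. kern \<nu> (?k \<tau> / 2) x y * cmod (V \<tau> y)) <= D0 * (1 + ?g * (?k \<tau> / 2) powr (\<nu> + 1))"
     using D0[OF Lt M(2)[OF tau(3)] kern_mass(1)[OF nu k2, of x] kern_nonneg[OF nu] kern_le_const[OF nu k2]]
     unfolding kern_mass(2)[OF nu k2] by simp
   qed simp
   also have "\<dots> = e / 2 + ?b (?k \<tau>)" by (simp add: algebra_simps)
   also have "\<dots> < e" by (rule order_less_le_trans[OF add_strict_left_mono[OF elim(1)]]) simp
   finally show ?case by (simp add: dist_norm)
  qed
 qed
 moreover have "((%\<tau>. flow \<nu> (V \<tau>) (?k \<tau>) x) \<longlongrightarrow> flow \<nu> (V s) (?k s) x) (at_left t)"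
 proof (rule tendsto_eventually)
  show "\<forall>\<^sub>F \<tau> in at_left t. flow \<nu> (V \<tau>) (?k \<tau>) x = flow \<nu> (V s) (?k s) x"
   using ev by eventually_elim (rule heat_pairing_constant[OF r Lr bd s(1)], auto)
 qed
 ultimately show ?thesis using tendsto_unique[OF trivial_limit_at_left_real] by blast
qed

text \<open>For a fixed positive time the flow is continuous from the space of the initial value to pointwise
values, so the initial time may tend to zero.\<close>

lemma eq_flow_of_initial:
 assumes r: "1 <= r" and Lr: "!!t. t > 0 ==> in_L \<nu> r (V t)"
  and bd: "!!t1 t2. 0 < t1 ==> t1 <= t2 ==> bounded ((%t. Lnorm \<nu> r (V t)) ` {t1..t2})"
  and p: "1 <= p" and F: "in_L \<nu> p F" and lim: "Lconv_at_0 \<nu> p V F" and t: "t > 0"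
 shows "V t x = flow \<nu> F (1 / (4 * \<sigma> * t)) x"
proof -
 have pos: "V t x = flow \<nu> F (remaining t 0) x" if x: "x >= 0" for x
 proof -
  have ev: "\<forall>\<^sub>F s in at_right 0. s \<in> {0<..<t}" using t by (rule eventually_at_right_real)
  have k: "(remaining t \<longlongrightarrow> remaining t 0) (at_right 0)"
   using DERIV_isCont[OF remaining_deriv(1)[OF t]] unfolding isCont_def by (rule tendsto_mono[rotated]) (auto intro: at_le)
  have k0: "remaining t 0 > 0" by (rule remaining_deriv(2)[OF t])
  note GF = in_L_imp_gauss_integrable[OF nu p F]
  let ?e = "enn2real (1 / p)"
  let ?C = "%s. (2 / Gamma (\<nu> + 1) * remaining t s powr (\<nu> + 1)) powr ?e * Lnorm \<nu> p (%x. V s x - F x)"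
  have "(?C \<longlongrightarrow> (2 / Gamma (\<nu> + 1) * remaining t 0 powr (\<nu> + 1)) powr ?e * 0) (at_right 0)"
   using lim k0 Gamma_Suc_pos[OF nu] unfolding Lconv_at_0_def by (intro tendsto_intros tendsto_powr k) auto
  then have C0: "(?C \<longlongrightarrow> 0) (at_right 0)" by simp
  have "((%s. V t x - flow \<nu> F (remaining t s) x) \<longlongrightarrow> 0) (at_right 0)"
  proof (rule Lim_null_comparison[OF _ C0])
   show "\<forall>\<^sub>F s in at_right 0. cmod (V t x - flow \<nu> F (remaining t s) x) <= ?C s"
    using ev lim[unfolded Lconv_at_0_def, THEN conjunct1]
   proof eventually_elim
    case (elim s)
    then have s: "0 < s" "s < t" and d: "in_L \<nu> p (%x. V s x - F x)" by auto
    have ks: "remaining t s > 0" by (rule remaining_deriv(2)[OF s(2)])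
    have e: "V t x = flow \<nu> (V s) (remaining t s) x" by (rule eq_flow_of_slice[OF r Lr bd s x])
    have "V t x - flow \<nu> F (remaining t s) x = flow \<nu> (%y. V s y - F y) (remaining t s) x"
     unfolding e
     by (rule flow_diff[symmetric, OF nu in_L_imp_gauss_integrable[OF nu r Lr[OF s(1)]] GF ks])
    then show ?case using flow_le_Lnorm[OF nu ks p d, of x] by simp
   qed
  qed
  moreover have "((%s. V t x - flow \<nu> F (remaining t s) x) \<longlongrightarrow> V t x - flow \<nu> F (remaining t 0) x) (at_right 0)"
  proof (intro tendsto_diff tendsto_const)
   have "continuous_on {0<..} (%\<kappa>. flow \<nu> F \<kappa> x)"
    by (rule continuous_on_heat_integral'[OF nu GF]) (auto intro: continuous_intros)
   then have "isCont (%\<kappa>. flow \<nu> F \<kappa> x) (remaining t 0)"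
    using k0 by (simp add: continuous_on_eq_continuous_at)
   from isCont_tendsto_compose[OF this k] show "((%s. flow \<nu> F (remaining t s) x) \<longlongrightarrow> flow \<nu> F (remaining t 0) x) (at_right 0)" .
  qed
  ultimately have "V t x - flow \<nu> F (remaining t 0) x = 0"
   using tendsto_unique[OF trivial_limit_at_right_real] by blast
  then show ?thesis by simp
 qed
 have even: "flow \<nu> F \<kappa> (- x) = flow \<nu> F \<kappa> x" for \<kappa> x
  by (simp add: heat_integral_def kern_def)
 have "V t x = flow \<nu> F (remaining t 0) x"
  using pos[of x] pos[of "- x"] even_in_space[OF t, of x] even[of _ x] by (cases "x >= 0") auto
 then show ?thesis by (simp add: remaining_def)
qed

end

section \<open>The Cauchy problem\<close>

text \<open>The chirp turns the equation into the Bessel heat equation.\<close>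

lemma cauchy_solution_unique:
 assumes nu: "\<nu> > - 1/2" and sigma: "\<sigma> > 0" and p: "1 <= p" and r: "1 <= r" and f: "in_L \<nu> p f"
  and v: "cauchy_solution \<nu> \<sigma> a b p r f v" and t: "t > 0"
 shows "v t x = heat_semigroup \<nu> \<sigma> a b t f x"
proof -
 let ?al = "a / b"
 have h: "heat_solution \<nu> \<sigma> a b v" and Lr: "!!t. t > 0 ==> in_L \<nu> r (v t)"
  and bd: "!!t1 t2. 0 < t1 ==> t1 <= t2 ==> bounded ((%t. Lnorm \<nu> r (v t)) ` {t1..t2})"
  and lim: "Lconv_at_0 \<nu> p v f"
  using v unfolding cauchy_solution_def by blast+
 have dv: "(v t has_vector_derivative D (v t) x) (at x)" "(D (v t) has_vector_derivative D (D (v t)) x) (at x)"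
   "((%s. v s x) has_vector_derivative D (%s. v s x) t) (at t)" if "t > 0" for t x
  using h that unfolding heat_solution_def vector_derivative_works by blast+
 have eq: "D (%s. v s x) t = of_real \<sigma> * delta_expr \<nu> a b (v t) x" if "t > 0" "x ~= 0" for t x
 proof -
  have "D (%s. v s x) t - of_real \<sigma> * delta \<nu> a b (v t) x = 0" using h that unfolding heat_solution_def by blast
  then show ?thesis using that by (simp add: delta_def)
 qed
 have cont: "continuous_on ({0<..} \<times> UNIV) (%(t, x). v t x)" "continuous_on ({0<..} \<times> UNIV) (%(t, x). D (v t) x)"
   "continuous_on ({0<..} \<times> UNIV) (%(t, x). D (D (v t)) x)" "continuous_on ({0<..} \<times> UNIV) (%(t, x). D (%s. v s x) t)"
  using h unfolding heat_solution_def by blast+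
 have cc: "continuous_on ({0<..} \<times> UNIV) (%z :: real \<times> real. chirp ?al (snd z))" for S
  by (intro continuous_on_chirp continuous_on_snd continuous_on_id)
 have cx: "continuous_on ({0<..} \<times> UNIV) (%z :: real \<times> real. complex_of_real (?al * snd z))"
  by (intro continuous_on_of_real continuous_on_mult continuous_on_const continuous_on_snd continuous_on_id)
 have cx2: "continuous_on ({0<..} \<times> UNIV) (%z :: real \<times> real. complex_of_real (?al\<^sup>2 * (snd z)\<^sup>2))"
  by (intro continuous_on_of_real continuous_on_mult continuous_on_const continuous_on_power continuous_on_snd continuous_on_id)
 define V where "V t x = chirp ?al x * v t x" for t x
 define Vx where "Vx t x = chirp ?al x * (D (v t) x + \<i> * of_real (?al * x) * v t x)" for t x
 define Vxx where "Vxx t x = chirp ?al x * (D (D (v t)) x + 2 * \<i> * of_real (?al * x) * D (v t) x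
   + (\<i> * of_real ?al - of_real (?al\<^sup>2 * x\<^sup>2)) * v t x)" for t x
 define Vt where "Vt t x = chirp ?al x * D (%s. v s x) t" for t x
 interpret flow_solution \<nu> \<sigma> V Vx Vxx Vt
 proof
  show "\<nu> > - 1/2" "\<sigma> > 0" by fact+
 next
  fix t x :: real assume t: "t > 0"
  show "(V t has_vector_derivative Vx t x) (at x)"
   unfolding V_def[abs_def] Vx_def by (rule chirp_mult_deriv[OF dv(1)[OF t]])
  show "(Vx t has_vector_derivative Vxx t x) (at x)"
   unfolding Vx_def[abs_def] Vxx_def by (rule chirp_mult_deriv2[OF dv(1)[OF t] dv(2)[OF t]])
  show "((%s. V s x) has_vector_derivative Vt t x) (at t)"
   unfolding V_def Vt_def by (rule has_vector_derivative_mult_right[OF dv(3)[OF t]])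
  assume x: "x ~= 0"
  define c where "c = complex_of_real ((2 * \<nu> + 1) / x)"
  have cal: "c * of_real (?al * x) = of_real ((2 * \<nu> + 1) * ?al)" using x by (simp add: c_def)
  have r: "delta_expr \<nu> a b (v t) x = D (D (v t)) x + (c + 2 * \<i> * of_real (?al * x)) * D (v t) x
   - (of_real (?al\<^sup>2 * x\<^sup>2) - 2 * \<i> * of_real ((\<nu> + 1) * ?al)) * v t x"
   unfolding delta_expr_def c_def by (simp add: power_divide)
  have "Vxx t x + c * Vx t x = chirp ?al x * (D (D (v t)) x + (c + 2 * \<i> * of_real (?al * x)) * D (v t) x
   + (\<i> * of_real ?al - of_real (?al\<^sup>2 * x\<^sup>2) + \<i> * (c * of_real (?al * x))) * v t x)"
   unfolding Vxx_def Vx_def by (simp only: ring_distribs mult_ac add_ac diff_conv_add_uminus)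
  also have "\<i> * of_real ?al - of_real (?al\<^sup>2 * x\<^sup>2) + \<i> * (c * of_real (?al * x)) = - (of_real (?al\<^sup>2 * x\<^sup>2) - 2 * \<i> * of_real ((\<nu> + 1) * ?al))"
   unfolding cal by (simp add: algebra_simps add_divide_distrib)
  finally have fin: "Vxx t x + c * Vx t x = chirp ?al x * delta_expr \<nu> a b (v t) x"
   unfolding r by (simp only: mult_minus_left add_uminus_conv_diff)
  show "Vt t x = of_real \<sigma> * (Vxx t x + of_real ((2 * \<nu> + 1) / x) * Vx t x)"
   unfolding c_def[symmetric] Vt_def eq[OF t x] fin by (rule mult.left_commute)
 next
  note U = cont[unfolded case_prod_unfold]
  show "continuous_on ({0<..} \<times> UNIV) (%(t, x). V t x)"
   unfolding V_def case_prod_unfold by (intro continuous_on_mult cc U)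
  show "continuous_on ({0<..} \<times> UNIV) (%(t, x). Vx t x)"
   unfolding Vx_def case_prod_unfold by (intro continuous_on_mult continuous_on_add continuous_on_const cc cx U)
  show "continuous_on ({0<..} \<times> UNIV) (%(t, x). Vxx t x)"
   unfolding Vxx_def case_prod_unfold by (intro continuous_on_mult continuous_on_add continuous_on_diff continuous_on_const cc cx cx2 U)
  show "continuous_on ({0<..} \<times> UNIV) (%(t, x). Vt t x)"
   unfolding Vt_def case_prod_unfold by (intro continuous_on_mult cc U)
 qed
 let ?F = "%y. chirp ?al y * f y"
 have VL: "V t = (%x. chirp ?al x * v t x)" for t by (simp add: V_def fun_eq_iff)
 have "V t x = flow \<nu> ?F (1 / (4 * \<sigma> * t)) x"
 proof (rule eq_flow_of_initial[OF r _ _ p _ _ t])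
  show "in_L \<nu> r (V t)" if "t > 0" for t unfolding VL in_L_chirp by (rule Lr[OF that])
  show "bounded ((%t. Lnorm \<nu> r (V t)) ` {t1..t2})" if "0 < t1" "t1 <= t2" for t1 t2
   unfolding VL Lnorm_chirp by (rule bd[OF that])
  show "in_L \<nu> p ?F" unfolding in_L_chirp by (rule f)
  have "(%x. V t x - ?F x) = (%x. chirp ?al x * (v t x - f x))" for t
   by (simp add: VL fun_eq_iff right_diff_distrib)
  then show "Lconv_at_0 \<nu> p V ?F" using lim by (simp only: Lconv_at_0_def in_L_chirp Lnorm_chirp)
 qed
 then have "chirp (- ?al) x * V t x = heat_semigroup \<nu> \<sigma> a b t f x" using heat_semigroup_eq[OF nu sigma t, of a b f x] by simp
 then show ?thesis by (simp add: V_def)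
qed

text \<open>The exponent \<open>q = 1 / (1 + 1/r - 1/p)\<close>.\<close>

lemma ennreal_Young_exponent:
 fixes p r :: ennreal
 assumes "1 <= p" "p <= r"
 obtains q :: ennreal where "1 <= q" "1 / p + 1 / q = 1 + 1 / r"
proof -
 have anti: "inverse y <= inverse x" if "x <= y" for x y :: ennreal
  using that ereal_inverse_antimono[of "enn2ereal x" "enn2ereal y"]
  by (simp only: less_eq_ennreal.rep_eq inverse_ennreal.rep_eq enn2ereal_nonneg)
 have rp: "1 / r <= 1 / p" using anti[OF assms(2)] by (simp add: divide_ennreal_def)
 have p1: "1 / p <= 1" using anti[OF assms(1)] by (simp add: divide_ennreal_def)
 define e where "e = 1 + 1 / r - 1 / p"
 have "1 / p + e = 1 + 1 / r"
  unfolding e_def by (rule add_diff_inverse_ennreal) (rule order_trans[OF p1], simp)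
 moreover have "e <= 1"
 proof -
  have "e <= 1 + 1 / p - 1 / p" unfolding e_def by (intro ennreal_minus_mono add_left_mono rp order_refl)
  also have "\<dots> = 1" using p1 by (subst ennreal_add_diff_cancel_right) (auto simp: top_unique)
  finally show ?thesis .
 qed
 then have "1 <= inverse e" using anti[of e 1] by simp
 moreover have "inverse (inverse e) = e"
 proof (cases e)
  case (real x)
  then show ?thesis by (cases "x = 0") (simp_all add: inverse_ennreal)
 qed simp
 ultimately show ?thesis by (intro that[of "inverse e"]) (simp_all add: divide_ennreal_def)
qed

lemma heat_semigroup_cauchy_solution:
 assumes nu: "\<nu> > - 1/2" and sigma: "\<sigma> > 0" and p: "1 <= p" and pr: "p <= r" and f: "in_L \<nu> p f"
  and adm: "admissible_initial \<nu> a b p f"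
 shows "cauchy_solution \<nu> \<sigma> a b p r f (%t x. heat_semigroup \<nu> \<sigma> a b t f x)"
proof -
 let ?u = "%t. heat_semigroup \<nu> \<sigma> a b t f"
 have r: "1 <= r" using p pr by (rule order_trans)
 obtain q where q: "1 <= q" "1 / p + 1 / q = 1 + 1 / r" using ennreal_Young_exponent[OF p pr] .
 note B = heat_semigroup_Lp_Lr[OF nu sigma _ p q(1) r q(2) f, of _ a b]
 define b0 where "b0 t = ((4 * \<sigma> * t) powr (\<nu> + 1) * Gamma (\<nu> + 1) / 2) powr (enn2real (1 / q) - 1)
      * (if q = top then 1 else enn2real q powr (- (\<nu> + 1) / enn2real q)) * Lnorm \<nu> p f" for t
 have "bounded ((%t. Lnorm \<nu> r (?u t)) ` {t1..t2})" if t: "0 < t1" "t1 <= t2" for t1 t2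
 proof -
  have pos: "(4 * \<sigma> * t) powr (\<nu> + 1) * Gamma (\<nu> + 1) ~= 0" "4 * \<sigma> * t ~= 0" if "t \<in> {t1..t2}" for t
   using that t sigma Gamma_Suc_pos[OF nu] by auto
  have "continuous_on {t1..t2} b0"
   unfolding b0_def[abs_def] divide_inverse
   by (intro continuous_on_mult continuous_on_const continuous_on_powr continuous_on_id) (use pos in auto)
  then have "bounded (b0 ` {t1..t2})" by (intro compact_imp_bounded compact_continuous_image compact_Icc)
  then obtain K where K: "!!t. t \<in> {t1..t2} ==> \<bar>b0 t\<bar> <= K" unfolding bounded_iff real_norm_def by blast
  have "\<bar>Lnorm \<nu> r (?u s)\<bar> <= K" if "s \<in> {t1..t2}" for s
  proof -
   have "Lnorm \<nu> r (?u s) <= b0 s" using B(2)[of s] that t unfolding b0_def by auto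
   then show ?thesis using K[OF that] Lnorm_nonneg[of \<nu> r "?u s"] by linarith
  qed
  then show ?thesis unfolding bounded_iff real_norm_def by blast
 qed
 moreover have "in_L \<nu> r (?u t)" if "t > 0" for t by (rule B(1)[OF that])
 moreover have "heat_solution \<nu> \<sigma> a b ?u"
  by (rule heat_semigroup_heat_solution[OF nu sigma in_L_imp_gauss_integrable[OF nu p]]) (use f in simp)
 moreover have "Lconv_at_0 \<nu> p ?u f" by (rule heat_semigroup_Lconv[OF nu sigma p f adm])
 ultimately show ?thesis unfolding cauchy_solution_def by blast
qed

section \<open>Schwartz functions\<close>

definition rapid :: "(real => complex) => bool" where
 "rapid f \<longleftrightarrow> (\<forall>n. \<exists>B. \<forall>x. (1 + x\<^sup>2) ^ n * cmod (f x) <= B)"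

definition schwartz :: "(real => complex) set" where
 "schwartz = {f. \<forall>m. (\<forall>x. (D ^^ m) f differentiable (at x)) & rapid ((D ^^ m) f)}"

lemma schwartz_even_iff: "f \<in> schwartz_even \<longleftrightarrow> f \<in> schwartz & (\<forall>x. f (- x) = f x)"
proof -
 have bd: "bdd_above (range h) \<longleftrightarrow> (\<exists>B. \<forall>x. h x <= B)" for h :: "real => real"
  by (simp add: bdd_above_def)
 show ?thesis unfolding schwartz_even_def schwartz_def rapid_def mem_Collect_eq bd by blast
qed

lemma D_funpow_Suc: "(D ^^ m) (D f) = (D ^^ Suc m) f"
 by (simp only: funpow_Suc_right o_apply)

lemma schwartzD:
 assumes f: "f \<in> schwartz"
 shows "rapid f" "(f has_vector_derivative D f x) (at x)" "D f \<in> schwartz" "continuous_on S f"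
proof -
 have all: "(D ^^ m) f differentiable (at x)" "rapid ((D ^^ m) f)" for m x using f unfolding schwartz_def by blast+
 show "rapid f" using all(2)[of 0] by simp
 have d: "(f has_vector_derivative D f x) (at x)" for x using all(1)[of 0 x] by (simp add: vector_derivative_works)
 show "(f has_vector_derivative D f x) (at x)" by (rule d)
 show "D f \<in> schwartz" unfolding schwartz_def mem_Collect_eq D_funpow_Suc using all by blast
 show "continuous_on S f"
  by (rule continuous_at_imp_continuous_on) (use has_vector_derivative_continuous[OF d] in blast)
qed

lemma schwartz_coinduct:
 assumes X: "!!f. f \<in> X ==> rapid f & (\<exists>f'\<in>X. \<forall>x. (f has_vector_derivative f' x) (at x))"
 shows "X \<subseteq> schwartz"
proof
 fix f assume f: "f \<in> X"
 have DX: "D g \<in> X" if g: "g \<in> X" for g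
 proof -
  obtain g' where g': "g' \<in> X" "!!x. (g has_vector_derivative g' x) (at x)" using X[OF g] by blast
  have "D g = g'" using vector_derivative_at[OF g'(2)] by (rule ext)
  then show ?thesis using g'(1) by (simp only:)
 qed
 have DmX: "(D ^^ m) f \<in> X" for m by (induction m) (simp add: f, simp only: funpow.simps o_apply DX)
 show "f \<in> schwartz"
  unfolding schwartz_def mem_Collect_eq
 proof (intro allI conjI)
  fix m x
  obtain g' where "!!x. ((D ^^ m) f has_vector_derivative g' x) (at x)" using X[OF DmX[of m]] by blast
  then show "(D ^^ m) f differentiable (at x)" by (rule differentiableI_vector)
  show "rapid ((D ^^ m) f)" using X[OF DmX[of m]] by (rule conjunct1)
 qed
qed

lemma rapid_bound:
 assumes "rapid f"
 shows "\<exists>B\<ge>0. \<forall>x. (1 + x\<^sup>2) ^ n * cmod (f x) <= B"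
proof -
 obtain B where B: "!!x. (1 + x\<^sup>2) ^ n * cmod (f x) <= B" using assms unfolding rapid_def by blast
 have "0 <= (1 + 0\<^sup>2) ^ n * cmod (f 0)" by simp
 also have "\<dots> <= B" by (rule B)
 finally have "B >= 0" .
 then show ?thesis by (intro exI[of _ B] conjI allI B)
qed

lemma rapid_bounded: "rapid f ==> \<exists>B\<ge>0. \<forall>x. cmod (f x) <= B"
 using rapid_bound[of f 0] by simp

lemma rapid_add: "rapid f ==> rapid g ==> rapid (%x. f x + g x)"
 unfolding rapid_def
proof (intro allI)
 fix n assume "\<forall>n. \<exists>B. \<forall>x. (1 + x\<^sup>2) ^ n * cmod (f x) <= B" "\<forall>n. \<exists>B. \<forall>x. (1 + x\<^sup>2) ^ n * cmod (g x) <= B"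
 then obtain A B where AB: "!!x. (1 + x\<^sup>2) ^ n * cmod (f x) <= A" "!!x. (1 + x\<^sup>2) ^ n * cmod (g x) <= B" by blast
 have "(1 + x\<^sup>2) ^ n * cmod (f x + g x) <= A + B" for x
 proof -
  have "(1 + x\<^sup>2) ^ n * cmod (f x + g x) <= (1 + x\<^sup>2) ^ n * (cmod (f x) + cmod (g x))"
   by (intro mult_left_mono norm_triangle_ineq) simp
  also have "\<dots> <= A + B" using AB[of x] by (simp add: distrib_left)
  finally show ?thesis .
 qed
 then show "\<exists>B. \<forall>x. (1 + x\<^sup>2) ^ n * cmod (f x + g x) <= B" by blast
qed

lemma rapid_scale:
 assumes "rapid f"
 shows "rapid (%x. c * f x)"
 unfolding rapid_def
proof
 fix n
 obtain B where B: "!!x. (1 + x\<^sup>2) ^ n * cmod (f x) <= B" using rapid_bound[OF assms] by blast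
 have "(1 + x\<^sup>2) ^ n * cmod (c * f x) <= cmod c * B" for x
  using mult_left_mono[OF B[of x], of "cmod c"] by (simp add: norm_mult mult_ac)
 then show "\<exists>B. \<forall>x. (1 + x\<^sup>2) ^ n * cmod (c * f x) <= B" by blast
qed

lemma abs_le_one_plus_square: "\<bar>x\<bar> <= 1 + (x::real)\<^sup>2"
proof -
 have "0 <= (\<bar>x\<bar> - 1)\<^sup>2" by simp
 then have "2 * \<bar>x\<bar> <= 1 + x\<^sup>2" by (simp add: power2_diff)
 then show ?thesis by linarith
qed

lemma rapid_mult_x:
 assumes "rapid f"
 shows "rapid (%x. of_real x * f x)"
 unfolding rapid_def
proof
 fix n
 obtain B where B: "!!x. (1 + x\<^sup>2) ^ Suc n * cmod (f x) <= B" using rapid_bound[OF assms, of "Suc n"] by blast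
 have "(1 + x\<^sup>2) ^ n * cmod (of_real x * f x) <= B" for x
 proof -
  have "\<bar>x\<bar> * ((1 + x\<^sup>2) ^ n * cmod (f x)) <= (1 + x\<^sup>2) * ((1 + x\<^sup>2) ^ n * cmod (f x))"
   by (intro mult_right_mono abs_le_one_plus_square) simp
  then show ?thesis using B[of x] by (simp add: norm_mult mult_ac)
 qed
 then show "\<exists>B. \<forall>x. (1 + x\<^sup>2) ^ n * cmod (of_real x * f x) <= B" by blast
qed

lemma one_plus_square_power_le: "\<bar>x\<bar> <= 1 ==> (1 + x\<^sup>2) ^ n <= (2::real) ^ n"
 by (intro power_mono) (auto simp: abs_square_le_1)

text \<open>Decay only concerns large \<open>x\<close>, where \<open>f\<close> is dominated by \<open>x f\<close>.\<close>

lemma rapid_of_mult_x: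
 assumes b: "!!x. cmod (f x) <= C" and r: "rapid (%x. of_real x * f x)"
 shows "rapid f"
 unfolding rapid_def
proof
 fix n
 obtain B where B: "B >= 0" "!!x. (1 + x\<^sup>2) ^ n * cmod (of_real x * f x) <= B" using rapid_bound[OF r] by blast
 have C: "C >= 0" using norm_ge_zero b[of 0] by (rule order_trans)
 have "(1 + x\<^sup>2) ^ n * cmod (f x) <= 2 ^ n * C + B" for x
 proof (cases "\<bar>x\<bar> <= 1")
  case True
  have "(1 + x\<^sup>2) ^ n * cmod (f x) <= 2 ^ n * C" by (intro mult_mono one_plus_square_power_le True b) auto
  then show ?thesis using B(1) by simp
 next
  case False
  have "1 * cmod (f x) <= \<bar>x\<bar> * cmod (f x)" using False by (intro mult_right_mono) auto
  then have "(1 + x\<^sup>2) ^ n * cmod (f x) <= (1 + x\<^sup>2) ^ n * cmod (of_real x * f x)"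
   by (intro mult_left_mono) (auto simp: norm_mult)
  moreover have "0 <= 2 ^ n * C" using C by simp
  ultimately show ?thesis using B(2)[of x] by linarith
 qed
 then show "\<exists>B. \<forall>x. (1 + x\<^sup>2) ^ n * cmod (f x) <= B" by blast
qed

text \<open>Closing a set of rapidly decreasing functions under linear combinations and multiplication by
 the variable turns it into a set of Schwartz functions as soon as derivatives do not leave it.\<close>

inductive_set span :: "(real => complex) set => (real => complex) set" for B where
 base: "f \<in> B ==> f \<in> span B"
| add: "f \<in> span B ==> g \<in> span B ==> (%x. f x + g x) \<in> span B"
| scale: "f \<in> span B ==> (%x. c * f x) \<in> span B"
| mult_x: "f \<in> span B ==> (%x. of_real x * f x) \<in> span B"

lemma has_vector_derivative_mult_x:
 fixes f :: "real => complex"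
 assumes "(f has_vector_derivative f') (at x)"
 shows "((%x. of_real x * f x) has_vector_derivative (f x + of_real x * f')) (at x)"
 using has_vector_derivative_mult[OF has_vector_derivative_of_real[OF DERIV_ident] assms]
 by (simp add: add.commute)

lemma span_schwartz:
 assumes B: "!!f. f \<in> B ==> rapid f & (\<exists>f'\<in>span B. \<forall>x. (f has_vector_derivative f' x) (at x))"
 shows "span B \<subseteq> schwartz"
proof (rule schwartz_coinduct)
 fix f assume "f \<in> span B"
 then show "rapid f & (\<exists>f'\<in>span B. \<forall>x. (f has_vector_derivative f' x) (at x))"
 proof induction
  case (base f)
  then show ?case by (rule B)
 next
  case (add f g)
  then obtain f' g' where "f' \<in> span B" "g' \<in> span B" "\<forall>x. (f has_vector_derivative f' x) (at x)" "\<forall>x. (g has_vector_derivative g' x) (at x)" by blast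
  then show ?case
   using add by (intro conjI rapid_add bexI[of _ "%x. f' x + g' x"] allI has_vector_derivative_add span.add) auto
 next
  case (scale f c)
  then obtain f' where "f' \<in> span B" "\<forall>x. (f has_vector_derivative f' x) (at x)" by blast
  then show ?case
   using scale by (intro conjI rapid_scale bexI[of _ "%x. c * f' x"] allI has_vector_derivative_mult_right span.scale) auto
 next
  case (mult_x f)
  then obtain f' where "f' \<in> span B" "\<forall>x. (f has_vector_derivative f' x) (at x)" by blast
  then show ?case
   using mult_x by (intro conjI rapid_mult_x bexI[of _ "%x. f x + of_real x * f' x"] allI has_vector_derivative_mult_x span.add span.mult_x) auto
 qed
qed

lemma schwartz_closed:
 shows schwartz_add: "f \<in> schwartz ==> g \<in> schwartz ==> (%x. f x + g x) \<in> schwartz"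
  and schwartz_scale: "f \<in> schwartz ==> (%x. c * f x) \<in> schwartz"
  and schwartz_mult_x: "f \<in> schwartz ==> (%x. of_real x * f x) \<in> schwartz"
proof -
 have S: "span schwartz \<subseteq> schwartz"
 proof (rule span_schwartz)
  fix f assume f: "f \<in> schwartz"
  show "rapid f & (\<exists>f'\<in>span schwartz. \<forall>x. (f has_vector_derivative f' x) (at x))"
   by (intro conjI bexI[of _ "D f"] allI schwartzD(1)[OF f] schwartzD(2)[OF f] span.base[OF schwartzD(3)[OF f]])
 qed
 show "f \<in> schwartz ==> g \<in> schwartz ==> (%x. f x + g x) \<in> schwartz"
  by (rule subsetD[OF S]) (intro span.add span.base)
 show "f \<in> schwartz ==> (%x. c * f x) \<in> schwartz"
  by (rule subsetD[OF S]) (intro span.scale span.base)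
 show "f \<in> schwartz ==> (%x. of_real x * f x) \<in> schwartz"
  by (rule subsetD[OF S]) (intro span.mult_x span.base)
qed

lemma schwartz_chirp:
 assumes "f \<in> schwartz"
 shows "(%x. chirp \<alpha> x * f x) \<in> schwartz"
proof -
 have "{%x. chirp \<alpha> x * f x |f. f \<in> schwartz} \<subseteq> schwartz"
 proof (rule schwartz_coinduct, clarify)
  fix f assume f: "f \<in> schwartz"
  have 1: "rapid (%x. chirp \<alpha> x * f x)" using schwartzD(1)[OF f] by (simp add: rapid_def norm_mult)
  have 2: "(%x. D f x + (\<i> * of_real \<alpha>) * (of_real x * f x)) \<in> schwartz"
   by (intro schwartz_add schwartz_scale schwartz_mult_x schwartzD(3) f)
  have 3: "((%x. chirp \<alpha> x * f x) has_vector_derivative chirp \<alpha> x * (D f x + (\<i> * of_real \<alpha>) * (of_real x * f x))) (at x)" for x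
   using chirp_mult_deriv[OF schwartzD(2)[OF f], of \<alpha> x] by (simp add: mult_ac)
  show "rapid (%x. chirp \<alpha> x * f x) \<and>
   (\<exists>f'\<in>{%x. chirp \<alpha> x * f x |f. f \<in> schwartz}. \<forall>x. ((%x. chirp \<alpha> x * f x) has_vector_derivative f' x) (at x))"
   by (intro conjI bexI[of _ "%x. chirp \<alpha> x * (D f x + (\<i> * of_real \<alpha>) * (of_real x * f x))"] allI 1 3)
    (rule CollectI, rule exI[of _ "%x. D f x + (\<i> * of_real \<alpha>) * (of_real x * f x)"], intro conjI refl 2)
 qed
 then show ?thesis using assms by blast
qed

section \<open>Division of the derivative by the variable\<close>

text \<open>For \<open>F = f'\<close> these averages are the derivatives of the difference quotient \<open>(f(x) - f(0)) / x\<close>.\<close>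

definition avg :: "nat => (real => complex) => real => complex" where
 "avg m F x = integral {0..1} (%\<tau>. of_real (\<tau> ^ m) * F (x * \<tau>))"

lemma continuous_on_dilate:
 assumes "continuous_on UNIV F"
 shows "continuous_on S (%\<tau>. of_real (\<tau> ^ m) * F (x * \<tau>) :: complex)"
 by (intro continuous_on_mult continuous_on_of_real continuous_on_power continuous_on_id
   continuous_on_compose2[OF assms] continuous_on_const subset_UNIV)

lemma dilate_deriv:
 fixes F F' :: "real => complex"
 assumes "!!x. (F has_vector_derivative F' x) (at x)"
 shows "((%x. F (x * \<tau>)) has_vector_derivative of_real \<tau> * F' (x * \<tau>)) (at x)"
proof -
 have "((%x. x * \<tau>) has_vector_derivative \<tau>) (at x)"
  unfolding has_real_derivative_iff_has_vector_derivative[symmetric] by (auto intro!: derivative_eq_intros)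
 from vector_diff_chain_at[OF this assms] show ?thesis by (simp add: o_def scaleR_conv_of_real)
qed

lemma avg_deriv:
 assumes d: "!!x. (F has_vector_derivative F' x) (at x)" and c: "continuous_on UNIV F'"
 shows "(avg m F has_vector_derivative avg (Suc m) F' x) (at x)"
proof -
 have cF: "continuous_on UNIV F"
  by (rule continuous_at_imp_continuous_on) (use has_vector_derivative_continuous[OF d] in blast)
 have "((%x. integral (cbox 0 1) (%\<tau>. of_real (\<tau> ^ m) * F (x * \<tau>))) has_vector_derivative
   integral (cbox 0 1) (%\<tau>. of_real (\<tau> ^ Suc m) * F' (x * \<tau>))) (at x within UNIV)"
 proof (rule leibniz_rule_vector_derivative)
  show "((%x. of_real (\<tau> ^ m) * F (x * \<tau>)) has_vector_derivative of_real (\<tau> ^ Suc m) * F' (x * \<tau>)) (at x within UNIV)" for x \<tau>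
   using has_vector_derivative_mult_right[OF dilate_deriv[OF d], of "of_real (\<tau> ^ m)" \<tau> x] by (simp add: mult_ac)
  show "(%\<tau>. of_real (\<tau> ^ m) * F (x * \<tau>)) integrable_on cbox 0 1" for x
   unfolding cbox_interval by (intro integrable_continuous_interval continuous_on_dilate cF)
  show "continuous_on (UNIV \<times> cbox 0 1) (%(x, \<tau>). of_real (\<tau> ^ Suc m) * F' (x * \<tau>))"
   unfolding case_prod_unfold
   by (intro continuous_on_mult continuous_on_of_real continuous_on_power continuous_on_fst continuous_on_snd continuous_on_id
    continuous_on_compose2[OF c] subset_UNIV)
 qed auto
 then show ?thesis by (simp add: avg_def[abs_def] cbox_interval)
qed

lemma avg_by_parts:
 assumes d: "!!x. (F has_vector_derivative F' x) (at x)" and c: "continuous_on UNIV F'"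
 shows "of_real x * avg (Suc m) F' x = F x - of_nat (Suc m) * avg m F x"
  and "of_real x * avg 0 F' x = F x - F 0"
proof -
 have cF: "continuous_on UNIV F"
  by (rule continuous_at_imp_continuous_on) (use has_vector_derivative_continuous[OF d] in blast)
 have dF: "((%\<tau>. F (x * \<tau>)) has_vector_derivative of_real x * F' (x * \<tau>)) (at \<tau>)" for \<tau>
  using dilate_deriv[OF d, of x \<tau>] by (simp add: mult.commute)
 have i: "(%\<tau>. of_real (\<tau> ^ k) * F (x * \<tau>)) integrable_on {0..1}" "(%\<tau>. of_real (\<tau> ^ k) * F' (x * \<tau>)) integrable_on {0..1}" for k
  by (intro integrable_continuous_interval continuous_on_dilate cF c)+
 have "((%\<tau>. of_real x * (of_real (\<tau> ^ 0) * F' (x * \<tau>))) has_integral F (x * 1) - F (x * 0)) {0..1}"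
 proof (rule fundamental_theorem_of_calculus)
  show "((%\<tau>. F (x * \<tau>)) has_vector_derivative of_real x * (of_real (\<tau> ^ 0) * F' (x * \<tau>))) (at \<tau> within {0..1})" for \<tau>
   using dF[of \<tau>] by (simp add: has_vector_derivative_at_within)
 qed simp
 from integral_unique[OF this, unfolded integral_mult_right]
 show "of_real x * avg 0 F' x = F x - F 0" unfolding avg_def by (simp only: mult_1_right mult_zero_right)
 have "((%\<tau>. of_nat (Suc m) * (of_real (\<tau> ^ m) * F (x * \<tau>)) + of_real x * (of_real (\<tau> ^ Suc m) * F' (x * \<tau>))) has_integral
  of_real (1 ^ Suc m) * F (x * 1) - of_real (0 ^ Suc m) * F (x * 0)) {0..1}"
 proof (rule fundamental_theorem_of_calculus)
  fix \<tau> :: real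
  have "((%\<tau>. complex_of_real (\<tau> ^ Suc m)) has_vector_derivative of_real (real (Suc m) * \<tau> ^ m)) (at \<tau>)"
   by (rule has_vector_derivative_of_real) (use DERIV_pow[of "Suc m" \<tau>] in simp)
  from has_vector_derivative_mult[OF this dF[of \<tau>]]
  have "((%\<tau>. of_real (\<tau> ^ Suc m) * F (x * \<tau>)) has_vector_derivative of_nat (Suc m) * (of_real (\<tau> ^ m) * F (x * \<tau>)) + of_real x * (of_real (\<tau> ^ Suc m) * F' (x * \<tau>))) (at \<tau>)"
   by (rule has_vector_derivative_eq_rhs) (simp add: algebra_simps)
  then show "((%\<tau>. of_real (\<tau> ^ Suc m) * F (x * \<tau>)) has_vector_derivative of_nat (Suc m) * (of_real (\<tau> ^ m) * F (x * \<tau>)) + of_real x * (of_real (\<tau> ^ Suc m) * F' (x * \<tau>))) (at \<tau> within {0..1})"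
   by (rule has_vector_derivative_at_within)
 qed simp
 note int = integral_unique[OF this]
 have "integral {0..1} (%\<tau>. of_nat (Suc m) * (of_real (\<tau> ^ m) * F (x * \<tau>)) + of_real x * (of_real (\<tau> ^ Suc m) * F' (x * \<tau>))) =
  integral {0..1} (%\<tau>. of_nat (Suc m) * (of_real (\<tau> ^ m) * F (x * \<tau>))) + integral {0..1} (%\<tau>. of_real x * (of_real (\<tau> ^ Suc m) * F' (x * \<tau>)))"
  by (intro Henstock_Kurzweil_Integration.integral_add integrable_on_mult_right i)
 from this[symmetric, unfolded integral_mult_right] int
 have "of_nat (Suc m) * avg m F x + of_real x * avg (Suc m) F' x = of_real (1 ^ Suc m) * F (x * 1) - of_real (0 ^ Suc m) * F (x * 0)"
  unfolding avg_def by (simp only:)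
 then have "of_nat (Suc m) * avg m F x + of_real x * avg (Suc m) F' x = F x" by simp
 then show "of_real x * avg (Suc m) F' x = F x - of_nat (Suc m) * avg m F x" by (simp add: algebra_simps)
qed

lemma norm_avg_le:
 assumes c: "continuous_on UNIV F" and b: "!!\<tau>. 0 <= \<tau> ==> \<tau> <= 1 ==> cmod (F (x * \<tau>)) <= B"
 shows "cmod (avg m F x) <= B"
proof -
 have "norm (integral {0..1} (%\<tau>. of_real (\<tau> ^ m) * F (x * \<tau>))) <= B * (1 - 0)"
 proof (rule integral_bound)
  fix \<tau> :: real assume t: "\<tau> \<in> {0..1}"
  then have "\<bar>\<tau> ^ m\<bar> * cmod (F (x * \<tau>)) <= 1 * B" by (intro mult_mono b) (auto simp: power_le_one)
  then show "norm (of_real (\<tau> ^ m) * F (x * \<tau>)) <= B" unfolding norm_mult norm_of_real mult_1 .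
 qed (use continuous_on_dilate[OF c] in \<open>simp_all only: zero_le_one\<close>)
 then show ?thesis by (simp add: avg_def)
qed

lemma D_reflect:
 fixes f f' :: "real => complex"
 assumes d: "!!x. (f has_vector_derivative f' x) (at x)" and e: "!!x. f (- x) = s * f x"
 shows "f' (- x) = - (s * f' x)"
proof -
 have "(uminus has_vector_derivative - 1) (at x)"
  using has_vector_derivative_minus[OF has_vector_derivative_id[of "at x"]] by simp
 from vector_diff_chain_at[OF this d] have "((%x. f (- x)) has_vector_derivative - f' (- x)) (at x)" by (simp add: o_def)
 moreover have "((%x. f (- x)) has_vector_derivative s * f' x) (at x)"
  unfolding e by (rule has_vector_derivative_mult_right[OF d])
 ultimately have "- f' (- x) = s * f' x" by (rule vector_derivative_unique_at)
 then show ?thesis by (metis minus_minus)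
qed

text \<open>The function \<open>g'(x) / x\<close> for even \<open>g\<close>, written so that the origin is not exceptional.\<close>

definition E2 :: "(real => complex) => real => complex" where
 "E2 g = avg 0 (D (D g))"

lemma schwartz_D_funpow: "f \<in> schwartz ==> (D ^^ m) f \<in> schwartz"
 by (induction m) (simp, simp only: funpow.simps o_apply schwartzD(3))

lemma schwartz_evenD:
 assumes "g \<in> schwartz_even"
 shows "g \<in> schwartz" "g (- x) = g x" "D g (- x) = - D g x" "D (D g) (- x) = D (D g) x" "D g 0 = 0"
proof -
 show g: "g \<in> schwartz" and e: "g (- x) = g x" for x using assms by (auto simp: schwartz_even_iff)
 show o: "D g (- x) = - D g x" for x
  using D_reflect[OF schwartzD(2)[OF g], of 1 x] e by simp
 show "D (D g) (- x) = D (D g) x"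
  using D_reflect[OF schwartzD(2)[OF schwartzD(3)[OF g]], of "- 1" x] o by simp
 show "D g 0 = 0" using o[of 0] by simp
qed

lemma D_eq_mult_E2:
 assumes g: "g \<in> schwartz_even"
 shows "D g x = of_real x * E2 g x"
 using avg_by_parts(2)[OF schwartzD(2)[OF schwartzD(3)[OF schwartz_evenD(1)[OF g]]] schwartzD(4)[OF schwartzD(3)[OF schwartzD(3)[OF schwartz_evenD(1)[OF g]]]], of x]
 unfolding E2_def schwartz_evenD(5)[OF g] by simp

lemma E2_funpow_deriv:
 assumes g: "g \<in> schwartz"
 shows "(avg m ((D ^^ (m + 2)) g) has_vector_derivative avg (Suc m) ((D ^^ (Suc m + 2)) g) x) (at x)"
  and "of_real x * avg (Suc m) ((D ^^ (Suc m + 2)) g) x = (D ^^ (m + 2)) g x - of_nat (Suc m) * avg m ((D ^^ (m + 2)) g) x"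
proof -
 have d: "((D ^^ (m + 2)) g has_vector_derivative (D ^^ (Suc m + 2)) g x) (at x)" for x
  using schwartzD(2)[OF schwartz_D_funpow[OF g, of "m + 2"], of x] by (simp only: add_Suc funpow.simps o_apply)
 have c: "continuous_on UNIV ((D ^^ (Suc m + 2)) g)" by (rule schwartzD(4)[OF schwartz_D_funpow[OF g]])
 show "(avg m ((D ^^ (m + 2)) g) has_vector_derivative avg (Suc m) ((D ^^ (Suc m + 2)) g) x) (at x)" by (rule avg_deriv[OF d c])
 show "of_real x * avg (Suc m) ((D ^^ (Suc m + 2)) g) x = (D ^^ (m + 2)) g x - of_nat (Suc m) * avg m ((D ^^ (m + 2)) g) x" by (rule avg_by_parts(1)[OF d c])
qed

lemma E2_alt: "E2 g = avg 0 ((D ^^ (0 + 2)) g)"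
 by (simp add: E2_def numeral_2_eq_2)

lemma D_funpow_E2:
 assumes g: "g \<in> schwartz"
 shows "(D ^^ m) (E2 g) = avg m ((D ^^ (m + 2)) g)"
proof (induction m)
 case 0
 show ?case unfolding E2_alt by simp
next
 case (Suc m)
 show ?case unfolding funpow.simps o_apply Suc using vector_derivative_at[OF E2_funpow_deriv(1)[OF g]] by (intro ext) simp
qed

text \<open>Integration by parts expresses \<open>x\<close> times an average through an average of lower order, so decay
is inherited by induction.\<close>

lemma rapid_E2_funpow:
 assumes g: "g \<in> schwartz_even"
 shows "rapid (avg m ((D ^^ (m + 2)) g))"
proof (induction m)
 have b: "\<exists>C. \<forall>x. cmod (avg m ((D ^^ (m + 2)) g) x) <= C" for m
 proof -
  note s = schwartz_D_funpow[OF schwartz_evenD(1)[OF g], of "m + 2"]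
  obtain B where "!!x. cmod ((D ^^ (m + 2)) g x) <= B" using rapid_bounded[OF schwartzD(1)[OF s]] by blast
  then have "cmod (avg m ((D ^^ (m + 2)) g) x) <= B" for x by (intro norm_avg_le schwartzD(4)[OF s])
  then show ?thesis by blast
 qed
 {
  case 0
  have "(%x. of_real x * avg 0 ((D ^^ (0 + 2)) g) x) = D g" by (intro ext) (rule D_eq_mult_E2[OF g, unfolded E2_alt, symmetric])
  then have "rapid (%x. of_real x * avg 0 ((D ^^ (0 + 2)) g) x)" using schwartzD(1)[OF schwartzD(3)[OF schwartz_evenD(1)[OF g]]] by (simp only:)
  moreover obtain C where "!!x. cmod (avg 0 ((D ^^ (0 + 2)) g) x) <= C" using b[of 0] by blast
  ultimately show ?case by (rule rapid_of_mult_x[rotated])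
 next
  case (Suc m)
  have "(%x. of_real x * avg (Suc m) ((D ^^ (Suc m + 2)) g) x) = (%x. (D ^^ (m + 2)) g x + (- of_nat (Suc m)) * avg m ((D ^^ (m + 2)) g) x)"
   unfolding E2_funpow_deriv(2)[OF schwartz_evenD(1)[OF g]] by (simp only: diff_conv_add_uminus mult_minus_left)
  moreover have "rapid (%x. (D ^^ (m + 2)) g x + (- of_nat (Suc m)) * avg m ((D ^^ (m + 2)) g) x)"
   by (intro rapid_add rapid_scale Suc schwartzD(1) schwartz_D_funpow schwartz_evenD(1)[OF g])
  ultimately have "rapid (%x. of_real x * avg (Suc m) ((D ^^ (Suc m + 2)) g) x)" by (simp only:)
  moreover obtain C where "!!x. cmod (avg (Suc m) ((D ^^ (Suc m + 2)) g) x) <= C" using b[of "Suc m"] by blast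
  ultimately show ?case by (rule rapid_of_mult_x[rotated])
 }
qed

lemma E2_schwartz_even:
 assumes g: "g \<in> schwartz_even"
 shows "E2 g \<in> schwartz_even"
proof -
 have "range (%m. avg m ((D ^^ (m + 2)) g)) \<subseteq> schwartz"
 proof (rule schwartz_coinduct)
  fix f assume "f \<in> range (%m. avg m ((D ^^ (m + 2)) g))"
  then obtain m where f: "f = avg m ((D ^^ (m + 2)) g)" by blast
  show "rapid f & (\<exists>f'\<in>range (%m. avg m ((D ^^ (m + 2)) g)). \<forall>x. (f has_vector_derivative f' x) (at x))"
   unfolding f by (intro conjI rapid_E2_funpow[OF g] bexI[of _ "avg (Suc m) ((D ^^ (Suc m + 2)) g)"] allI
     E2_funpow_deriv(1)[OF schwartz_evenD(1)[OF g]] rangeI)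
 qed
 then have "E2 g \<in> schwartz" unfolding E2_alt by (rule subsetD) (rule rangeI)
 moreover have "E2 g (- x) = E2 g x" for x
  using schwartz_evenD(4)[OF g] by (simp add: E2_def avg_def)
 ultimately show ?thesis by (simp add: schwartz_even_iff)
qed

text \<open>Off the origin one divides by \<open>x\<close>; continuity does the rest.\<close>

lemma E2_unique:
 assumes f: "f \<in> schwartz_even" and h: "continuous_on UNIV h"
  and d: "!!x. (f has_vector_derivative of_real x * h x) (at x)"
 shows "E2 f = h"
proof
 fix x
 have eq: "E2 f y = h y" if "y ~= 0" for y
  using vector_derivative_at[OF d[of y]] D_eq_mult_E2[OF f, of y] that by simp
 have c: "isCont (%y. E2 f y - h y) 0"
  using schwartzD(4)[OF schwartz_evenD(1)[OF E2_schwartz_even[OF f]], of UNIV] h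
  by (intro continuous_diff) (simp_all add: continuous_on_eq_continuous_at)
 have "((%y. E2 f y - h y) \<longlongrightarrow> 0) (at 0)"
  by (rule tendsto_eventually) (use eq in \<open>auto simp: eventually_at_filter\<close>)
 from LIM_unique[OF this c[unfolded isCont_def]] have "E2 f 0 - h 0 = 0" by simp
 then show "E2 f x = h x" using eq[of x] by (cases "x = 0") auto
qed

lemma E2_deriv:
 assumes "g \<in> schwartz_even"
 shows "(g has_vector_derivative of_real x * E2 g x) (at x)"
 unfolding D_eq_mult_E2[OF assms, symmetric] by (rule schwartzD(2)[OF schwartz_evenD(1)[OF assms]])

lemma schwartz_even_add: "f \<in> schwartz_even ==> g \<in> schwartz_even ==> (%x. f x + g x) \<in> schwartz_even"
 by (simp add: schwartz_even_iff schwartz_add)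

lemma schwartz_even_scale: "f \<in> schwartz_even ==> (%x. c * f x) \<in> schwartz_even"
 by (simp add: schwartz_even_iff schwartz_scale)

lemma schwartz_even_chirp: "f \<in> schwartz_even ==> (%x. chirp \<alpha> x * f x) \<in> schwartz_even"
 by (simp add: schwartz_even_iff schwartz_chirp)

lemma schwartz_even_mult_square:
 assumes "f \<in> schwartz_even"
 shows "(%x. of_real (x\<^sup>2) * f x) \<in> schwartz_even"
 using schwartz_mult_x[OF schwartz_mult_x[OF schwartz_evenD(1)[OF assms]]] assms
 by (simp add: schwartz_even_iff power2_eq_square mult.assoc)

lemma continuous_schwartz_even: "f \<in> schwartz_even ==> continuous_on S f"
 using schwartzD(4) schwartz_evenD(1) by blast

lemma E2_add:
 assumes f: "f \<in> schwartz_even" and g: "g \<in> schwartz_even"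
 shows "E2 (%x. f x + g x) = (%x. E2 f x + E2 g x)"
proof (rule E2_unique[OF schwartz_even_add[OF f g]])
 show "continuous_on UNIV (%x. E2 f x + E2 g x)" by (intro continuous_schwartz_even schwartz_even_add E2_schwartz_even f g)
 show "((%x. f x + g x) has_vector_derivative of_real x * (E2 f x + E2 g x)) (at x)" for x
  unfolding distrib_left by (intro has_vector_derivative_add E2_deriv f g)
qed

lemma E2_scale:
 assumes f: "f \<in> schwartz_even"
 shows "E2 (%x. c * f x) = (%x. c * E2 f x)"
proof (rule E2_unique[OF schwartz_even_scale[OF f]])
 show "continuous_on UNIV (%x. c * E2 f x)" by (intro continuous_schwartz_even schwartz_even_scale E2_schwartz_even f)
 show "((%x. c * f x) has_vector_derivative of_real x * (c * E2 f x)) (at x)" for x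
  unfolding mult.left_commute[of "of_real x"] by (intro has_vector_derivative_mult_right E2_deriv f)
qed

lemma E2_chirp:
 assumes f: "f \<in> schwartz_even"
 shows "E2 (%x. chirp \<alpha> x * f x) = (%x. chirp \<alpha> x * (E2 f x + \<i> * of_real \<alpha> * f x))"
proof (rule E2_unique[OF schwartz_even_chirp[OF f]])
 show "continuous_on UNIV (%x. chirp \<alpha> x * (E2 f x + \<i> * of_real \<alpha> * f x))"
  by (intro continuous_schwartz_even schwartz_even_add schwartz_even_scale schwartz_even_chirp E2_schwartz_even f)
 show "((%x. chirp \<alpha> x * f x) has_vector_derivative of_real x * (chirp \<alpha> x * (E2 f x + \<i> * of_real \<alpha> * f x))) (at x)" for x
  by (rule has_vector_derivative_eq_rhs[OF chirp_mult_deriv[OF E2_deriv[OF f]]]) (simp add: algebra_simps)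
qed

section \<open>The heat operators on Schwartz functions\<close>

lemma schwartz_even_gauss_integrable:
 assumes nu: "\<nu> > - 1/2" and G: "G \<in> schwartz_even"
 shows "gauss_integrable \<nu> G"
proof -
 obtain B where B: "!!x. cmod (G x) <= B" using rapid_bounded[OF schwartzD(1)[OF schwartz_evenD(1)[OF G]]] by blast
 show ?thesis by (rule bounded_continuous_gauss_integrable[OF nu continuous_schwartz_even[OF G] B])
qed

lemma flow_E2_intertwining:
 assumes nu: "\<nu> > - 1/2" and k: "\<kappa> > 0" and G: "G \<in> schwartz_even"
 shows "of_real (2 * \<kappa>) * (heat_integral \<nu> G 1 1 \<kappa> x - flow \<nu> G \<kappa> x) = flow (\<nu> + 1) (E2 G) \<kappa> x"
proof -
 obtain B where B: "!!x. cmod (G x) <= B" using rapid_bounded[OF schwartzD(1)[OF schwartz_evenD(1)[OF G]]] by blast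
 have nu1: "\<nu> + 1 > - 1/2" using nu by simp
 show ?thesis
  by (rule flow_intertwining[OF nu k continuous_schwartz_even[OF G] B E2_deriv[OF G] schwartz_even_gauss_integrable[OF nu1 E2_schwartz_even[OF G]]])
qed

lemma flow_even: "flow \<nu> F \<kappa> (- x) = flow \<nu> F \<kappa> x"
 by (simp add: heat_integral_def kern_def)

lemma one_plus_square_exp_le:
 assumes c: "c > (0::real)"
 shows "(1 + s\<^sup>2) ^ n * exp (- c * s\<^sup>2) <= fact n / c ^ n * exp c"
proof -
 have "(sqrt (1 + s\<^sup>2)) ^ (2 * n) <= fact n / c ^ n * exp (c * (sqrt (1 + s\<^sup>2))\<^sup>2)" by (rule even_power_le_exp[OF c])
 then have "(1 + s\<^sup>2) ^ n <= fact n / c ^ n * exp (c * (1 + s\<^sup>2))" by (simp add: power_mult)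
 then have "(1 + s\<^sup>2) ^ n * exp (- c * s\<^sup>2) <= fact n / c ^ n * exp (c * (1 + s\<^sup>2)) * exp (- c * s\<^sup>2)"
  by (rule mult_right_mono) simp
 also have "\<dots> = fact n / c ^ n * exp c"
  unfolding mult.assoc exp_add[symmetric] by (simp add: distrib_left)
 finally show ?thesis .
qed

text \<open>A weight in \<open>x\<close> is traded for a weight in \<open>y\<close> and a power of \<open>1 + (x - y)\<^sup>2\<close>, which is absorbed
by passing to the kernel of half the parameter.\<close>

lemma rapid_flow:
 assumes nu: "\<nu> > - 1/2" and k: "\<kappa> > 0" and G: "G \<in> schwartz_even"
 shows "rapid (flow \<nu> G \<kappa>)"
 unfolding rapid_def
proof
 fix n
 have k2: "\<kappa> / 2 > 0" using k by simp
 note g = schwartz_even_gauss_integrable[OF nu G]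
 obtain B where B: "B >= 0" "!!y. (1 + y\<^sup>2) ^ n * cmod (G y) <= B" using rapid_bound[OF schwartzD(1)[OF schwartz_evenD(1)[OF G]]] by blast
 define C where "C = 2 ^ n * B * (2 powr (\<nu> + 1) * (fact n / (\<kappa> / 2) ^ n * exp (\<kappa> / 2)))"
 have pos: "(1 + x\<^sup>2) ^ n * cmod (flow \<nu> G \<kappa> x) <= C" if x: "x >= 0" for x
 proof -
  have "(1 + x\<^sup>2) ^ n * cmod (flow \<nu> G \<kappa> x) <= (1 + x\<^sup>2) ^ n * (LINT y|bmeas \<nu>. kern \<nu> \<kappa> x y * cmod (G y))"
   by (intro mult_left_mono norm_flow_le_LINT(2)[OF nu g k]) simp
  also have "\<dots> = (LINT y|bmeas \<nu>. (1 + x\<^sup>2) ^ n * (kern \<nu> \<kappa> x y * cmod (G y)))" by simp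
  also have "\<dots> <= (LINT y|bmeas \<nu>. C * kern \<nu> (\<kappa> / 2) x y)"
  proof (rule integral_mono)
   show "integrable (bmeas \<nu>) (%y. (1 + x\<^sup>2) ^ n * (kern \<nu> \<kappa> x y * cmod (G y)))"
    by (intro integrable_mult_right norm_flow_le_LINT(1)[OF nu g k])
   show "integrable (bmeas \<nu>) (%y. C * kern \<nu> (\<kappa> / 2) x y)" by (intro integrable_mult_right kern_mass(1)[OF nu k2])
   fix y assume "y \<in> space (bmeas \<nu>)"
   then have y: "y >= 0" by simp
   define s where "s = \<bar>y - x\<bar>"
   have "1 + x\<^sup>2 <= 2 * (1 + y\<^sup>2) * (1 + s\<^sup>2)"
   proof -
    have "0 <= (x - 2 * y)\<^sup>2" by simp
    also have "(x - 2 * y)\<^sup>2 = x\<^sup>2 - 4 * (x * y) + 4 * y\<^sup>2" by (simp add: power2_diff power_mult_distrib)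
    finally have 1: "0 <= x\<^sup>2 - 4 * (x * y) + 4 * y\<^sup>2" .
    have 2: "s\<^sup>2 = x\<^sup>2 - 2 * (x * y) + y\<^sup>2" by (simp add: s_def power2_diff)
    have 3: "2 * (1 + y\<^sup>2) * (1 + s\<^sup>2) = 2 + 2 * s\<^sup>2 + 2 * y\<^sup>2 + 2 * (y\<^sup>2 * s\<^sup>2)" by (simp add: algebra_simps)
    have "0 <= y\<^sup>2 * s\<^sup>2" by simp
    then show ?thesis using 1 2 unfolding 3 by linarith
   qed
   then have "(1 + x\<^sup>2) ^ n <= (2 * (1 + y\<^sup>2) * (1 + s\<^sup>2)) ^ n" by (intro power_mono) auto
   then have 1: "(1 + x\<^sup>2) ^ n <= 2 ^ n * (1 + y\<^sup>2) ^ n * (1 + s\<^sup>2) ^ n" by (simp only: power_mult_distrib)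
   let ?K = "kern \<nu> \<kappa> x y" and ?L = "kern \<nu> (\<kappa> / 2) x y"
   have K: "?K <= 2 powr (\<nu> + 1) * exp (- (\<kappa> / 2) * s\<^sup>2) * ?L"
    by (rule kern_far[OF nu k x y]) (auto simp: s_def)
   have "(1 + x\<^sup>2) ^ n * (?K * cmod (G y)) <= (2 ^ n * (1 + y\<^sup>2) ^ n * (1 + s\<^sup>2) ^ n) * ((2 powr (\<nu> + 1) * exp (- (\<kappa> / 2) * s\<^sup>2) * ?L) * cmod (G y))"
    using kern_nonneg[OF nu] by (intro mult_mono 1 K mult_right_mono) auto
   also have "\<dots> = 2 ^ n * ((1 + y\<^sup>2) ^ n * cmod (G y)) * (2 powr (\<nu> + 1) * ((1 + s\<^sup>2) ^ n * exp (- (\<kappa> / 2) * s\<^sup>2))) * ?L" by (simp only: mult_ac)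
   also have "\<dots> <= C * ?L"
    unfolding C_def using kern_nonneg[OF nu] B(1)
    by (intro mult_right_mono mult_mono[OF mult_left_mono[OF B(2)] mult_left_mono[OF one_plus_square_exp_le[OF k2]]]) auto
   finally show "(1 + x\<^sup>2) ^ n * (?K * cmod (G y)) <= C * ?L" .
  qed
  also have "\<dots> = C" by (simp add: kern_mass(2)[OF nu k2])
  finally show ?thesis .
 qed
 have "(1 + x\<^sup>2) ^ n * cmod (flow \<nu> G \<kappa> x) <= C" for x
  using pos[of x] pos[of "- x"] flow_even[of \<nu> G \<kappa> x] by (cases "x >= 0") auto
 then show "\<exists>B. \<forall>x. (1 + x\<^sup>2) ^ n * cmod (flow \<nu> G \<kappa> x) <= B" by blast
qed

lemma flow_E2_deriv:
 assumes nu: "\<nu> > - 1/2" and k: "\<kappa> > 0" and G: "G \<in> schwartz_even"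
 shows "(flow \<nu> G \<kappa> has_vector_derivative of_real x * flow (\<nu> + 1) (E2 G) \<kappa> x) (at x)"
proof (rule has_vector_derivative_eq_rhs[OF heat_integral_deriv_x[OF nu schwartz_even_gauss_integrable[OF nu G] k]])
 show "of_real (2 * \<kappa> * x) * (heat_integral \<nu> G (Suc 0) (Suc 0) \<kappa> x - flow \<nu> G \<kappa> x) = of_real x * flow (\<nu> + 1) (E2 G) \<kappa> x"
  unfolding flow_E2_intertwining[OF nu k G, symmetric] One_nat_def by (simp only: of_real_mult mult_ac)
qed

text \<open>By the intertwining relation the derivative of a flow is \<open>x\<close> times a flow of the next order, so the
flows of all orders span a space closed under differentiation.\<close>

lemma flow_schwartz_even:
 assumes nu: "\<nu> > - 1/2" and k: "\<kappa> > 0" and G: "G \<in> schwartz_even"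
 shows "flow \<nu> G \<kappa> \<in> schwartz_even"
proof -
 let ?B = "{flow \<mu> G \<kappa> |\<mu> G. \<mu> > - 1/2 & G \<in> schwartz_even}"
 have "span ?B \<subseteq> schwartz"
 proof (rule span_schwartz)
  fix f assume "f \<in> ?B"
  then obtain \<mu> G where f: "f = flow \<mu> G \<kappa>" and m: "\<mu> > - 1/2" and G: "G \<in> schwartz_even" by blast
  have m1: "\<mu> + 1 > - 1/2" using m by simp
  have "(%x. of_real x * flow (\<mu> + 1) (E2 G) \<kappa> x) \<in> span ?B"
   by (rule span.mult_x, rule span.base) (use m1 E2_schwartz_even[OF G] in blast)
  then show "rapid f & (\<exists>f'\<in>span ?B. \<forall>x. (f has_vector_derivative f' x) (at x))"
   unfolding f by (intro conjI rapid_flow[OF m k G] bexI[of _ "%x. of_real x * flow (\<mu> + 1) (E2 G) \<kappa> x"] allI flow_E2_deriv[OF m k G])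
 qed
 moreover have "flow \<nu> G \<kappa> \<in> span ?B" by (rule span.base) (use nu G in blast)
 ultimately have "flow \<nu> G \<kappa> \<in> schwartz" by blast
 then show ?thesis by (simp add: schwartz_even_iff flow_even)
qed

lemma E2_flow:
 assumes nu: "\<nu> > - 1/2" and k: "\<kappa> > 0" and G: "G \<in> schwartz_even"
 shows "E2 (flow \<nu> G \<kappa>) = flow (\<nu> + 1) (E2 G) \<kappa>"
proof (rule E2_unique[OF flow_schwartz_even[OF assms] _ flow_E2_deriv[OF assms]])
 have nu1: "\<nu> + 1 > - 1/2" using nu by simp
 show "continuous_on UNIV (flow (\<nu> + 1) (E2 G) \<kappa>)"
  by (rule continuous_schwartz_even[OF flow_schwartz_even[OF nu1 k E2_schwartz_even[OF G]]])
qed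

text \<open>The Bessel operator \<open>g'' + ((2 \<nu> + 1) / x) g'\<close>, since \<open>g' = x E g\<close> and \<open>g'' = E g + x\<^sup>2 E\<^sup>2 g\<close>
for \<open>E g = g' / x\<close>.\<close>

definition bessel_op :: "real => (real => complex) => real => complex" where
 "bessel_op \<nu> G x = of_real (x\<^sup>2) * E2 (E2 G) x + of_real (2 * \<nu> + 2) * E2 G x"

text \<open>Moving \<open>E2\<close> through the flow raises the order; the contiguity relation, integrated against
\<open>y\<^sup>2\<close>, and the intertwining relation bring it down again.\<close>

lemma bessel_op_flow:
 assumes nu: "\<nu> > - 1/2" and k: "\<kappa> > 0" and G: "G \<in> schwartz_even"
 shows "bessel_op \<nu> (flow \<nu> G \<kappa>) x = flow \<nu> (bessel_op \<nu> G) \<kappa> x"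
proof -
 define H where "H = E2 G"
 have H: "H \<in> schwartz_even" "E2 H \<in> schwartz_even" using G by (simp_all add: H_def E2_schwartz_even)
 have nu1: "\<nu> + 1 > - 1/2" using nu by simp
 have e2: "\<nu> + 1 + 1 = \<nu> + 2" by simp
 note gi = schwartz_even_gauss_integrable
 have sq: "heat_integral \<nu> F 1 1 \<kappa> x = flow (\<nu> + 1) F \<kappa> x" if F: "F \<in> schwartz_even" for F
 proof -
  have "(%y. of_real (kern (\<nu> + 1) \<kappa> x y) * F y) \<in> borel_measurable (bmeas \<nu>)"
   using gauss_integrable_measurable[OF gi[OF nu F]] nu1 by measurable
  from bessel_measure_Suc(2)[OF this] show ?thesis by (simp add: heat_integral_def mult_ac)
 qed
 have Msq: "flow \<nu> (%y. of_real (y\<^sup>2) * F y) \<kappa> x = of_real ((\<nu> + 1) / \<kappa>) * flow (\<nu> + 1) F \<kappa> x + of_real (x\<^sup>2) * flow (\<nu> + 2) F \<kappa> x"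
  if F: "F \<in> schwartz_even" for F
 proof -
  have m: "(%y. of_real (kern \<mu> \<kappa> x y) * F y) \<in> borel_measurable (bmeas \<nu>')" if "\<mu> > - 1/2" "\<nu>' > - 1/2" for \<mu> \<nu>'
   using gauss_integrable_measurable[OF gi[OF that(2) F]] that(1) by measurable
  have a: "flow \<nu> (%y. of_real (y\<^sup>2) * F y) \<kappa> x = heat_integral \<nu> F 0 1 \<kappa> x" by (simp add: heat_integral_def mult_ac)
  have "(LINT y|bmeas (\<nu> + 1). of_real (y\<^sup>2) * (of_real (kern (\<nu> + 2) \<kappa> x y) * F y)) = (LINT y|bmeas \<nu>. of_real (y\<^sup>2) * (of_real (y\<^sup>2) * (of_real (kern (\<nu> + 2) \<kappa> x y) * F y)))"
  proof (rule bessel_measure_Suc(2))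
   have "(%y. complex_of_real (y\<^sup>2)) \<in> borel_measurable (bmeas \<nu>)"
    by (intro continuous_imp_bessel_measurable continuous_on_of_real continuous_on_power continuous_on_id)
   from borel_measurable_times[OF this m[of "\<nu> + 2" \<nu>]] show "(%y. of_real (y\<^sup>2) * (of_real (kern (\<nu> + 2) \<kappa> x y) * F y)) \<in> borel_measurable (bmeas \<nu>)" using nu by simp
  qed
  moreover have "(LINT y|bmeas (\<nu> + 1 + 1). of_real (kern (\<nu> + 2) \<kappa> x y) * F y) = (LINT y|bmeas (\<nu> + 1). of_real (y\<^sup>2) * (of_real (kern (\<nu> + 2) \<kappa> x y) * F y))"
   by (rule bessel_measure_Suc(2)[OF m]) (use nu in auto)
  ultimately have b: "heat_integral \<nu> F 2 2 \<kappa> x = flow (\<nu> + 2) F \<kappa> x"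
   unfolding e2 by (simp add: heat_integral_def mult_ac power2_eq_square power4_eq_xxxx)
  note heat_integral_contiguous[OF nu gi[OF nu F] k, of 0 1 x, unfolded One_nat_def[symmetric] Suc_1 of_nat_0 add_0_right]
  then show ?thesis unfolding a b sq[OF F] .
 qed
 have tw: "of_real (2 * \<kappa>) * (flow (\<nu> + 1) H \<kappa> x - flow \<nu> H \<kappa> x) = flow (\<nu> + 1) (E2 H) \<kappa> x"
  using flow_E2_intertwining[OF nu k H(1), of x] unfolding sq[OF H(1)] .
 have "bessel_op \<nu> (flow \<nu> G \<kappa>) x = of_real (x\<^sup>2) * flow (\<nu> + 2) (E2 H) \<kappa> x + of_real (2 * \<nu> + 2) * flow (\<nu> + 1) H \<kappa> x"
  unfolding bessel_op_def E2_flow[OF nu k G] H_def[symmetric] E2_flow[OF nu1 k H(1)] e2 ..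
 moreover have "flow \<nu> (bessel_op \<nu> G) \<kappa> x = flow \<nu> (%y. of_real (y\<^sup>2) * E2 H y) \<kappa> x + of_real (2 * \<nu> + 2) * flow \<nu> H \<kappa> x"
  unfolding bessel_op_def[abs_def] H_def[symmetric]
  by (subst flow_add[OF nu gi[OF nu schwartz_even_mult_square[OF H(2)]] gi[OF nu schwartz_even_scale[OF H(1)]] k])
   (simp only: flow_cmult)
 moreover have "complex_of_real ((\<nu> + 1) / \<kappa>) * (of_real (2 * \<kappa>) * z) = of_real (2 * \<nu> + 2) * z" for z
 proof -
  have "(\<nu> + 1) / \<kappa> * (2 * \<kappa>) = 2 * \<nu> + 2" using k by simp
  then show ?thesis by (simp only: mult.assoc[symmetric] of_real_mult[symmetric])
 qed
 ultimately show ?thesis unfolding Msq[OF H(2)] tw[symmetric] by (simp add: right_diff_distrib)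
qed

section \<open>Expansion of the semigroup at time zero\<close>

text \<open>The operator \<open>delta\<close> written through \<open>E2\<close>, which makes its value at the origin visible.\<close>

definition chirp_op :: "real => real => (real => complex) => real => complex" where
 "chirp_op \<nu> \<alpha> g x = of_real (x\<^sup>2) * E2 (E2 g) x + of_real (2 * \<nu> + 2) * E2 g x
  + (2 * \<i> * of_real \<alpha>) * (of_real (x\<^sup>2) * E2 g x) + (- of_real (\<alpha>\<^sup>2)) * (of_real (x\<^sup>2) * g x)
  + (2 * \<i> * of_real ((\<nu> + 1) * \<alpha>)) * g x"

lemma chirp_op_schwartz_even: "g \<in> schwartz_even ==> chirp_op \<nu> \<alpha> g \<in> schwartz_even"
 unfolding chirp_op_def[abs_def]
 by (intro schwartz_even_add schwartz_even_scale schwartz_even_mult_square E2_schwartz_even)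

lemma delta_schwartz:
 assumes g: "g \<in> schwartz_even"
 shows "delta \<nu> a b g = chirp_op \<nu> (a / b) g"
proof
 define \<alpha> where "\<alpha> = a / b"
 have a2: "a\<^sup>2 / b\<^sup>2 = \<alpha>\<^sup>2" by (simp add: \<alpha>_def power_divide)
 have Dg: "D g = (%x. of_real x * E2 g x)" by (intro ext D_eq_mult_E2[OF g])
 have expr: "delta_expr \<nu> a b g x = chirp_op \<nu> \<alpha> g x" if x: "x ~= 0" for x
 proof -
  have q: "complex_of_real ((2 * \<nu> + 1) / x) * (of_real x * z) = of_real (2 * \<nu> + 1) * z" for z
   using x by simp
  have "((%x. of_real x * E2 g x) has_vector_derivative E2 g x + of_real x * (of_real x * E2 (E2 g) x)) (at x)"
   by (rule has_vector_derivative_mult_x[OF E2_deriv[OF E2_schwartz_even[OF g]]])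
  from vector_derivative_at[OF this] have DD: "D (D g) x = E2 g x + of_real x * (of_real x * E2 (E2 g) x)" unfolding Dg .
  have "delta_expr \<nu> a b g x = D (D g) x
  + (of_real ((2 * \<nu> + 1) / x) + 2 * \<i> * of_real (\<alpha> * x)) * D g x
  - (of_real (\<alpha>\<^sup>2 * x\<^sup>2) - 2 * \<i> * of_real ((\<nu> + 1) * \<alpha>)) * g x"
   unfolding delta_expr_def a2 \<alpha>_def[symmetric] ..
  also have "\<dots> = E2 g x + of_real x * (of_real x * E2 (E2 g) x)
  + (of_real ((2 * \<nu> + 1) / x) + 2 * \<i> * of_real (\<alpha> * x)) * (of_real x * E2 g x)
  - (of_real (\<alpha>\<^sup>2 * x\<^sup>2) - 2 * \<i> * of_real ((\<nu> + 1) * \<alpha>)) * g x"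
  proof -
   have "A + c * B - e = A' + c * B' - e" if "A = A'" "B = B'" for A A' B B' c e :: complex using that by simp
   from this[OF DD D_eq_mult_E2[OF g, of x]] show ?thesis .
  qed
  also have "\<dots> = E2 g x + of_real x * (of_real x * E2 (E2 g) x)
  + (of_real (2 * \<nu> + 1) * E2 g x + 2 * \<i> * of_real (\<alpha> * x) * (of_real x * E2 g x))
  - (of_real (\<alpha>\<^sup>2 * x\<^sup>2) - 2 * \<i> * of_real ((\<nu> + 1) * \<alpha>)) * g x"
   unfolding distrib_right q ..
  also have "\<dots> = chirp_op \<nu> \<alpha> g x" unfolding chirp_op_def by (simp add: algebra_simps power2_eq_square)
  finally show ?thesis .
 qed
 have cont: "continuous_on UNIV (chirp_op \<nu> \<alpha> g)" by (rule continuous_schwartz_even[OF chirp_op_schwartz_even[OF g]])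
 then have "(chirp_op \<nu> \<alpha> g \<longlongrightarrow> chirp_op \<nu> \<alpha> g 0) (at 0)" by (simp add: continuous_on_eq_continuous_at isCont_def)
 then have "(delta_expr \<nu> a b g \<longlongrightarrow> chirp_op \<nu> \<alpha> g 0) (at 0)"
  by (rule Lim_transform_eventually) (use expr in \<open>auto simp: eventually_at_filter\<close>)
 then have "Lim (at 0) (delta_expr \<nu> a b g) = chirp_op \<nu> \<alpha> g 0" by (intro tendsto_Lim) auto
 then show "delta \<nu> a b g x = chirp_op \<nu> (a / b) g x" for x
  unfolding delta_def \<alpha>_def[symmetric] using expr[of x] by (cases "x = 0") simp_all
qed

lemma chirp_op_conjugate:
 assumes g: "g \<in> schwartz_even"
 shows "chirp \<alpha> x * chirp_op \<nu> \<alpha> g x = bessel_op \<nu> (%x. chirp \<alpha> x * g x) x"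
proof -
 define H where "H x = E2 g x + \<i> * of_real \<alpha> * g x" for x
 have H: "H \<in> schwartz_even" unfolding H_def[abs_def] by (intro schwartz_even_add schwartz_even_scale E2_schwartz_even g)
 have EH: "E2 H = (%x. E2 (E2 g) x + \<i> * of_real \<alpha> * E2 g x)"
  unfolding H_def[abs_def] E2_add[OF E2_schwartz_even[OF g] schwartz_even_scale[OF g]] E2_scale[OF g] ..
 have 1: "E2 (%x. chirp \<alpha> x * g x) = (%x. chirp \<alpha> x * H x)" unfolding E2_chirp[OF g] H_def ..
 show ?thesis
  unfolding bessel_op_def 1 E2_chirp[OF H] unfolding EH unfolding chirp_op_def H_def
  by (simp add: algebra_simps power2_eq_square)
qed

lemma heat_semigroup_schwartz_eq:
 assumes nu: "\<nu> > - 1/2" and sigma: "\<sigma> > 0" and t: "t > 0"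
 shows "heat_semigroup \<nu> \<sigma> a b t g = (%x. chirp (- (a / b)) x * flow \<nu> (%y. chirp (a / b) y * g y) (1 / (4 * \<sigma> * t)) x)"
 by (intro ext heat_semigroup_eq[OF nu sigma t])

lemma heat_semigroup_schwartz_even:
 assumes nu: "\<nu> > - 1/2" and sigma: "\<sigma> > 0" and t: "t > 0" and g: "g \<in> schwartz_even"
 shows "heat_semigroup \<nu> \<sigma> a b t g \<in> schwartz_even"
 unfolding heat_semigroup_schwartz_eq[OF nu sigma t]
 using sigma t by (intro schwartz_even_chirp flow_schwartz_even nu g) simp

lemma chirp_op_heat_semigroup:
 assumes nu: "\<nu> > - 1/2" and sigma: "\<sigma> > 0" and t: "t > 0" and g: "g \<in> schwartz_even"
 shows "chirp_op \<nu> (a / b) (heat_semigroup \<nu> \<sigma> a b t g) x = heat_semigroup \<nu> \<sigma> a b t (chirp_op \<nu> (a / b) g) x"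
proof -
 let ?S = "heat_semigroup \<nu> \<sigma> a b t" and ?k = "1 / (4 * \<sigma> * t)" and ?al = "a / b"
 have k: "?k > 0" using sigma t by simp
 let ?G = "%y. chirp ?al y * g y"
 have e: "(%x. chirp ?al x * ?S g x) = flow \<nu> ?G ?k"
  unfolding heat_semigroup_schwartz_eq[OF nu sigma t] by simp
 have "chirp ?al x * chirp_op \<nu> ?al (?S g) x = bessel_op \<nu> (flow \<nu> ?G ?k) x"
  unfolding chirp_op_conjugate[OF heat_semigroup_schwartz_even[OF nu sigma t g]] e ..
 also have "\<dots> = flow \<nu> (bessel_op \<nu> ?G) ?k x"
  by (rule bessel_op_flow[OF nu k schwartz_even_chirp[OF g]])
 also have "bessel_op \<nu> ?G = (%x. chirp ?al x * chirp_op \<nu> ?al g x)"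
  by (intro ext chirp_op_conjugate[OF g, symmetric])
 finally have "chirp (- ?al) x * (chirp ?al x * chirp_op \<nu> ?al (?S g) x) = ?S (chirp_op \<nu> ?al g) x"
  unfolding heat_semigroup_schwartz_eq[OF nu sigma t] by (simp only:)
 then show ?thesis by (simp only: chirp_inverse)
qed

lemma heat_semigroup_scale:
 assumes "\<nu> > - 1/2" "\<sigma> > 0" "t > 0"
 shows "heat_semigroup \<nu> \<sigma> a b t (%y. c * g y) x = c * heat_semigroup \<nu> \<sigma> a b t g x"
 unfolding heat_semigroup_schwartz_eq[OF assms] mult.left_commute[of _ c] flow_cmult ..

text \<open>The heat equation together with the fact that the semigroup commutes with its generator.\<close>

lemma heat_semigroup_time_deriv:
 assumes nu: "\<nu> > - 1/2" and sigma: "\<sigma> > 0" and t: "t > 0" and g: "g \<in> schwartz_even"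
 shows "((%s. heat_semigroup \<nu> \<sigma> a b s g x) has_vector_derivative heat_semigroup \<nu> \<sigma> a b t (%y. of_real \<sigma> * delta \<nu> a b g y) x) (at t)"
proof -
 let ?u = "%t x. heat_semigroup \<nu> \<sigma> a b t g x"
 have h: "heat_solution \<nu> \<sigma> a b ?u"
  by (rule heat_semigroup_heat_solution[OF nu sigma schwartz_even_gauss_integrable[OF nu schwartz_even_chirp[OF g]]])
 have d: "((%s. ?u s x) has_vector_derivative D (%s. ?u s x) t) (at t)"
  and e: "D (%s. ?u s x) t - of_real \<sigma> * delta \<nu> a b (?u t) x = 0"
  using h t unfolding heat_solution_def vector_derivative_works by blast+
 have "D (%s. ?u s x) t = of_real \<sigma> * delta \<nu> a b (?u t) x" using e by simp
 also have "\<dots> = heat_semigroup \<nu> \<sigma> a b t (%y. of_real \<sigma> * delta \<nu> a b g y) x"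
  unfolding heat_semigroup_scale[OF nu sigma t] delta_schwartz[OF g] delta_schwartz[OF heat_semigroup_schwartz_even[OF nu sigma t g]]
   chirp_op_heat_semigroup[OF nu sigma t g] ..
 finally show ?thesis using d by simp
qed

lemma heat_semigroup_initial:
 assumes nu: "\<nu> > - 1/2" and sigma: "\<sigma> > 0" and x: "x >= 0" and g: "g \<in> schwartz_even"
 shows "((%t. heat_semigroup \<nu> \<sigma> a b t g x) \<longlongrightarrow> g x) (at_right 0)"
proof -
 let ?G = "%y. chirp (a / b) y * g y"
 have G: "?G \<in> schwartz_even" by (rule schwartz_even_chirp[OF g])
 obtain B where B: "!!x. cmod (?G x) <= B" using rapid_bounded[OF schwartzD(1)[OF schwartz_evenD(1)[OF G]]] by blast
 have "((%\<kappa>. flow \<nu> ?G \<kappa> x) \<longlongrightarrow> ?G x) at_top"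
 proof (rule flow_tendsto_bounded[OF nu schwartz_even_gauss_integrable[OF nu G] x])
  show "AE y in bmeas \<nu>. cmod (?G y) <= B" using B by simp
  fix \<epsilon> :: real assume "\<epsilon> > 0"
  then obtain \<delta> where "\<delta> > 0" "!!y. dist y x < \<delta> ==> dist (?G y) (?G x) < \<epsilon>"
   using continuous_schwartz_even[OF G, of UNIV] unfolding continuous_on_iff by blast
  then show "\<exists>\<delta>>0. AE y in bmeas \<nu>. \<bar>y - x\<bar> < \<delta> --> cmod (?G y - ?G x) <= \<epsilon>"
   by (intro exI[of _ \<delta>] conjI AE_I2) (auto simp: dist_norm intro: less_imp_le)
 qed
 from filterlim_compose[OF this inverse_time_at_top[OF sigma]]
 have "((%t. chirp (- (a / b)) x * flow \<nu> ?G (1 / (4 * \<sigma> * t)) x) \<longlongrightarrow> chirp (- (a / b)) x * ?G x) (at_right 0)"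
  by (rule tendsto_mult_left)
 then have "((%t. chirp (- (a / b)) x * flow \<nu> ?G (1 / (4 * \<sigma> * t)) x) \<longlongrightarrow> g x) (at_right 0)" by simp
 moreover have "\<forall>\<^sub>F t in at_right 0. chirp (- (a / b)) x * flow \<nu> ?G (1 / (4 * \<sigma> * t)) x = heat_semigroup \<nu> \<sigma> a b t g x"
  using eventually_at_right_less by eventually_elim (simp only: heat_semigroup_schwartz_eq[OF nu sigma])
 ultimately show ?thesis by (rule Lim_transform_eventually)
qed

text \<open>Induction on \<open>n\<close>: the time derivative of the remainder is the remainder of order \<open>n - 1\<close> for the
generator applied to \<open>g\<close>, and the remainder vanishes as \<open>t\<close> tends to zero.\<close>

lemma heat_semigroup_Taylor:
 fixes \<nu> \<sigma> a b :: real
 defines "T \<equiv> %h y. of_real \<sigma> * delta \<nu> a b h y"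
 assumes nu: "\<nu> > - 1/2" and sigma: "\<sigma> > 0"
 assumes "g \<in> schwartz_even" "!!y. y >= 0 ==> cmod ((T ^^ n) g y) <= B" "t > 0" "x >= 0"
 shows "cmod (heat_semigroup \<nu> \<sigma> a b t g x - (\<Sum>k<n. of_real (t ^ k / fact k) * (T ^^ k) g x)) <= B * t ^ n / fact n"
 using assms(4-)
proof (induction n arbitrary: g t)
 case 0
 have k: "1 / (4 * \<sigma> * t) > 0" using sigma 0 by simp
 have "cmod (flow \<nu> (%y. chirp (a / b) y * g y) (1 / (4 * \<sigma> * t)) x) <= B"
  by (rule norm_flow_le_sup[OF nu schwartz_even_gauss_integrable[OF nu schwartz_even_chirp[OF 0(1)]] k])
   (use 0(2) in \<open>auto simp: norm_mult intro!: AE_I2\<close>)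
 then show ?case unfolding heat_semigroup_schwartz_eq[OF nu sigma 0(3)] by (simp add: norm_mult)
next
 case (Suc n)
 let ?S = "%t. heat_semigroup \<nu> \<sigma> a b t"
 have Tg: "T g \<in> schwartz_even"
  unfolding T_def delta_schwartz[OF Suc.prems(1)] by (intro schwartz_even_scale chirp_op_schwartz_even Suc.prems(1))
 have sw: "(T ^^ k) (T g) = (T ^^ Suc k) g" for k by (simp add: funpow_swap1)
 have B: "B >= 0" using norm_ge_zero Suc.prems(2)[of 0] by (rule order_trans) simp
 define f where "f \<tau> = ?S \<tau> g x - (\<Sum>k<Suc n. of_real (\<tau> ^ k / fact k) * (T ^^ k) g x)" for \<tau>
 define f' where "f' \<tau> = ?S \<tau> (T g) x - (\<Sum>k<n. of_real (\<tau> ^ k / fact k) * (T ^^ k) (T g) x)" for \<tau>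
 have f_eq: "f \<tau> = ?S \<tau> g x - (g x + (\<Sum>k<n. of_real (\<tau> ^ Suc k / fact (Suc k)) * (T ^^ Suc k) g x))" for \<tau>
  unfolding f_def sum.lessThan_Suc_shift by simp
 have df: "(f has_vector_derivative f' \<tau>) (at \<tau>)" if tau: "\<tau> > 0" for \<tau>
 proof -
  have p: "((%\<tau>. complex_of_real (\<tau> ^ Suc k / fact (Suc k)) * z) has_vector_derivative of_real (\<tau> ^ k / fact k) * z) (at \<tau>)" for k z
  proof -
   have "((%\<tau>. \<tau> ^ Suc k / fact (Suc k)) has_real_derivative real (Suc k) * \<tau> ^ k / fact (Suc k)) (at \<tau>)"
    by (rule DERIV_cdivide) (use DERIV_pow[of "Suc k" \<tau>] in simp)
   moreover have "real (Suc k) * \<tau> ^ k / fact (Suc k) = \<tau> ^ k / fact k" by (simp add: fact_Suc del: of_nat_Suc)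
   ultimately have "((%\<tau>. \<tau> ^ Suc k / fact (Suc k)) has_real_derivative \<tau> ^ k / fact k) (at \<tau>)" by (simp only:)
   from has_vector_derivative_mult_left[OF has_vector_derivative_of_real[OF this]] show ?thesis .
  qed
  have "((%\<tau>. ?S \<tau> g x - (g x + (\<Sum>k<n. of_real (\<tau> ^ Suc k / fact (Suc k)) * (T ^^ Suc k) g x))) has_vector_derivative
    ?S \<tau> (T g) x - (0 + (\<Sum>k<n. of_real (\<tau> ^ k / fact k) * (T ^^ Suc k) g x))) (at \<tau>)"
   unfolding T_def
   by (intro has_vector_derivative_diff has_vector_derivative_add has_vector_derivative_const has_vector_derivative_sum p
     heat_semigroup_time_deriv[OF nu sigma tau Suc.prems(1)])
  then show ?thesis unfolding f_eq[abs_def] f'_def sw by simp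
 qed
 have bf: "cmod (f' \<tau>) <= B * \<tau> ^ n / fact n" if "\<tau> > 0" for \<tau>
  unfolding f'_def by (rule Suc.IH[OF Tg _ that Suc.prems(4)]) (use Suc.prems(2) in \<open>simp only: sw\<close>)
 have dphi: "((%\<tau>. B * \<tau> ^ Suc n / fact (Suc n)) has_vector_derivative B * \<tau> ^ n / fact n) (at \<tau>)" for \<tau>
 proof -
  have "((%\<tau>. B * \<tau> ^ Suc n / fact (Suc n)) has_real_derivative B * (real (Suc n) * \<tau> ^ n) / fact (Suc n)) (at \<tau>)"
   by (intro DERIV_cdivide DERIV_cmult) (use DERIV_pow[of "Suc n" \<tau>] in simp)
  moreover have "B * (real (Suc n) * \<tau> ^ n) / fact (Suc n) = B * \<tau> ^ n / fact n" by (simp add: fact_Suc del: of_nat_Suc)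
  ultimately show ?thesis unfolding has_real_derivative_iff_has_vector_derivative[symmetric] by (simp only:)
 qed
 have step: "cmod (f t) <= cmod (f \<epsilon>) + B * t ^ Suc n / fact (Suc n)" if e: "0 < \<epsilon>" "\<epsilon> < t" for \<epsilon>
 proof -
  have "norm (f t - f \<epsilon>) <= B * t ^ Suc n / fact (Suc n) - B * \<epsilon> ^ Suc n / fact (Suc n)"
  proof (rule differentiable_bound_general[where f = f and f' = f' and \<phi> = "%\<tau>. B * \<tau> ^ Suc n / fact (Suc n)" and \<phi>' = "%\<tau>. B * \<tau> ^ n / fact n"])
   show "\<epsilon> < t" by (rule e(2))
   show "continuous_on {\<epsilon>..t} f"
    by (rule continuous_at_imp_continuous_on) (use has_vector_derivative_continuous[OF df] e in auto)
   show "continuous_on {\<epsilon>..t} (%\<tau>. B * \<tau> ^ Suc n / fact (Suc n))"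
    by (rule continuous_at_imp_continuous_on) (use has_vector_derivative_continuous[OF dphi] in blast)
   show "((%\<tau>. B * \<tau> ^ Suc n / fact (Suc n)) has_vector_derivative B * \<tau> ^ n / fact n) (at \<tau>)" for \<tau> by (rule dphi)
   show "(f has_vector_derivative f' \<tau>) (at \<tau>)" if "\<epsilon> < \<tau>" for \<tau> using that e by (intro df) simp
   show "norm (f' \<tau>) <= B * \<tau> ^ n / fact n" if "\<epsilon> < \<tau>" for \<tau> using that e by (intro bf) simp
  qed
  moreover have "0 <= B * \<epsilon> ^ Suc n / fact (Suc n)" using B e by simp
  moreover have "cmod (f t) <= cmod (f \<epsilon>) + cmod (f t - f \<epsilon>)" by (rule norm_triangle_sub)
  ultimately show ?thesis by linarith
 qed
 have "(f \<longlongrightarrow> g x - (g x + (\<Sum>k<n. of_real (0 ^ Suc k / fact (Suc k)) * (T ^^ Suc k) g x))) (at_right 0)"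
  unfolding f_eq[abs_def]
  by (intro tendsto_diff tendsto_add tendsto_const tendsto_sum tendsto_mult tendsto_of_real tendsto_divide tendsto_power tendsto_ident_at
    heat_semigroup_initial[OF nu sigma Suc.prems(4,1)]) auto
 then have "(f \<longlongrightarrow> 0) (at_right 0)" by simp
 then have "((%\<epsilon>. cmod (f \<epsilon>) + B * t ^ Suc n / fact (Suc n)) \<longlongrightarrow> 0 + B * t ^ Suc n / fact (Suc n)) (at_right 0)"
  by (intro tendsto_add tendsto_const tendsto_norm_zero)
 moreover have "\<forall>\<^sub>F \<epsilon> in at_right 0. cmod (f t) <= cmod (f \<epsilon>) + B * t ^ Suc n / fact (Suc n)"
  using eventually_at_right_real[OF Suc.prems(3)] by eventually_elim (use step in auto)
 ultimately have "cmod (f t) <= 0 + B * t ^ Suc n / fact (Suc n)"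
  by (rule tendsto_lowerbound) simp
 then show ?case unfolding f_def by simp
qed

section \<open>Continuity with respect to the seminorms\<close>

text \<open>The pointwise parameter \<open>x\<close> allows seminorms to be handled before taking the supremum.\<close>

definition ctrl :: "((real => complex) => real => real) => bool" where
 "ctrl Q \<longleftrightarrow> (\<exists>C\<ge>0. \<exists>nms. \<forall>g\<in>schwartz_even. \<forall>x\<ge>0. Q g x <= C * (\<Sum>(i, j)\<leftarrow>nms. schwartz_seminorm i j g))"

lemma schwartz_seminorm_ge:
 assumes g: "g \<in> schwartz" and x: "x >= 0"
 shows "(1 + x\<^sup>2) ^ n * cmod ((D ^^ m) g x) <= schwartz_seminorm n m g"
proof -
 obtain B where B: "!!x. (1 + x\<^sup>2) ^ n * cmod ((D ^^ m) g x) <= B"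
  using rapid_bound[OF schwartzD(1)[OF schwartz_D_funpow[OF g, of m]], of n] by blast
 then have "bdd_above ((%x. (1 + x\<^sup>2) ^ n * cmod ((D ^^ m) g x)) ` {0..})" by (intro bdd_aboveI2)
 then show ?thesis unfolding schwartz_seminorm_def using x by (intro cSUP_upper) auto
qed

lemma schwartz_seminorm_nonneg: "g \<in> schwartz ==> schwartz_seminorm n m g >= 0"
 by (rule order_trans[OF _ schwartz_seminorm_ge[of g 0]]) auto

lemma seminorm_sum_nonneg: "g \<in> schwartz_even ==> 0 <= (\<Sum>(i, j)\<leftarrow>nms. schwartz_seminorm i j g)"
 by (induction nms) (auto intro!: add_nonneg_nonneg schwartz_seminorm_nonneg schwartz_evenD(1))

lemma ctrl_seminorm: "ctrl (%g x. schwartz_seminorm i j g)"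
 unfolding ctrl_def by (rule exI[of _ 1], rule conjI, simp, rule exI[of _ "[(i, j)]"]) simp

lemma ctrl_mono:
 assumes "ctrl Q'" "!!g x. g \<in> schwartz_even ==> x >= 0 ==> Q g x <= Q' g x"
 shows "ctrl Q"
 using assms(1) unfolding ctrl_def
proof (elim exE conjE)
 fix C nms assume C: "C >= 0" and b: "\<forall>g\<in>schwartz_even. \<forall>x\<ge>0. Q' g x <= C * (\<Sum>(i, j)\<leftarrow>nms. schwartz_seminorm i j g)"
 show "\<exists>C\<ge>0. \<exists>nms. \<forall>g\<in>schwartz_even. \<forall>x\<ge>0. Q g x <= C * (\<Sum>(i, j)\<leftarrow>nms. schwartz_seminorm i j g)"
  by (intro exI[of _ C] exI[of _ nms] conjI C ballI allI impI, rule order_trans[OF assms(2)], assumption+) (use b in blast)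
qed

lemma ctrl_weight: "ctrl (%g x. (1 + x\<^sup>2) ^ n * cmod ((D ^^ m) g x))"
 by (rule ctrl_mono[OF ctrl_seminorm[of n m]]) (rule schwartz_seminorm_ge[OF schwartz_evenD(1)])

lemma ctrl_add:
 assumes "ctrl Q1" "ctrl Q2"
 shows "ctrl (%g x. Q1 g x + Q2 g x)"
proof -
 let ?s = "%nms g. \<Sum>(i, j)\<leftarrow>nms. schwartz_seminorm i j g"
 obtain C1 n1 where 1: "C1 >= 0" "!!g x. g \<in> schwartz_even ==> x >= 0 ==> Q1 g x <= C1 * ?s n1 g" using assms(1) unfolding ctrl_def by blast
 obtain C2 n2 where 2: "C2 >= 0" "!!g x. g \<in> schwartz_even ==> x >= 0 ==> Q2 g x <= C2 * ?s n2 g" using assms(2) unfolding ctrl_def by blast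
 have key: "Q1 g x + Q2 g x <= (C1 + C2) * ?s (n1 @ n2) g" if g: "g \<in> schwartz_even" "x >= 0" for g x
 proof -
  have "0 <= C1 * ?s n2 g" "0 <= C2 * ?s n1 g" using 1(1) 2(1) seminorm_sum_nonneg[OF g(1)] by simp_all
  moreover have "(C1 + C2) * ?s (n1 @ n2) g = C1 * ?s n1 g + C2 * ?s n2 g + C1 * ?s n2 g + C2 * ?s n1 g" by (simp add: algebra_simps)
  ultimately show ?thesis using 1(2)[OF g] 2(2)[OF g] by linarith
 qed
 show ?thesis unfolding ctrl_def
  by (intro exI[of _ "C1 + C2"] conjI exI[of _ "n1 @ n2"] ballI allI impI add_nonneg_nonneg 1(1) 2(1) key)
qed

lemma ctrl_scale:
 assumes "ctrl Q" "c >= 0"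
 shows "ctrl (%g x. c * Q g x)"
proof -
 let ?s = "%nms g. \<Sum>(i, j)\<leftarrow>nms. schwartz_seminorm i j g"
 obtain C n where 1: "C >= 0" "!!g x. g \<in> schwartz_even ==> x >= 0 ==> Q g x <= C * ?s n g" using assms(1) unfolding ctrl_def by blast
 have "c * Q g x <= (c * C) * ?s n g" if "g \<in> schwartz_even" "x >= 0" for g x
  using mult_left_mono[OF 1(2)[OF that] assms(2)] by (simp only: mult.assoc)
 then show ?thesis unfolding ctrl_def using 1(1) assms(2) by (intro exI[of _ "c * C"] exI[of _ n]) auto
qed

text \<open>Continuous operators on the even Schwartz functions.\<close>

definition tame :: "((real => complex) => real => complex) => bool" where
 "tame T \<longleftrightarrow> (\<forall>g\<in>schwartz_even. T g \<in> schwartz_even) & (\<forall>n m. ctrl (%g x. (1 + x\<^sup>2) ^ n * cmod ((D ^^ m) (T g) x)))"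

lemma tame_ctrl: "tame T ==> ctrl (%g x. (1 + x\<^sup>2) ^ n * cmod ((D ^^ m) (T g) x))"
 unfolding tame_def by blast

lemma tame_schwartz: "tame T ==> g \<in> schwartz_even ==> T g \<in> schwartz_even"
 unfolding tame_def by blast

lemma tame_id: "tame (%g. g)"
 unfolding tame_def using ctrl_weight by simp

lemma tame_seminorm:
 assumes T: "tame T"
 shows "ctrl (%g x. schwartz_seminorm i j (T g))"
proof -
 obtain C nms where C: "C >= 0" "!!g x. g \<in> schwartz_even ==> x >= 0 ==>
   (1 + x\<^sup>2) ^ i * cmod ((D ^^ j) (T g) x) <= C * (\<Sum>(i, j)\<leftarrow>nms. schwartz_seminorm i j g)"
  using tame_ctrl[OF T, of i j] unfolding ctrl_def by blast
 have "schwartz_seminorm i j (T g) <= C * (\<Sum>(i, j)\<leftarrow>nms. schwartz_seminorm i j g)" if "g \<in> schwartz_even" for g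
  unfolding schwartz_seminorm_def[of i j] by (rule cSUP_least) (use C(2)[OF that] in auto)
 then show ?thesis unfolding ctrl_def using C(1) by (intro exI[of _ C] exI[of _ nms]) auto
qed

lemma ctrl_comp:
 assumes Q: "ctrl Q" and T: "tame T"
 shows "ctrl (%g x. Q (T g) x)"
proof -
 obtain C nms where C: "C >= 0" "!!g x. g \<in> schwartz_even ==> x >= 0 ==> Q g x <= C * (\<Sum>(i, j)\<leftarrow>nms. schwartz_seminorm i j g)"
  using Q unfolding ctrl_def by blast
 have "ctrl (%g x. (\<Sum>(i, j)\<leftarrow>nms. schwartz_seminorm i j (T g)))" for nms
 proof (induction nms)
  case Nil
  show ?case unfolding ctrl_def by (rule exI[of _ 0], rule conjI, simp, rule exI[of _ "[]"]) simp
 next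
  case (Cons p nms)
  then show ?case using ctrl_add[OF tame_seminorm[OF T, of "fst p" "snd p"] Cons] by (simp add: case_prod_unfold)
 qed
 then show ?thesis by (rule ctrl_mono[OF ctrl_scale[OF _ C(1)]]) (rule C(2)[OF tame_schwartz[OF T]])
qed

lemma tame_comp:
 assumes T1: "tame T1" and T2: "tame T2"
 shows "tame (%g. T1 (T2 g))"
 unfolding tame_def
proof (intro conjI ballI allI)
 show "T1 (T2 g) \<in> schwartz_even" if "g \<in> schwartz_even" for g by (rule tame_schwartz[OF T1 tame_schwartz[OF T2 that]])
 show "ctrl (%g x. (1 + x\<^sup>2) ^ n * cmod ((D ^^ m) (T1 (T2 g)) x))" for n m
  by (rule ctrl_comp[OF tame_ctrl[OF T1] T2])
qed

lemma D_funpow_add: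
 assumes "f \<in> schwartz" "g \<in> schwartz"
 shows "(D ^^ m) (%x. f x + g x) = (%x. (D ^^ m) f x + (D ^^ m) g x)"
proof (induction m)
 case (Suc m)
 show ?case unfolding funpow.simps o_apply Suc
  by (intro ext vector_derivative_at has_vector_derivative_add schwartzD(2) schwartz_D_funpow assms)
qed simp

lemma D_funpow_scale:
 assumes "f \<in> schwartz"
 shows "(D ^^ m) (%x. c * f x) = (%x. c * (D ^^ m) f x)"
proof (induction m)
 case (Suc m)
 show ?case unfolding funpow.simps o_apply Suc
  by (intro ext vector_derivative_at has_vector_derivative_mult_right schwartzD(2) schwartz_D_funpow assms)
qed simp

lemma D_funpow_mult_x:
 assumes f: "f \<in> schwartz"
 shows "(D ^^ m) (%x. of_real x * f x) = (%x. of_real x * (D ^^ m) f x + of_nat m * (D ^^ (m - 1)) f x)"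
proof (induction m)
 case (Suc m)
 have d: "((D ^^ k) f has_vector_derivative (D ^^ Suc k) f x) (at x)" for k x
  using schwartzD(2)[OF schwartz_D_funpow[OF f, of k], of x] by (simp only: funpow.simps o_apply)
 have m: "((%x. of_nat m * (D ^^ (m - 1)) f x) has_vector_derivative of_nat m * (D ^^ m) f x) (at x)" for x
  using has_vector_derivative_mult_right[OF d[of "m - 1" x], of "of_nat m"] by (cases m) (simp_all only: diff_Suc_1 of_nat_0 mult_zero_left)
 have "D (%x. of_real x * (D ^^ m) f x + of_nat m * (D ^^ (m - 1)) f x) x = ((D ^^ m) f x + of_real x * (D ^^ Suc m) f x) + of_nat m * (D ^^ m) f x" for x
  by (intro vector_derivative_at has_vector_derivative_add has_vector_derivative_mult_x d m)
 then show ?case unfolding funpow.simps(2)[of m D] o_apply Suc diff_Suc_1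
  by (intro ext) (simp only: funpow.simps(2)[of m D] o_apply of_nat_Suc distrib_right mult_1 add_ac)
qed simp

lemma tame_add:
 assumes T: "tame T1" "tame T2"
 shows "tame (%g x. T1 g x + T2 g x)"
 unfolding tame_def
proof (intro conjI ballI allI)
 show "(%x. T1 g x + T2 g x) \<in> schwartz_even" if "g \<in> schwartz_even" for g
  by (rule schwartz_even_add[OF tame_schwartz[OF T(1) that] tame_schwartz[OF T(2) that]])
 show "ctrl (%g x. (1 + x\<^sup>2) ^ n * cmod ((D ^^ m) (%x. T1 g x + T2 g x) x))" for n m
 proof (rule ctrl_mono[OF ctrl_add[OF tame_ctrl[OF T(1), of n m] tame_ctrl[OF T(2), of n m]]])
  fix g and x :: real assume g: "g \<in> schwartz_even"
  have "(1 + x\<^sup>2) ^ n * cmod ((D ^^ m) (T1 g) x + (D ^^ m) (T2 g) x) <= (1 + x\<^sup>2) ^ n * (cmod ((D ^^ m) (T1 g) x) + cmod ((D ^^ m) (T2 g) x))"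
   by (intro mult_left_mono norm_triangle_ineq) simp
  then show "(1 + x\<^sup>2) ^ n * cmod ((D ^^ m) (%x. T1 g x + T2 g x) x) <= (1 + x\<^sup>2) ^ n * cmod ((D ^^ m) (T1 g) x) + (1 + x\<^sup>2) ^ n * cmod ((D ^^ m) (T2 g) x)"
   unfolding D_funpow_add[OF schwartz_evenD(1)[OF tame_schwartz[OF T(1) g]] schwartz_evenD(1)[OF tame_schwartz[OF T(2) g]]] by (simp only: distrib_left)
 qed
qed

lemma tame_scale: "tame (%g x. c * g x)"
 unfolding tame_def
proof (intro conjI ballI allI)
 show "(%x. c * g x) \<in> schwartz_even" if "g \<in> schwartz_even" for g by (rule schwartz_even_scale[OF that])
 show "ctrl (%g x. (1 + x\<^sup>2) ^ n * cmod ((D ^^ m) (%x. c * g x) x))" for n m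
 proof (rule ctrl_mono[OF ctrl_scale[OF ctrl_weight[of n m] norm_ge_zero[of c]]])
  fix g and x :: real assume g: "g \<in> schwartz_even"
  show "(1 + x\<^sup>2) ^ n * cmod ((D ^^ m) (%x. c * g x) x) <= cmod c * ((1 + x\<^sup>2) ^ n * cmod ((D ^^ m) g x))"
   unfolding D_funpow_scale[OF schwartz_evenD(1)[OF g]] norm_mult by (simp only: mult.left_commute order_refl)
 qed
qed

lemma tame_mult_square: "tame (%g x. of_real (x\<^sup>2) * g x)"
 unfolding tame_def
proof (intro conjI ballI allI)
 show "(%x. of_real (x\<^sup>2) * g x) \<in> schwartz_even" if "g \<in> schwartz_even" for g by (rule schwartz_even_mult_square[OF that])
 fix n m
 let ?w = "%n m g x. (1 + x\<^sup>2) ^ n * cmod ((D ^^ m) g x)"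
 show "ctrl (%g x. ?w n m (%x. of_real (x\<^sup>2) * g x) x)"
 proof (rule ctrl_mono[OF ctrl_add[OF ctrl_weight[of "Suc n" m] ctrl_add[OF ctrl_scale[OF ctrl_weight[of "Suc n" "m - 1"], of "2 * real m"]
    ctrl_scale[OF ctrl_weight[of n "m - 1 - 1"], of "real m * real (m - 1)"]]]])
  fix g and x :: real assume g: "g \<in> schwartz_even"
  note gs = schwartz_evenD(1)[OF g]
  let ?d = "%k. cmod ((D ^^ k) g x)"
  have "(D ^^ m) (%x. of_real (x\<^sup>2) * g x) x = (D ^^ m) (%x. of_real x * (of_real x * g x)) x" by (simp add: power2_eq_square mult.assoc)
  also have "\<dots> = of_real (x * x) * (D ^^ m) g x + of_real (2 * real m * x) * (D ^^ (m - 1)) g x + of_real (real m * real (m - 1)) * (D ^^ (m - 1 - 1)) g x"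
   unfolding D_funpow_mult_x[OF schwartz_mult_x[OF gs]] D_funpow_mult_x[OF gs] by (simp add: algebra_simps)
  also have "cmod \<dots> <= \<bar>x * x\<bar> * ?d m + \<bar>2 * real m * x\<bar> * ?d (m - 1) + \<bar>real m * real (m - 1)\<bar> * ?d (m - 1 - 1)"
   unfolding norm_of_real[symmetric, where 'a = complex] norm_mult[symmetric] by (intro norm_triangle_mono add_mono order_refl)
  also have "\<dots> <= (1 + x\<^sup>2) * ?d m + 2 * real m * (1 + x\<^sup>2) * ?d (m - 1) + real m * real (m - 1) * ?d (m - 1 - 1)"
  proof (intro add_mono mult_right_mono)
   show "\<bar>2 * real m * x\<bar> <= 2 * real m * (1 + x\<^sup>2)" unfolding abs_mult by (intro mult_mono abs_le_one_plus_square) auto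
  qed (auto simp: power2_eq_square)
  finally have "?w n m (%x. of_real (x\<^sup>2) * g x) x <= (1 + x\<^sup>2) ^ n * ((1 + x\<^sup>2) * ?d m + 2 * real m * (1 + x\<^sup>2) * ?d (m - 1) + real m * real (m - 1) * ?d (m - 1 - 1))"
   by (intro mult_left_mono) auto
  also have "\<dots> = ?w (Suc n) m g x + (2 * real m * ?w (Suc n) (m - 1) g x + real m * real (m - 1) * ?w n (m - 1 - 1) g x)"
  proof -
   have "W * (S * d0 + 2 * k * S * d1 + k * l * d2) = S * W * d0 + (2 * k * (S * W * d1) + k * l * (W * d2))"
    for W S d0 d1 d2 k l :: real by (simp add: algebra_simps)
   then show ?thesis unfolding power_Suc .
  qed
  finally show "?w n m (%x. of_real (x\<^sup>2) * g x) x <= ?w (Suc n) m g x + (2 * real m * ?w (Suc n) (m - 1) g x + real m * real (m - 1) * ?w n (m - 1 - 1) g x)" .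
 qed auto
qed

lemma weighted_split:
 assumes x: "x >= 0" and near: "x <= 1 ==> cmod V <= Z" and far: "cmod (of_real x * V) <= Y" and Z: "Z >= 0"
 shows "(1 + x\<^sup>2) ^ n * cmod V <= 2 ^ n * Z + (1 + x\<^sup>2) ^ n * Y"
proof (cases "x <= 1")
 case True
 have "(1 + x\<^sup>2) ^ n * cmod V <= 2 ^ n * Z" using x by (intro mult_mono one_plus_square_power_le near True) (auto simp: True)
 moreover have "0 <= Y" using norm_ge_zero far by (rule order_trans)
 then have "0 <= (1 + x\<^sup>2) ^ n * Y" by (intro mult_nonneg_nonneg) auto
 ultimately show ?thesis by linarith
next
 case False
 have "1 * cmod V <= x * cmod V" using False by (intro mult_right_mono) auto
 then have "cmod V <= Y" using far x by (simp add: norm_mult)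
 then have "(1 + x\<^sup>2) ^ n * cmod V <= (1 + x\<^sup>2) ^ n * Y" by (intro mult_left_mono) auto
 moreover have "0 <= 2 ^ n * Z" using Z by simp
 ultimately show ?thesis by linarith
qed

text \<open>On \<open>[0, 1]\<close> the averages are bounded by a derivative of \<open>g\<close>; beyond \<open>1\<close> the recursion from
integration by parts applies.\<close>

lemma tame_E2: "tame E2"
 unfolding tame_def
proof (intro conjI ballI allI)
 show "E2 g \<in> schwartz_even" if "g \<in> schwartz_even" for g by (rule E2_schwartz_even[OF that])
 fix n m
 let ?W = "%m g. avg m ((D ^^ (m + 2)) g)"
 have near: "cmod (?W m g x) <= schwartz_seminorm 0 (m + 2) g" if g: "g \<in> schwartz_even" and x: "x >= 0" for g x m
 proof (rule norm_avg_le)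
  show "continuous_on UNIV ((D ^^ (m + 2)) g)" by (rule schwartzD(4)[OF schwartz_D_funpow[OF schwartz_evenD(1)[OF g]]])
  show "cmod ((D ^^ (m + 2)) g (x * \<tau>)) <= schwartz_seminorm 0 (m + 2) g" if "0 <= \<tau>" for \<tau>
   using schwartz_seminorm_ge[OF schwartz_evenD(1)[OF g], of "x * \<tau>" 0 "m + 2"] x that by (simp only: power_0 mult_1 mult_nonneg_nonneg)
 qed
 have nn: "0 <= schwartz_seminorm i j g" if "g \<in> schwartz_even" for i j g by (rule schwartz_seminorm_nonneg[OF schwartz_evenD(1)[OF that]])
 have "ctrl (%g x. (1 + x\<^sup>2) ^ n * cmod (?W m g x))"
 proof (induction m)
  case 0
  show ?case
  proof (rule ctrl_mono[OF ctrl_add[OF ctrl_scale[OF ctrl_seminorm[of 0 "0 + 2"], of "2 ^ n"] ctrl_weight[of n 1]]])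
   fix g and x :: real assume g: "g \<in> schwartz_even" and x: "x >= 0"
   have "of_real x * ?W 0 g x = (D ^^ 1) g x" using D_eq_mult_E2[OF g, of x] unfolding E2_alt by (simp only: One_nat_def funpow.simps o_apply id_apply)
   then show "(1 + x\<^sup>2) ^ n * cmod (?W 0 g x) <= 2 ^ n * schwartz_seminorm 0 (0 + 2) g + (1 + x\<^sup>2) ^ n * cmod ((D ^^ 1) g x)"
    by (intro weighted_split x near[OF g x] nn[OF g]) (simp only: order_refl)
  qed simp
 next
  case (Suc m)
  show ?case
  proof (rule ctrl_mono[OF ctrl_add[OF ctrl_scale[OF ctrl_seminorm[of 0 "Suc m + 2"], of "2 ^ n"]
     ctrl_add[OF ctrl_weight[of n "m + 2"] ctrl_scale[OF Suc, of "real (Suc m)"]]]])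
   fix g and x :: real assume g: "g \<in> schwartz_even" and x: "x >= 0"
   have "cmod (of_real x * ?W (Suc m) g x) <= cmod ((D ^^ (m + 2)) g x) + cmod (of_nat (Suc m) * ?W m g x)"
    unfolding E2_funpow_deriv(2)[OF schwartz_evenD(1)[OF g]] by (rule norm_triangle_ineq4)
   also have "cmod (of_nat (Suc m) * ?W m g x) = real (Suc m) * cmod (?W m g x)" by (simp only: norm_mult norm_of_nat)
   finally have "(1 + x\<^sup>2) ^ n * cmod (?W (Suc m) g x) <= 2 ^ n * schwartz_seminorm 0 (Suc m + 2) g + (1 + x\<^sup>2) ^ n * (cmod ((D ^^ (m + 2)) g x) + real (Suc m) * cmod (?W m g x))"
    by (intro weighted_split x near[OF g x] nn[OF g])
   then show "(1 + x\<^sup>2) ^ n * cmod (?W (Suc m) g x) <= 2 ^ n * schwartz_seminorm 0 (Suc m + 2) g +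
     ((1 + x\<^sup>2) ^ n * cmod ((D ^^ (m + 2)) g x) + real (Suc m) * ((1 + x\<^sup>2) ^ n * cmod (?W m g x)))"
    by (simp only: distrib_left mult.left_commute)
  qed simp_all
 qed
 then show "ctrl (%g x. (1 + x\<^sup>2) ^ n * cmod ((D ^^ m) (E2 g) x))"
  by (rule ctrl_mono) (simp only: D_funpow_E2[OF schwartz_evenD(1)] order_refl)
qed

lemma tame_cong:
 assumes T: "tame T" and e: "!!g. g \<in> schwartz_even ==> T' g = T g"
 shows "tame T'"
 unfolding tame_def
proof (intro conjI ballI allI)
 show "T' g \<in> schwartz_even" if "g \<in> schwartz_even" for g unfolding e[OF that] by (rule tame_schwartz[OF T that])
 show "ctrl (%g x. (1 + x\<^sup>2) ^ n * cmod ((D ^^ m) (T' g) x))" for n m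
  by (rule ctrl_mono[OF tame_ctrl[OF T, of n m]]) (simp only: e order_refl)
qed

lemma tame_chirp_op: "tame (chirp_op \<nu> \<alpha>)"
proof -
 note sc = tame_comp[OF tame_scale] and sq = tame_comp[OF tame_mult_square]
 show ?thesis
  unfolding chirp_op_def[abs_def]
  by (intro tame_add sc[OF sq[OF tame_E2]] sc[OF sq[OF tame_id]] sc[OF tame_E2] sq[OF tame_comp[OF tame_E2 tame_E2]] tame_scale)
qed

lemma tame_delta: "tame (%h y. of_real \<sigma> * delta \<nu> a b h y)"
 by (rule tame_cong[OF tame_comp[OF tame_scale[of "of_real \<sigma>"] tame_chirp_op[of \<nu> "a / b"]]]) (simp only: delta_schwartz)

lemma tame_funpow: "tame T ==> tame (T ^^ n)"
proof (induction n)
 case 0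
 show ?case using tame_id by (simp add: id_def)
next
 case (Suc n)
 show ?case using tame_comp[OF Suc.prems Suc.IH[OF Suc.prems]] by (simp add: o_def)
qed

lemma heat_semigroup_expansion:
 fixes \<nu> \<sigma> a b :: real
 assumes nu: "\<nu> > - 1/2" and sigma: "\<sigma> > 0"
 defines "T \<equiv> %h y. of_real \<sigma> * delta \<nu> a b h y"
 shows "\<exists>C>0. \<exists>nms :: (nat \<times> nat) list. \<forall>g\<in>schwartz_even. \<forall>t>0.
  (let R = (%x. heat_semigroup \<nu> \<sigma> a b t g x - (\<Sum>k=0..n. of_real (t ^ k / fact k) * (T ^^ k) g x))
  in in_L \<nu> top R & Lnorm \<nu> top R <= t ^ (n + 1) / fact (n + 1) * C * (\<Sum>(i, j)\<leftarrow>nms. schwartz_seminorm i j g))"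
proof -
 have T: "tame T" unfolding T_def by (rule tame_delta)
 have Tk: "(T ^^ k) g \<in> schwartz_even" if "g \<in> schwartz_even" for g k by (rule tame_schwartz[OF tame_funpow[OF T] that])
 obtain C nms where C: "C >= 0" "!!g x. g \<in> schwartz_even ==> x >= 0 ==>
   (1 + x\<^sup>2) ^ 0 * cmod ((D ^^ 0) ((T ^^ Suc n) g) x) <= C * (\<Sum>(i, j)\<leftarrow>nms. schwartz_seminorm i j g)"
  using tame_ctrl[OF tame_funpow[OF T, of "Suc n"], of 0 0] unfolding ctrl_def by blast
 show ?thesis
 proof (rule exI[of _ "C + 1"], rule conjI, use C(1) in simp, rule exI[of _ nms], intro ballI allI impI)
  fix g and t :: real assume g: "g \<in> schwartz_even" and t: "t > 0"
  let ?s = "\<Sum>(i, j)\<leftarrow>nms. schwartz_seminorm i j g"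
  have s: "0 <= ?s" by (rule seminorm_sum_nonneg[OF g])
  have b: "cmod ((T ^^ Suc n) g y) <= (C + 1) * ?s" if "y >= 0" for y
  proof -
   have "cmod ((T ^^ Suc n) g y) <= C * ?s" using C(2)[OF g that] by (simp only: power_0 mult_1 funpow.simps(1) id_apply)
   then show ?thesis using s unfolding distrib_right mult_1 by linarith
  qed
  define R where "R x = heat_semigroup \<nu> \<sigma> a b t g x - (\<Sum>k=0..n. of_real (t ^ k / fact k) * (T ^^ k) g x)" for x
  have R: "cmod (R x) <= t ^ (n + 1) / fact (n + 1) * (C + 1) * ?s" if "x >= 0" for x
  proof -
   have "cmod (R x) <= (C + 1) * ?s * t ^ Suc n / fact (Suc n)"
    using heat_semigroup_Taylor[OF nu sigma g, of "Suc n" a b "(C + 1) * ?s" t x, folded T_def, OF b t that]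
    unfolding R_def atLeast0AtMost lessThan_Suc_atMost .
   then show ?thesis by (simp add: mult_ac)
  qed
  have m: "R \<in> borel_measurable (bmeas \<nu>)"
   unfolding R_def[abs_def]
   by (intro continuous_imp_bessel_measurable continuous_on_diff continuous_on_sum continuous_on_mult continuous_on_const
     continuous_schwartz_even Tk g heat_semigroup_schwartz_even nu sigma t)
  have "0 <= t ^ (n + 1) / fact (n + 1) * (C + 1) * ?s" using t C(1) s by (intro mult_nonneg_nonneg divide_nonneg_nonneg) auto
  note K = this
  have ae: "AE y in bmeas \<nu>. cmod (R y) <= t ^ (n + 1) / fact (n + 1) * (C + 1) * ?s"
   by (rule AE_I2) (rule R, simp only: space_bessel_measure atLeast_iff)
  have "in_L \<nu> top R & Lnorm \<nu> top R <= t ^ (n + 1) / fact (n + 1) * (C + 1) * ?s"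
   by (intro conjI in_L_topI[OF m ae K])
  then show "let R = (%x. heat_semigroup \<nu> \<sigma> a b t g x - (\<Sum>k=0..n. of_real (t ^ k / fact k) * (T ^^ k) g x))
  in in_L \<nu> top R & Lnorm \<nu> top R <= t ^ (n + 1) / fact (n + 1) * (C + 1) * ?s"
   unfolding Let_def R_def[abs_def] .
 qed
qed

section \<open>The theorem\<close>

theorem theorem4p1:
  fixes \<nu> \<sigma> a b c d :: real and p :: ennreal
    and f :: "real \<Rightarrow> complex" and u :: "real \<Rightarrow> real \<Rightarrow> complex"
  assumes nu: "\<nu> > - 1/2" and sigma: "\<sigma> > 0"
    and SL2: "a * d - b * c = 1" and b: "b \<noteq> 0"
    and p: "1 \<le> p" and f: "in_L \<nu> p f"
    and u: "u = (\<lambda>t x. heat_semigroup \<nu> \<sigma> a b t f x)"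
  shows
    "heat_solution \<nu> \<sigma> a b u
     \<and> (admissible_initial \<nu> a b p f \<longrightarrow> Lconv_at_0 \<nu> p u f)
     \<and> (\<forall>q r t. 1 \<le> q \<and> 1 \<le> r \<and> 1 / p + 1 / q = 1 + 1 / r \<and> 0 < t \<longrightarrow>
          in_L \<nu> r (u t) \<and>
          Lnorm \<nu> r (u t) \<le>
            ((4 * \<sigma> * t) powr (\<nu> + 1) * Gamma (\<nu> + 1) / 2) powr (enn2real (1 / q) - 1)
            * (if q = top then 1 else enn2real q powr (- (\<nu> + 1) / enn2real q))
            * Lnorm \<nu> p f)
     \<and> (\<forall>r\<ge>1.
          (admissible_initial \<nu> a b p f \<and> p \<le> r \<longrightarrow> cauchy_solution \<nu> \<sigma> a b p r f u) \<and>
          (\<forall>v. cauchy_solution \<nu> \<sigma> a b p r f v \<longrightarrow> (\<forall>t>0. \<forall>x. v t x = u t x)))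
     \<and> ((f \<in> schwartz_even \<longrightarrow> (\<forall>t>0. u t \<in> schwartz_even)) \<and>
        (\<forall>n::nat. \<exists>C>0. \<exists>nms :: (nat \<times> nat) list.
          \<forall>g\<in>schwartz_even. \<forall>t>0.
            (let R = (\<lambda>x. heat_semigroup \<nu> \<sigma> a b t g x
                       - (\<Sum>k=0..n. of_real (t ^ k / fact k) *
                            ((\<lambda>h y. of_real \<sigma> * delta \<nu> a b h y) ^^ k) g x))
             in in_L \<nu> top R \<and>
                Lnorm \<nu> top R \<le> t ^ (n + 1) / fact (n + 1) * C *
                  (\<Sum>(i, j)\<leftarrow>nms. schwartz_seminorm i j g))))"
proof -
 let ?S = "%t. heat_semigroup \<nu> \<sigma> a b t"
 have ut: "u t = ?S t f" for t by (simp add: u)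
 show ?thesis
 proof (intro conjI)
  show "heat_solution \<nu> \<sigma> a b u"
   unfolding u by (rule heat_semigroup_heat_solution[OF nu sigma in_L_imp_gauss_integrable[OF nu p]]) (use f in simp)
  show "admissible_initial \<nu> a b p f \<longrightarrow> Lconv_at_0 \<nu> p u f"
   unfolding u by (intro impI heat_semigroup_Lconv[OF nu sigma p f])
  show "\<forall>q r t. 1 \<le> q \<and> 1 \<le> r \<and> 1 / p + 1 / q = 1 + 1 / r \<and> 0 < t \<longrightarrow>
          in_L \<nu> r (u t) \<and>
          Lnorm \<nu> r (u t) \<le>
            ((4 * \<sigma> * t) powr (\<nu> + 1) * Gamma (\<nu> + 1) / 2) powr (enn2real (1 / q) - 1)
            * (if q = top then 1 else enn2real q powr (- (\<nu> + 1) / enn2real q))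
            * Lnorm \<nu> p f"
  proof (intro allI impI, elim conjE)
   fix q r :: ennreal and t :: real
   assume "1 \<le> q" "1 \<le> r" "1 / p + 1 / q = 1 + 1 / r" "0 < t"
   note N = heat_semigroup_Lp_Lr[OF nu sigma this(4) p this(1,2,3) f, of a b]
   show "in_L \<nu> r (u t) \<and>
          Lnorm \<nu> r (u t) \<le>
            ((4 * \<sigma> * t) powr (\<nu> + 1) * Gamma (\<nu> + 1) / 2) powr (enn2real (1 / q) - 1)
            * (if q = top then 1 else enn2real q powr (- (\<nu> + 1) / enn2real q))
            * Lnorm \<nu> p f"
    unfolding ut by (rule conjI[OF N])
  qed
  show "\<forall>r\<ge>1.
          (admissible_initial \<nu> a b p f \<and> p \<le> r \<longrightarrow> cauchy_solution \<nu> \<sigma> a b p r f u) \<and>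
          (\<forall>v. cauchy_solution \<nu> \<sigma> a b p r f v \<longrightarrow> (\<forall>t>0. \<forall>x. v t x = u t x))"
  proof (intro allI impI conjI)
   fix r :: ennreal assume r: "1 \<le> r"
   show "cauchy_solution \<nu> \<sigma> a b p r f u" if "admissible_initial \<nu> a b p f \<and> p \<le> r"
    unfolding u using that by (intro heat_semigroup_cauchy_solution[OF nu sigma p _ f]) auto
   fix v t x assume "cauchy_solution \<nu> \<sigma> a b p r f v" "t > (0::real)"
   then show "v t x = u t x" unfolding ut by (rule cauchy_solution_unique[OF nu sigma p r f])
  qed
  show "f \<in> schwartz_even \<longrightarrow> (\<forall>t>0. u t \<in> schwartz_even)"
   unfolding ut by (intro impI allI heat_semigroup_schwartz_even[OF nu sigma])
  show "\<forall>n::nat. \<exists>C>0. \<exists>nms :: (nat \<times> nat) list.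
          \<forall>g\<in>schwartz_even. \<forall>t>0.
            (let R = (\<lambda>x. heat_semigroup \<nu> \<sigma> a b t g x
                       - (\<Sum>k=0..n. of_real (t ^ k / fact k) *
                            ((\<lambda>h y. of_real \<sigma> * delta \<nu> a b h y) ^^ k) g x))
             in in_L \<nu> top R \<and>
                Lnorm \<nu> top R \<le> t ^ (n + 1) / fact (n + 1) * C *
                  (\<Sum>(i, j)\<leftarrow>nms. schwartz_seminorm i j g))"
   by (intro allI heat_semigroup_expansion[OF nu sigma])
 qed
qed

end
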